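(* Let $R$ be a one-dimensional Gorenstein (commutative Noetherian) local ring and let $M$ be a finitely generated $R$-module which has rank. Assume $M$ and $M\otimes_R M^{\ast}$ are both torsion-free, where $M^{\ast}=\mathrm{Hom}_R(M,R)$. If $M$ is Burch, then $R$ is regular and $M$ is free.
   Context: $\mathfrak{m}$ denotes the maximal ideal of $R$; all modules are finitely generated. An $R$-module $M$ is torsion-free if every non zero-divisor of $R$ is a non zero-divisor on $M$. $M$ has rank if there is an integer $r\ge 0$ such that $M_{\mathfrak{p}}\cong R_{\mathfrak{p}}^{\oplus r}$ for all $\mathfrak{p}\in \mathrm{Ass}(R)$. $M$ is Burch if it is an $R$-submodule of some (finitely generated) $R$-module $T$ such that $\mathfrak{m}(M:_T\mathfrak{m})\nsubseteq \mathfrak{m}M$, where $(M:_T\mathfrak{m})=\{t\in T : \mathfrak{m}t\subseteq M\}$. *)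

theory Defs
  imports "HOL-Algebra.Ring_Divisibility" "HOL-Algebra.Module" "HOL-Library.Extended_Nat"
begin

text \<open>
  Modules are the records of HOL-Algebra; their fields \<open>mult\<close> and \<open>one\<close>, inherited from
  rings, play no role and are left \<open>undefined\<close> in the constructions below.
\<close>

section \<open>Modules\<close>

definition self_module :: "'a ring \<Rightarrow> ('a, 'a) module" where
  "self_module R = \<lparr>carrier = carrier R, mult = mult R, one = one R, zero = zero R,
     add = add R, smult = mult R\<rparr>"

definition lin_maps :: "'a ring \<Rightarrow> ('a, 'b) module \<Rightarrow> ('a, 'c) module \<Rightarrow> ('b \<Rightarrow> 'c) set" where
  "lin_maps R M N = {f \<in> carrier M \<rightarrow>\<^sub>E carrier N.
     (\<forall>x\<in>carrier M. \<forall>y\<in>carrier M. f (x \<oplus>\<^bsub>M\<^esub> y) = f x \<oplus>\<^bsub>N\<^esub> f y) \<and>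
     (\<forall>a\<in>carrier R. \<forall>x\<in>carrier M. f (a \<odot>\<^bsub>M\<^esub> x) = a \<odot>\<^bsub>N\<^esub> f x)}"

definition module_iso :: "'a ring \<Rightarrow> ('a, 'b) module \<Rightarrow> ('a, 'c) module \<Rightarrow> bool" where
  "module_iso R M N \<longleftrightarrow> (\<exists>f\<in>lin_maps R M N. bij_betw f (carrier M) (carrier N))"

definition Hom_module ::
    "'a ring \<Rightarrow> ('a, 'b) module \<Rightarrow> ('a, 'c) module \<Rightarrow> ('a, 'b \<Rightarrow> 'c) module" where
  "Hom_module R M N = \<lparr>carrier = lin_maps R M N, mult = undefined, one = undefined,
     zero = (\<lambda>x\<in>carrier M. \<zero>\<^bsub>N\<^esub>),
     add = (\<lambda>f g. \<lambda>x\<in>carrier M. f x \<oplus>\<^bsub>N\<^esub> g x),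
     smult = (\<lambda>a f. \<lambda>x\<in>carrier M. a \<odot>\<^bsub>N\<^esub> f x)\<rparr>"

definition dual_module :: "'a ring \<Rightarrow> ('a, 'b) module \<Rightarrow> ('a, 'b \<Rightarrow> 'a) module" where
  "dual_module R M = Hom_module R M (self_module R)"

definition mod_span :: "'a ring \<Rightarrow> ('a, 'b) module \<Rightarrow> 'b set \<Rightarrow> 'b set" where
  "mod_span R M A = \<Inter>{H. submodule H R M \<and> A \<subseteq> H}"

definition fg_module :: "'a ring \<Rightarrow> ('a, 'b) module \<Rightarrow> bool" where
  "fg_module R M \<longleftrightarrow> module R M \<and>
     (\<exists>A. finite A \<and> A \<subseteq> carrier M \<and> mod_span R M A = carrier M)"

definition quot_module :: "('a, 'b) module \<Rightarrow> 'b set \<Rightarrow> ('a, 'b set) module" where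
  "quot_module M K = \<lparr>carrier = a_rcosets\<^bsub>M\<^esub> K, mult = undefined, one = undefined,
     zero = K,
     add = (\<lambda>X Y. X <+>\<^bsub>M\<^esub> Y),
     smult = (\<lambda>a X. \<Union>x\<in>X. K +>\<^bsub>M\<^esub> (a \<odot>\<^bsub>M\<^esub> x))\<rparr>"

text \<open>The direct sum of copies of \<open>R\<close> indexed by \<open>X\<close>.\<close>

definition free_module :: "'a ring \<Rightarrow> 'x set \<Rightarrow> ('a, 'x \<Rightarrow> 'a) module" where
  "free_module R X = \<lparr>carrier = {f \<in> X \<rightarrow>\<^sub>E carrier R. finite {x \<in> X. f x \<noteq> \<zero>\<^bsub>R\<^esub>}},
     mult = undefined, one = undefined,
     zero = (\<lambda>x\<in>X. \<zero>\<^bsub>R\<^esub>),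
     add = (\<lambda>f g. \<lambda>x\<in>X. f x \<oplus>\<^bsub>R\<^esub> g x),
     smult = (\<lambda>a f. \<lambda>x\<in>X. a \<otimes>\<^bsub>R\<^esub> f x)\<rparr>"

text \<open>
  Over a nonzero ring a basis of \<open>M\<close> is a subset of \<open>M\<close>, so index sets of type \<open>'b\<close> suffice.
\<close>

definition is_free_module :: "'a ring \<Rightarrow> ('a, 'b) module \<Rightarrow> bool" where
  "is_free_module R M \<longleftrightarrow> (\<exists>X :: 'b set. module_iso R M (free_module R X))"

text \<open>
  The tensor product is the free module on the symbols \<open>x \<otimes> y\<close> modulo the bilinearity relations.
\<close>

definition tensor_gen ::
    "'a ring \<Rightarrow> ('a, 'b) module \<Rightarrow> ('a, 'c) module \<Rightarrow> 'b \<Rightarrow> 'c \<Rightarrow> ('b \<times> 'c \<Rightarrow> 'a)" where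
  "tensor_gen R M N x y =
     (\<lambda>p \<in> carrier M \<times> carrier N. if p = (x, y) then \<one>\<^bsub>R\<^esub> else \<zero>\<^bsub>R\<^esub>)"

definition tensor_rels ::
    "'a ring \<Rightarrow> ('a, 'b) module \<Rightarrow> ('a, 'c) module \<Rightarrow> ('b \<times> 'c \<Rightarrow> 'a) set" where
  "tensor_rels R M N =
    (let F = free_module R (carrier M \<times> carrier N); e = tensor_gen R M N in
      {e (x \<oplus>\<^bsub>M\<^esub> x') y \<ominus>\<^bsub>F\<^esub> (e x y \<oplus>\<^bsub>F\<^esub> e x' y) | x x' y.
         x \<in> carrier M \<and> x' \<in> carrier M \<and> y \<in> carrier N} \<union>
      {e x (y \<oplus>\<^bsub>N\<^esub> y') \<ominus>\<^bsub>F\<^esub> (e x y \<oplus>\<^bsub>F\<^esub> e x y') | x y y'.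
         x \<in> carrier M \<and> y \<in> carrier N \<and> y' \<in> carrier N} \<union>
      {e (a \<odot>\<^bsub>M\<^esub> x) y \<ominus>\<^bsub>F\<^esub> a \<odot>\<^bsub>F\<^esub> e x y | a x y.
         a \<in> carrier R \<and> x \<in> carrier M \<and> y \<in> carrier N} \<union>
      {e x (a \<odot>\<^bsub>N\<^esub> y) \<ominus>\<^bsub>F\<^esub> a \<odot>\<^bsub>F\<^esub> e x y | a x y.
         a \<in> carrier R \<and> x \<in> carrier M \<and> y \<in> carrier N})"

definition tensor_module ::
    "'a ring \<Rightarrow> ('a, 'b) module \<Rightarrow> ('a, 'c) module \<Rightarrow> ('a, ('b \<times> 'c \<Rightarrow> 'a) set) module" where
  "tensor_module R M N =
    (let F = free_module R (carrier M \<times> carrier N) in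
      quot_module F (mod_span R F (tensor_rels R M N)))"

definition torsion_free :: "'a ring \<Rightarrow> ('a, 'b) module \<Rightarrow> bool" where
  "torsion_free R M \<longleftrightarrow>
    (\<forall>r\<in>carrier R. (\<forall>s\<in>carrier R. r \<otimes>\<^bsub>R\<^esub> s = \<zero>\<^bsub>R\<^esub> \<longrightarrow> s = \<zero>\<^bsub>R\<^esub>) \<longrightarrow>
      (\<forall>x\<in>carrier M. r \<odot>\<^bsub>M\<^esub> x = \<zero>\<^bsub>M\<^esub> \<longrightarrow> x = \<zero>\<^bsub>M\<^esub>))"


section \<open>Localization and rank\<close>

text \<open>\<open>frac_rel R S M `` {(x, s)}\<close> is the fraction \<open>x / s\<close>.\<close>

definition frac_rel :: "'a ring \<Rightarrow> 'a set \<Rightarrow> ('a, 'b) module \<Rightarrow> (('b \<times> 'a) \<times> ('b \<times> 'a)) set" where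
  "frac_rel R S M = {((x, s), (y, t)).
     x \<in> carrier M \<and> s \<in> S \<and> y \<in> carrier M \<and> t \<in> S \<and>
     (\<exists>u\<in>S. u \<odot>\<^bsub>M\<^esub> (t \<odot>\<^bsub>M\<^esub> x) = u \<odot>\<^bsub>M\<^esub> (s \<odot>\<^bsub>M\<^esub> y))}"

definition loc_module ::
    "'a ring \<Rightarrow> 'a set \<Rightarrow> ('a, 'b) module \<Rightarrow> (('a \<times> 'a) set, ('b \<times> 'a) set) module" where
  "loc_module R S M = \<lparr>carrier = (carrier M \<times> S) // frac_rel R S M,
     mult = undefined, one = undefined,
     zero = frac_rel R S M `` {(\<zero>\<^bsub>M\<^esub>, \<one>\<^bsub>R\<^esub>)},
     add = (\<lambda>X Y. \<Union>(x, s)\<in>X. \<Union>(y, t)\<in>Y.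
       frac_rel R S M `` {(t \<odot>\<^bsub>M\<^esub> x \<oplus>\<^bsub>M\<^esub> s \<odot>\<^bsub>M\<^esub> y, s \<otimes>\<^bsub>R\<^esub> t)}),
     smult = (\<lambda>A X. \<Union>(a, s)\<in>A. \<Union>(x, t)\<in>X.
       frac_rel R S M `` {(a \<odot>\<^bsub>M\<^esub> x, s \<otimes>\<^bsub>R\<^esub> t)})\<rparr>"

definition loc_ring :: "'a ring \<Rightarrow> 'a set \<Rightarrow> ('a \<times> 'a) set ring" where
  "loc_ring R S =
    (let L = loc_module R S (self_module R) in
      \<lparr>carrier = carrier L, mult = smult L,
       one = frac_rel R S (self_module R) `` {(\<one>\<^bsub>R\<^esub>, \<one>\<^bsub>R\<^esub>)},
       zero = zero L, add = add L\<rparr>)"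

definition Ass :: "'a ring \<Rightarrow> 'a set set" where
  "Ass R = {p. primeideal p R \<and>
     (\<exists>x\<in>carrier R. p = {a \<in> carrier R. a \<otimes>\<^bsub>R\<^esub> x = \<zero>\<^bsub>R\<^esub>})}"

definition has_rank :: "'a ring \<Rightarrow> ('a, 'b) module \<Rightarrow> bool" where
  "has_rank R M \<longleftrightarrow>
    (\<exists>r::nat. \<forall>p\<in>Ass R.
      let S = carrier R - p; Rp = loc_ring R S in
        module_iso Rp (loc_module R S M) (free_module Rp {..<r}))"


section \<open>Local rings\<close>

definition local_ring :: "'a ring \<Rightarrow> bool" where
  "local_ring R \<longleftrightarrow> cring R \<and> (\<exists>!m. maximalideal m R)"

definition max_ideal :: "'a ring \<Rightarrow> 'a set" where
  "max_ideal R = (THE m. maximalideal m R)"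

definition krull_dim :: "'a ring \<Rightarrow> enat" where
  "krull_dim R = Sup {enat n | n. \<exists>p :: nat \<Rightarrow> 'a set.
     (\<forall>i\<le>n. primeideal (p i) R) \<and> (\<forall>i<n. p i \<subset> p (Suc i))}"

text \<open>A Noetherian local ring is regular if its maximal ideal is generated by \<open>dim R\<close> elements.\<close>

definition regular_local_ring :: "'a ring \<Rightarrow> bool" where
  "regular_local_ring R \<longleftrightarrow> noetherian_ring R \<and> local_ring R \<and>
     (\<exists>A. finite A \<and> A \<subseteq> carrier R \<and> enat (card A) = krull_dim R \<and>
        max_ideal R = Idl\<^bsub>R\<^esub> A)"

text \<open>
  HOL cannot quantify over all types of carriers, so homomorphisms are extended from submodules of
  modules carried by one fixed type. This is no restriction: that type contains a copy of \<open>R\<close>,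
  and by Baer's criterion it is enough to extend homomorphisms from the ideals of \<open>R\<close>.
\<close>

definition injective_module :: "'a ring \<Rightarrow> ('a, 'b) module \<Rightarrow> bool" where
  "injective_module R E \<longleftrightarrow> module R E \<and>
    (\<forall>(N :: ('a, (nat \<Rightarrow> 'a) set) module) A. module R N \<and> submodule A R N \<longrightarrow>
      (\<forall>f\<in>lin_maps R (N\<lparr>carrier := A\<rparr>) E. \<exists>g\<in>lin_maps R N E. \<forall>x\<in>A. g x = f x))"

text \<open>
  \<open>M\<close> has a finite injective resolution \<open>0 \<rightarrow> M \<rightarrow> I 0 \<rightarrow> \<dots> \<rightarrow> I n \<rightarrow> 0\<close> whose terms are carried
  by the type \<open>'i\<close>. A theorem assuming this for a type variable \<open>'i\<close> covers all injective
  resolutions.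
\<close>

definition finite_inj_dim :: "'i itself \<Rightarrow> 'a ring \<Rightarrow> ('a, 'b) module \<Rightarrow> bool" where
  "finite_inj_dim _ R M \<longleftrightarrow>
    (\<exists>(I :: nat \<Rightarrow> ('a, 'i) module) \<epsilon> d n.
      (\<forall>j. injective_module R (I j)) \<and>
      (\<forall>j>n. carrier (I j) = {\<zero>\<^bsub>I j\<^esub>}) \<and>
      \<epsilon> \<in> lin_maps R M (I 0) \<and> inj_on \<epsilon> (carrier M) \<and>
      (\<forall>j. d j \<in> lin_maps R (I j) (I (Suc j))) \<and>
      \<epsilon> ` carrier M = {x \<in> carrier (I 0). d 0 x = \<zero>\<^bsub>I (Suc 0)\<^esub>} \<and>
      (\<forall>j. d j ` carrier (I j) =
         {x \<in> carrier (I (Suc j)). d (Suc j) x = \<zero>\<^bsub>I (Suc (Suc j))\<^esub>}))"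

definition gorenstein_local_ring :: "'i itself \<Rightarrow> 'a ring \<Rightarrow> bool" where
  "gorenstein_local_ring i R \<longleftrightarrow>
     noetherian_ring R \<and> local_ring R \<and> finite_inj_dim i R (self_module R)"


section \<open>Burch modules\<close>

definition ideal_smult :: "'a ring \<Rightarrow> ('a, 'b) module \<Rightarrow> 'a set \<Rightarrow> 'b set \<Rightarrow> 'b set" where
  "ideal_smult R M I N = mod_span R M {a \<odot>\<^bsub>M\<^esub> x | a x. a \<in> I \<and> x \<in> N}"

definition colon :: "('a, 'b) module \<Rightarrow> 'b set \<Rightarrow> 'a set \<Rightarrow> 'b set" where
  "colon M N I = {t \<in> carrier M. \<forall>a\<in>I. a \<odot>\<^bsub>M\<^esub> t \<in> N}"

text \<open>
  The overmodule \<open>T\<close> may live on any type \<open>'t\<close>, hence the submodule is given by an embedding \<open>\<iota>\<close>.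
  A theorem assuming this for a type variable \<open>'t\<close> covers all \<open>T\<close>.
\<close>

definition burch_module :: "'t itself \<Rightarrow> 'a ring \<Rightarrow> ('a, 'b) module \<Rightarrow> bool" where
  "burch_module _ R M \<longleftrightarrow>
    (\<exists>(T :: ('a, 't) module) \<iota>.
      fg_module R T \<and> \<iota> \<in> lin_maps R M T \<and> inj_on \<iota> (carrier M) \<and>
      (let \<mm> = max_ideal R; N = \<iota> ` carrier M in
        \<not> ideal_smult R T \<mm> (colon T N \<mm>) \<subseteq> ideal_smult R T \<mm> N))"

end

theory Submission
  imports Defs
begin

text \<open>
  Let \<open>\<mm>\<close> be the maximal ideal, \<open>A\<close> a minimal finite generating set of \<open>M\<close>, \<open>Z\<close> the module of
  relations between its elements, a submodule of \<open>R\<^sup>A\<close>, and \<open>M\<^sup>*\<close> the dual of \<open>M\<close>. The idea is to show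
  that the entries of all relations lie in one nonmaximal prime ideal; the rank then leaves no room
  for relations.

  The Gorenstein property enters through two consequences of a finite injective resolution of \<open>R\<close>:
  \<open>R\<close> has positive depth (\<open>depth_pos\<close>), and for a regular element \<open>a\<close> of \<open>\<mm>\<close> the ring
  \<open>R/aR\<close> is injective over itself (\<open>quotient_self_injective\<close>). From the latter follow that the socle of
  \<open>R/aR\<close> is generated by one element \<open>s\<close> (\<open>socle_one_dimensional\<close>) and that every functional
  \<open>L \<rightarrow> R/aR\<close> on a finitely generated torsion-free module \<open>L\<close> lifts to a functional \<open>L \<rightarrow> R\<close>
  (\<open>lift_functional\<close>), which amounts to the vanishing of \<open>Ext\<^sup>1(L, R)\<close>.

  The Burch property provides a regular \<open>a \<in> \<mm>\<close> and \<open>y \<in> M\<close>, \<open>y \<notin> \<mm>M\<close>, with \<open>\<mm>y \<subseteq> aM\<close>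
  (\<open>burch_element\<close>). So the residue field is a direct summand of \<open>M/aM\<close>: some \<open>l : M \<rightarrow> R/\<mm>\<close> has
  \<open>l(y) = 1\<close>. The functional \<open>s l : M \<rightarrow> R/aR\<close> lifts to \<open>\<eta> \<in> M\<^sup>*\<close>, which does not lie in \<open>aM\<^sup>*\<close>.
  For \<open>\<psi> \<in> M\<^sup>*\<close> the value \<open>\<psi>(y)\<close> lies in the socle modulo \<open>a\<close>, and hence \<open>x \<otimes> \<psi> \<mapsto> l(x) \<psi>(y)\<close> is a
  well-defined functional on \<open>M \<otimes> M\<^sup>*\<close> with values in \<open>R/aR\<close>. As \<open>M \<otimes> M\<^sup>*\<close> is torsion-free, this
  functional lifts, and by adjunction the lift is an endomorphism \<open>\<phi>\<close> of \<open>M\<^sup>*\<close>. Modulo \<open>aM\<^sup>*\<close> it fixes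
  \<open>\<eta>\<close> and maps everything into \<open>R\<eta>\<close>.

  Let \<open>J\<close> be the ideal generated by the entries of the relations. For a relation \<open>z\<close>, all \<open>z\<^sub>i \<eta>\<close> are
  divisible by \<open>a\<close> in \<open>M\<^sup>*\<close>, and \<open>\<Sum>\<^sub>i i \<otimes> z\<^sub>i \<eta> = 0\<close>; since \<open>M \<otimes> M\<^sup>*\<close> is torsion-free, this
  equation can be divided by \<open>a\<close>, which shows \<open>z\<^sub>i \<eta> \<in> aJM\<^sup>*\<close> (\<open>eta_coeff_U\<close>). Consequently
  \<open>\<phi>(JM\<^sup>*) \<subseteq> aJM\<^sup>*\<close> (\<open>phi_U\<close>). If \<open>a\<^sup>kM\<^sup>* \<subseteq> JM\<^sup>*\<close>, then \<open>\<phi>\<^sup>k\<^sup>+\<^sup>1(a\<^sup>k\<eta>) \<in> a\<^sup>k\<^sup>+\<^sup>1M\<^sup>*\<close>, and cancelling \<open>a\<^sup>k\<close>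
  gives \<open>\<eta> \<in> aM\<^sup>*\<close>, a contradiction (\<open>no_power\<close>). So the ideal \<open>{c. cM\<^sup>* \<subseteq> JM\<^sup>*} \<supseteq> J\<close> contains no
  power of \<open>a\<close> and lies in a prime \<open>p\<close> without \<open>a\<close> (\<open>relations_in_minimal_prime\<close>).

  Modulo \<open>p\<close> the relations vanish, so \<open>M\<close> localized at \<open>p\<close> needs \<open>|A|\<close> generators and the rank is at
  least \<open>|A|\<close>. At every nonmaximal prime, a module with \<open>|A|\<close> generators that is free of at least this
  rank has no relations. Since some power of a regular element kills \<open>Z\<close>, this gives \<open>Z = 0\<close>
  (\<open>relations_vanish\<close>) and \<open>M\<close> is free with basis \<open>A\<close>. Finally \<open>y\<close> has a unit coordinate, and at this
  coordinate \<open>\<mm>y \<subseteq> aM\<close> reads \<open>\<mm> = aR\<close>.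

  Submodules of \<open>R\<^sup>n\<close> and functionals on their quotients are handled as sets of functions (vectors)
  and dot products, because the dimensions vary within the proof.
\<close>

section \<open>Ideals\<close>

context cring
begin

lemma ideal_intro:
  assumes "A \<subseteq> carrier R" "\<zero> \<in> A" "\<And>x y. x \<in> A \<Longrightarrow> y \<in> A \<Longrightarrow> x \<oplus> y \<in> A"
    "\<And>r x. r \<in> carrier R \<Longrightarrow> x \<in> A \<Longrightarrow> r \<otimes> x \<in> A"
  shows "ideal A R"
proof (rule idealI[OF ring_axioms])
  have m: "\<ominus> x \<in> A" if "x \<in> A" for x
  proof -
    have "\<ominus> x = (\<ominus> \<one>) \<otimes> x" using that assms(1) by (metis l_minus l_one one_closed subsetD)
    then show ?thesis using assms(4)[of "\<ominus> \<one>" x] that by simp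
  qed
  show "subgroup A (add_monoid R)"
    using assms m by (intro subgroup.intro) (auto simp: a_inv_def[symmetric])
  fix a x assume "a \<in> A" "x \<in> carrier R"
  then show "x \<otimes> a \<in> A" "a \<otimes> x \<in> A"
    using assms(1) assms(4)[of x a] m_comm[of a x] by auto
qed

lemma ideal_sub: "ideal J R \<Longrightarrow> x \<in> J \<Longrightarrow> y \<in> J \<Longrightarrow> x \<ominus> y \<in> J"
  by (simp add: a_minus_def additive_subgroup.a_closed additive_subgroup.a_inv_closed ideal.axioms(1))

lemma ideal_mem: "ideal J R \<Longrightarrow> x \<in> J \<Longrightarrow> x \<in> carrier R"
  using ideal.Icarr by metis

lemma ideal_addD: "ideal J R \<Longrightarrow> x \<oplus> y \<in> J \<Longrightarrow> y \<in> J \<Longrightarrow> x \<in> carrier R \<Longrightarrow> x \<in> J"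
  using ideal_sub[of J "x \<oplus> y" y] ideal_mem[of J y] by (simp add: a_minus_def a_assoc r_neg)

section \<open>Vectors\<close>

text \<open>Vectors are total functions that vanish off the index set, so that equality of vectors is equality
  of functions and \<open>vec X \<subseteq> vec Y\<close> for \<open>X \<subseteq> Y\<close>.\<close>

definition vec :: "'x set \<Rightarrow> ('x \<Rightarrow> 'a) set" where
  "vec X = {v. (\<forall>i. v i \<in> carrier R) \<and> (\<forall>i. i \<notin> X \<longrightarrow> v i = \<zero>)}"

definition vzero :: "'x \<Rightarrow> 'a" where "vzero = (\<lambda>_. \<zero>)"

definition vadd :: "('x \<Rightarrow> 'a) \<Rightarrow> ('x \<Rightarrow> 'a) \<Rightarrow> 'x \<Rightarrow> 'a"  (infixl \<open>+\<^sub>v\<close> 65) where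
  "u +\<^sub>v v = (\<lambda>i. u i \<oplus> v i)"

definition vscale :: "'a \<Rightarrow> ('x \<Rightarrow> 'a) \<Rightarrow> 'x \<Rightarrow> 'a"  (infixr \<open>*\<^sub>v\<close> 70) where
  "r *\<^sub>v v = (\<lambda>i. r \<otimes> v i)"

abbreviation vdiff :: "('x \<Rightarrow> 'a) \<Rightarrow> ('x \<Rightarrow> 'a) \<Rightarrow> 'x \<Rightarrow> 'a"  (infixl \<open>-\<^sub>v\<close> 65) where
  "u -\<^sub>v v \<equiv> u +\<^sub>v (\<ominus> \<one>) *\<^sub>v v"

definition unitv :: "'x \<Rightarrow> 'x \<Rightarrow> 'a" where
  "unitv x = (\<lambda>i. if i = x then \<one> else \<zero>)"

definition dot :: "'x set \<Rightarrow> ('x \<Rightarrow> 'a) \<Rightarrow> ('x \<Rightarrow> 'a) \<Rightarrow> 'a" where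
  "dot X u v = (\<Oplus>i\<in>X. u i \<otimes> v i)"

definition linsub :: "'x set \<Rightarrow> ('x \<Rightarrow> 'a) set \<Rightarrow> bool" where
  "linsub X K \<longleftrightarrow> K \<subseteq> vec X \<and> vzero \<in> K \<and> (\<forall>u\<in>K. \<forall>v\<in>K. u +\<^sub>v v \<in> K) \<and>
     (\<forall>r\<in>carrier R. \<forall>u\<in>K. r *\<^sub>v u \<in> K)"

lemma vec_closed: "v \<in> vec X \<Longrightarrow> v i \<in> carrier R"
  by (simp add: vec_def)

lemma vec_off: "v \<in> vec X \<Longrightarrow> i \<notin> X \<Longrightarrow> v i = \<zero>"
  by (simp add: vec_def)

lemma vec_add [simp]: "u \<in> vec X \<Longrightarrow> v \<in> vec X \<Longrightarrow> u +\<^sub>v v \<in> vec X"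
  by (simp add: vec_def vadd_def)

lemma vec_scale [simp]: "r \<in> carrier R \<Longrightarrow> v \<in> vec X \<Longrightarrow> r *\<^sub>v v \<in> vec X"
  by (simp add: vec_def vscale_def)

lemma vec_zero [simp]: "vzero \<in> vec X"
  by (simp add: vec_def vzero_def)

lemma vec_unitv [simp]: "x \<in> X \<Longrightarrow> unitv x \<in> vec X"
  by (auto simp: vec_def unitv_def)

lemma vec_mono: "X \<subseteq> Y \<Longrightarrow> v \<in> vec X \<Longrightarrow> v \<in> vec Y"
  by (auto simp: vec_def)

declare vec_closed [simp]

lemma vadd_nth [simp]: "(u +\<^sub>v v) i = u i \<oplus> v i" by (simp add: vadd_def)
lemma vscale_nth [simp]: "(r *\<^sub>v v) i = r \<otimes> v i" by (simp add: vscale_def)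
lemma vzero_nth [simp]: "vzero i = \<zero>" by (simp add: vzero_def)

lemma vdiff_nth: "u \<in> vec X \<Longrightarrow> v \<in> vec X \<Longrightarrow> (u -\<^sub>v v) i = u i \<ominus> v i"
  by (simp add: a_minus_def l_minus)

lemma vec_eqI: "(\<And>i. u i = v i) \<Longrightarrow> u = v" by (rule ext)

lemma vec_eqI': "u \<in> vec X \<Longrightarrow> v \<in> vec X \<Longrightarrow> (\<And>i. i \<in> X \<Longrightarrow> u i = v i) \<Longrightarrow> u = v"
  by (rule ext) (metis vec_off)

lemma linsubD:
  assumes "linsub X K"
  shows "u \<in> K \<Longrightarrow> u \<in> vec X" "vzero \<in> K" "u \<in> K \<Longrightarrow> v \<in> K \<Longrightarrow> u +\<^sub>v v \<in> K"
    "r \<in> carrier R \<Longrightarrow> u \<in> K \<Longrightarrow> r *\<^sub>v u \<in> K" "u \<in> K \<Longrightarrow> v \<in> K \<Longrightarrow> u -\<^sub>v v \<in> K"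
  using assms by (auto simp: linsub_def)

lemma linsub_closed: "linsub X K \<Longrightarrow> u \<in> K \<Longrightarrow> u i \<in> carrier R"
  by (rule vec_closed[OF linsubD(1)])

lemma vdiff_add: "u \<in> vec X \<Longrightarrow> v \<in> vec X \<Longrightarrow> (u -\<^sub>v v) +\<^sub>v v = u"
  by (rule vec_eqI) (simp add: l_minus a_assoc l_neg)

lemma linsub_diffD:
  assumes "linsub X K" "u -\<^sub>v v \<in> K" "v \<in> K" "u \<in> vec X" shows "u \<in> K"
  using linsubD(3)[OF assms(1,2,3)] vdiff_add[OF assms(4) linsubD(1)[OF assms(1,3)]] by simp

text \<open>The span does not refer to an index set: an intersection of sets that are closed under the vector
  operations.\<close>

definition vclosed :: "('x \<Rightarrow> 'a) set \<Rightarrow> bool" where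
  "vclosed K \<longleftrightarrow> vzero \<in> K \<and> (\<forall>u\<in>K. \<forall>v\<in>K. u +\<^sub>v v \<in> K) \<and> (\<forall>r\<in>carrier R. \<forall>u\<in>K. r *\<^sub>v u \<in> K)"

definition vspan :: "('x \<Rightarrow> 'a) set \<Rightarrow> ('x \<Rightarrow> 'a) set" where
  "vspan S = \<Inter>{K. vclosed K \<and> S \<subseteq> K}"

lemma vspan_zero: "vzero \<in> vspan S" by (auto simp: vspan_def vclosed_def)
lemma vspan_base: "v \<in> S \<Longrightarrow> v \<in> vspan S" by (auto simp: vspan_def)
lemma vspan_add: "u \<in> vspan S \<Longrightarrow> v \<in> vspan S \<Longrightarrow> u +\<^sub>v v \<in> vspan S"
  by (auto simp: vspan_def vclosed_def)
lemma vspan_scale: "r \<in> carrier R \<Longrightarrow> u \<in> vspan S \<Longrightarrow> r *\<^sub>v u \<in> vspan S"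
  by (auto simp: vspan_def vclosed_def)

lemma vspan_induct [consumes 1, case_names zero base add scale]:
  assumes "v \<in> vspan S" "P vzero" "\<And>v. v \<in> S \<Longrightarrow> P v"
    "\<And>u v. u \<in> vspan S \<Longrightarrow> P u \<Longrightarrow> v \<in> vspan S \<Longrightarrow> P v \<Longrightarrow> P (u +\<^sub>v v)"
    "\<And>r u. r \<in> carrier R \<Longrightarrow> u \<in> vspan S \<Longrightarrow> P u \<Longrightarrow> P (r *\<^sub>v u)"
  shows "P v"
proof -
  define Q where "Q = {v \<in> vspan S. P v}"
  have "vclosed Q"
    unfolding vclosed_def Q_def
    by (simp add: assms(2,4,5) vspan_zero vspan_add vspan_scale)
  moreover have "S \<subseteq> Q" by (auto simp: Q_def assms(3) vspan_base)
  ultimately have "v \<in> Q" using assms(1) unfolding vspan_def by (simp add: Inter_iff)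
  then have "v \<in> {v \<in> vspan S. P v}" by (simp add: Q_def)
  then show ?thesis by simp
qed

lemma vspan_subset: assumes "linsub X K" "S \<subseteq> K" shows "vspan S \<subseteq> K"
using assms unfolding vspan_def by (intro Inter_lower) (simp add: linsub_def vclosed_def)

lemma vspan_linsub: "S \<subseteq> vec X \<Longrightarrow> linsub X (vspan S)"
  using vspan_subset[of X "vec X" S]
  by (simp add: linsub_def vspan_zero vspan_add vspan_scale)

lemma vspan_mono: "S \<subseteq> T \<Longrightarrow> vspan S \<subseteq> vspan T"
unfolding vspan_def by blast

text \<open>The leading-coefficient ideals of the basis theorem: they reduce finite generation of \<open>K\<close> to one
  index less.\<close>

lemma linsub_coord_ideal: assumes "linsub X K" shows "ideal ((\<lambda>v. v i) ` K) R"
proof (rule ideal_intro)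
  show "(\<lambda>v. v i) ` K \<subseteq> carrier R" using linsubD(1)[OF assms, THEN vec_closed] by auto
  show "\<zero> \<in> (\<lambda>v. v i) ` K"
    by (rule image_eqI[of _ _ vzero]) (simp_all add: linsubD(2)[OF assms])
  show "x \<oplus> y \<in> (\<lambda>v. v i) ` K" if xy: "x \<in> (\<lambda>v. v i) ` K" "y \<in> (\<lambda>v. v i) ` K" for x y
  proof -
    from xy(1) obtain u where u: "x = u i" "u \<in> K" by (rule imageE)
    from xy(2) obtain v where v: "y = v i" "v \<in> K" by (rule imageE)
    show ?thesis
      by (rule image_eqI[of _ _ "u +\<^sub>v v"]) (simp_all add: u v linsubD(3)[OF assms])
  qed
  show "r \<otimes> x \<in> (\<lambda>v. v i) ` K" if r: "r \<in> carrier R" and x: "x \<in> (\<lambda>v. v i) ` K" for r x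
  proof -
    from x obtain u where u: "x = u i" "u \<in> K" by (rule imageE)
    show ?thesis
      by (rule image_eqI[of _ _ "r *\<^sub>v u"]) (simp_all add: u r linsubD(4)[OF assms])
  qed
qed

text \<open>Induction on the index set: generators of the vectors in \<open>K\<close> with entry zero at the new index,
  together with vectors whose entries at this index generate the ideal of all such entries.\<close>

lemma noetherian_vec:
  assumes noeth: "noetherian_ring R" and "finite X" "linsub X K"
  shows "\<exists>S. finite S \<and> S \<subseteq> K \<and> K = vspan S"
  using assms(2,3)
proof (induction X arbitrary: K)
  case empty
  have "K = vspan {}"
  proof
    show "K \<subseteq> vspan {}"
    proof
      fix v assume "v \<in> K"
      then have "v \<in> vec {}" using linsubD(1)[OF empty] by auto
      then have "v = vzero" by (rule vec_eqI') auto
      then show "v \<in> vspan {}" by (simp add: vspan_zero)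
    qed
  qed (use vspan_subset[OF empty, of "{}"] in auto)
  then show ?case by blast
next
  case (insert x X)
  note K = insert.prems
  have K0: "linsub X (K \<inter> vec X)" using K by (auto simp: linsub_def)
  from insert.IH[OF this] obtain S0 where S0: "finite S0" "S0 \<subseteq> K \<inter> vec X" "K \<inter> vec X = vspan S0"
    by blast
  let ?A = "((\<lambda>v. v x) ` K)"
  obtain B where B: "B \<subseteq> carrier R" "finite B" "?A = Idl B"
    using noetherian_ring.finetely_gen[OF noeth linsub_coord_ideal[OF K, of x]] by blast
  have "\<forall>b\<in>B. \<exists>v\<in>K. v x = b"
  proof
    fix b assume "b \<in> B"
    then have "b \<in> ?A" using genideal_self[OF B(1)] B(3) by blast
    then show "\<exists>v\<in>K. v x = b" by (metis imageE)
  qed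
  then obtain g where g: "\<And>b. b \<in> B \<Longrightarrow> g b \<in> K \<and> g b x = b" by metis
  let ?S = "S0 \<union> g ` B"
  have SK: "?S \<subseteq> K" using S0 g by auto
  have lin: "linsub (insert x X) (vspan ?S)"
    by (rule vspan_linsub) (use SK linsubD(1)[OF K] in auto)
  have sub: "vspan ?S \<subseteq> K" by (rule vspan_subset[OF K SK])
  have "Idl B \<subseteq> ((\<lambda>v. v x) ` vspan ?S)"
  proof (rule genideal_minimal[OF linsub_coord_ideal[OF lin]])
    show "B \<subseteq> ((\<lambda>v. v x) ` vspan ?S)"
    proof
      fix b assume "b \<in> B"
      then show "b \<in> ((\<lambda>v. v x) ` vspan ?S)"
        using g[of b] vspan_base[of "g b" ?S] by (intro image_eqI[of _ _ "g b"]) auto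
    qed
  qed
  then have A: "?A \<subseteq> ((\<lambda>v. v x) ` vspan ?S)" using B(3) by simp
  have "K \<subseteq> vspan ?S"
  proof
    fix v assume v: "v \<in> K"
    then obtain w where w: "w \<in> vspan ?S" "v x = w x" using A by auto
    then have wK: "w \<in> K" using sub by auto
    note vv = linsubD(1)[OF K v] and ww = linsubD(1)[OF K wK]
    have d: "v -\<^sub>v w \<in> K" by (rule linsubD(5)[OF K v wK])
    have "v -\<^sub>v w \<in> vec X"
      unfolding vec_def
    proof (intro CollectI conjI allI impI)
      fix i
      show "(v -\<^sub>v w) i \<in> carrier R" using vv ww by simp
      assume "i \<notin> X"
      then show "(v -\<^sub>v w) i = \<zero>"
        using vec_off[OF vv, of i] vec_off[OF ww, of i] w(2) ww
        by (cases "i = x") (auto simp: l_minus r_neg)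
    qed
    then have "v -\<^sub>v w \<in> vspan S0" using d S0(3) by auto
    then have "v -\<^sub>v w \<in> vspan ?S" using vspan_mono[of S0 ?S] by auto
    then show "v \<in> vspan ?S" by (rule linsub_diffD[OF lin _ w(1) vv])
  qed
  then have "K = vspan ?S" using sub by auto
  then show ?case using SK S0(1) B(2) by (metis finite_UnI finite_imageI)
qed

section \<open>Dot products\<close>

lemma dot_closed [simp]: "u \<in> vec X \<Longrightarrow> v \<in> vec X \<Longrightarrow> dot X u v \<in> carrier R"
  unfolding dot_def by (rule finsum_closed) auto

lemma dot_comm: "u \<in> vec X \<Longrightarrow> v \<in> vec X \<Longrightarrow> dot X u v = dot X v u"
  unfolding dot_def by (rule finsum_cong') (auto simp: m_comm)

lemma dot_add_left: "u \<in> vec X \<Longrightarrow> v \<in> vec X \<Longrightarrow> w \<in> vec X \<Longrightarrow> dot X (u +\<^sub>v v) w = dot X u w \<oplus> dot X v w"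
  unfolding dot_def by (subst finsum_addf[symmetric]) (auto intro!: finsum_cong' simp: l_distr)

lemma dot_add_right: "u \<in> vec X \<Longrightarrow> v \<in> vec X \<Longrightarrow> w \<in> vec X \<Longrightarrow> dot X w (u +\<^sub>v v) = dot X w u \<oplus> dot X w v"
  by (simp add: dot_comm[of w] dot_add_left)

lemma dot_scale_left:
  assumes "finite X" "r \<in> carrier R" "u \<in> vec X" "w \<in> vec X"
  shows "dot X (r *\<^sub>v u) w = r \<otimes> dot X u w"
  unfolding dot_def by (subst finsum_rdistr) (use assms in \<open>auto intro!: finsum_cong' simp: m_assoc\<close>)

lemma dot_scale_right:
  assumes "finite X" "r \<in> carrier R" "u \<in> vec X" "w \<in> vec X"
  shows "dot X w (r *\<^sub>v u) = r \<otimes> dot X w u"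
  using assms by (simp add: dot_comm[of w] dot_scale_left)

lemma dot_zero_left [simp]: "u \<in> vec X \<Longrightarrow> dot X vzero u = \<zero>"
  unfolding dot_def by (simp add: finsum_zero cong: finsum_cong)

lemma dot_zero_right [simp]: "u \<in> vec X \<Longrightarrow> dot X u vzero = \<zero>"
  by (simp add: dot_comm[of u])

lemma dot_unitv:
  assumes "finite X" "x \<in> X" "v \<in> vec X" shows "dot X (unitv x) v = v x"
proof -
  have "dot X (unitv x) v = (\<Oplus>i\<in>X. if x = i then v i else \<zero>)"
    unfolding dot_def unitv_def by (rule finsum_cong') (use assms in auto)
  also have "\<dots> = v x" by (rule finsum_singleton) (use assms in auto)
  finally show ?thesis .
qed

lemma dot_coeff_ideal:
  assumes "ideal J R" "finite X" "u \<in> vec X" "v \<in> vec X" "\<And>i. i \<in> X \<Longrightarrow> u i \<in> J"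
  shows "dot X u v \<in> J"
proof -
  interpret J: ideal J R by fact
  have "(\<Oplus>i\<in>Y. u i \<otimes> v i) \<in> J" if "Y \<subseteq> X" for Y
    using finite_subset[OF that assms(2)] that
    by (induction Y) (use assms in \<open>auto simp: J.I_r_closed\<close>)
  then show ?thesis unfolding dot_def by simp
qed

lemma finsum_swap:
  assumes "finite A" "finite B" "\<And>i j. i \<in> A \<Longrightarrow> j \<in> B \<Longrightarrow> f i j \<in> carrier R"
  shows "(\<Oplus>i\<in>A. \<Oplus>j\<in>B. f i j) = (\<Oplus>j\<in>B. \<Oplus>i\<in>A. f i j)"
  using assms(1,3)
proof (induction A)
  case empty then show ?case by (simp add: finsum_zero)
next
  case (insert a A)
  have "(\<Oplus>i\<in>insert a A. \<Oplus>j\<in>B. f i j) = (\<Oplus>j\<in>B. f a j) \<oplus> (\<Oplus>i\<in>A. \<Oplus>j\<in>B. f i j)"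
    by (rule finsum_insert) (use insert in auto)
  also have "\<dots> = (\<Oplus>j\<in>B. f a j) \<oplus> (\<Oplus>j\<in>B. \<Oplus>i\<in>A. f i j)" using insert by simp
  also have "\<dots> = (\<Oplus>j\<in>B. f a j \<oplus> (\<Oplus>i\<in>A. f i j))"
    by (rule finsum_addf[symmetric]) (use insert in auto)
  also have "\<dots> = (\<Oplus>j\<in>B. \<Oplus>i\<in>insert a A. f i j)"
    by (rule finsum_cong') (use insert in auto)
  finally show ?case .
qed

lemma vspan_coeffs:
  assumes "finite S" "S \<subseteq> vec X" "v \<in> vspan S"
  shows "\<exists>d\<in>vec S. \<forall>i. v i = (\<Oplus>s\<in>S. d s \<otimes> s i)"
  using assms(3)
proof (induction rule: vspan_induct)
  case zero
  show ?case
  proof (rule bexI[of _ vzero], rule allI)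
    fix i have "(\<Oplus>s\<in>S. vzero s \<otimes> s i) = (\<Oplus>s\<in>S. \<zero>)"
      by (rule finsum_cong') (use assms(2) in auto)
    then show "vzero i = (\<Oplus>s\<in>S. vzero s \<otimes> s i)" by simp
  qed simp
next
  case (base v)
  show ?case
  proof (rule bexI[of _ "unitv v"], rule allI)
    fix i
    have "(\<Oplus>s\<in>S. unitv v s \<otimes> s i) = (\<Oplus>s\<in>S. if v = s then s i else \<zero>)"
      unfolding unitv_def by (rule finsum_cong') (use assms(2) in auto)
    also have "\<dots> = v i" by (rule finsum_singleton) (use assms base in auto)
    finally show "v i = (\<Oplus>s\<in>S. unitv v s \<otimes> s i)" by simp
  qed (use base in simp)
next
  case (add u v)
  then obtain c d where c: "c \<in> vec S" "\<forall>i. u i = (\<Oplus>s\<in>S. c s \<otimes> s i)"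
    and d: "d \<in> vec S" "\<forall>i. v i = (\<Oplus>s\<in>S. d s \<otimes> s i)" by auto
  show ?case
  proof (rule bexI[of _ "c +\<^sub>v d"], rule allI)
    fix i
    have s: "s i \<in> carrier R" if "s \<in> S" for s using that assms(2) by auto
    have "(\<Oplus>s\<in>S. (c +\<^sub>v d) s \<otimes> s i) = (\<Oplus>s\<in>S. c s \<otimes> s i \<oplus> d s \<otimes> s i)"
      by (rule finsum_cong') (use c d s in \<open>auto simp: l_distr\<close>)
    also have "\<dots> = (\<Oplus>s\<in>S. c s \<otimes> s i) \<oplus> (\<Oplus>s\<in>S. d s \<otimes> s i)"
      by (rule finsum_addf) (use c d s in auto)
    finally show "(u +\<^sub>v v) i = (\<Oplus>s\<in>S. (c +\<^sub>v d) s \<otimes> s i)" using c d by simp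
  qed (use c d in simp)
next
  case (scale r u)
  then obtain c where c: "c \<in> vec S" "\<forall>i. u i = (\<Oplus>s\<in>S. c s \<otimes> s i)" by auto
  show ?case
  proof (rule bexI[of _ "r *\<^sub>v c"], rule allI)
    fix i
    have s: "s i \<in> carrier R" if "s \<in> S" for s using that assms(2) by auto
    have "(\<Oplus>s\<in>S. (r *\<^sub>v c) s \<otimes> s i) = (\<Oplus>s\<in>S. r \<otimes> (c s \<otimes> s i))"
      by (rule finsum_cong') (use c s scale in \<open>auto simp: m_assoc\<close>)
    also have "\<dots> = r \<otimes> (\<Oplus>s\<in>S. c s \<otimes> s i)"
      by (rule finsum_rdistr[symmetric]) (use c s assms scale in auto)
    finally show "(r *\<^sub>v u) i = (\<Oplus>s\<in>S. (r *\<^sub>v c) s \<otimes> s i)" using c by simp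
  qed (use c scale in simp)
qed

end

section \<open>Sums and quotients of ideals, regular elements\<close>

context cring
begin

lemma ideal_add: "ideal J R \<Longrightarrow> x \<in> J \<Longrightarrow> y \<in> J \<Longrightarrow> x \<oplus> y \<in> J"
  by (simp add: additive_subgroup.a_closed ideal.axioms(1))

lemma ideal_zero: "ideal J R \<Longrightarrow> \<zero> \<in> J"
  by (simp add: additive_subgroup.zero_closed ideal.axioms(1))

lemma ideal_mult: "ideal J R \<Longrightarrow> x \<in> J \<Longrightarrow> r \<in> carrier R \<Longrightarrow> r \<otimes> x \<in> J"
  by (simp add: ideal.I_l_closed)

lemma ideal_mult': "ideal J R \<Longrightarrow> x \<in> J \<Longrightarrow> r \<in> carrier R \<Longrightarrow> x \<otimes> r \<in> J"
  by (simp add: ideal.I_r_closed)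

text \<open>The ideal \<open>J + aR\<close>.\<close>

definition isum :: "'a set \<Rightarrow> 'a \<Rightarrow> 'a set" where
  "isum J a = {j \<oplus> r \<otimes> a |j r. j \<in> J \<and> r \<in> carrier R}"

lemma isumE:
  assumes "x \<in> isum J a" obtains j r where "x = j \<oplus> r \<otimes> a" "j \<in> J" "r \<in> carrier R"
  using assms by (auto simp: isum_def)

lemma ideal_sum_gen:
  assumes "ideal J R" "a \<in> carrier R"
  shows "ideal (isum J a) R" "J \<subseteq> isum J a" "a \<in> isum J a"
  unfolding isum_def
proof -
  let ?S = "{j \<oplus> r \<otimes> a |j r. j \<in> J \<and> r \<in> carrier R}"
  note J = ideal_mem[OF assms(1)]
  show "ideal ?S R"
  proof (rule ideal_intro)
    show "?S \<subseteq> carrier R" using J assms(2) by auto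
    show "\<zero> \<in> ?S" using ideal_zero[OF assms(1)] assms(2) by (intro CollectI exI[of _ \<zero>]) auto
    fix x assume "x \<in> ?S"
    then obtain j r where x: "x = j \<oplus> r \<otimes> a" "j \<in> J" "r \<in> carrier R" by auto
    show "x \<oplus> y \<in> ?S" if "y \<in> ?S" for y
    proof -
      obtain j' r' where y: "y = j' \<oplus> r' \<otimes> a" "j' \<in> J" "r' \<in> carrier R" using \<open>y \<in> ?S\<close> by auto
      have "x \<oplus> y = (j \<oplus> j') \<oplus> (r \<oplus> r') \<otimes> a"
        using J[OF x(2)] J[OF y(2)] x(3) y(3) assms(2) by (simp add: x(1) y(1) l_distr a_ac)
      then show ?thesis using ideal_add[OF assms(1) x(2) y(2)] x(3) y(3) by blast
    qed
    show "s \<otimes> x \<in> ?S" if "s \<in> carrier R" for s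
    proof -
      have "s \<otimes> x = s \<otimes> j \<oplus> (s \<otimes> r) \<otimes> a"
        using J[OF x(2)] x(3) assms(2) that by (simp add: x(1) r_distr m_assoc)
      then show ?thesis using ideal_mult[OF assms(1) x(2) that] x(3) that by blast
    qed
  qed
  show "J \<subseteq> ?S"
  proof
    fix j assume "j \<in> J"
    then have "j = j \<oplus> \<zero> \<otimes> a" using J assms(2) by simp
    then show "j \<in> ?S" using \<open>j \<in> J\<close> by blast
  qed
  have "a = \<zero> \<oplus> \<one> \<otimes> a" using assms(2) by simp
  then show "a \<in> ?S" using ideal_zero[OF assms(1)] by blast
qed

text \<open>The ideal quotient \<open>(J : b)\<close>; \<open>icolon {\<zero>} b\<close> is the annihilator of \<open>b\<close>.\<close>

definition icolon :: "'a set \<Rightarrow> 'a \<Rightarrow> 'a set" where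
  "icolon J b = {r \<in> carrier R. r \<otimes> b \<in> J}"

lemma ideal_icolon: assumes "ideal J R" "b \<in> carrier R" shows "ideal (icolon J b) R"
  by (rule ideal_intro)
    (use assms ideal_zero[OF assms(1)] in \<open>auto simp: icolon_def l_distr m_assoc ideal_add ideal_mult\<close>)

lemma icolon_subset: assumes "ideal J R" "b \<in> carrier R" shows "J \<subseteq> icolon J b"
  using assms ideal_mem[OF assms(1)] by (auto simp: icolon_def ideal_mult')

definition regular :: "'a \<Rightarrow> bool" where
  "regular a \<longleftrightarrow> a \<in> carrier R \<and> (\<forall>s\<in>carrier R. a \<otimes> s = \<zero> \<longrightarrow> s = \<zero>)"

lemma regular_cancel:
  assumes "regular a" "x \<in> carrier R" "y \<in> carrier R" "a \<otimes> x = a \<otimes> y" shows "x = y"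
proof -
  have a: "a \<in> carrier R" using assms(1) by (simp add: regular_def)
  have "a \<otimes> (x \<ominus> y) = \<zero>"
    using assms a by (simp add: a_minus_def r_distr r_minus r_neg)
  then have "x \<ominus> y = \<zero>" using assms by (simp add: regular_def)
  then show ?thesis using assms(2,3) by simp
qed

text \<open>Products of lists serve to say that a product of prime ideals lies in an ideal without forming
  the product ideal.\<close>

definition lprod :: "'a list \<Rightarrow> 'a" where "lprod xs = foldr (\<otimes>) xs \<one>"

lemma lprod_Nil [simp]: "lprod [] = \<one>" by (simp add: lprod_def)
lemma lprod_Cons [simp]: "lprod (x # xs) = x \<otimes> lprod xs" by (simp add: lprod_def)

lemma lprod_closed: "set xs \<subseteq> carrier R \<Longrightarrow> lprod xs \<in> carrier R"
  by (induction xs) auto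

lemma lprod_append: "set xs \<subseteq> carrier R \<Longrightarrow> set ys \<subseteq> carrier R \<Longrightarrow> lprod (xs @ ys) = lprod xs \<otimes> lprod ys"
  by (induction xs) (auto simp: lprod_closed m_assoc)

end

lemma (in primeideal) prime_notin:
  "a \<in> carrier R \<Longrightarrow> b \<in> carrier R \<Longrightarrow> a \<notin> I \<Longrightarrow> b \<notin> I \<Longrightarrow> a \<otimes> b \<notin> I"
  using I_prime by blast

section \<open>Noetherian local rings\<close>

locale noeth_local = cring R for R :: "'a ring" (structure) +
  assumes noeth: "noetherian_ring R"
    and local: "\<exists>!m. maximalideal m R"
begin

abbreviation \<mm> :: "'a set" where "\<mm> \<equiv> max_ideal R"

lemma noeth_max:
  assumes "A \<noteq> {}" "\<And>J. J \<in> A \<Longrightarrow> ideal J R"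
  shows "\<exists>M\<in>A. \<forall>X\<in>A. M \<subseteq> X \<longrightarrow> X = M"
proof (rule subset_Zorn_nonempty[OF assms(1)])
  fix C assume C: "C \<noteq> {}" "subset.chain A C"
  then have "subset.chain {I. ideal I R} C" using assms(2) by (auto simp: pred_on.chain_def)
  then have "\<Union>C \<in> C" by (rule noetherian_ring.ideal_chain_is_trivial[OF noeth C(1)])
  then show "\<Union>C \<in> A" using C(2) by (auto simp: pred_on.chain_def)
qed

lemma noeth_induct [consumes 1, case_names step]:
  assumes "ideal J R"
    and step: "\<And>J. ideal J R \<Longrightarrow> (\<And>J'. ideal J' R \<Longrightarrow> J \<subset> J' \<Longrightarrow> P J') \<Longrightarrow> P J"
  shows "P J"
proof (rule ccontr)
  assume "\<not> P J"
  then have "{J. ideal J R \<and> \<not> P J} \<noteq> {}" using assms(1) by auto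
  from noeth_max[OF this] obtain M where M: "ideal M R" "\<not> P M"
    "\<forall>X. ideal X R \<and> \<not> P X \<longrightarrow> M \<subseteq> X \<longrightarrow> X = M" by auto
  have "P M" by (rule step[OF M(1)]) (use M(3) in blast)
  then show False using M(2) by blast
qed

lemma mm_maximal: "maximalideal \<mm> R"
  unfolding max_ideal_def by (rule theI'[OF local])

lemma mm_unique: "maximalideal m R \<Longrightarrow> m = \<mm>"
  using local mm_maximal by blast

lemma mm_prime: "primeideal \<mm> R" by (rule maximalideal_prime[OF mm_maximal])

lemma mm_ideal: "ideal \<mm> R" using mm_maximal by (simp add: maximalideal_def)

lemma mm_carrier: "x \<in> \<mm> \<Longrightarrow> x \<in> carrier R" using ideal_mem[OF mm_ideal] .

lemma proper_subset_mm: assumes "ideal J R" "J \<noteq> carrier R" shows "J \<subseteq> \<mm>"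
  using assms
proof (induction J rule: noeth_induct)
  case (step J)
  show ?case
  proof (cases "maximalideal J R")
    case True then show ?thesis using mm_unique by blast
  next
    case False
    then obtain J' where "ideal J' R" "J \<subseteq> J'" "J' \<noteq> J" "J' \<noteq> carrier R"
      using step(1) step.prems maximalidealI[of J R] by metis
    then show ?thesis using step(2)[of J'] by blast
  qed
qed

lemma one_notin_mm: "\<one> \<notin> \<mm>"
  using mm_maximal ideal.one_imp_carrier[OF mm_ideal] by (auto simp: maximalideal_def maximalideal_axioms_def)

lemma unit_iff: assumes "x \<in> carrier R" shows "x \<in> Units R \<longleftrightarrow> x \<notin> \<mm>"
proof
  assume u: "x \<in> Units R"
  show "x \<notin> \<mm>"
  proof
    assume "x \<in> \<mm>"
    then have "inv x \<otimes> x \<in> \<mm>" using u by (intro ideal_mult[OF mm_ideal]) auto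
    then show False using one_notin_mm u by simp
  qed
next
  assume x: "x \<notin> \<mm>"
  then have "PIdl x = carrier R"
    using proper_subset_mm[OF cgenideal_ideal[OF assms]] cgenideal_self[OF assms] by blast
  then have "\<one> \<in> PIdl x" by simp
  then obtain y where "y \<in> carrier R" "\<one> = y \<otimes> x" by (auto simp: cgenideal_def)
  then show "x \<in> Units R" using assms by (auto simp: Units_def m_comm[of x y] intro!: bexI[of _ y])
qed

lemma one_minus_unit:
  assumes "x \<in> \<mm>" shows "\<one> \<ominus> x \<in> Units R"
proof -
  have x: "x \<in> carrier R" by (rule mm_carrier[OF assms])
  have "\<one> \<ominus> x \<notin> \<mm>"
  proof
    assume "\<one> \<ominus> x \<in> \<mm>"
    then have "(\<one> \<ominus> x) \<oplus> x \<in> \<mm>" using ideal_add[OF mm_ideal _ assms] by blast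
    then show False using one_notin_mm x by (simp add: a_minus_def a_assoc l_neg)
  qed
  then show ?thesis using unit_iff x by simp
qed

text \<open>Nakayama's lemma for \<open>L = P + aL\<close>: a generator \<open>s\<close> of \<open>L\<close> over \<open>P\<close> is \<open>p + a w\<close> with \<open>w\<close> a combination
  of the other generators and of \<open>c s\<close>, and can be eliminated because \<open>1 - a c\<close> is a unit.\<close>

lemma nakayama:
  assumes "finite X" "linsub X P" "linsub X L" "P \<subseteq> L" "a \<in> \<mm>"
    and step: "\<And>v. v \<in> L \<Longrightarrow> \<exists>p\<in>P. \<exists>w\<in>L. v = p +\<^sub>v a *\<^sub>v w"
  shows "L = P"
proof -
  have a: "a \<in> carrier R" by (rule mm_carrier[OF assms(5)])
  have *: "L \<subseteq> P" if "finite S" "S \<subseteq> L" "L = vspan (P \<union> S)" for S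
    using that
  proof (induction S)
    case empty
    then show ?case using vspan_subset[OF assms(2), of P] by simp
  next
    case (insert s S)
    have lin: "linsub X (vspan (P \<union> S))"
      using insert.prems linsubD(1)[OF assms(3)] assms(4) by (intro vspan_linsub) auto
    have sL: "s \<in> L" using insert.prems by simp
    obtain p w where pw: "p \<in> P" "w \<in> L" "s = p +\<^sub>v a *\<^sub>v w" using step[OF sL] by blast
    note closed = linsub_closed[OF assms(3) sL] linsub_closed[OF lin]
    have dec: "\<exists>w'\<in>vspan (P \<union> S). \<exists>c\<in>carrier R. w = w' +\<^sub>v c *\<^sub>v s" if "w \<in> vspan (P \<union> insert s S)" for w
      using that
    proof (induction rule: vspan_induct)
      case zero
      show ?case
        by (intro bexI[of _ vzero] bexI[of _ \<zero>])
          (use closed vspan_zero in \<open>auto intro!: vec_eqI\<close>)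
    next
      case (base v)
      show ?case
      proof (cases "v = s")
        case True
        have "s = vzero +\<^sub>v \<one> *\<^sub>v s" using closed by (intro vec_eqI) simp
        then show ?thesis using True vspan_zero by blast
      next
        case False
        then have v: "v \<in> vspan (P \<union> S)" using base by (auto intro: vspan_base)
        have "v = v +\<^sub>v \<zero> *\<^sub>v s"
          using closed v by (intro vec_eqI) simp
        then show ?thesis using v by blast
      qed
    next
      case (add u v)
      then obtain u' c v' d where
        "u' \<in> vspan (P \<union> S)" "c \<in> carrier R" "u = u' +\<^sub>v c *\<^sub>v s"
        "v' \<in> vspan (P \<union> S)" "d \<in> carrier R" "v = v' +\<^sub>v d *\<^sub>v s" by blast
      then show ?case
        using closed
        by (intro bexI[of _ "u' +\<^sub>v v'"] bexI[of _ "c \<oplus> d"])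
          (auto intro!: vec_eqI vspan_add simp: l_distr a_ac)
    next
      case (scale r u)
      then obtain u' c where
        "u' \<in> vspan (P \<union> S)" "c \<in> carrier R" "u = u' +\<^sub>v c *\<^sub>v s" by blast
      then show ?case
        using closed scale(1)
        by (intro bexI[of _ "r *\<^sub>v u'"] bexI[of _ "r \<otimes> c"])
          (auto intro!: vec_eqI vspan_scale simp: r_distr m_assoc)
    qed
    obtain w' c where w': "w' \<in> vspan (P \<union> S)" "c \<in> carrier R" "w = w' +\<^sub>v c *\<^sub>v s"
      using dec[of w] pw(2) insert.prems(2) by auto
    have sv: "s \<in> vec X" and wv: "w' \<in> vec X" and pv: "p \<in> vec X"
      using linsubD(1)[OF assms(3) sL] linsubD(1)[OF lin w'(1)] linsubD(1)[OF assms(2) pw(1)] by auto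
    have "a \<otimes> c \<in> \<mm>" using ideal_mult'[OF mm_ideal assms(5) w'(2)] .
    then have u: "\<one> \<ominus> a \<otimes> c \<in> Units R" by (rule one_minus_unit)
    let ?u = "inv (\<one> \<ominus> a \<otimes> c)"
    have uc: "?u \<in> carrier R" using u by simp
    have eq: "s = ?u *\<^sub>v (p +\<^sub>v a *\<^sub>v w')"
    proof (rule vec_eqI)
      fix i
      have c: "s i \<in> carrier R" "w' i \<in> carrier R" "p i \<in> carrier R" using sv wv pv by auto
      have "s i = (p +\<^sub>v a *\<^sub>v (w' +\<^sub>v c *\<^sub>v s)) i" using pw(3) w'(3) by simp
      then have s1: "s i = p i \<oplus> a \<otimes> (w' i \<oplus> c \<otimes> s i)" by simp
      have "(\<one> \<ominus> a \<otimes> c) \<otimes> s i = s i \<ominus> a \<otimes> (c \<otimes> s i)"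
        using c a w'(2) by (simp add: a_minus_def l_distr l_minus m_assoc)
      also have "\<dots> = (p i \<oplus> a \<otimes> (w' i \<oplus> c \<otimes> s i)) \<ominus> a \<otimes> (c \<otimes> s i)" using s1 by simp
      also have "\<dots> = p i \<oplus> a \<otimes> w' i"
        using c a w'(2) by (simp add: a_minus_def r_distr a_assoc r_neg)
      finally have "?u \<otimes> ((\<one> \<ominus> a \<otimes> c) \<otimes> s i) = ?u \<otimes> (p i \<oplus> a \<otimes> w' i)" by simp
      then show "s i = (?u *\<^sub>v (p +\<^sub>v a *\<^sub>v w')) i"
        using u c a w'(2) by (simp add: m_assoc[symmetric])
    qed
    have "p \<in> vspan (P \<union> S)" using pw(1) by (auto intro: vspan_base)
    then have "s \<in> vspan (P \<union> S)"
      using eq linsubD(3,4)[OF lin] w'(1) a uc by metis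
    then have "vspan (P \<union> insert s S) \<subseteq> vspan (P \<union> S)"
      by (intro vspan_subset[OF lin]) (auto intro: vspan_base)
    then have "L = vspan (P \<union> S)"
      using insert.prems(2) vspan_mono[of "P \<union> S" "P \<union> insert s S"] by auto
    then show ?case using insert.IH insert.prems(1) by simp
  qed
  obtain S where S: "finite S" "S \<subseteq> L" "L = vspan S"
    using noetherian_vec[OF noeth assms(1,3)] by blast
  have "L = vspan (P \<union> S)"
    using S vspan_mono[of S "P \<union> S"] vspan_subset[OF assms(3), of "P \<union> S"] assms(4) by auto
  then show ?thesis using *[OF S(1,2)] assms(4) by auto
qed

section \<open>Prime ideals\<close>

text \<open>Every ideal contains a product of primes above it. Noetherian induction: a proper ideal that is not
  prime contains the product of two larger ideals \<open>J + aR\<close> and \<open>J + bR\<close> with \<open>ab \<in> J\<close>.\<close>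

lemma prime_product:
  assumes "ideal J R"
  shows "\<exists>ps. (\<forall>p\<in>set ps. primeideal p R \<and> J \<subseteq> p) \<and> (\<forall>xs. list_all2 (\<in>) xs ps \<longrightarrow> lprod xs \<in> J)"
  using assms
proof (induction J rule: noeth_induct)
  case (step J)
  show ?case
  proof (cases "J = carrier R")
    case True then show ?thesis by (intro exI[of _ "[]"]) simp
  next
    case J: False
    show ?thesis
    proof (cases "primeideal J R")
      case True
      then show ?thesis
        using ideal_mem[OF step(1)] by (intro exI[of _ "[J]"]) (auto simp: list_all2_Cons2)
    next
      case False
      then obtain a b where ab: "a \<in> carrier R" "b \<in> carrier R" "a \<otimes> b \<in> J" "a \<notin> J" "b \<notin> J"
        using primeidealI[OF step(1) is_cring J[symmetric]] by blast
      let ?A = "isum J a"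
      let ?B = "isum J b"
      note A = ideal_sum_gen[OF step(1) ab(1)] and B = ideal_sum_gen[OF step(1) ab(2)]
      obtain ps where ps: "\<forall>p\<in>set ps. primeideal p R \<and> ?A \<subseteq> p" "\<forall>xs. list_all2 (\<in>) xs ps \<longrightarrow> lprod xs \<in> ?A"
        using step(2)[OF A(1)] A(2,3) ab(4) by blast
      obtain qs where qs: "\<forall>p\<in>set qs. primeideal p R \<and> ?B \<subseteq> p" "\<forall>xs. list_all2 (\<in>) xs qs \<longrightarrow> lprod xs \<in> ?B"
        using step(2)[OF B(1)] B(2,3) ab(5) by blast
      have car: "set xs \<subseteq> carrier R" if "list_all2 (\<in>) xs rs" "\<forall>p\<in>set rs. primeideal p R" for xs rs
        using that
      proof (induction rule: list_all2_induct)
        case (Cons x xs y ys)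
        then show ?case using ideal_mem[of y x] by (auto simp: primeideal_def)
      qed simp
      show ?thesis
      proof (intro exI[of _ "ps @ qs"] conjI allI impI)
        show "\<forall>p\<in>set (ps @ qs). primeideal p R \<and> J \<subseteq> p"
          using ps(1) qs(1) A(2) B(2) by (metis UnE set_append subset_trans)
        fix zs assume "list_all2 (\<in>) zs (ps @ qs)"
        then obtain xs ys where xy: "zs = xs @ ys" "list_all2 (\<in>) xs ps" "list_all2 (\<in>) ys qs"
          by (auto simp: list_all2_append2)
        have "lprod xs \<in> ?A" "lprod ys \<in> ?B" using ps(2) qs(2) xy by auto
        then obtain j r j' r' where
          j: "lprod xs = j \<oplus> r \<otimes> a" "j \<in> J" "r \<in> carrier R" "lprod ys = j' \<oplus> r' \<otimes> b" "j' \<in> J" "r' \<in> carrier R"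
          by (meson isumE)
        have jc: "j \<in> carrier R" "j' \<in> carrier R" using j ideal_mem[OF step(1)] by auto
        have "lprod zs = (j \<oplus> r \<otimes> a) \<otimes> (j' \<oplus> r' \<otimes> b)"
          using car[OF xy(2)] car[OF xy(3)] ps(1) qs(1) by (simp add: xy(1) lprod_append j(1,4))
        also have "\<dots> = j \<otimes> (j' \<oplus> r' \<otimes> b) \<oplus> (r \<otimes> a \<otimes> j' \<oplus> r \<otimes> r' \<otimes> (a \<otimes> b))"
          using jc j(3,6) ab(1,2) by (simp add: l_distr r_distr m_ac a_ac)
        also have "\<dots> \<in> J"
        proof (intro ideal_add[OF step(1)])
          show "j \<otimes> (j' \<oplus> r' \<otimes> b) \<in> J" using jc j ab by (intro ideal_mult'[OF step(1)]) auto
          show "r \<otimes> a \<otimes> j' \<in> J" using j ab by (intro ideal_mult[OF step(1)]) auto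
          show "r \<otimes> r' \<otimes> (a \<otimes> b) \<in> J" using j ab by (intro ideal_mult[OF step(1) ab(3)]) auto
        qed
        finally show "lprod zs \<in> J" .
      qed
    qed
  qed
qed

text \<open>Otherwise \<open>a\<close> would lie in every prime of a product that is contained in \<open>J\<close>.\<close>

lemma prime_avoiding_powers:
  assumes "ideal J R" "a \<in> carrier R" "\<And>n::nat. a [^] n \<notin> J"
  shows "\<exists>p. primeideal p R \<and> J \<subseteq> p \<and> a \<notin> p"
proof (rule ccontr)
  assume no: "\<not> ?thesis"
  obtain ps where ps: "\<forall>p\<in>set ps. primeideal p R \<and> J \<subseteq> p" "\<forall>xs. list_all2 (\<in>) xs ps \<longrightarrow> lprod xs \<in> J"
    using prime_product[OF assms(1)] by blast
  have "\<forall>p\<in>set ps. a \<in> p" using no ps(1) by blast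
  then have "list_all2 (\<in>) (replicate (length ps) a) ps" by (simp add: list_all2_conv_all_nth)
  moreover have "lprod (replicate n a) = a [^] n" for n
    using assms(2) by (induction n) (simp_all add: m_comm)
  ultimately have "a [^] length ps \<in> J" using ps(2) by metis
  then show False using assms(3) by blast
qed

text \<open>Existence of associated primes of \<open>R/J\<close>: an ideal \<open>(J : b)\<close>, \<open>b \<notin> J\<close>, that is maximal among those
  containing \<open>r\<close> is prime.\<close>

lemma exists_prime_colon:
  assumes "ideal J R" "r \<in> carrier R" "c \<in> carrier R" "c \<notin> J" "r \<otimes> c \<in> J"
  shows "\<exists>b\<in>carrier R. b \<notin> J \<and> r \<in> icolon J b \<and> primeideal (icolon J b) R"
proof -
  let ?A = "{icolon J b |b. b \<in> carrier R \<and> b \<notin> J \<and> r \<otimes> b \<in> J}"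
  have "?A \<noteq> {}" using assms by auto
  moreover have "ideal K R" if "K \<in> ?A" for K using that ideal_icolon[OF assms(1)] by auto
  ultimately obtain M where M: "M \<in> ?A" "\<forall>X\<in>?A. M \<subseteq> X \<longrightarrow> X = M" using noeth_max by meson
  then obtain b where b: "M = icolon J b" "b \<in> carrier R" "b \<notin> J" "r \<otimes> b \<in> J" by auto
  have "primeideal M R"
  proof (rule primeidealI)
    show "ideal M R" using b ideal_icolon[OF assms(1)] by simp
    show "cring R" by (rule is_cring)
    have "\<one> \<notin> M" using b by (simp add: icolon_def)
    then show "carrier R \<noteq> M" by auto
    fix x y assume xy: "x \<in> carrier R" "y \<in> carrier R" "x \<otimes> y \<in> M"
    show "x \<in> M \<or> y \<in> M"
    proof (rule ccontr)
      assume n: "\<not> (x \<in> M \<or> y \<in> M)"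
      then have yb: "y \<otimes> b \<notin> J" using b xy by (simp add: icolon_def)
      have "r \<otimes> (y \<otimes> b) \<in> J"
        using ideal_mult[OF assms(1) b(4) xy(2)] b(2) xy(2) assms(2) by (simp add: m_ac)
      then have "icolon J (y \<otimes> b) \<in> ?A" using yb b(2) xy(2) by auto
      moreover have "M \<subseteq> icolon J (y \<otimes> b)"
      proof
        fix z assume "z \<in> M"
        then have z: "z \<in> carrier R" "z \<otimes> b \<in> J" using b(1) by (auto simp: icolon_def)
        have "z \<otimes> (y \<otimes> b) = y \<otimes> (z \<otimes> b)" using z xy b by (simp add: m_ac)
        then show "z \<in> icolon J (y \<otimes> b)" using z ideal_mult[OF assms(1) z(2) xy(2)] by (simp add: icolon_def)
      qed
      ultimately have "icolon J (y \<otimes> b) = M" using M(2) by blast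
      moreover have "x \<in> icolon J (y \<otimes> b)"
        using xy b by (simp add: icolon_def m_assoc)
      ultimately show False using n by blast
    qed
  qed
  then show ?thesis using b assms(2) by (auto simp: icolon_def)
qed


lemma regular_carrier: "regular a \<Longrightarrow> a \<in> carrier R" by (simp add: regular_def)

lemma nonregular_in_prime:
  assumes "r \<in> carrier R" "\<not> regular r"
  shows "\<exists>b\<in>carrier R. b \<noteq> \<zero> \<and> r \<in> icolon {\<zero>} b \<and> primeideal (icolon {\<zero>} b) R"
proof -
  obtain c where "c \<in> carrier R" "r \<otimes> c = \<zero>" "c \<noteq> \<zero>" using assms by (auto simp: regular_def)
  then show ?thesis using exists_prime_colon[OF zeroideal assms(1), of c] by auto
qed

end

section \<open>Dimension one\<close>

locale noeth_local_dim1 = noeth_local +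
  assumes dim1: "krull_dim R = 1"
begin

lemma prime_subset_mm: "primeideal p R \<Longrightarrow> p \<subseteq> \<mm>"
  by (rule proper_subset_mm)
    (auto simp: primeideal_def primeideal_axioms_def)

lemma prime_minimal:
  assumes "primeideal p R" "primeideal q R" "q \<subset> p" shows "p = \<mm>"
proof (rule ccontr)
  assume "p \<noteq> \<mm>"
  then have pm: "p \<subset> \<mm>" using prime_subset_mm[OF assms(1)] by blast
  define c :: "nat \<Rightarrow> 'a set" where "c i = (if i = 0 then q else if i = 1 then p else \<mm>)" for i
  have "\<exists>p. (\<forall>i\<le>2. primeideal (p i) R) \<and> (\<forall>i<2. p i \<subset> p (Suc i))"
    using assms pm mm_prime by (intro exI[of _ c]) (auto simp: c_def less_Suc_eq numeral_2_eq_2)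
  then have "enat 2 \<le> krull_dim R" unfolding krull_dim_def by (intro Sup_upper) blast
  then show False using dim1 by (simp add: one_enat_def)
qed

lemma prime_eq: "primeideal p R \<Longrightarrow> primeideal q R \<Longrightarrow> q \<subseteq> p \<Longrightarrow> p \<noteq> \<mm> \<Longrightarrow> q = p"
  using prime_minimal[of p q] by blast

lemma exists_nonmax_prime: "\<exists>p. primeideal p R \<and> p \<noteq> \<mm>"
proof (rule ccontr)
  assume no: "\<not> ?thesis"
  have "krull_dim R \<le> 0"
    unfolding krull_dim_def
  proof (rule Sup_least, safe)
    fix n :: nat and p :: "nat \<Rightarrow> 'a set"
    assume p: "\<forall>i\<le>n. primeideal (p i) R" "\<forall>i<n. p i \<subset> p (Suc i)"
    have "n = 0"
    proof (rule ccontr)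
      assume "n \<noteq> 0"
      then have "p 0 \<subset> p (Suc 0)" "p 0 = \<mm>" "p (Suc 0) = \<mm>" using p no by auto
      then show False by simp
    qed
    then show "enat n \<le> 0" by (simp add: zero_enat_def)
  qed
  then show False using dim1 by simp
qed

text \<open>A nonmaximal prime \<open>p\<close> is minimal. In a product of primes that is zero, take the factor \<open>b\<close> in the
  primes equal to \<open>p\<close> and a factor outside \<open>p\<close> in the others.\<close>

lemma minimal_prime_nilpotent:
  assumes "primeideal p R" "p \<noteq> \<mm>" "b \<in> p"
  shows "\<exists>u\<in>carrier R - p. \<exists>k::nat. u \<otimes> b [^] k = \<zero>"
proof -
  interpret p: primeideal p R by fact
  have b: "b \<in> carrier R" using assms(3) by (rule p.Icarr)
  obtain ps where ps: "\<forall>q\<in>set ps. primeideal q R" "\<forall>xs. list_all2 (\<in>) xs ps \<longrightarrow> lprod xs \<in> {\<zero>}"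
    using prime_product[OF zeroideal] by blast
  have "\<exists>xs. list_all2 (\<in>) xs ps \<and> (\<exists>u\<in>carrier R - p. \<exists>k::nat. lprod xs = u \<otimes> b [^] k)"
    using ps(1)
  proof (induction ps)
    case Nil
    have "\<one> \<notin> p" using p.one_imp_carrier p.I_notcarr by auto
    then show ?case by (intro exI[of _ "[]"]) (auto intro!: bexI[of _ \<one>] exI[of _ 0])
  next
    case (Cons q ps)
    then obtain xs u and k :: nat where x: "list_all2 (\<in>) xs ps" "u \<in> carrier R - p" "lprod xs = u \<otimes> b [^] k"
      by auto
    have q: "primeideal q R" using Cons.prems by simp
    show ?case
    proof (cases "q \<subseteq> p")
      case True
      then have "q = p" using prime_eq[OF assms(1) q _ assms(2)] by blast
      moreover have "lprod (b # xs) = u \<otimes> b [^] Suc k" using x b by (simp add: m_ac)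
      ultimately show ?thesis using x(1,2) assms(3) by (metis list_all2_Cons)
    next
      case False
      then obtain y where y: "y \<in> q" "y \<notin> p" by blast
      then have yc: "y \<in> carrier R" using q ideal_mem by (auto simp: primeideal_def)
      have "lprod (y # xs) = (y \<otimes> u) \<otimes> b [^] k" using x b yc by (simp add: m_assoc)
      moreover have "y \<otimes> u \<in> carrier R - p" using p.prime_notin[of y u] x(2) y yc by auto
      ultimately show ?thesis using x(1) y(1) by (metis list_all2_Cons)
    qed
  qed
  then show ?thesis using ps(2) by fastforce
qed

lemma common_annihilator:
  assumes "primeideal p R" "x \<in> carrier R" "finite B" "\<forall>b\<in>B. b \<in> carrier R \<and> (\<exists>u\<in>carrier R - p. u \<otimes> (b \<otimes> x) = \<zero>)"
  shows "\<exists>u\<in>carrier R - p. \<forall>b\<in>B. u \<otimes> (b \<otimes> x) = \<zero>"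
  using assms(3,4)
proof (induction B)
  interpret p: primeideal p R by fact
  case empty
  have "\<one> \<notin> p" using p.one_imp_carrier p.I_notcarr by auto
  then show ?case by auto
next
  interpret p: primeideal p R by fact
  case (insert b B)
  then obtain u v where u: "u \<in> carrier R - p" "\<forall>b\<in>B. u \<otimes> (b \<otimes> x) = \<zero>"
    and v: "v \<in> carrier R - p" "v \<otimes> (b \<otimes> x) = \<zero>" by auto
  have "(v \<otimes> u) \<otimes> (c \<otimes> x) = \<zero>" if "c \<in> insert b B" for c
  proof (cases "c = b")
    case True
    then have "(v \<otimes> u) \<otimes> (c \<otimes> x) = u \<otimes> (v \<otimes> (b \<otimes> x))"
      using u v assms(2) insert.prems by (simp add: m_ac)
    then show ?thesis using u v by simp
  next
    case False
    then have "c \<in> B" using that by simp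
    have "(v \<otimes> u) \<otimes> (c \<otimes> x) = v \<otimes> (u \<otimes> (c \<otimes> x))"
      using u v assms(2) insert.prems that by (auto simp: m_assoc)
    then show ?thesis using u(2) v \<open>c \<in> B\<close> by simp
  qed
  moreover have "v \<otimes> u \<in> carrier R - p" using p.prime_notin[of v u] u v by auto
  ultimately show ?case by blast
qed

text \<open>Nonmaximal primes are annihilators. Among the annihilators \<open>(0 : x) \<subseteq> p\<close> choose a maximal one. If
  \<open>bx\<close> with \<open>b \<in> p\<close> were nonzero in the localization at \<open>p\<close>, then by maximality \<open>(0 : b\<^sup>kx) = (0 : x)\<close>
  for all \<open>k\<close>, although \<open>b\<close> is nilpotent there. So a multiple of \<open>x\<close> by an element outside \<open>p\<close> is
  killed by \<open>p\<close>.\<close>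

lemma nonmax_prime_associated:
  assumes "primeideal p R" "p \<noteq> \<mm>"
  shows "\<exists>s\<in>carrier R. p = icolon {\<zero>} s"
proof -
  interpret p: primeideal p R by fact
  let ?A = "{icolon {\<zero>} x |x. x \<in> carrier R \<and> icolon {\<zero>} x \<subseteq> p}"
  have "icolon {\<zero>} \<one> \<subseteq> p" by (auto simp: icolon_def)
  then have "?A \<noteq> {}" by blast
  moreover have "ideal J R" if "J \<in> ?A" for J using that ideal_icolon[OF zeroideal] by auto
  ultimately obtain M where M: "M \<in> ?A" "\<forall>X\<in>?A. M \<subseteq> X \<longrightarrow> X = M" using noeth_max by meson
  then obtain x where x: "x \<in> carrier R" "M = icolon {\<zero>} x" "M \<subseteq> p" by auto
  have ex: "\<exists>u\<in>carrier R - p. u \<otimes> (b \<otimes> x) = \<zero>" if bp: "b \<in> p" for b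
  proof (rule ccontr)
    assume no: "\<not> ?thesis"
    have b: "b \<in> carrier R" using bp by (rule p.Icarr)
    have pow: "icolon {\<zero>} (b [^] k \<otimes> x) = M" for k :: nat
    proof (induction k)
      case 0 then show ?case using x by simp
    next
      case (Suc k)
      have sub: "icolon {\<zero>} (b [^] Suc k \<otimes> x) \<subseteq> p"
      proof
        fix c assume "c \<in> icolon {\<zero>} (b [^] Suc k \<otimes> x)"
        then have c: "c \<in> carrier R" "c \<otimes> (b [^] Suc k \<otimes> x) = \<zero>" by (auto simp: icolon_def)
        have "(c \<otimes> b) \<otimes> (b [^] k \<otimes> x) = \<zero>" using c b x by (simp add: m_ac)
        then have "c \<otimes> b \<in> icolon {\<zero>} (b [^] k \<otimes> x)" using b c by (simp add: icolon_def)
        then have "c \<otimes> b \<in> icolon {\<zero>} x" using Suc x by simp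
        then have "c \<otimes> (b \<otimes> x) = \<zero>" using b c x by (simp add: icolon_def m_assoc)
        then show "c \<in> p" using no c by blast
      qed
      have "M \<subseteq> icolon {\<zero>} (b [^] Suc k \<otimes> x)"
      proof
        fix c assume "c \<in> M"
        then have c: "c \<in> carrier R" "c \<otimes> x = \<zero>" using x by (auto simp: icolon_def)
        have "c \<otimes> (b [^] Suc k \<otimes> x) = b [^] Suc k \<otimes> (c \<otimes> x)"
          using c x b by (intro m_lcomm) auto
        then show "c \<in> icolon {\<zero>} (b [^] Suc k \<otimes> x)" using c b by (simp add: icolon_def)
      qed
      moreover have "icolon {\<zero>} (b [^] Suc k \<otimes> x) \<in> ?A"
        using sub b x(1) by (intro CollectI exI[of _ "b [^] Suc k \<otimes> x"] conjI refl m_closed nat_pow_closed)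
      ultimately show ?case using M(2) by simp
    qed
    obtain u and k :: nat where u: "u \<in> carrier R - p" "u \<otimes> b [^] k = \<zero>"
      using minimal_prime_nilpotent[OF assms bp] by blast
    have "u \<otimes> (b [^] k \<otimes> x) = \<zero>" using u b x by (simp add: m_assoc[symmetric])
    then have "u \<in> icolon {\<zero>} (b [^] k \<otimes> x)" using u by (simp add: icolon_def)
    then have "u \<in> M" using pow by simp
    then show False using x(3) u by blast
  qed
  obtain B where B: "B \<subseteq> carrier R" "finite B" "p = Idl B"
    using noetherian_ring.finetely_gen[OF noeth p.is_ideal] by blast
  have "B \<subseteq> p" using genideal_self[OF B(1)] B(3) by simp
  then obtain u where u: "u \<in> carrier R - p" "\<forall>b\<in>B. u \<otimes> (b \<otimes> x) = \<zero>"
    using common_annihilator[OF assms(1) x(1) B(2)] ex B(1) by blast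
  have "B \<subseteq> icolon {\<zero>} (u \<otimes> x)"
  proof
    fix b assume "b \<in> B"
    then have "b \<in> carrier R" "u \<otimes> (b \<otimes> x) = \<zero>" using B u by auto
    then show "b \<in> icolon {\<zero>} (u \<otimes> x)" using u x by (simp add: icolon_def m_ac)
  qed
  then have "p \<subseteq> icolon {\<zero>} (u \<otimes> x)"
    unfolding B(3) using u x by (intro genideal_minimal ideal_icolon zeroideal) auto
  moreover have "icolon {\<zero>} (u \<otimes> x) \<subseteq> p"
  proof
    fix c assume "c \<in> icolon {\<zero>} (u \<otimes> x)"
    then have c: "c \<in> carrier R" "c \<otimes> (u \<otimes> x) = \<zero>" by (auto simp: icolon_def)
    then have "c \<otimes> u \<in> M" using x u by (simp add: icolon_def m_assoc)
    then have "c \<otimes> u \<in> p" using x by blast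
    then show "c \<in> p" using p.prime_notin[of c u] c u by auto
  qed
  ultimately show ?thesis using u x by (intro bexI[of _ "u \<otimes> x"]) auto
qed

lemma nonmax_prime_Ass: "primeideal p R \<Longrightarrow> p \<noteq> \<mm> \<Longrightarrow> p \<in> Ass R"
  using nonmax_prime_associated[of p] by (auto simp: Ass_def icolon_def)

lemma regular_notin_prime:
  assumes "regular a" "primeideal p R" "p \<noteq> \<mm>" shows "a \<notin> p"
proof
  interpret p: primeideal p R by fact
  assume "a \<in> p"
  obtain s where s: "s \<in> carrier R" "p = icolon {\<zero>} s" using nonmax_prime_associated[OF assms(2,3)] by blast
  have "a \<in> icolon {\<zero>} s" using \<open>a \<in> p\<close> s(2) by blast
  then have "a \<otimes> s = \<zero>" by (simp add: icolon_def)
  then have "s = \<zero>" using assms(1) s(1) by (simp add: regular_def)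
  then have "\<one> \<in> icolon {\<zero>} s" by (simp add: icolon_def)
  then have "\<one> \<in> p" using s(2) by blast
  then show False using p.I_notcarr p.one_imp_carrier by auto
qed

text \<open>They all occur in a product of primes that is zero.\<close>

lemma finite_nonmax_primes: "finite {p. primeideal p R \<and> p \<noteq> \<mm>}"
proof -
  obtain ps where ps: "\<forall>q\<in>set ps. primeideal q R" "\<forall>xs. list_all2 (\<in>) xs ps \<longrightarrow> lprod xs \<in> {\<zero>}"
    using prime_product[OF zeroideal] by blast
  have "{p. primeideal p R \<and> p \<noteq> \<mm>} \<subseteq> set ps"
  proof
    fix p assume "p \<in> {p. primeideal p R \<and> p \<noteq> \<mm>}"
    then have p: "primeideal p R" "p \<noteq> \<mm>" by auto
    interpret p: primeideal p R by fact
    show "p \<in> set ps"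
    proof (rule ccontr)
      assume "p \<notin> set ps"
      then have "\<forall>q\<in>set ps. \<exists>y\<in>q. y \<in> carrier R \<and> y \<notin> p"
        using prime_eq[OF p(1) _ _ p(2)] ps(1) ideal_mem by (metis primeideal_def subsetI)
      then have "\<exists>xs. list_all2 (\<in>) xs ps \<and> lprod xs \<in> carrier R - p"
      proof (induction ps)
        case Nil
        have "\<one> \<notin> p" using p.one_imp_carrier p.I_notcarr by auto
        then show ?case by (intro exI[of _ "[]"]) auto
      next
        case (Cons q ps)
        then obtain xs y where "list_all2 (\<in>) xs ps" "lprod xs \<in> carrier R - p" "y \<in> q" "y \<in> carrier R - p"
          by auto
        then show ?case using p.prime_notin[of y "lprod xs"] by (intro exI[of _ "y # xs"]) auto
      qed
      then show False using ps(2) ideal_zero[OF p.is_ideal] by auto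
    qed
  qed
  then show ?thesis by (rule finite_subset) simp
qed

text \<open>Prime avoidance for the nonmaximal primes, which are finite in number and pairwise incomparable,
  and the ideal \<open>J\<close>, which need not be prime but contains \<open>\<mm>\<^sup>2\<close>. The elements used for corrections
  lie in all but one of the primes and, as multiples of squares, in \<open>J\<close>. By positive depth a nonregular
  element lies in a nonmaximal prime.\<close>

lemma exists_regular_avoiding:
  assumes depth: "\<And>s. s \<in> carrier R \<Longrightarrow> icolon {\<zero>} s \<noteq> \<mm>"
    and J: "ideal J R" "\<not> \<mm> \<subseteq> J" "\<And>x y. x \<in> \<mm> \<Longrightarrow> y \<in> \<mm> \<Longrightarrow> x \<otimes> y \<in> J"
  shows "\<exists>a\<in>\<mm> - J. regular a"
proof -
  have in_all: "\<exists>y\<in>\<mm> \<inter> J. y \<notin> p \<and> (\<forall>q\<in>Q. y \<in> q)"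
    if p: "primeideal p R" "p \<noteq> \<mm>" and "finite Q" "\<forall>q\<in>Q. primeideal q R \<and> q \<noteq> \<mm> \<and> q \<noteq> p" for p Q
    using that(3,4)
  proof (induction Q)
    interpret p: primeideal p R by fact
    case empty
    obtain z where z: "z \<in> \<mm>" "z \<notin> p" using prime_subset_mm[OF p(1)] p(2) by blast
    then have "z \<otimes> z \<in> J" "z \<otimes> z \<in> \<mm>" "z \<otimes> z \<notin> p"
      using J(3)[of z z] ideal_mult[OF mm_ideal z(1)] mm_carrier[OF z(1)] p.prime_notin[of z z] by auto
    then show ?case by blast
  next
    interpret p: primeideal p R by fact
    case (insert q Q)
    then obtain y where y: "y \<in> \<mm> \<inter> J" "y \<notin> p" "\<forall>q\<in>Q. y \<in> q" by auto
    have q: "primeideal q R" "q \<noteq> \<mm>" "q \<noteq> p" using insert.prems by auto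
    then obtain z where z: "z \<in> q" "z \<notin> p" using prime_eq[OF p(1) q(1) _ p(2)] by blast
    have qi: "ideal q R" using q(1) by (simp add: primeideal_def)
    have zc: "z \<in> carrier R" and yc: "y \<in> carrier R" using ideal_mem[OF qi z(1)] mm_carrier y(1) by auto
    have "z \<otimes> y \<in> r" if "r \<in> Q" for r
    proof -
      have "ideal r R" using insert.prems that by (auto simp: primeideal_def)
      then show ?thesis using y(3) that zc by (intro ideal_mult) auto
    qed
    moreover have "z \<otimes> y \<in> q" using ideal_mult'[OF qi z(1) yc] .
    moreover have "z \<otimes> y \<in> \<mm> \<inter> J" using y(1) zc ideal_mult[OF mm_ideal] ideal_mult[OF J(1)] by auto
    moreover have "z \<otimes> y \<notin> p" using p.prime_notin zc yc z y by auto
    ultimately show ?case by blast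
  qed
  have "\<exists>x\<in>\<mm> - J. \<forall>p\<in>Q. x \<notin> p" if "finite Q" "Q \<subseteq> {p. primeideal p R \<and> p \<noteq> \<mm>}" for Q
    using that
  proof (induction Q)
    case empty then show ?case using J(2) by auto
  next
    case (insert p Q)
    then obtain x where x: "x \<in> \<mm> - J" "\<forall>p\<in>Q. x \<notin> p" by auto
    show ?case
    proof (cases "x \<in> p")
      case False then show ?thesis using x by auto
    next
      case True
      have p: "primeideal p R" "p \<noteq> \<mm>" using insert.prems by auto
      obtain y where y: "y \<in> \<mm> \<inter> J" "y \<notin> p" "\<forall>q\<in>Q. y \<in> q"
        using in_all[OF p insert.hyps(1)] insert.prems insert.hyps(2) by blast
      have xc: "x \<in> carrier R" and yc: "y \<in> carrier R" using x y mm_carrier by auto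
      have "x \<oplus> y \<notin> q" if "q \<in> Q" for q
      proof
        assume "x \<oplus> y \<in> q"
        moreover have "ideal q R" using insert.prems that by (auto simp: primeideal_def)
        ultimately show False using x(2) that ideal_addD[of q x y] y(3) xc by auto
      qed
      moreover have "x \<oplus> y \<notin> p"
      proof
        assume "x \<oplus> y \<in> p"
        moreover have "ideal p R" using p by (simp add: primeideal_def)
        ultimately show False using True y(2) ideal_addD[of p y x] xc yc by (simp add: a_comm)
      qed
      moreover have "x \<oplus> y \<in> \<mm>" using x y ideal_add[OF mm_ideal] by auto
      moreover have "x \<oplus> y \<notin> J" using x y ideal_addD[OF J(1), of x y] xc by auto
      ultimately show ?thesis by blast
    qed
  qed
  from this[OF finite_nonmax_primes order_refl] obtain x where
    x: "x \<in> \<mm> - J" "\<And>p. primeideal p R \<Longrightarrow> p \<noteq> \<mm> \<Longrightarrow> x \<notin> p" by blast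
  have "regular x"
  proof (rule ccontr)
    assume "\<not> regular x"
    then obtain b where "b \<in> carrier R" "x \<in> icolon {\<zero>} b" "primeideal (icolon {\<zero>} b) R"
      using nonregular_in_prime[of x] mm_carrier x(1) by blast
    then show False using x(2) depth by blast
  qed
  then show ?thesis using x(1) by blast
qed

end

section \<open>Injective modules\<close>

context cring
begin

text \<open>A copy of \<open>R\<close> on the type of carriers over which injectivity is stated.\<close>

definition enc :: "'a \<Rightarrow> (nat \<Rightarrow> 'a) set" where "enc r = {\<lambda>_. r}"
definition dec :: "(nat \<Rightarrow> 'a) set \<Rightarrow> 'a" where "dec X = the_elem X 0"

lemma dec_enc [simp]: "dec (enc r) = r" by (simp add: enc_def dec_def)

definition copy_module :: "('a, (nat \<Rightarrow> 'a) set) module" where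
  "copy_module = \<lparr>carrier = enc ` carrier R, mult = undefined, one = undefined, zero = enc \<zero>,
     add = (\<lambda>X Y. enc (dec X \<oplus> dec Y)), smult = (\<lambda>a X. enc (a \<otimes> dec X))\<rparr>"

lemma copy_module_simps [simp]:
  "carrier copy_module = enc ` carrier R" "zero copy_module = enc \<zero>"
  "add copy_module X Y = enc (dec X \<oplus> dec Y)" "smult copy_module a X = enc (a \<otimes> dec X)"
  by (simp_all add: copy_module_def)

lemma copy_module: "module R copy_module"
proof (rule moduleI)
  show "cring R" by (rule is_cring)
  show "abelian_group copy_module"
  proof (rule abelian_groupI)
    fix X assume "X \<in> carrier copy_module"
    then obtain x where x: "X = enc x" "x \<in> carrier R" by auto
    show "\<exists>Y\<in>carrier copy_module. Y \<oplus>\<^bsub>copy_module\<^esub> X = \<zero>\<^bsub>copy_module\<^esub>"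
      by (rule bexI[of _ "enc (\<ominus> x)"]) (use x in \<open>auto simp: l_neg\<close>)
  qed (auto simp: a_ac)
qed (auto simp: l_distr r_distr m_assoc)

end

context noeth_local
begin

text \<open>Baer's form of injectivity: a homomorphism \<open>f\<close> from an ideal to \<open>E\<close> is multiplication by an element
  \<open>z\<close>, the value at \<open>\<one>\<close> of its extension to \<open>R\<close>.\<close>

lemma injective_baer:
  fixes E :: "('a, 'i) module"
  assumes inj: "injective_module R E" and A: "ideal A R"
    and f: "\<And>x. x \<in> A \<Longrightarrow> f x \<in> carrier E"
    and f_add: "\<And>x y. x \<in> A \<Longrightarrow> y \<in> A \<Longrightarrow> f (x \<oplus> y) = f x \<oplus>\<^bsub>E\<^esub> f y"
    and f_mult: "\<And>r x. r \<in> carrier R \<Longrightarrow> x \<in> A \<Longrightarrow> f (r \<otimes> x) = r \<odot>\<^bsub>E\<^esub> f x"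
  shows "\<exists>z\<in>carrier E. \<forall>x\<in>A. f x = x \<odot>\<^bsub>E\<^esub> z"
proof -
  interpret N: module R copy_module by (rule copy_module)
  let ?B = "enc ` A"
  have Ac: "x \<in> carrier R" if "x \<in> A" for x using ideal_mem[OF A that] .
  have B: "submodule ?B R copy_module"
  proof (rule N.submoduleI)
    show "\<zero>\<^bsub>copy_module\<^esub> \<in> ?B" using ideal_zero[OF A] by auto
    fix X assume "X \<in> ?B"
    then obtain x where x: "X = enc x" "x \<in> A" by auto
    have "\<ominus> \<one> \<otimes> x \<in> A" using ideal_mult[OF A x(2), of "\<ominus> \<one>"] by simp
    moreover have "\<ominus>\<^bsub>copy_module\<^esub> X = enc (\<ominus> x)"
      by (rule N.minus_equality) (use x Ac in \<open>auto simp: l_neg\<close>)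
    ultimately show "\<ominus>\<^bsub>copy_module\<^esub> X \<in> ?B" using Ac[OF x(2)] by (simp add: l_minus)
  qed (use Ac ideal_add[OF A] ideal_mult[OF A] in auto)
  define g where "g = (\<lambda>X\<in>?B. f (dec X))"
  have g: "g \<in> lin_maps R (copy_module\<lparr>carrier := ?B\<rparr>) E"
    unfolding lin_maps_def g_def
    by (auto simp: f f_add f_mult ideal_add[OF A] ideal_mult[OF A] PiE_def Pi_def extensional_def)
  obtain h where h: "h \<in> lin_maps R copy_module E" "\<forall>X\<in>?B. h X = g X"
    using inj copy_module B g unfolding injective_module_def by blast
  have hc: "h (enc \<one>) \<in> carrier E" using h(1) by (auto simp: lin_maps_def PiE_def Pi_def)
  have "f x = x \<odot>\<^bsub>E\<^esub> h (enc \<one>)" if x: "x \<in> A" for x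
  proof -
    have "f x = h (enc x)" using h(2) x by (simp add: g_def)
    also have "enc x = x \<odot>\<^bsub>copy_module\<^esub> enc \<one>" using Ac[OF x] by simp
    also have "h \<dots> = x \<odot>\<^bsub>E\<^esub> h (enc \<one>)"
      using h(1) Ac[OF x] by (simp add: lin_maps_def del: copy_module_simps(4))
    finally show ?thesis .
  qed
  then show ?thesis using hc by blast
qed

text \<open>Congruence modulo \<open>aR\<close>. Computations in \<open>R/aR\<close> are done with representatives.\<close>

definition eqm :: "'a \<Rightarrow> 'a \<Rightarrow> 'a \<Rightarrow> bool" where
  "eqm a x y \<longleftrightarrow> (\<exists>t\<in>carrier R. x = y \<oplus> a \<otimes> t)"

end

section \<open>Injective resolutions\<close>

locale inj_resolution = noeth_local_dim1 +
  fixes I :: "nat \<Rightarrow> ('a, 'i) module" and \<epsilon> :: "'a \<Rightarrow> 'i" and d :: "nat \<Rightarrow> 'i \<Rightarrow> 'i" and n :: nat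
  assumes I_inj: "\<And>j. injective_module R (I j)"
    and I_top: "\<And>j. j > n \<Longrightarrow> carrier (I j) = {\<zero>\<^bsub>I j\<^esub>}"
    and eps: "\<epsilon> \<in> lin_maps R (self_module R) (I 0)" and eps_inj: "inj_on \<epsilon> (carrier R)"
    and d_lin: "\<And>j. d j \<in> lin_maps R (I j) (I (Suc j))"
    and eps_img: "\<epsilon> ` carrier R = {x \<in> carrier (I 0). d 0 x = \<zero>\<^bsub>I (Suc 0)\<^esub>}"
    and d_img: "\<And>j. d j ` carrier (I j) = {x \<in> carrier (I (Suc j)). d (Suc j) x = \<zero>\<^bsub>I (Suc (Suc j))\<^esub>}"
begin

lemma I_module: "module R (I j)" using I_inj by (simp add: injective_module_def)

interpretation I: module R "I j" for j by (rule I_module)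

lemma d_closed [simp]: "x \<in> carrier (I j) \<Longrightarrow> d j x \<in> carrier (I (Suc j))"
  using d_lin[of j] by (auto simp: lin_maps_def PiE_def Pi_def)

lemma d_add: "x \<in> carrier (I j) \<Longrightarrow> y \<in> carrier (I j) \<Longrightarrow> d j (x \<oplus>\<^bsub>I j\<^esub> y) = d j x \<oplus>\<^bsub>I (Suc j)\<^esub> d j y"
  using d_lin[of j] by (auto simp: lin_maps_def)

lemma d_smult: "a \<in> carrier R \<Longrightarrow> x \<in> carrier (I j) \<Longrightarrow> d j (a \<odot>\<^bsub>I j\<^esub> x) = a \<odot>\<^bsub>I (Suc j)\<^esub> d j x"
  using d_lin[of j] by (auto simp: lin_maps_def)

lemma d_zero [simp]: "d j \<zero>\<^bsub>I j\<^esub> = \<zero>\<^bsub>I (Suc j)\<^esub>"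
  using d_smult[of \<zero> "\<zero>\<^bsub>I j\<^esub>" j] by simp

lemma I_minus: "x \<in> carrier (I j) \<Longrightarrow> \<ominus>\<^bsub>I j\<^esub> x = (\<ominus> \<one>) \<odot>\<^bsub>I j\<^esub> x"
  by (simp add: I.smult_l_minus)

lemma d_diff: "x \<in> carrier (I j) \<Longrightarrow> y \<in> carrier (I j) \<Longrightarrow> d j (x \<ominus>\<^bsub>I j\<^esub> y) = d j x \<ominus>\<^bsub>I (Suc j)\<^esub> d j y"
  by (simp add: a_minus_def I_minus d_add d_smult)

lemma dd [simp]: "x \<in> carrier (I j) \<Longrightarrow> d (Suc j) (d j x) = \<zero>\<^bsub>I (Suc (Suc j))\<^esub>"
  using d_img[of j] by blast

lemma d_exact: "x \<in> carrier (I (Suc j)) \<Longrightarrow> d (Suc j) x = \<zero>\<^bsub>I (Suc (Suc j))\<^esub> \<Longrightarrow> \<exists>z\<in>carrier (I j). d j z = x"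
proof -
  assume "x \<in> carrier (I (Suc j))" "d (Suc j) x = \<zero>\<^bsub>I (Suc (Suc j))\<^esub>"
  then have "x \<in> d j ` carrier (I j)" unfolding d_img by simp
  then show ?thesis by (elim imageE) (intro bexI, auto)
qed

lemma smult_diff: "r \<in> carrier R \<Longrightarrow> x \<in> carrier (I j) \<Longrightarrow> y \<in> carrier (I j) \<Longrightarrow>
    r \<odot>\<^bsub>I j\<^esub> (x \<ominus>\<^bsub>I j\<^esub> y) = r \<odot>\<^bsub>I j\<^esub> x \<ominus>\<^bsub>I j\<^esub> r \<odot>\<^bsub>I j\<^esub> y"
  by (simp add: a_minus_def I.smult_r_distr I.smult_r_minus)

lemma diff_self: "x \<in> carrier (I j) \<Longrightarrow> x \<ominus>\<^bsub>I j\<^esub> x = \<zero>\<^bsub>I j\<^esub>"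
  by (simp add: a_minus_def I.M.r_neg)

lemma diff_zero: "x \<in> carrier (I j) \<Longrightarrow> x \<ominus>\<^bsub>I j\<^esub> \<zero>\<^bsub>I j\<^esub> = x"
  by (simp add: a_minus_def)

lemma diff_add: "x \<in> carrier (I j) \<Longrightarrow> y \<in> carrier (I j) \<Longrightarrow> y \<oplus>\<^bsub>I j\<^esub> (x \<ominus>\<^bsub>I j\<^esub> y) = x"
  by (simp add: a_minus_def I.M.a_ac I.M.r_neg)

lemma eps_closed [simp]: "r \<in> carrier R \<Longrightarrow> \<epsilon> r \<in> carrier (I 0)"
  using eps_img by blast

lemma eps_smult: "r \<in> carrier R \<Longrightarrow> x \<in> carrier R \<Longrightarrow> \<epsilon> (r \<otimes> x) = r \<odot>\<^bsub>I 0\<^esub> \<epsilon> x"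
  using eps by (simp add: lin_maps_def self_module_def)

lemma eps_add: "r \<in> carrier R \<Longrightarrow> x \<in> carrier R \<Longrightarrow> \<epsilon> (r \<oplus> x) = \<epsilon> r \<oplus>\<^bsub>I 0\<^esub> \<epsilon> x"
  using eps by (simp add: lin_maps_def self_module_def)

lemma eps_zero [simp]: "\<epsilon> \<zero> = \<zero>\<^bsub>I 0\<^esub>"
  using eps_smult[of \<zero> \<zero>] by simp

lemma d_eps [simp]: "r \<in> carrier R \<Longrightarrow> d 0 (\<epsilon> r) = \<zero>\<^bsub>I (Suc 0)\<^esub>"
  using eps_img by blast

lemma eps_exact: "x \<in> carrier (I 0) \<Longrightarrow> d 0 x = \<zero>\<^bsub>I (Suc 0)\<^esub> \<Longrightarrow> \<exists>r\<in>carrier R. \<epsilon> r = x"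
proof -
  assume "x \<in> carrier (I 0)" "d 0 x = \<zero>\<^bsub>I (Suc 0)\<^esub>"
  then have "x \<in> \<epsilon> ` carrier R" unfolding eps_img by simp
  then show ?thesis by (elim imageE) (intro bexI, auto)
qed

lemma eps_eq: "r \<in> carrier R \<Longrightarrow> s \<in> carrier R \<Longrightarrow> \<epsilon> r = \<epsilon> s \<Longrightarrow> r = s"
  using eps_inj by (auto simp: inj_on_def)

text \<open>The submodule \<open>Hom(R/J, I j)\<close> of \<open>I j\<close>.\<close>

definition killed :: "nat \<Rightarrow> 'a set \<Rightarrow> 'i set" where
  "killed j J = {x \<in> carrier (I j). \<forall>r\<in>J. r \<odot>\<^bsub>I j\<^esub> x = \<zero>\<^bsub>I j\<^esub>}"

text \<open>The vanishing of \<open>Ext\<^sup>j\<^sup>+\<^sup>1(R/J, R)\<close>, computed by the injective resolution.\<close>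

definition ext_vanishes :: "nat \<Rightarrow> 'a set \<Rightarrow> bool" where
  "ext_vanishes j J \<longleftrightarrow> (\<forall>x\<in>killed (Suc j) J. d (Suc j) x = \<zero>\<^bsub>I (Suc (Suc j))\<^esub> \<longrightarrow> (\<exists>z\<in>killed j J. d j z = x))"

lemma killed_carrier: "x \<in> killed j J \<Longrightarrow> x \<in> carrier (I j)" by (simp add: killed_def)

lemma killed_smult: "x \<in> killed j J \<Longrightarrow> r \<in> J \<Longrightarrow> r \<odot>\<^bsub>I j\<^esub> x = \<zero>\<^bsub>I j\<^esub>" by (simp add: killed_def)

lemma killed_diff: "ideal J R \<Longrightarrow> x \<in> killed j J \<Longrightarrow> y \<in> killed j J \<Longrightarrow> x \<ominus>\<^bsub>I j\<^esub> y \<in> killed j J"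
  using ideal_mem[of J] by (auto simp: killed_def smult_diff diff_self)

lemma killed_add: "ideal J R \<Longrightarrow> x \<in> killed j J \<Longrightarrow> y \<in> killed j J \<Longrightarrow> x \<oplus>\<^bsub>I j\<^esub> y \<in> killed j J"
  using ideal_mem[of J] by (auto simp: killed_def I.smult_r_distr)

lemma killed_d: "ideal J R \<Longrightarrow> x \<in> killed j J \<Longrightarrow> d j x \<in> killed (Suc j) J"
  using ideal_mem[of J] by (auto simp: killed_def d_smult[symmetric])

lemma killed_mono: "J \<subseteq> K \<Longrightarrow> x \<in> killed j K \<Longrightarrow> x \<in> killed j J"
  by (auto simp: killed_def)

lemma killed_isum:
  assumes "ideal J R" "s \<in> carrier R" "x \<in> killed j J" "s \<odot>\<^bsub>I j\<^esub> x = \<zero>\<^bsub>I j\<^esub>"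
  shows "x \<in> killed j (isum J s)"
  unfolding killed_def
proof (intro CollectI conjI ballI)
  show x: "x \<in> carrier (I j)" using assms(3) by (rule killed_carrier)
  fix r assume "r \<in> isum J s"
  then obtain i t where "r = i \<oplus> t \<otimes> s" "i \<in> J" "t \<in> carrier R" by (rule isumE)
  then show "r \<odot>\<^bsub>I j\<^esub> x = \<zero>\<^bsub>I j\<^esub>"
    using ideal_mem[OF assms(1)] assms x killed_smult[OF assms(3)]
    by (simp add: I.smult_l_distr I.smult_assoc1)
qed

lemma killed_icolon:
  assumes "ideal J R" "s \<in> carrier R" "x \<in> killed j J"
  shows "s \<odot>\<^bsub>I j\<^esub> x \<in> killed j (icolon J s)"
  using assms killed_carrier[OF assms(3)] killed_smult[OF assms(3)]
  by (auto simp: killed_def icolon_def I.smult_assoc1[symmetric])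

lemma killed_PIdl: "a \<in> carrier R \<Longrightarrow> x \<in> carrier (I j) \<Longrightarrow> a \<odot>\<^bsub>I j\<^esub> x = \<zero>\<^bsub>I j\<^esub> \<Longrightarrow> x \<in> killed j (PIdl a)"
  by (auto simp: killed_def cgenideal_def I.smult_assoc1)

text \<open>The map \<open>(J + sR)/J \<rightarrow> I j\<close>, \<open>s \<mapsto> x\<close>, is well-defined because \<open>x\<close> is killed by \<open>(J : s)\<close>; \<open>z\<close> comes from
  its extension to \<open>R/J\<close>.\<close>

lemma killed_divide:
  assumes J: "ideal J R" and s: "s \<in> carrier R" and x: "x \<in> killed j (icolon J s)"
  shows "\<exists>z\<in>killed j J. s \<odot>\<^bsub>I j\<^esub> z = x"
proof -
  have xc: "x \<in> carrier (I j)" using x by (rule killed_carrier)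
  \<comment> \<open>The coefficient \<open>r\<close> in \<open>\<alpha> = i + r s\<close> is unique only up to \<open>(J : s)\<close>; this does not affect \<open>f\<close>.\<close>
  define f where "f \<alpha> = (SOME r. r \<in> carrier R \<and> (\<exists>i\<in>J. \<alpha> = i \<oplus> r \<otimes> s)) \<odot>\<^bsub>I j\<^esub> x" for \<alpha>
  have f: "f (i \<oplus> r \<otimes> s) = r \<odot>\<^bsub>I j\<^esub> x" if i: "i \<in> J" and r: "r \<in> carrier R" for i r
  proof -
    let ?P = "\<lambda>r'. r' \<in> carrier R \<and> (\<exists>i'\<in>J. i \<oplus> r \<otimes> s = i' \<oplus> r' \<otimes> s)"
    define t where "t = (SOME r'. ?P r')"
    have "?P t" unfolding t_def by (rule someI[of ?P r]) (use i r in blast)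
    then obtain i' where t: "t \<in> carrier R" "i' \<in> J" "i \<oplus> r \<otimes> s = i' \<oplus> t \<otimes> s" by blast
    have ic: "i \<in> carrier R" "i' \<in> carrier R" using ideal_mem[OF J] i t(2) by auto
    have "(t \<ominus> r) \<otimes> s = (i \<ominus> i') \<oplus> (\<ominus> i \<oplus> i' \<oplus> t \<otimes> s \<ominus> r \<otimes> s)"
      using ic s r t(1) by algebra
    also have "\<ominus> i \<oplus> i' \<oplus> t \<otimes> s \<ominus> r \<otimes> s = \<ominus> i \<oplus> (i' \<oplus> t \<otimes> s) \<ominus> r \<otimes> s"
      using ic s r t(1) by algebra
    also have "\<dots> = \<zero>" unfolding t(3)[symmetric] using ic s r by algebra
    finally have "(t \<ominus> r) \<otimes> s \<in> J" using ideal_sub[OF J i t(2)] ic by simp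
    then have "(t \<ominus> r) \<odot>\<^bsub>I j\<^esub> x = \<zero>\<^bsub>I j\<^esub>"
      using killed_smult[OF x] t(1) r by (simp add: icolon_def)
    moreover have "t \<odot>\<^bsub>I j\<^esub> x = ((t \<ominus> r) \<oplus> r) \<odot>\<^bsub>I j\<^esub> x"
      using t(1) r by (simp add: a_minus_def a_assoc l_neg)
    ultimately have "t \<odot>\<^bsub>I j\<^esub> x = r \<odot>\<^bsub>I j\<^esub> x"
      using t(1) r xc by (simp add: I.smult_l_distr)
    then show ?thesis unfolding f_def t_def by simp
  qed
  note A = ideal_sum_gen[OF J s]
  have "\<exists>z\<in>carrier (I j). \<forall>\<alpha>\<in>isum J s. f \<alpha> = \<alpha> \<odot>\<^bsub>I j\<^esub> z"
  proof (rule injective_baer[OF I_inj A(1)])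
    fix \<alpha> assume "\<alpha> \<in> isum J s"
    then obtain i r where a: "\<alpha> = i \<oplus> r \<otimes> s" "i \<in> J" "r \<in> carrier R" by (rule isumE)
    then have ic: "i \<in> carrier R" using ideal_mem[OF J] by simp
    show "f \<alpha> \<in> carrier (I j)" using a f xc by simp
    show "f (\<alpha> \<oplus> \<beta>) = f \<alpha> \<oplus>\<^bsub>I j\<^esub> f \<beta>" if beta: "\<beta> \<in> isum J s" for \<beta>
    proof -
      from beta obtain k t where b: "\<beta> = k \<oplus> t \<otimes> s" "k \<in> J" "t \<in> carrier R" by (rule isumE)
      then have kc: "k \<in> carrier R" using ideal_mem[OF J] by simp
      have "\<alpha> \<oplus> \<beta> = (i \<oplus> k) \<oplus> (r \<oplus> t) \<otimes> s"
        unfolding a(1) b(1) using ic kc a(3) b(3) s by algebra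
      then show ?thesis using f[OF ideal_add[OF J a(2) b(2)], of "r \<oplus> t"] f[OF a(2,3)] f[OF b(2,3)] a b xc
        by (simp add: I.smult_l_distr)
    qed
    show "f (t \<otimes> \<alpha>) = t \<odot>\<^bsub>I j\<^esub> f \<alpha>" if t: "t \<in> carrier R" for t
    proof -
      have "t \<otimes> \<alpha> = t \<otimes> i \<oplus> (t \<otimes> r) \<otimes> s" unfolding a(1) using ic a(3) s t by algebra
      then show ?thesis using f[OF ideal_mult[OF J a(2) t], of "t \<otimes> r"] f[OF a(2,3)] a t xc
        by (simp add: I.smult_assoc1)
    qed
  qed
  then obtain z where z: "z \<in> carrier (I j)" "\<And>\<alpha>. \<alpha> \<in> isum J s \<Longrightarrow> f \<alpha> = \<alpha> \<odot>\<^bsub>I j\<^esub> z" by blast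
  have "i \<odot>\<^bsub>I j\<^esub> z = \<zero>\<^bsub>I j\<^esub>" if i: "i \<in> J" for i
    using f[OF i zero_closed] z(2)[of i] A(2) i ideal_mem[OF J i] s xc by auto
  moreover have "s \<odot>\<^bsub>I j\<^esub> z = x"
    using f[OF ideal_zero[OF J] one_closed] z(2)[OF A(3)] s xc by simp
  ultimately show ?thesis using z(1) by (auto simp: killed_def)
qed

text \<open>Part of the long exact sequence of \<open>0 \<rightarrow> R/(J : s) \<rightarrow> R/J \<rightarrow> R/(J + sR) \<rightarrow> 0\<close>, whose first map is
  multiplication by \<open>s\<close>.\<close>

lemma ext_vanishes_colon:
  assumes J: "ideal J R" and s: "s \<in> carrier R"
    and v1: "ext_vanishes (Suc j) (isum J s)" and v0: "ext_vanishes j J"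
  shows "ext_vanishes j (icolon J s)"
  unfolding ext_vanishes_def
proof (intro ballI impI)
  fix x assume x: "x \<in> killed (Suc j) (icolon J s)" "d (Suc j) x = \<zero>\<^bsub>I (Suc (Suc j))\<^esub>"
  obtain z where z: "z \<in> killed (Suc j) J" "s \<odot>\<^bsub>I (Suc j)\<^esub> z = x"
    using killed_divide[OF J s x(1)] by blast
  note zc = killed_carrier[OF z(1)]
  have "s \<odot>\<^bsub>I (Suc (Suc j))\<^esub> d (Suc j) z = \<zero>\<^bsub>I (Suc (Suc j))\<^esub>"
    using d_smult[OF s zc] z(2) x(2) by simp
  then have "d (Suc j) z \<in> killed (Suc (Suc j)) (isum J s)"
    using killed_isum[OF J s killed_d[OF J z(1)]] by simp
  then obtain w where w: "w \<in> killed (Suc j) (isum J s)" "d (Suc j) w = d (Suc j) z"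
    using v1 zc unfolding ext_vanishes_def by (metis dd)
  have wJ: "w \<in> killed (Suc j) J" using killed_mono[OF ideal_sum_gen(2)[OF J s] w(1)] .
  note wc = killed_carrier[OF wJ]
  have "d (Suc j) (z \<ominus>\<^bsub>I (Suc j)\<^esub> w) = \<zero>\<^bsub>I (Suc (Suc j))\<^esub>"
    using d_diff[OF zc wc] w(2) zc by (simp add: diff_self)
  then obtain v where v: "v \<in> killed j J" "d j v = z \<ominus>\<^bsub>I (Suc j)\<^esub> w"
    using v0 killed_diff[OF J z(1) wJ] unfolding ext_vanishes_def by blast
  have "s \<odot>\<^bsub>I (Suc j)\<^esub> w = \<zero>\<^bsub>I (Suc j)\<^esub>"
    using killed_smult[OF w(1) ideal_sum_gen(3)[OF J s]] .
  then have "d j (s \<odot>\<^bsub>I j\<^esub> v) = x"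
    using d_smult[OF s killed_carrier[OF v(1)]] v(2) smult_diff[OF s zc wc] z(2) killed_carrier[OF x(1)]
    by (simp add: diff_zero)
  then show "\<exists>z\<in>killed j (icolon J s). d j z = x" using killed_icolon[OF J s v(1)] by blast
qed

text \<open>Another part of the same long exact sequence: the middle term vanishes if the outer terms do.\<close>

lemma ext_vanishes_extension:
  assumes J: "ideal J R" and b: "b \<in> carrier R"
    and v1: "ext_vanishes j (icolon J b)" and v2: "ext_vanishes j (isum J b)"
  shows "ext_vanishes j J"
  unfolding ext_vanishes_def
proof (intro ballI impI)
  fix x assume x: "x \<in> killed (Suc j) J" "d (Suc j) x = \<zero>\<^bsub>I (Suc (Suc j))\<^esub>"
  note xc = killed_carrier[OF x(1)]
  have "d (Suc j) (b \<odot>\<^bsub>I (Suc j)\<^esub> x) = \<zero>\<^bsub>I (Suc (Suc j))\<^esub>" using d_smult[OF b xc] x(2) b by simp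
  then obtain z where z: "z \<in> killed j (icolon J b)" "d j z = b \<odot>\<^bsub>I (Suc j)\<^esub> x"
    using v1 killed_icolon[OF J b x(1)] unfolding ext_vanishes_def by blast
  obtain w where w: "w \<in> killed j J" "b \<odot>\<^bsub>I j\<^esub> w = z" using killed_divide[OF J b z(1)] by blast
  note wc = killed_carrier[OF w(1)]
  let ?y = "x \<ominus>\<^bsub>I (Suc j)\<^esub> d j w"
  have "b \<odot>\<^bsub>I (Suc j)\<^esub> ?y = \<zero>\<^bsub>I (Suc j)\<^esub>"
    using smult_diff[OF b xc d_closed[OF wc]] d_smult[OF b wc] w(2) z(2) diff_self[OF I.smult_closed[OF b xc]] by simp
  then have "?y \<in> killed (Suc j) (isum J b)"
    using killed_isum[OF J b killed_diff[OF J x(1) killed_d[OF J w(1)]]] by simp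
  moreover have "d (Suc j) ?y = \<zero>\<^bsub>I (Suc (Suc j))\<^esub>"
    using d_diff[OF xc d_closed[OF wc]] x(2) wc by (simp add: diff_self)
  ultimately obtain v where v: "v \<in> killed j (isum J b)" "d j v = ?y"
    using v2 unfolding ext_vanishes_def by blast
  have vJ: "v \<in> killed j J" using killed_mono[OF ideal_sum_gen(2)[OF J b] v(1)] .
  have "d j (w \<oplus>\<^bsub>I j\<^esub> v) = x"
    using d_add[OF wc killed_carrier[OF vJ]] v(2) diff_add[OF xc d_closed[OF wc]] by simp
  then show "\<exists>z\<in>killed j J. d j z = x" using killed_add[OF J w(1) vJ] by blast
qed

lemma ext_vanishes_top: assumes "j \<ge> n" "ideal J R" shows "ext_vanishes j J"
  unfolding ext_vanishes_def
proof (intro ballI impI)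
  fix x assume "x \<in> killed (Suc j) J"
  then have "x = \<zero>\<^bsub>I (Suc j)\<^esub>" using I_top[of "Suc j"] assms(1) killed_carrier by fastforce
  moreover have "\<zero>\<^bsub>I j\<^esub> \<in> killed j J" using ideal_mem[OF assms(2)] by (simp add: killed_def)
  ultimately show "\<exists>z\<in>killed j J. d j z = x" by (metis d_zero)
qed

lemma ext_vanishes_carrier: "ext_vanishes j (carrier R)"
  unfolding ext_vanishes_def
proof (intro ballI impI)
  fix x assume x: "x \<in> killed (Suc j) (carrier R)"
  have "x = \<zero>\<^bsub>I (Suc j)\<^esub>" using killed_smult[OF x one_closed] killed_carrier[OF x] by simp
  moreover have "\<zero>\<^bsub>I j\<^esub> \<in> killed j (carrier R)" by (simp add: killed_def)
  ultimately show "\<exists>z\<in>killed j (carrier R). d j z = x" by (metis d_zero)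
qed

text \<open>Vanishing for all indices from \<open>j0\<close> on passes from \<open>R/J0\<close> to all its cyclic quotients if every prime
  above \<open>J0\<close> is associated to \<open>J0\<close>. Descending induction on the degree, starting from the end of the
  resolution: for a prime \<open>p = (J0 : s)\<close> use the embedding of \<open>R/p\<close> in \<open>R/J0\<close> and the next degree;
  every other ideal is reached by Noetherian induction along extensions by some \<open>R/p\<close>.\<close>

lemma ext_vanishes_descend:
  assumes J0: "ideal J0 R"
    and primes: "\<And>p. primeideal p R \<Longrightarrow> J0 \<subseteq> p \<Longrightarrow> \<exists>s\<in>carrier R. p = icolon J0 s"
    and base: "\<And>j. j \<ge> j0 \<Longrightarrow> ext_vanishes j J0"
  shows "j \<ge> j0 \<Longrightarrow> ideal J R \<Longrightarrow> J0 \<subseteq> J \<Longrightarrow> ext_vanishes j J"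
proof (induction "n - j" arbitrary: j J)
  case 0
  then show ?case using ext_vanishes_top by simp
next
  case (Suc k)
  have up: "ext_vanishes (Suc j) K" if "ideal K R" "J0 \<subseteq> K" for K
    by (rule Suc.hyps(1)) (use Suc.hyps(2) Suc.prems(1) that in auto)
  have pr: "ext_vanishes j p" if p: "primeideal p R" "J0 \<subseteq> p" for p
  proof -
    obtain s where s: "s \<in> carrier R" "p = icolon J0 s" using primes[OF p] by blast
    note K = ideal_sum_gen[OF J0 s(1)]
    show ?thesis unfolding s(2)
      by (rule ext_vanishes_colon[OF J0 s(1) up[OF K(1,2)] base[OF Suc.prems(1)]])
  qed
  have "J0 \<subseteq> J \<longrightarrow> ext_vanishes j J" using Suc.prems(2)
  proof (induction J rule: noeth_induct)
    case (step J)
    show ?case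
    proof (intro impI, cases "J = carrier R")
      case True then show "ext_vanishes j J" using ext_vanishes_carrier by simp
    next
      case False
      assume sub: "J0 \<subseteq> J"
      have "\<one> \<notin> J" using ideal.one_imp_carrier[OF step(1)] False by blast
      then obtain b where b: "b \<in> carrier R" "b \<notin> J" "primeideal (icolon J b) R"
        using exists_prime_colon[OF step(1) zero_closed one_closed] ideal_zero[OF step(1)] by auto
      note K = ideal_sum_gen[OF step(1) b(1)]
      show "ext_vanishes j J"
      proof (rule ext_vanishes_extension[OF step(1) b(1)])
        show "ext_vanishes j (icolon J b)" using pr[OF b(3)] icolon_subset[OF step(1) b(1)] sub by blast
        show "ext_vanishes j (isum J b)" using step(2)[OF K(1)] K(2,3) b(2) sub by blast
      qed
    qed
  qed
  then show ?case using Suc.prems(3) by blast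
qed

lemma ext_vanishes_zero: "ext_vanishes j {\<zero>}"
  unfolding ext_vanishes_def
proof (intro ballI impI)
  fix x assume "x \<in> killed (Suc j) {\<zero>}" "d (Suc j) x = \<zero>\<^bsub>I (Suc (Suc j))\<^esub>"
  then obtain z where "z \<in> carrier (I j)" "d j z = x" using d_exact killed_carrier by blast
  then show "\<exists>z\<in>killed j {\<zero>}. d j z = x" by (intro bexI[of _ z]) (auto simp: killed_def)
qed

lemma icolon_zero_regular: "regular a \<Longrightarrow> icolon {\<zero>} a = {\<zero>}"
  by (auto simp: icolon_def regular_def m_comm)

text \<open>Injective modules are divisible by regular elements.\<close>

lemma divisible:
  assumes "regular a" "x \<in> carrier (I j)" shows "\<exists>z\<in>carrier (I j). a \<odot>\<^bsub>I j\<^esub> z = x"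
  using killed_divide[OF zeroideal regular_carrier[OF assms(1)], of x j] assms
  by (auto simp: icolon_zero_regular killed_def)

text \<open>\<open>R/aR\<close> has projective dimension one.\<close>

lemma ext_vanishes_regular:
  assumes a: "regular a" and "j \<ge> 1" shows "ext_vanishes j (PIdl a)"
  unfolding ext_vanishes_def
proof (intro ballI impI)
  note ac = regular_carrier[OF a]
  obtain i where j: "j = Suc i" using \<open>j \<ge> 1\<close> by (cases j) auto
  fix x assume x: "x \<in> killed (Suc j) (PIdl a)" "d (Suc j) x = \<zero>\<^bsub>I (Suc (Suc j))\<^esub>"
  have ax: "a \<odot>\<^bsub>I (Suc j)\<^esub> x = \<zero>\<^bsub>I (Suc j)\<^esub>" using killed_smult[OF x(1) cgenideal_self[OF ac]] .
  obtain z where z: "z \<in> carrier (I j)" "d j z = x" using d_exact[OF killed_carrier[OF x(1)] x(2)] by blast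
  have "d j (a \<odot>\<^bsub>I j\<^esub> z) = \<zero>\<^bsub>I (Suc j)\<^esub>" using d_smult[OF ac z(1)] z(2) ax by simp
  then obtain w where w: "w \<in> carrier (I i)" "d i w = a \<odot>\<^bsub>I j\<^esub> z"
    using d_exact[of "a \<odot>\<^bsub>I j\<^esub> z" i] z(1) ac unfolding j by auto
  obtain w' where w': "w' \<in> carrier (I i)" "a \<odot>\<^bsub>I i\<^esub> w' = w" using divisible[OF a w(1)] by blast
  have dw: "d i w' \<in> carrier (I j)" using w'(1) j by simp
  have "a \<odot>\<^bsub>I j\<^esub> d i w' = a \<odot>\<^bsub>I j\<^esub> z" using d_smult[OF ac w'(1)] w'(2) w(2) j by simp
  then have "a \<odot>\<^bsub>I j\<^esub> (z \<ominus>\<^bsub>I j\<^esub> d i w') = \<zero>\<^bsub>I j\<^esub>"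
    using smult_diff[OF ac z(1) dw] z(1) ac by (simp add: diff_self)
  then have "z \<ominus>\<^bsub>I j\<^esub> d i w' \<in> killed j (PIdl a)" using killed_PIdl[OF ac] z(1) dw by simp
  moreover have "d j (d i w') = \<zero>\<^bsub>I (Suc j)\<^esub>" using w'(1) j by simp
  then have "d j (z \<ominus>\<^bsub>I j\<^esub> d i w') = x"
    using d_diff[OF z(1) dw] z killed_carrier[OF x(1)] by (simp add: diff_zero)
  ultimately show "\<exists>z\<in>killed j (PIdl a). d j z = x" by blast
qed

text \<open>If \<open>\<mm>\<close> were an annihilator, then all primes would be annihilators, and descending from the end of
  the resolution would show that all \<open>Ext\<^sup>1(R/J, R)\<close> vanish. So \<open>R\<close> would be injective over itself and every
  element killed by \<open>(0 : x)\<close> would be a multiple of \<open>x\<close>. Apply this to \<open>x = b s\<close>, where \<open>(0 : s)\<close> is a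
  nonmaximal prime \<open>p\<close> and \<open>b \<in> \<mm>\<close> lies outside \<open>p\<close>: as \<open>(0 : b s) = (0 : s)\<close>, \<open>s\<close> is a multiple of
  \<open>b s\<close>, and \<open>s = 0\<close>.\<close>

lemma depth_pos:
  assumes s0: "s0 \<in> carrier R" shows "icolon {\<zero>} s0 \<noteq> \<mm>"
proof
  assume m: "icolon {\<zero>} s0 = \<mm>"
  have primes: "\<exists>s\<in>carrier R. p = icolon {\<zero>} s" if "primeideal p R" for p
    using nonmax_prime_associated[OF that] m s0 by metis
  have van: "ext_vanishes 0 J" if "ideal J R" for J
    by (rule ext_vanishes_descend[OF zeroideal primes ext_vanishes_zero, of 0])
      (use that ideal_zero[OF that] in auto)
  obtain p where p: "primeideal p R" "p \<noteq> \<mm>" using exists_nonmax_prime by blast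
  interpret p: primeideal p R by (rule p(1))
  obtain s where s: "s \<in> carrier R" "p = icolon {\<zero>} s" using primes[OF p(1)] by blast
  obtain b where b: "b \<in> \<mm>" "b \<notin> p" using prime_subset_mm[OF p(1)] p(2) by blast
  have bc: "b \<in> carrier R" using mm_carrier[OF b(1)] .
  have bs: "b \<otimes> s \<in> carrier R" using bc s by simp
  have "\<epsilon> s \<in> killed 0 (icolon {\<zero>} (b \<otimes> s))"
    unfolding killed_def
  proof (intro CollectI conjI ballI)
    fix r assume "r \<in> icolon {\<zero>} (b \<otimes> s)"
    then have r: "r \<in> carrier R" "(r \<otimes> b) \<otimes> s = \<zero>" using bc s(1) by (auto simp: icolon_def m_assoc)
    then have "r \<otimes> b \<in> icolon {\<zero>} s" using bc by (simp add: icolon_def)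
    then have "r \<in> p" using p.prime_notin[of r b] r bc b(2) s(2) by auto
    then have "r \<otimes> s = \<zero>" unfolding s(2) by (simp add: icolon_def)
    then show "r \<odot>\<^bsub>I 0\<^esub> \<epsilon> s = \<zero>\<^bsub>I 0\<^esub>" using eps_smult[OF r(1) s(1)] by simp
  qed (use s in simp)
  then obtain u where u: "u \<in> carrier (I 0)" "(b \<otimes> s) \<odot>\<^bsub>I 0\<^esub> u = \<epsilon> s"
    using killed_divide[OF zeroideal bs] killed_carrier by blast
  have "d 0 u \<in> killed (Suc 0) (PIdl (b \<otimes> s))"
    using killed_PIdl[OF bs] d_smult[OF bs u(1)] u s(1) by simp
  then obtain v where v: "v \<in> killed 0 (PIdl (b \<otimes> s))" "d 0 v = d 0 u"
    using van[OF cgenideal_ideal[OF bs]] u(1) unfolding ext_vanishes_def by (metis dd)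
  note vc = killed_carrier[OF v(1)]
  have "d 0 (u \<ominus>\<^bsub>I 0\<^esub> v) = \<zero>\<^bsub>I (Suc 0)\<^esub>" using d_diff[OF u(1) vc] v(2) u(1) by (simp add: diff_self)
  then obtain \<rho> where \<rho>: "\<rho> \<in> carrier R" "\<epsilon> \<rho> = u \<ominus>\<^bsub>I 0\<^esub> v"
    using eps_exact[of "u \<ominus>\<^bsub>I 0\<^esub> v"] u(1) vc by auto
  have "\<epsilon> ((b \<otimes> s) \<otimes> \<rho>) = (b \<otimes> s) \<odot>\<^bsub>I 0\<^esub> (u \<ominus>\<^bsub>I 0\<^esub> v)" using eps_smult[OF bs \<rho>(1)] \<rho>(2) by simp
  also have "\<dots> = \<epsilon> s"
    using smult_diff[OF bs u(1) vc] u(2) killed_smult[OF v(1) cgenideal_self[OF bs]] s(1) by (simp add: diff_zero)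
  finally have eq: "(b \<otimes> s) \<otimes> \<rho> = s" using eps_eq bs \<rho>(1) s(1) by simp
  have bm: "b \<otimes> \<rho> \<in> \<mm>" using ideal_mult'[OF mm_ideal b(1) \<rho>(1)] .
  have "(\<one> \<ominus> b \<otimes> \<rho>) \<otimes> s = s \<ominus> (b \<otimes> s) \<otimes> \<rho>" using bc \<rho>(1) s(1) by algebra
  also have "\<dots> = \<zero>" unfolding eq using s(1) by algebra
  finally have z: "(\<one> \<ominus> b \<otimes> \<rho>) \<otimes> s = \<zero>" .
  note un = one_minus_unit[OF bm]
  have "s = inv (\<one> \<ominus> b \<otimes> \<rho>) \<otimes> ((\<one> \<ominus> b \<otimes> \<rho>) \<otimes> s)"
    using un s(1) bc \<rho>(1) by (simp add: m_assoc[symmetric])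
  then have "s = \<zero>" using z un by simp
  then have "\<one> \<in> p" unfolding s(2) by (simp add: icolon_def)
  then show False using p.one_imp_carrier p.I_notcarr by auto
qed

lemma prime_over_regular:
  assumes "regular a" "primeideal p R" "a \<in> p" shows "p = \<mm>"
  using regular_notin_prime[OF assms(1,2)] assms(3) by blast

text \<open>A prime annihilator in \<open>R/aR\<close> contains \<open>a\<close> and is therefore \<open>\<mm>\<close>.\<close>

lemma exists_socle:
  assumes a: "regular a" "a \<in> \<mm>"
  shows "\<exists>s\<in>carrier R. s \<notin> PIdl a \<and> icolon (PIdl a) s = \<mm>"
proof -
  note ac = regular_carrier[OF a(1)]
  note P = cgenideal_ideal[OF ac]
  have "PIdl a \<subseteq> \<mm>" using cgenideal_minimal[OF mm_ideal a(2)] .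
  then have "\<one> \<notin> PIdl a" using one_notin_mm by blast
  then obtain s where s: "s \<in> carrier R" "s \<notin> PIdl a" "primeideal (icolon (PIdl a) s) R"
    using exists_prime_colon[OF P zero_closed one_closed] ideal_zero[OF P] by auto
  have "a \<in> icolon (PIdl a) s" using icolon_subset[OF P s(1)] cgenideal_self[OF ac] by blast
  then show ?thesis using prime_over_regular[OF a(1) s(3)] s by blast
qed

text \<open>The primes above \<open>aR\<close> reduce to \<open>\<mm>\<close>, which is associated to \<open>aR\<close>; the vanishing over \<open>aR\<close> itself
  holds by its projective dimension.\<close>

lemma ext_vanishes_over_regular:
  assumes a: "regular a" "a \<in> \<mm>" and "ideal J R" "a \<in> J" "j \<ge> 1"
  shows "ext_vanishes j J"
proof (rule ext_vanishes_descend[of "PIdl a" 1])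
  note ac = regular_carrier[OF a(1)]
  show "ideal (PIdl a) R" by (rule cgenideal_ideal[OF ac])
  show "\<exists>s\<in>carrier R. p = icolon (PIdl a) s" if p: "primeideal p R" "PIdl a \<subseteq> p" for p
    using exists_socle[OF a] prime_over_regular[OF a(1) p(1)] p(2) cgenideal_self[OF ac] by blast
  show "PIdl a \<subseteq> J" using cgenideal_minimal[OF assms(3,4)] .
qed (use assms ext_vanishes_regular in auto)

text \<open>Self-injectivity of \<open>R/aR\<close> in Baer's form. With \<open>\<epsilon> \<one> = a e\<close> the element \<open>d 0 e\<close> generates a copy of
  \<open>R/aR\<close> in \<open>I 1\<close>, so that \<open>f\<close> becomes a map from \<open>A\<close> to \<open>I 1\<close> and is given by some \<open>w \<in> I 1\<close>. Now \<open>d 1 w\<close> is a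
  cocycle killed by \<open>A\<close>; as \<open>Ext\<^sup>2(R/A, R) = 0\<close>, correcting \<open>w\<close> by an element killed by \<open>A\<close> makes it a
  boundary \<open>d 0 u\<close>, and \<open>a u = \<epsilon> \<rho>\<close>.\<close>

lemma quotient_self_injective:
  assumes a: "regular a" "a \<in> \<mm>" and A: "ideal A R" "a \<in> A"
    and f: "\<And>x. x \<in> A \<Longrightarrow> f x \<in> carrier R"
    and f_add: "\<And>x y. x \<in> A \<Longrightarrow> y \<in> A \<Longrightarrow> eqm a (f (x \<oplus> y)) (f x \<oplus> f y)"
    and f_mult: "\<And>r x. r \<in> carrier R \<Longrightarrow> x \<in> A \<Longrightarrow> eqm a (f (r \<otimes> x)) (r \<otimes> f x)"
    and f_a: "eqm a (f a) \<zero>"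
  shows "\<exists>\<rho>\<in>carrier R. \<forall>x\<in>A. eqm a (f x) (x \<otimes> \<rho>)"
proof -
  note ac = regular_carrier[OF a(1)]
  obtain e where e: "e \<in> carrier (I 0)" "a \<odot>\<^bsub>I 0\<^esub> e = \<epsilon> \<one>" using divisible[OF a(1), of "\<epsilon> \<one>" 0] by auto
  have de: "d 0 e \<in> carrier (I (Suc 0))" using e(1) by simp
  have ade: "a \<odot>\<^bsub>I (Suc 0)\<^esub> d 0 e = \<zero>\<^bsub>I (Suc 0)\<^esub>" using d_smult[OF ac e(1)] e(2) by simp
  have cong: "x \<odot>\<^bsub>I (Suc 0)\<^esub> d 0 e = y \<odot>\<^bsub>I (Suc 0)\<^esub> d 0 e" if "eqm a x y" "y \<in> carrier R" for x y
  proof -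
    from that(1) obtain t where t: "t \<in> carrier R" "x = y \<oplus> a \<otimes> t" unfolding eqm_def by blast
    have "x \<odot>\<^bsub>I (Suc 0)\<^esub> d 0 e = (y \<oplus> t \<otimes> a) \<odot>\<^bsub>I (Suc 0)\<^esub> d 0 e"
      using t m_comm[OF ac t(1)] by simp
    also have "\<dots> = y \<odot>\<^bsub>I (Suc 0)\<^esub> d 0 e" using t(1) that(2) ac de ade by (simp add: I.smult_l_distr I.smult_assoc1)
    finally show ?thesis .
  qed
  have "\<exists>w\<in>carrier (I (Suc 0)). \<forall>x\<in>A. f x \<odot>\<^bsub>I (Suc 0)\<^esub> d 0 e = x \<odot>\<^bsub>I (Suc 0)\<^esub> w"
  proof (rule injective_baer[OF I_inj A(1)])
    fix x assume x: "x \<in> A"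
    show "f x \<odot>\<^bsub>I (Suc 0)\<^esub> d 0 e \<in> carrier (I (Suc 0))" using f[OF x] de by simp
    show "f (x \<oplus> y) \<odot>\<^bsub>I (Suc 0)\<^esub> d 0 e =
        f x \<odot>\<^bsub>I (Suc 0)\<^esub> d 0 e \<oplus>\<^bsub>I (Suc 0)\<^esub> f y \<odot>\<^bsub>I (Suc 0)\<^esub> d 0 e" if "y \<in> A" for y
      using cong[OF f_add[OF x that]] f[OF x] f[OF that] de by (simp add: I.smult_l_distr)
    show "f (r \<otimes> x) \<odot>\<^bsub>I (Suc 0)\<^esub> d 0 e = r \<odot>\<^bsub>I (Suc 0)\<^esub> (f x \<odot>\<^bsub>I (Suc 0)\<^esub> d 0 e)" if "r \<in> carrier R" for r
      using cong[OF f_mult[OF that x]] f[OF x] that de by (simp add: I.smult_assoc1)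
  qed
  then obtain w where w: "w \<in> carrier (I (Suc 0))"
    "\<And>x. x \<in> A \<Longrightarrow> f x \<odot>\<^bsub>I (Suc 0)\<^esub> d 0 e = x \<odot>\<^bsub>I (Suc 0)\<^esub> w" by blast
  have "d (Suc 0) w \<in> killed (Suc (Suc 0)) A"
    unfolding killed_def
  proof (intro CollectI conjI ballI)
    fix x assume x: "x \<in> A"
    have xc: "x \<in> carrier R" using ideal_mem[OF A(1) x] .
    have "x \<odot>\<^bsub>I (Suc (Suc 0))\<^esub> d (Suc 0) w = d (Suc 0) (f x \<odot>\<^bsub>I (Suc 0)\<^esub> d 0 e)"
      using d_smult[OF xc w(1)] w(2)[OF x] by simp
    also have "\<dots> = \<zero>\<^bsub>I (Suc (Suc 0))\<^esub>" using d_smult[OF f[OF x] de] f[OF x] e(1) by simp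
    finally show "x \<odot>\<^bsub>I (Suc (Suc 0))\<^esub> d (Suc 0) w = \<zero>\<^bsub>I (Suc (Suc 0))\<^esub>" .
  qed (use w in simp)
  moreover have "ext_vanishes (Suc 0) A" using ext_vanishes_over_regular[OF a A] by simp
  ultimately obtain v where v: "v \<in> killed (Suc 0) A" "d (Suc 0) v = d (Suc 0) w"
    using w(1) unfolding ext_vanishes_def by (metis dd)
  note vc = killed_carrier[OF v(1)]
  have "d (Suc 0) (w \<ominus>\<^bsub>I (Suc 0)\<^esub> v) = \<zero>\<^bsub>I (Suc (Suc 0))\<^esub>"
    using d_diff[OF w(1) vc] v(2) w(1) by (simp add: diff_self)
  then obtain u where u: "u \<in> carrier (I 0)" "d 0 u = w \<ominus>\<^bsub>I (Suc 0)\<^esub> v"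
    using d_exact[of "w \<ominus>\<^bsub>I (Suc 0)\<^esub> v" 0] w(1) vc by auto
  have du: "d 0 (x \<odot>\<^bsub>I 0\<^esub> u) = f x \<odot>\<^bsub>I (Suc 0)\<^esub> d 0 e" if x: "x \<in> A" for x
  proof -
    have xc: "x \<in> carrier R" using ideal_mem[OF A(1) x] .
    have "d 0 (x \<odot>\<^bsub>I 0\<^esub> u) = x \<odot>\<^bsub>I (Suc 0)\<^esub> w \<ominus>\<^bsub>I (Suc 0)\<^esub> x \<odot>\<^bsub>I (Suc 0)\<^esub> v"
      using d_smult[OF xc u(1)] u(2) smult_diff[OF xc w(1) vc] by simp
    then show ?thesis using killed_smult[OF v(1) x] w(1) xc w(2)[OF x] by (simp add: diff_zero)
  qed
  have "d 0 (a \<odot>\<^bsub>I 0\<^esub> u) = \<zero>\<^bsub>I (Suc 0)\<^esub>" using du[OF A(2)] cong[OF f_a] de by simp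
  then obtain \<rho> where \<rho>: "\<rho> \<in> carrier R" "\<epsilon> \<rho> = a \<odot>\<^bsub>I 0\<^esub> u"
    using eps_exact[of "a \<odot>\<^bsub>I 0\<^esub> u"] u(1) ac by auto
  have "eqm a (f x) (x \<otimes> \<rho>)" if x: "x \<in> A" for x
  proof -
    have xc: "x \<in> carrier R" using ideal_mem[OF A(1) x] .
    have "d 0 (f x \<odot>\<^bsub>I 0\<^esub> e \<ominus>\<^bsub>I 0\<^esub> x \<odot>\<^bsub>I 0\<^esub> u) = \<zero>\<^bsub>I (Suc 0)\<^esub>"
      using d_diff[of "f x \<odot>\<^bsub>I 0\<^esub> e" 0 "x \<odot>\<^bsub>I 0\<^esub> u"] du[OF x] d_smult[OF f[OF x] e(1)] f[OF x] e(1) xc u(1)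
      by (simp add: diff_self)
    then obtain t where t: "t \<in> carrier R" "\<epsilon> t = f x \<odot>\<^bsub>I 0\<^esub> e \<ominus>\<^bsub>I 0\<^esub> x \<odot>\<^bsub>I 0\<^esub> u"
      using eps_exact[of "f x \<odot>\<^bsub>I 0\<^esub> e \<ominus>\<^bsub>I 0\<^esub> x \<odot>\<^bsub>I 0\<^esub> u"] f[OF x] e(1) xc u(1) by auto
    have 1: "a \<odot>\<^bsub>I 0\<^esub> (f x \<odot>\<^bsub>I 0\<^esub> e) = \<epsilon> (f x)"
      using I.smult_assoc1[OF ac f[OF x] e(1)] I.smult_assoc1[OF f[OF x] ac e(1)] e(2)
        eps_smult[OF f[OF x] one_closed] f[OF x] ac by (simp add: m_comm)
    have 2: "a \<odot>\<^bsub>I 0\<^esub> (x \<odot>\<^bsub>I 0\<^esub> u) = \<epsilon> (x \<otimes> \<rho>)"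
      using I.smult_assoc1[OF ac xc u(1)] I.smult_assoc1[OF xc ac u(1)] \<rho> eps_smult[OF xc \<rho>(1)] xc ac
      by (simp add: m_comm)
    have "\<epsilon> (a \<otimes> t) = \<epsilon> (f x) \<ominus>\<^bsub>I 0\<^esub> \<epsilon> (x \<otimes> \<rho>)"
      using eps_smult[OF ac t(1)] t(2) smult_diff[OF ac, of "f x \<odot>\<^bsub>I 0\<^esub> e" 0 "x \<odot>\<^bsub>I 0\<^esub> u"] 1 2 f[OF x] e(1) xc u(1)
      by simp
    then have "\<epsilon> (x \<otimes> \<rho> \<oplus> a \<otimes> t) = \<epsilon> (f x)"
      using eps_add[of "x \<otimes> \<rho>" "a \<otimes> t"] diff_add[of "\<epsilon> (f x)" 0 "\<epsilon> (x \<otimes> \<rho>)"] f[OF x] xc \<rho>(1) ac t(1) by simp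
    then have "x \<otimes> \<rho> \<oplus> a \<otimes> t = f x" using eps_eq[of "x \<otimes> \<rho> \<oplus> a \<otimes> t" "f x"] f[OF x] xc \<rho>(1) ac t(1) by simp
    then have "f x = x \<otimes> \<rho> \<oplus> a \<otimes> t" by simp
    then show ?thesis using t(1) unfolding eqm_def by blast
  qed
  then show ?thesis using \<rho>(1) by blast
qed

end

section \<open>Functionals modulo a regular element\<close>

context noeth_local
begin

lemma add_cancel_left:
  "x \<in> carrier R \<Longrightarrow> y \<in> carrier R \<Longrightarrow> z \<in> carrier R \<Longrightarrow> x \<oplus> y = x \<oplus> z \<Longrightarrow> y = z"
  using add.l_cancel[of x y z] by blast

lemma eqm_refl: "a \<in> carrier R \<Longrightarrow> x \<in> carrier R \<Longrightarrow> eqm a x x"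
  unfolding eqm_def by (intro bexI[of _ \<zero>]) auto

lemma eqmI: "t \<in> carrier R \<Longrightarrow> x = y \<oplus> a \<otimes> t \<Longrightarrow> eqm a x y"
  unfolding eqm_def by blast

lemma eqmE: assumes "eqm a x y" obtains t where "t \<in> carrier R" "x = y \<oplus> a \<otimes> t"
  using assms unfolding eqm_def by blast

lemma eqm_sym: assumes "a \<in> carrier R" "y \<in> carrier R" "eqm a x y" shows "eqm a y x"
proof -
  from assms(3) obtain t where t: "t \<in> carrier R" "x = y \<oplus> a \<otimes> t" by (rule eqmE)
  have "y = x \<oplus> a \<otimes> (\<ominus> t)" unfolding t(2) using assms(1,2) t(1) by algebra
  then show ?thesis using t(1) by (intro eqmI[of "\<ominus> t"]) auto
qed

lemma eqm_trans: assumes "a \<in> carrier R" "z \<in> carrier R" "eqm a x y" "eqm a y z" shows "eqm a x z"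
proof -
  from assms(3) obtain t where t: "t \<in> carrier R" "x = y \<oplus> a \<otimes> t" by (rule eqmE)
  from assms(4) obtain s where s: "s \<in> carrier R" "y = z \<oplus> a \<otimes> s" by (rule eqmE)
  have "x = z \<oplus> a \<otimes> (s \<oplus> t)" unfolding t(2) s(2) using assms(1,2) t(1) s(1) by algebra
  then show ?thesis using s(1) t(1) by (intro eqmI[of "s \<oplus> t"]) auto
qed

lemma eqm_add:
  assumes "a \<in> carrier R" "y \<in> carrier R" "y' \<in> carrier R" "eqm a x y" "eqm a x' y'"
  shows "eqm a (x \<oplus> x') (y \<oplus> y')"
proof -
  from assms(4) obtain t where t: "t \<in> carrier R" "x = y \<oplus> a \<otimes> t" by (rule eqmE)
  from assms(5) obtain s where s: "s \<in> carrier R" "x' = y' \<oplus> a \<otimes> s" by (rule eqmE)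
  have "x \<oplus> x' = (y \<oplus> y') \<oplus> a \<otimes> (t \<oplus> s)" unfolding t(2) s(2) using assms(1-3) t(1) s(1) by algebra
  then show ?thesis using s(1) t(1) by (intro eqmI[of "t \<oplus> s"]) auto
qed

lemma eqm_mult:
  assumes "a \<in> carrier R" "y \<in> carrier R" "r \<in> carrier R" "eqm a x y"
  shows "eqm a (r \<otimes> x) (r \<otimes> y)"
proof -
  from assms(4) obtain t where t: "t \<in> carrier R" "x = y \<oplus> a \<otimes> t" by (rule eqmE)
  have "r \<otimes> x = r \<otimes> y \<oplus> a \<otimes> (r \<otimes> t)" unfolding t(2) using assms(1-3) t(1) by algebra
  then show ?thesis using assms(3) t(1) by (intro eqmI[of "r \<otimes> t"]) auto
qed

lemma eqm_zero_iff: "a \<in> carrier R \<Longrightarrow> eqm a x \<zero> \<longleftrightarrow> x \<in> PIdl a"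
proof
  assume a: "a \<in> carrier R" and "eqm a x \<zero>"
  then obtain t where t: "t \<in> carrier R" "x = \<zero> \<oplus> a \<otimes> t" by (elim eqmE)
  then have "x = t \<otimes> a" using a m_comm[OF a t(1)] by simp
  then show "x \<in> PIdl a" using t(1) unfolding cgenideal_def by blast
next
  assume a: "a \<in> carrier R" and "x \<in> PIdl a"
  then obtain t where t: "t \<in> carrier R" "x = t \<otimes> a" by (auto simp: cgenideal_def)
  then have "x = \<zero> \<oplus> a \<otimes> t" using a m_comm[OF a t(1)] by simp
  then show "eqm a x \<zero>" using t(1) by (intro eqmI)
qed

lemma eqm_diff:
  assumes "a \<in> carrier R" "y \<in> carrier R" "y' \<in> carrier R" "eqm a x y" "eqm a x' y'"
  shows "eqm a (x \<ominus> x') (y \<ominus> y')"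
proof -
  from assms(4) obtain t where t: "t \<in> carrier R" "x = y \<oplus> a \<otimes> t" by (rule eqmE)
  from assms(5) obtain s where s: "s \<in> carrier R" "x' = y' \<oplus> a \<otimes> s" by (rule eqmE)
  have "x \<ominus> x' = (y \<ominus> y') \<oplus> a \<otimes> (t \<ominus> s)" unfolding t(2) s(2) using assms(1-3) t(1) s(1) by algebra
  then show ?thesis using s(1) t(1) by (intro eqmI[of "t \<ominus> s"]) auto
qed

lemma eqm_iff_diff:
  assumes "a \<in> carrier R" "x \<in> carrier R" "y \<in> carrier R"
  shows "eqm a x y \<longleftrightarrow> x \<ominus> y \<in> PIdl a"
proof
  assume "eqm a x y"
  then have "eqm a (x \<ominus> y) (y \<ominus> y)" using assms by (intro eqm_diff eqm_refl) auto
  moreover have "y \<ominus> y = \<zero>" using assms by algebra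
  ultimately show "x \<ominus> y \<in> PIdl a" using eqm_zero_iff[OF assms(1)] by simp
next
  assume "x \<ominus> y \<in> PIdl a"
  then have "eqm a (x \<ominus> y) \<zero>" using eqm_zero_iff[OF assms(1)] by simp
  then have "eqm a ((x \<ominus> y) \<oplus> y) (\<zero> \<oplus> y)" using assms by (intro eqm_add eqm_refl) auto
  moreover have "(x \<ominus> y) \<oplus> y = x" "\<zero> \<oplus> y = y" using assms by algebra+
  ultimately show "eqm a x y" by simp
qed

lemma dot_extend:
  assumes "finite Y" "X \<subseteq> Y" "u \<in> vec Y" "v \<in> vec X" shows "dot Y u v = dot X u v"
  unfolding dot_def
proof (rule add.finprod_mono_neutral_cong_right[OF assms(1,2)])
  show "\<And>i. i \<in> Y - X \<Longrightarrow> u i \<otimes> v i = \<zero>" using assms vec_off[OF assms(4)] by simp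
qed (use assms in auto)

definition lin_on :: "('x \<Rightarrow> 'a) set \<Rightarrow> (('x \<Rightarrow> 'a) \<Rightarrow> 'a) \<Rightarrow> bool" where
  "lin_on K \<kappa> \<longleftrightarrow> (\<forall>u\<in>K. \<kappa> u \<in> carrier R) \<and> (\<forall>u\<in>K. \<forall>v\<in>K. \<kappa> (u +\<^sub>v v) = \<kappa> u \<oplus> \<kappa> v) \<and>
     (\<forall>r\<in>carrier R. \<forall>u\<in>K. \<kappa> (r *\<^sub>v u) = r \<otimes> \<kappa> u)"

lemma lin_onD:
  assumes "lin_on K \<kappa>"
  shows "u \<in> K \<Longrightarrow> \<kappa> u \<in> carrier R" "u \<in> K \<Longrightarrow> v \<in> K \<Longrightarrow> \<kappa> (u +\<^sub>v v) = \<kappa> u \<oplus> \<kappa> v"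
    "r \<in> carrier R \<Longrightarrow> u \<in> K \<Longrightarrow> \<kappa> (r *\<^sub>v u) = r \<otimes> \<kappa> u"
  using assms by (auto simp: lin_on_def)

lemma lin_on_dot: "finite X \<Longrightarrow> linsub X K \<Longrightarrow> G \<in> vec X \<Longrightarrow> lin_on K (\<lambda>c. dot X c G)"
  unfolding lin_on_def using linsubD(1)[of X K] by (auto simp: dot_add_left dot_scale_left)

lemma lin_on_diff: assumes K: "linsub X K" and \<kappa>: "lin_on K \<kappa>" and "u \<in> K" "v \<in> K"
  shows "\<kappa> (u -\<^sub>v v) = \<kappa> u \<ominus> \<kappa> v"
  using lin_onD[OF \<kappa>] linsubD(4)[OF K] assms(3,4) by (simp add: a_minus_def l_minus)

lemma lin_on_eq_span:
  assumes "linsub X K" "lin_on K \<kappa>" "lin_on K \<mu>" "K = vspan S" "\<And>s. s \<in> S \<Longrightarrow> \<kappa> s = \<mu> s" "v \<in> K"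
  shows "\<kappa> v = \<mu> v"
proof -
  have "v \<in> vspan S" using assms(4,6) by simp
  then show ?thesis
  proof (induction rule: vspan_induct)
    case zero
    have z: "vzero \<in> K" by (rule linsubD(2)[OF assms(1)])
    have "\<zero> *\<^sub>v vzero = (vzero :: 'b \<Rightarrow> 'a)" by (rule vec_eqI) simp
    then have "\<kappa> vzero = \<mu> vzero"
      using lin_onD(3)[OF assms(2) zero_closed z] lin_onD(3)[OF assms(3) zero_closed z]
        lin_onD(1)[OF assms(2) z] lin_onD(1)[OF assms(3) z] by simp
    then show ?case .
  next
    case (add u v)
    then have "\<kappa> (u +\<^sub>v v) = \<mu> (u +\<^sub>v v)"
      using lin_onD(2)[OF assms(2)] lin_onD(2)[OF assms(3)] assms(4) by metis
    then show ?case .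
  next
    case (scale r u)
    then have "\<kappa> (r *\<^sub>v u) = \<mu> (r *\<^sub>v u)"
      using lin_onD(3)[OF assms(2)] lin_onD(3)[OF assms(3)] assms(4) by metis
    then show ?case .
  qed (use assms in auto)
qed

end

context inj_resolution
begin

text \<open>Maps into \<open>R/aR\<close> extend from submodules of finite free modules over \<open>R/aR\<close>; these submodules are
  represented by the \<open>K\<close> that contain \<open>a R\<^sup>X\<close>. Induction on \<open>X\<close>: after subtraction of an extension from
  the vectors with entry zero at the new index, the map depends only on this entry, and
  self-injectivity of \<open>R/aR\<close> applies to the ideal of these entries.\<close>

lemma quotient_extension:
  assumes a: "regular a" "a \<in> \<mm>" and "finite X" "linsub X K"
    and "\<And>v. v \<in> vec X \<Longrightarrow> a *\<^sub>v v \<in> K" "\<And>v. v \<in> K \<Longrightarrow> \<kappa> v \<in> carrier R"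
    and "\<And>u v. u \<in> K \<Longrightarrow> v \<in> K \<Longrightarrow> eqm a (\<kappa> (u +\<^sub>v v)) (\<kappa> u \<oplus> \<kappa> v)"
    and "\<And>r v. r \<in> carrier R \<Longrightarrow> v \<in> K \<Longrightarrow> eqm a (\<kappa> (r *\<^sub>v v)) (r \<otimes> \<kappa> v)"
    and "\<And>v. v \<in> vec X \<Longrightarrow> eqm a (\<kappa> (a *\<^sub>v v)) \<zero>"
  shows "\<exists>G\<in>vec X. \<forall>v\<in>K. eqm a (\<kappa> v) (dot X v G)"
  using assms(3-)
proof (induction X arbitrary: K)
  note ac = regular_carrier[OF a(1)]
  case empty
  have "eqm a (\<kappa> v) (dot {} v vzero)" if "v \<in> K" for v
  proof -
    have "v = a *\<^sub>v vzero" using linsubD(1)[OF empty(1) that] ac by (intro vec_eqI') auto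
    moreover have "eqm a (\<kappa> (a *\<^sub>v vzero)) \<zero>" by (rule empty(6)[OF vec_zero])
    ultimately show ?thesis by (simp add: dot_def)
  qed
  then show ?case by (intro bexI[of _ vzero] ballI vec_zero)
next
  note ac = regular_carrier[OF a(1)]
  case (insert x X)
  let ?Y = "insert x X"
  have fY: "finite ?Y" using insert.hyps by simp
  note K = insert.prems(1) and \<kappa>c = insert.prems(3)
  have aK: "a *\<^sub>v v \<in> K" if "v \<in> vec ?Y" for v by (rule insert.prems(2)[OF that])
  have \<kappa>a: "eqm a (\<kappa> (u +\<^sub>v v)) (\<kappa> u \<oplus> \<kappa> v)" if "u \<in> K" "v \<in> K" for u v
    by (rule insert.prems(4)[OF that])
  have \<kappa>s: "eqm a (\<kappa> (r *\<^sub>v v)) (r \<otimes> \<kappa> v)" if "r \<in> carrier R" "v \<in> K" for r v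
    by (rule insert.prems(5)[OF that])
  have \<kappa>z: "eqm a (\<kappa> (a *\<^sub>v v)) \<zero>" if "v \<in> vec ?Y" for v by (rule insert.prems(6)[OF that])
  note Kv = linsubD(1)[OF K]
  have K0: "linsub X (K \<inter> vec X)" using K by (auto simp: linsub_def)
  have sub: "v \<in> vec ?Y" if "v \<in> vec X" for v using vec_mono[OF _ that] by auto
  obtain G' where G': "G' \<in> vec X" "\<And>v. v \<in> K \<inter> vec X \<Longrightarrow> eqm a (\<kappa> v) (dot X v G')"
  proof -
    have "\<exists>G\<in>vec X. \<forall>v\<in>K \<inter> vec X. eqm a (\<kappa> v) (dot X v G)"
    proof (rule insert.IH[OF K0])
      show "a *\<^sub>v v \<in> K \<inter> vec X" if "v \<in> vec X" for v
        using aK[OF sub[OF that]] vec_scale[OF ac that] by blast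
      show "eqm a (\<kappa> (a *\<^sub>v v)) \<zero>" if "v \<in> vec X" for v using \<kappa>z[OF sub[OF that]] .
    qed (use \<kappa>c \<kappa>a \<kappa>s in blast)+
    then show ?thesis using that by blast
  qed
  note GY = sub[OF G'(1)]
  define \<mu> where "\<mu> v = \<kappa> v \<ominus> dot ?Y v G'" for v
  have dc: "dot ?Y v G' \<in> carrier R" if "v \<in> K" for v using Kv[OF that] GY by simp
  have \<mu>c: "\<mu> v \<in> carrier R" if "v \<in> K" for v using \<kappa>c[OF that] dc[OF that] by (simp add: \<mu>_def)
  have \<mu>a: "eqm a (\<mu> (u +\<^sub>v v)) (\<mu> u \<oplus> \<mu> v)" if "u \<in> K" "v \<in> K" for u v
  proof -
    have "eqm a (\<kappa> (u +\<^sub>v v) \<ominus> dot ?Y (u +\<^sub>v v) G') ((\<kappa> u \<oplus> \<kappa> v) \<ominus> (dot ?Y u G' \<oplus> dot ?Y v G'))"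
      using \<kappa>a[OF that] \<kappa>c that dc ac dot_add_left[OF Kv[OF that(1)] Kv[OF that(2)] GY]
      by (intro eqm_diff) (auto intro: eqm_refl)
    moreover have "(\<kappa> u \<oplus> \<kappa> v) \<ominus> (dot ?Y u G' \<oplus> dot ?Y v G') = \<mu> u \<oplus> \<mu> v"
      unfolding \<mu>_def using \<kappa>c[OF that(1)] \<kappa>c[OF that(2)] dc[OF that(1)] dc[OF that(2)] by algebra
    ultimately show ?thesis by (simp add: \<mu>_def)
  qed
  have \<mu>s: "eqm a (\<mu> (r *\<^sub>v v)) (r \<otimes> \<mu> v)" if "r \<in> carrier R" "v \<in> K" for r v
  proof -
    have "eqm a (\<kappa> (r *\<^sub>v v) \<ominus> dot ?Y (r *\<^sub>v v) G') (r \<otimes> \<kappa> v \<ominus> r \<otimes> dot ?Y v G')"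
      using \<kappa>s[OF that] \<kappa>c that dc ac dot_scale_left[OF fY that(1) Kv[OF that(2)] GY]
      by (intro eqm_diff) (auto intro: eqm_refl)
    moreover have "r \<otimes> \<kappa> v \<ominus> r \<otimes> dot ?Y v G' = r \<otimes> \<mu> v"
      unfolding \<mu>_def using \<kappa>c[OF that(2)] dc[OF that(2)] that(1) by algebra
    ultimately show ?thesis by (simp add: \<mu>_def)
  qed
  have \<mu>0: "eqm a (\<mu> v) \<zero>" if v: "v \<in> K" "v x = \<zero>" for v
  proof -
    have "v \<in> vec X"
      unfolding vec_def
    proof (intro CollectI conjI allI impI)
      show "v i \<in> carrier R" for i by (rule linsub_closed[OF K v(1)])
      show "v i = \<zero>" if "i \<notin> X" for i
        using vec_off[OF Kv[OF v(1)], of i] v(2) that by (cases "i = x") auto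
    qed
    then have "eqm a (\<kappa> v) (dot ?Y v G')"
      using G'(2) v(1) dot_extend[OF fY subset_insertI Kv[OF v(1)] G'(1)] by auto
    then have "\<mu> v \<in> PIdl a" using eqm_iff_diff[OF ac \<kappa>c[OF v(1)] dc[OF v(1)]] by (simp add: \<mu>_def)
    then show ?thesis using eqm_zero_iff[OF ac] by simp
  qed
  have \<mu>eq: "eqm a (\<mu> v) (\<mu> w)" if v: "v \<in> K" "w \<in> K" "v x = w x" for v w
  proof -
    have d: "v -\<^sub>v w \<in> K" using linsubD(5)[OF K v(1,2)] .
    have "(v -\<^sub>v w) x = \<zero>" using v(3) linsub_closed[OF K v(2), of x] by (simp add: l_minus r_neg)
    then have 1: "eqm a (\<mu> (v -\<^sub>v w)) \<zero>" using \<mu>0[OF d] by simp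
    have "eqm a (\<mu> ((v -\<^sub>v w) +\<^sub>v w)) (\<mu> (v -\<^sub>v w) \<oplus> \<mu> w)" using \<mu>a[OF d v(2)] .
    moreover have "eqm a (\<mu> (v -\<^sub>v w) \<oplus> \<mu> w) (\<zero> \<oplus> \<mu> w)" using 1 \<mu>c[OF v(2)] ac by (intro eqm_add eqm_refl) auto
    ultimately have "eqm a (\<mu> ((v -\<^sub>v w) +\<^sub>v w)) (\<zero> \<oplus> \<mu> w)"
      by (rule eqm_trans[OF ac a_closed[OF zero_closed \<mu>c[OF v(2)]]])
    then show ?thesis using vdiff_add[OF Kv[OF v(1)] Kv[OF v(2)]] \<mu>c[OF v(2)] by simp
  qed
  define A where "A = (\<lambda>v. v x) ` K"
  have A: "ideal A R" unfolding A_def by (rule linsub_coord_ideal[OF K])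
  \<comment> \<open>\<open>\<mu> v\<close> as a function of the entry \<open>v x\<close>, well-defined modulo \<open>a\<close> by \<open>\<mu>eq\<close>.\<close>
  define f where "f \<alpha> = \<mu> (SOME v. v \<in> K \<and> v x = \<alpha>)" for \<alpha>
  have f: "eqm a (f (v x)) (\<mu> v)" and fc: "f (v x) \<in> carrier R" if v: "v \<in> K" for v
  proof -
    define w where "w = (SOME w. w \<in> K \<and> w x = v x)"
    have "w \<in> K \<and> w x = v x" unfolding w_def by (rule someI[of _ v]) (use v in blast)
    then show "eqm a (f (v x)) (\<mu> v)" "f (v x) \<in> carrier R"
      using \<mu>eq[of w v] \<mu>c[of w] v unfolding f_def w_def by auto
  qed
  have uK: "a *\<^sub>v unitv x \<in> K" using aK by simp
  have ux: "(a *\<^sub>v unitv x) x = a" using ac by (simp add: unitv_def)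
  have "\<exists>\<rho>\<in>carrier R. \<forall>\<alpha>\<in>A. eqm a (f \<alpha>) (\<alpha> \<otimes> \<rho>)"
  proof (rule quotient_self_injective[OF a A])
    show "a \<in> A" unfolding A_def using uK ux by (metis imageI)
    have "eqm a (\<mu> (a *\<^sub>v unitv x)) (a \<otimes> dot ?Y (unitv x) (\<ominus> \<one> *\<^sub>v G'))"
    proof -
      have "eqm a (\<kappa> (a *\<^sub>v unitv x) \<ominus> dot ?Y (a *\<^sub>v unitv x) G') (\<zero> \<ominus> dot ?Y (a *\<^sub>v unitv x) G')"
        using \<kappa>z[of "unitv x"] dc[OF uK] ac by (intro eqm_diff eqm_refl) auto
      moreover have "\<zero> \<ominus> dot ?Y (a *\<^sub>v unitv x) G' = a \<otimes> dot ?Y (unitv x) (\<ominus> \<one> *\<^sub>v G')"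
        using dot_scale_left[OF fY ac, of "unitv x" G'] dot_scale_right[OF fY, of "\<ominus> \<one>" G' "unitv x"] GY ac
        by (simp add: a_minus_def l_minus r_minus)
      ultimately show ?thesis by (simp add: \<mu>_def)
    qed
    moreover have "eqm a (a \<otimes> dot ?Y (unitv x) (\<ominus> \<one> *\<^sub>v G')) \<zero>"
      using ac GY by (intro eqmI[of "dot ?Y (unitv x) (\<ominus> \<one> *\<^sub>v G')"]) auto
    ultimately have "eqm a (\<mu> (a *\<^sub>v unitv x)) \<zero>" by (rule eqm_trans[OF ac zero_closed])
    with f[OF uK] have "eqm a (f ((a *\<^sub>v unitv x) x)) \<zero>" by (rule eqm_trans[OF ac zero_closed])
    then show "eqm a (f a) \<zero>" by (simp only: ux)
    fix \<alpha> assume "\<alpha> \<in> A"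
    then obtain u where u: "u \<in> K" "\<alpha> = u x" by (auto simp: A_def)
    show "f \<alpha> \<in> carrier R" using fc[OF u(1)] u(2) by simp
    show "eqm a (f (\<alpha> \<oplus> \<beta>)) (f \<alpha> \<oplus> f \<beta>)" if "\<beta> \<in> A" for \<beta>
    proof -
      obtain v where v: "v \<in> K" "\<beta> = v x" using \<open>\<beta> \<in> A\<close> by (auto simp: A_def)
      have uv: "u +\<^sub>v v \<in> K" using linsubD(3)[OF K u(1) v(1)] .
      have "eqm a (f (\<alpha> \<oplus> \<beta>)) (\<mu> (u +\<^sub>v v))" using f[OF uv] u(2) v(2) by simp
      then have "eqm a (f (\<alpha> \<oplus> \<beta>)) (\<mu> u \<oplus> \<mu> v)"
        using \<mu>a[OF u(1) v(1)] by (rule eqm_trans[OF ac a_closed[OF \<mu>c[OF u(1)] \<mu>c[OF v(1)]]])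
      moreover have "eqm a (\<mu> u \<oplus> \<mu> v) (f (u x) \<oplus> f (v x))"
        by (rule eqm_add[OF ac fc[OF u(1)] fc[OF v(1)] eqm_sym[OF ac \<mu>c[OF u(1)] f[OF u(1)]]
              eqm_sym[OF ac \<mu>c[OF v(1)] f[OF v(1)]]])
      ultimately have "eqm a (f (\<alpha> \<oplus> \<beta>)) (f (u x) \<oplus> f (v x))"
        by (rule eqm_trans[OF ac a_closed[OF fc[OF u(1)] fc[OF v(1)]]])
      then show ?thesis using u(2) v(2) by simp
    qed
    show "eqm a (f (r \<otimes> \<alpha>)) (r \<otimes> f \<alpha>)" if r: "r \<in> carrier R" for r
    proof -
      have ru: "r *\<^sub>v u \<in> K" using linsubD(4)[OF K r u(1)] .
      have "eqm a (f (r \<otimes> \<alpha>)) (\<mu> (r *\<^sub>v u))" using f[OF ru] u(2) by simp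
      then have "eqm a (f (r \<otimes> \<alpha>)) (r \<otimes> \<mu> u)"
        using \<mu>s[OF r u(1)] by (rule eqm_trans[OF ac m_closed[OF r \<mu>c[OF u(1)]]])
      moreover have "eqm a (r \<otimes> \<mu> u) (r \<otimes> f (u x))"
        by (rule eqm_mult[OF ac fc[OF u(1)] r eqm_sym[OF ac \<mu>c[OF u(1)] f[OF u(1)]]])
      ultimately have "eqm a (f (r \<otimes> \<alpha>)) (r \<otimes> f (u x))"
        by (rule eqm_trans[OF ac m_closed[OF r fc[OF u(1)]]])
      then show ?thesis using u(2) by simp
    qed
  qed
  then obtain \<rho> where \<rho>: "\<rho> \<in> carrier R" "\<And>\<alpha>. \<alpha> \<in> A \<Longrightarrow> eqm a (f \<alpha>) (\<alpha> \<otimes> \<rho>)" by blast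
  let ?G = "G' +\<^sub>v \<rho> *\<^sub>v unitv x"
  have uY: "unitv x \<in> vec ?Y" by simp
  have G: "?G \<in> vec ?Y" using GY \<rho>(1) by simp
  have "eqm a (\<kappa> v) (dot ?Y v ?G)" if v: "v \<in> K" for v
  proof -
    have vx: "v x \<in> carrier R" using linsub_closed[OF K v] .
    have "v x \<in> A" using v by (simp add: A_def)
    then have "eqm a (\<mu> v) (v x \<otimes> \<rho>)"
      by (intro eqm_trans[OF ac m_closed[OF vx \<rho>(1)] eqm_sym[OF ac \<mu>c[OF v] f[OF v]]] \<rho>(2))
    then have "eqm a (\<mu> v \<oplus> dot ?Y v G') (v x \<otimes> \<rho> \<oplus> dot ?Y v G')"
      using ac \<mu>c[OF v] dc[OF v] vx \<rho>(1) by (intro eqm_add eqm_refl) auto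
    moreover have "\<mu> v \<oplus> dot ?Y v G' = \<kappa> v" unfolding \<mu>_def using \<kappa>c[OF v] dc[OF v] by algebra
    moreover have "dot ?Y v ?G = dot ?Y v G' \<oplus> \<rho> \<otimes> v x"
      using dot_add_right[OF GY vec_scale[OF \<rho>(1) uY] Kv[OF v]] dot_scale_right[OF fY \<rho>(1) uY Kv[OF v]]
        dot_unitv[OF fY _ Kv[OF v], of x] dot_comm[OF Kv[OF v] uY] by simp
    then have "v x \<otimes> \<rho> \<oplus> dot ?Y v G' = dot ?Y v ?G" using vx \<rho>(1) dc[OF v] by (simp add: a_comm m_comm)
    ultimately show ?thesis by simp
  qed
  then show ?case using G by blast
qed

text \<open>Functionals on a submodule \<open>K\<close> of \<open>F = R\<^sup>X\<close> extend to \<open>F\<close> if \<open>F/K\<close> has no \<open>a\<close>-torsion. In that case \<open>K/aK\<close>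
  embeds in \<open>F/aF\<close>, so every functional agrees modulo \<open>a\<close> with the restriction of a functional on \<open>F\<close>.
  Hence \<open>L = P + aL\<close> for the module \<open>L\<close> of all functionals and its submodule \<open>P\<close> of restrictions, and
  Nakayama's lemma gives \<open>L = P\<close>. A functional is represented by its values on finitely many
  generators of \<open>K\<close>.\<close>

lemma functional_extension:
  assumes a: "regular a" "a \<in> \<mm>" and X: "finite X" and K: "linsub X K"
    and sat: "\<And>c. c \<in> vec X \<Longrightarrow> a *\<^sub>v c \<in> K \<Longrightarrow> c \<in> K"
    and \<kappa>: "lin_on K \<kappa>"
  shows "\<exists>G\<in>vec X. \<forall>c\<in>K. \<kappa> c = dot X c G"
proof -
  note ac = regular_carrier[OF a(1)]
  note Kv = linsubD(1)[OF K]
  obtain S where S: "finite S" "S \<subseteq> K" "K = vspan S" using noetherian_vec[OF noeth X K] by blast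
  define res where "res \<mu> = (\<lambda>s. if s \<in> S then \<mu> s else \<zero>)" for \<mu> :: "('b \<Rightarrow> 'a) \<Rightarrow> 'a"
  define L where "L = res ` {\<mu>. lin_on K \<mu>}"
  define P where "P = res ` ((\<lambda>G c. dot X c G) ` vec X)"
  have res_vec: "res \<mu> \<in> vec S" if "lin_on K \<mu>" for \<mu>
    using lin_onD(1)[OF that] S(2) by (auto simp: vec_def res_def simp del: vec_closed)
  have res_add: "res \<mu> +\<^sub>v res \<nu> = res (\<lambda>c. \<mu> c \<oplus> \<nu> c)" for \<mu> \<nu>
    by (rule vec_eqI) (simp add: res_def)
  have res_scale: "r *\<^sub>v res \<mu> = res (\<lambda>c. r \<otimes> \<mu> c)" if "r \<in> carrier R" for \<mu> r
    using that by (intro vec_eqI) (simp add: res_def)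
  have res_zero: "vzero = res (\<lambda>c. \<zero>)" by (rule vec_eqI) (simp add: res_def)
  have l_zero: "lin_on K (\<lambda>c. \<zero>)" by (simp add: lin_on_def)
  have l_add: "lin_on K (\<lambda>c. \<mu> c \<oplus> \<nu> c)" if "lin_on K \<mu>" "lin_on K \<nu>" for \<mu> \<nu>
    using lin_onD[OF that(1)] lin_onD[OF that(2)] by (auto simp: lin_on_def a_ac r_distr)
  have l_scale: "lin_on K (\<lambda>c. r \<otimes> \<mu> c)" if "r \<in> carrier R" "lin_on K \<mu>" for \<mu> r
    using lin_onD[OF that(2)] that(1) by (auto simp: lin_on_def r_distr m_lcomm)
  have L: "linsub S L"
    unfolding linsub_def
  proof (intro conjI ballI)
    show "L \<subseteq> vec S" using res_vec by (auto simp: L_def)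
    show "vzero \<in> L" unfolding L_def res_zero using l_zero by blast
    show "u +\<^sub>v v \<in> L" if "u \<in> L" "v \<in> L" for u v
      using that l_add unfolding L_def by (auto simp: res_add)
    show "r *\<^sub>v u \<in> L" if "r \<in> carrier R" "u \<in> L" for r u
      using that l_scale unfolding L_def by (auto simp: res_scale)
  qed
  have P: "linsub S P"
    unfolding linsub_def
  proof (intro conjI ballI)
    show "P \<subseteq> vec S" using res_vec lin_on_dot[OF X K] by (auto simp: P_def)
    have "(vzero :: ('b \<Rightarrow> 'a) \<Rightarrow> 'a) = res (\<lambda>c. dot X c vzero)"
      using S(2) Kv by (intro vec_eqI) (auto simp: res_def)
    then show "vzero \<in> P" unfolding P_def using vec_zero by blast
    fix u assume "u \<in> P"
    then obtain G where G: "G \<in> vec X" "u = res (\<lambda>c. dot X c G)" by (auto simp: P_def)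
    show "u +\<^sub>v v \<in> P" if vP: "v \<in> P" for v
    proof -
      obtain H where H: "H \<in> vec X" "v = res (\<lambda>c. dot X c H)" using vP by (auto simp: P_def)
      have "u +\<^sub>v v = res (\<lambda>c. dot X c (G +\<^sub>v H))"
        using G H S(2) Kv by (intro vec_eqI) (auto simp: res_def dot_add_right)
      then show ?thesis unfolding P_def using vec_add[OF G(1) H(1)] by blast
    qed
    show "r *\<^sub>v u \<in> P" if r: "r \<in> carrier R" for r
    proof -
      have "r *\<^sub>v u = res (\<lambda>c. dot X c (r *\<^sub>v G))"
        using G S(2) Kv r X by (intro vec_eqI) (auto simp: res_def dot_scale_right)
      then show ?thesis unfolding P_def using vec_scale[OF r G(1)] by blast
    qed
  qed
  have PL: "P \<subseteq> L" unfolding P_def L_def using lin_on_dot[OF X K] by blast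
  have "L = P"
  proof (rule nakayama[OF S(1) P L PL a(2)])
    fix v assume "v \<in> L"
    then obtain \<mu> where \<mu>: "lin_on K \<mu>" "v = res \<mu>" by (auto simp: L_def)
    define K' where "K' = {k +\<^sub>v a *\<^sub>v w |k w. k \<in> K \<and> w \<in> vec X}"
    \<comment> \<open>The functional \<open>\<mu>\<close> modulo \<open>a\<close>, extended by zero to \<open>K + aR\<^sup>X\<close>.\<close>
    define \<mu>' where "\<mu>' u = \<mu> (SOME k. k \<in> K \<and> (\<exists>w\<in>vec X. u = k +\<^sub>v a *\<^sub>v w))" for u
    have \<mu>': "eqm a (\<mu>' (k +\<^sub>v a *\<^sub>v w)) (\<mu> k)" and \<mu>'c: "\<mu>' (k +\<^sub>v a *\<^sub>v w) \<in> carrier R"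
      if k: "k \<in> K" and w: "w \<in> vec X" for k w
    proof -
      let ?Q = "\<lambda>k'. k' \<in> K \<and> (\<exists>w'\<in>vec X. k +\<^sub>v a *\<^sub>v w = k' +\<^sub>v a *\<^sub>v w')"
      define k' where "k' = (SOME k'. ?Q k')"
      have "?Q k'" unfolding k'_def by (rule someI[of ?Q k]) (use k w in blast)
      then obtain w' where k': "k' \<in> K" "w' \<in> vec X" "k +\<^sub>v a *\<^sub>v w = k' +\<^sub>v a *\<^sub>v w'" by blast
      note kv = Kv[OF k] and kv' = Kv[OF k'(1)]
      have "a *\<^sub>v (w -\<^sub>v w') = k' -\<^sub>v k"
      proof (rule vec_eqI)
        fix i
        have e: "k i \<oplus> a \<otimes> w i = k' i \<oplus> a \<otimes> w' i" using fun_cong[OF k'(3), of i] by simp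
        have c: "k i \<in> carrier R" "k' i \<in> carrier R" "w i \<in> carrier R" "w' i \<in> carrier R"
          using kv kv' w k'(2) by auto
        have "a \<otimes> (w i \<ominus> w' i) = (k i \<oplus> a \<otimes> w i) \<ominus> k i \<ominus> a \<otimes> w' i" using c ac by algebra
        also have "\<dots> = k' i \<ominus> k i" unfolding e using c ac by algebra
        finally show "(a *\<^sub>v (w -\<^sub>v w')) i = (k' -\<^sub>v k) i"
          using vdiff_nth[OF w k'(2)] vdiff_nth[OF kv' kv] by simp
      qed
      moreover from this have wK: "w -\<^sub>v w' \<in> K"
        using sat[of "w -\<^sub>v w'"] linsubD(5)[OF K k'(1) k] w k'(2) by simp
      ultimately have "\<mu> k' \<ominus> \<mu> k = a \<otimes> \<mu> (w -\<^sub>v w')"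
        using lin_on_diff[OF K \<mu>(1) k'(1) k] lin_onD(3)[OF \<mu>(1) ac wK] by simp
      then have "\<mu> k' = \<mu> k \<oplus> a \<otimes> \<mu> (w -\<^sub>v w')"
        using lin_onD(1)[OF \<mu>(1) k] lin_onD(1)[OF \<mu>(1) k'(1)] lin_onD(1)[OF \<mu>(1) wK] ac
        by (metis a_comm a_minus_def add.inv_solve_right m_closed minus_closed)
      then show "eqm a (\<mu>' (k +\<^sub>v a *\<^sub>v w)) (\<mu> k)" "\<mu>' (k +\<^sub>v a *\<^sub>v w) \<in> carrier R"
        using lin_onD(1)[OF \<mu>(1) wK] lin_onD(1)[OF \<mu>(1) k'(1)]
        unfolding \<mu>'_def k'_def by (auto intro: eqmI)
    qed
    have rep: "\<exists>k w. k \<in> K \<and> w \<in> vec X \<and> u = k +\<^sub>v a *\<^sub>v w" if "u \<in> K'" for u using that by (auto simp: K'_def)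
    have \<mu>c: "\<mu> k \<in> carrier R" if "k \<in> K" for k using lin_onD(1)[OF \<mu>(1) that] .
    have K'_add: "(k +\<^sub>v a *\<^sub>v w) +\<^sub>v (k' +\<^sub>v a *\<^sub>v w') = (k +\<^sub>v k') +\<^sub>v a *\<^sub>v (w +\<^sub>v w')"
      if "k \<in> K" "k' \<in> K" "w \<in> vec X" "w' \<in> vec X" for k k' w w'
    proof (rule vec_eqI)
      fix i
      have "k i \<in> carrier R" "k' i \<in> carrier R" "w i \<in> carrier R" "w' i \<in> carrier R"
        using linsub_closed[OF K] that by auto
      then show "((k +\<^sub>v a *\<^sub>v w) +\<^sub>v (k' +\<^sub>v a *\<^sub>v w')) i = ((k +\<^sub>v k') +\<^sub>v a *\<^sub>v (w +\<^sub>v w')) i"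
        using ac by simp algebra
    qed
    have K'_scale: "r *\<^sub>v (k +\<^sub>v a *\<^sub>v w) = (r *\<^sub>v k) +\<^sub>v a *\<^sub>v (r *\<^sub>v w)"
      if "k \<in> K" "w \<in> vec X" "r \<in> carrier R" for k w r
    proof (rule vec_eqI)
      fix i
      have "k i \<in> carrier R" "w i \<in> carrier R" using linsub_closed[OF K] that by auto
      then show "(r *\<^sub>v (k +\<^sub>v a *\<^sub>v w)) i = ((r *\<^sub>v k) +\<^sub>v a *\<^sub>v (r *\<^sub>v w)) i"
        using ac that(3) by simp algebra
    qed
    have in_K': "k +\<^sub>v a *\<^sub>v w \<in> K'" if "k \<in> K" "w \<in> vec X" for k w using that unfolding K'_def by blast
    have aw: "a *\<^sub>v w = vzero +\<^sub>v a *\<^sub>v w" if "w \<in> vec X" for w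
      using that ac by (intro vec_eqI) simp
    have k0: "k = k +\<^sub>v a *\<^sub>v vzero" if "k \<in> K" for k
      using Kv[OF that] ac by (intro vec_eqI) simp
    have K': "linsub X K'"
      unfolding linsub_def
    proof (intro conjI ballI)
      show "K' \<subseteq> vec X" using Kv ac by (auto simp: K'_def)
      show "vzero \<in> K'" using in_K'[OF linsubD(2)[OF K] vec_zero] k0[OF linsubD(2)[OF K]] by simp
      fix u assume "u \<in> K'"
      then obtain k w where u: "k \<in> K" "w \<in> vec X" "u = k +\<^sub>v a *\<^sub>v w" using rep by blast
      show "u +\<^sub>v v \<in> K'" if vK: "v \<in> K'" for v
      proof -
        obtain k' w' where v: "k' \<in> K" "w' \<in> vec X" "v = k' +\<^sub>v a *\<^sub>v w'" using rep[OF vK] by blast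
        show ?thesis unfolding u(3) v(3) K'_add[OF u(1) v(1) u(2) v(2)]
          using in_K'[OF linsubD(3)[OF K u(1) v(1)] vec_add[OF u(2) v(2)]] .
      qed
      show "r *\<^sub>v u \<in> K'" if r: "r \<in> carrier R" for r
        unfolding u(3) K'_scale[OF u(1,2) r] using in_K'[OF linsubD(4)[OF K r u(1)] vec_scale[OF r u(2)]] .
    qed
    have "\<exists>G\<in>vec X. \<forall>v\<in>K'. eqm a (\<mu>' v) (dot X v G)"
    proof (rule quotient_extension[OF a X K'])
      show "a *\<^sub>v w \<in> K'" if "w \<in> vec X" for w
        using in_K'[OF linsubD(2)[OF K] that] aw[OF that] by simp
      have "\<zero> *\<^sub>v vzero = (vzero :: 'b \<Rightarrow> 'a)" by (rule vec_eqI) simp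
      then have "\<mu> vzero = \<zero>"
        using lin_onD(3)[OF \<mu>(1) zero_closed linsubD(2)[OF K]] \<mu>c[OF linsubD(2)[OF K]] by simp
      then show "eqm a (\<mu>' (a *\<^sub>v w)) \<zero>" if "w \<in> vec X" for w
        using \<mu>'[OF linsubD(2)[OF K] that] aw[OF that] by simp
      fix u assume "u \<in> K'"
      then obtain k w where u: "k \<in> K" "w \<in> vec X" "u = k +\<^sub>v a *\<^sub>v w" using rep by blast
      show u'c: "\<mu>' u \<in> carrier R" using \<mu>'c[OF u(1,2)] u(3) by simp
      have us: "eqm a (\<mu> k) (\<mu>' u)" using eqm_sym[OF ac \<mu>c[OF u(1)] \<mu>'[OF u(1,2)]] u(3) by simp
      show "eqm a (\<mu>' (u +\<^sub>v v)) (\<mu>' u \<oplus> \<mu>' v)" if vK: "v \<in> K'" for v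
      proof -
        obtain k' w' where v: "k' \<in> K" "w' \<in> vec X" "v = k' +\<^sub>v a *\<^sub>v w'" using rep[OF vK] by blast
        have vs: "eqm a (\<mu> k') (\<mu>' v)" using eqm_sym[OF ac \<mu>c[OF v(1)] \<mu>'[OF v(1,2)]] v(3) by simp
        have v'c: "\<mu>' v \<in> carrier R" using \<mu>'c[OF v(1,2)] v(3) by simp
        have "eqm a (\<mu>' (u +\<^sub>v v)) (\<mu> k \<oplus> \<mu> k')"
          unfolding u(3) v(3) K'_add[OF u(1) v(1) u(2) v(2)]
          using \<mu>'[OF linsubD(3)[OF K u(1) v(1)] vec_add[OF u(2) v(2)]] lin_onD(2)[OF \<mu>(1) u(1) v(1)] by simp
        moreover have "eqm a (\<mu> k \<oplus> \<mu> k') (\<mu>' u \<oplus> \<mu>' v)" using eqm_add[OF ac u'c v'c us vs] .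
        ultimately show ?thesis by (rule eqm_trans[OF ac a_closed[OF u'c v'c]])
      qed
      show "eqm a (\<mu>' (r *\<^sub>v u)) (r \<otimes> \<mu>' u)" if r: "r \<in> carrier R" for r
      proof -
        have "eqm a (\<mu>' (r *\<^sub>v u)) (r \<otimes> \<mu> k)"
          unfolding u(3) K'_scale[OF u(1,2) r]
          using \<mu>'[OF linsubD(4)[OF K r u(1)] vec_scale[OF r u(2)]] lin_onD(3)[OF \<mu>(1) r u(1)] by simp
        moreover have "eqm a (r \<otimes> \<mu> k) (r \<otimes> \<mu>' u)" using eqm_mult[OF ac u'c r us] .
        ultimately show ?thesis by (rule eqm_trans[OF ac m_closed[OF r u'c]])
      qed
    qed
    then obtain G where G: "G \<in> vec X" "\<And>v. v \<in> K' \<Longrightarrow> eqm a (\<mu>' v) (dot X v G)" by blast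
    have Gc: "dot X k G \<in> carrier R" if "k \<in> K" for k using Kv[OF that] G(1) by simp
    have "\<exists>t\<in>carrier R. \<mu> k = dot X k G \<oplus> a \<otimes> t" if k: "k \<in> K" for k
    proof -
      have "k \<in> K'" using in_K'[OF k vec_zero] k0[OF k] by simp
      moreover have "eqm a (\<mu> k) (\<mu>' k)"
        using eqm_sym[OF ac \<mu>c[OF k] \<mu>'[OF k vec_zero]] k0[OF k] by simp
      ultimately have "eqm a (\<mu> k) (dot X k G)" using eqm_trans[OF ac Gc[OF k] _ G(2)] by simp
      then show ?thesis by (simp add: eqm_def)
    qed
    then obtain \<nu> where \<nu>: "\<And>k. k \<in> K \<Longrightarrow> \<nu> k \<in> carrier R \<and> \<mu> k = dot X k G \<oplus> a \<otimes> \<nu> k" by metis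
    have "lin_on K \<nu>"
      unfolding lin_on_def
    proof (intro conjI ballI)
      fix k assume k: "k \<in> K"
      show "\<nu> k \<in> carrier R" using \<nu>[OF k] by simp
      show "\<nu> (k +\<^sub>v k') = \<nu> k \<oplus> \<nu> k'" if k': "k' \<in> K" for k'
      proof (rule regular_cancel[OF a(1)])
        have s: "k +\<^sub>v k' \<in> K" using linsubD(3)[OF K k k'] .
        show "\<nu> (k +\<^sub>v k') \<in> carrier R" "\<nu> k \<oplus> \<nu> k' \<in> carrier R" using \<nu> s k k' by auto
        have "dot X k G \<oplus> dot X k' G \<oplus> a \<otimes> \<nu> (k +\<^sub>v k') = \<mu> (k +\<^sub>v k')"
          using \<nu>[OF s] dot_add_left[OF Kv[OF k] Kv[OF k'] G(1)] by simp
        also have "\<dots> = dot X k G \<oplus> a \<otimes> \<nu> k \<oplus> (dot X k' G \<oplus> a \<otimes> \<nu> k')"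
          using lin_onD(2)[OF \<mu>(1) k k'] \<nu>[OF k] \<nu>[OF k'] by simp
        also have "\<dots> = dot X k G \<oplus> dot X k' G \<oplus> a \<otimes> (\<nu> k \<oplus> \<nu> k')"
          using \<nu>[OF k] \<nu>[OF k'] Gc[OF k] Gc[OF k'] ac by (simp add: r_distr a_ac)
        finally show "a \<otimes> \<nu> (k +\<^sub>v k') = a \<otimes> (\<nu> k \<oplus> \<nu> k')"
          by (rule add_cancel_left[rotated -1]) (use \<nu> k k' s Gc ac in auto)
      qed
      show "\<nu> (r *\<^sub>v k) = r \<otimes> \<nu> k" if r: "r \<in> carrier R" for r
      proof (rule regular_cancel[OF a(1)])
        have s: "r *\<^sub>v k \<in> K" using linsubD(4)[OF K r k] .
        show "\<nu> (r *\<^sub>v k) \<in> carrier R" "r \<otimes> \<nu> k \<in> carrier R" using \<nu> s k r by auto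
        have "r \<otimes> dot X k G \<oplus> a \<otimes> \<nu> (r *\<^sub>v k) = \<mu> (r *\<^sub>v k)"
          using \<nu>[OF s] dot_scale_left[OF X r Kv[OF k] G(1)] by simp
        also have "\<dots> = r \<otimes> (dot X k G \<oplus> a \<otimes> \<nu> k)"
          using lin_onD(3)[OF \<mu>(1) r k] \<nu>[OF k] by simp
        also have "\<dots> = r \<otimes> dot X k G \<oplus> a \<otimes> (r \<otimes> \<nu> k)"
          using \<nu>[OF k] Gc[OF k] ac r by (simp add: r_distr m_lcomm)
        finally show "a \<otimes> \<nu> (r *\<^sub>v k) = a \<otimes> (r \<otimes> \<nu> k)"
          by (rule add_cancel_left[rotated -1]) (use \<nu> k s Gc ac r in auto)
      qed
    qed
    moreover have "v = res (\<lambda>c. dot X c G) +\<^sub>v a *\<^sub>v res \<nu>"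
      unfolding \<mu>(2) using \<nu> S(2) ac by (intro vec_eqI) (auto simp: res_def)
    ultimately show "\<exists>p\<in>P. \<exists>w\<in>L. v = p +\<^sub>v a *\<^sub>v w" using G(1) unfolding P_def L_def by blast
  qed
  moreover have "res \<kappa> \<in> L" using \<kappa> by (auto simp: L_def)
  ultimately obtain G where G: "G \<in> vec X" "res \<kappa> = res (\<lambda>c. dot X c G)" by (auto simp: P_def)
  have "\<kappa> s = dot X s G" if "s \<in> S" for s using fun_cong[OF G(2), of s] that by (simp add: res_def)
  then have "\<kappa> c = dot X c G" if "c \<in> K" for c
    using lin_on_eq_span[OF K \<kappa> lin_on_dot[OF X K G(1)] S(3) _ that] by simp
  then show ?thesis using G(1) by blast
qed

text \<open>Functionals modulo \<open>a\<close> on \<open>F/K\<close> lift to functionals: on \<open>K\<close> the representative \<open>f\<close> is \<open>a \<kappa>\<close> for a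
  functional \<open>\<kappa>\<close>, and \<open>\<kappa>\<close> extends to some \<open>G\<close> on \<open>F\<close>; then \<open>f - a G\<close> vanishes on \<open>K\<close>.\<close>

lemma lift_functional:
  assumes a: "regular a" "a \<in> \<mm>" and X: "finite X" and K: "linsub X K"
    and sat: "\<And>c. c \<in> vec X \<Longrightarrow> a *\<^sub>v c \<in> K \<Longrightarrow> c \<in> K"
    and f: "f \<in> vec X" "\<And>c. c \<in> K \<Longrightarrow> dot X c f \<in> PIdl a"
  shows "\<exists>g\<in>vec X. (\<forall>i. eqm a (g i) (f i)) \<and> (\<forall>c\<in>K. dot X c g = \<zero>)"
proof -
  note ac = regular_carrier[OF a(1)]
  note Kv = linsubD(1)[OF K]
  have "\<exists>t\<in>carrier R. dot X c f = a \<otimes> t" if c: "c \<in> K" for c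
  proof -
    obtain t where t: "t \<in> carrier R" "dot X c f = t \<otimes> a" using f(2)[OF c] by (auto simp: cgenideal_def)
    then show ?thesis using m_comm[OF ac t(1)] by metis
  qed
  then obtain \<kappa> where \<kappa>: "\<And>c. c \<in> K \<Longrightarrow> \<kappa> c \<in> carrier R \<and> dot X c f = a \<otimes> \<kappa> c" by metis
  have "lin_on K \<kappa>"
    unfolding lin_on_def
  proof (intro conjI ballI)
    fix k assume k: "k \<in> K"
    show "\<kappa> k \<in> carrier R" using \<kappa>[OF k] by simp
    show "\<kappa> (k +\<^sub>v k') = \<kappa> k \<oplus> \<kappa> k'" if k': "k' \<in> K" for k'
    proof (rule regular_cancel[OF a(1)])
      have s: "k +\<^sub>v k' \<in> K" using linsubD(3)[OF K k k'] .
      show "\<kappa> (k +\<^sub>v k') \<in> carrier R" "\<kappa> k \<oplus> \<kappa> k' \<in> carrier R" using \<kappa> s k k' by auto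
      show "a \<otimes> \<kappa> (k +\<^sub>v k') = a \<otimes> (\<kappa> k \<oplus> \<kappa> k')"
        using \<kappa>[OF s] \<kappa>[OF k] \<kappa>[OF k'] dot_add_left[OF Kv[OF k] Kv[OF k'] f(1)] ac by (simp add: r_distr)
    qed
    show "\<kappa> (r *\<^sub>v k) = r \<otimes> \<kappa> k" if r: "r \<in> carrier R" for r
    proof (rule regular_cancel[OF a(1)])
      have s: "r *\<^sub>v k \<in> K" using linsubD(4)[OF K r k] .
      show "\<kappa> (r *\<^sub>v k) \<in> carrier R" "r \<otimes> \<kappa> k \<in> carrier R" using \<kappa> s k r by auto
      show "a \<otimes> \<kappa> (r *\<^sub>v k) = a \<otimes> (r \<otimes> \<kappa> k)"
        using \<kappa>[OF s] \<kappa>[OF k] dot_scale_left[OF X r Kv[OF k] f(1)] ac r by (simp add: m_lcomm)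
    qed
  qed
  from functional_extension[OF a X K sat this] obtain G where
    G: "G \<in> vec X" "\<And>c. c \<in> K \<Longrightarrow> \<kappa> c = dot X c G" by blast
  let ?g = "f +\<^sub>v a *\<^sub>v (\<ominus> \<one> *\<^sub>v G)"
  have "eqm a (?g i) (f i)" for i
    using G(1) by (intro eqmI[of "\<ominus> \<one> \<otimes> G i"]) auto
  moreover have "dot X c ?g = \<zero>" if c: "c \<in> K" for c
  proof -
    have g: "dot X c G \<in> carrier R" using Kv[OF c] G(1) by simp
    have "dot X c ?g = dot X c f \<oplus> a \<otimes> (\<ominus> \<one> \<otimes> dot X c G)"
      using dot_add_right[OF f(1) _ Kv[OF c], of "a *\<^sub>v (\<ominus> \<one> *\<^sub>v G)"] ac G(1) Kv[OF c] X
      by (simp add: dot_scale_right)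
    also have "\<dots> = a \<otimes> dot X c G \<oplus> a \<otimes> (\<ominus> \<one> \<otimes> dot X c G)" using \<kappa>[OF c] G(2)[OF c] by simp
    also have "\<dots> = \<zero>" using g ac by algebra
    finally show ?thesis .
  qed
  moreover have "?g \<in> vec X" using f(1) G(1) ac by simp
  ultimately show ?thesis by blast
qed

text \<open>The socle of \<open>R/aR\<close> is generated by any nonzero element \<open>s\<close> of it: for \<open>\<tau>\<close> in the socle, \<open>s \<mapsto> \<tau>\<close> defines a
  map from the ideal generated by \<open>s\<close> to \<open>R/aR\<close>, which is multiplication by some \<open>\<rho>\<close>.\<close>

lemma socle_one_dimensional:
  assumes a: "regular a" "a \<in> \<mm>"
    and s: "s \<in> carrier R" "icolon (PIdl a) s = \<mm>"
    and \<tau>: "\<tau> \<in> carrier R" "\<And>c. c \<in> \<mm> \<Longrightarrow> c \<otimes> \<tau> \<in> PIdl a"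
  shows "\<exists>\<rho>\<in>carrier R. eqm a \<tau> (s \<otimes> \<rho>)"
proof -
  note ac = regular_carrier[OF a(1)]
  note J = cgenideal_ideal[OF ac]
  let ?J = "PIdl a"
  define f where "f \<alpha> = (SOME r. r \<in> carrier R \<and> (\<exists>i\<in>?J. \<alpha> = i \<oplus> r \<otimes> s)) \<otimes> \<tau>" for \<alpha>
  have f: "eqm a (f (i \<oplus> r \<otimes> s)) (r \<otimes> \<tau>)" and fc: "f (i \<oplus> r \<otimes> s) \<in> carrier R"
    if i: "i \<in> ?J" and r: "r \<in> carrier R" for i r
  proof -
    let ?P = "\<lambda>r'. r' \<in> carrier R \<and> (\<exists>i'\<in>?J. i \<oplus> r \<otimes> s = i' \<oplus> r' \<otimes> s)"
    define t where "t = (SOME r'. ?P r')"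
    have "?P t" unfolding t_def by (rule someI[of ?P r]) (use i r in blast)
    then obtain i' where t: "t \<in> carrier R" "i' \<in> ?J" "i \<oplus> r \<otimes> s = i' \<oplus> t \<otimes> s" by blast
    have ic: "i \<in> carrier R" "i' \<in> carrier R" using ideal_mem[OF J] i t(2) by auto
    have "(t \<ominus> r) \<otimes> s = (i \<ominus> i') \<oplus> (\<ominus> i \<oplus> i' \<oplus> t \<otimes> s \<ominus> r \<otimes> s)"
      using ic s(1) r t(1) by algebra
    also have "\<ominus> i \<oplus> i' \<oplus> t \<otimes> s \<ominus> r \<otimes> s = \<ominus> i \<oplus> (i' \<oplus> t \<otimes> s) \<ominus> r \<otimes> s"
      using ic s(1) r t(1) by algebra
    also have "\<dots> = \<zero>" unfolding t(3)[symmetric] using ic s(1) r by algebra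
    finally have "(t \<ominus> r) \<otimes> s \<in> ?J" using ideal_sub[OF J i t(2)] ic by simp
    then have "t \<ominus> r \<in> icolon ?J s" using t(1) r by (simp add: icolon_def)
    then have "(t \<ominus> r) \<otimes> \<tau> \<in> ?J" using s(2) \<tau>(2) by simp
    moreover have "(t \<ominus> r) \<otimes> \<tau> = t \<otimes> \<tau> \<ominus> r \<otimes> \<tau>" using t(1) r \<tau>(1) by algebra
    ultimately have "eqm a (t \<otimes> \<tau>) (r \<otimes> \<tau>)" using eqm_iff_diff[OF ac] t(1) r \<tau>(1) by simp
    then show "eqm a (f (i \<oplus> r \<otimes> s)) (r \<otimes> \<tau>)" "f (i \<oplus> r \<otimes> s) \<in> carrier R"
      using t(1) \<tau>(1) unfolding f_def t_def by auto
  qed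
  note A = ideal_sum_gen[OF J s(1)]
  have aJ: "a \<in> ?J" using cgenideal_self[OF ac] .
  have "\<exists>\<rho>\<in>carrier R. \<forall>\<alpha>\<in>isum ?J s. eqm a (f \<alpha>) (\<alpha> \<otimes> \<rho>)"
  proof (rule quotient_self_injective[OF a A(1)])
    show "a \<in> isum ?J s" using A(2) aJ by blast
    show "eqm a (f a) \<zero>" using f[OF aJ zero_closed] ac s(1) \<tau>(1) by simp
    fix \<alpha> assume "\<alpha> \<in> isum ?J s"
    then obtain i r where u: "\<alpha> = i \<oplus> r \<otimes> s" "i \<in> ?J" "r \<in> carrier R" by (rule isumE)
    have ic: "i \<in> carrier R" using ideal_mem[OF J u(2)] .
    show uc: "f \<alpha> \<in> carrier R" using fc[OF u(2,3)] u(1) by simp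
    have us: "eqm a (r \<otimes> \<tau>) (f \<alpha>)" 
      using eqm_sym[OF ac m_closed[OF u(3) \<tau>(1)] f[OF u(2,3)]] u(1) by simp
    show "eqm a (f (\<alpha> \<oplus> \<beta>)) (f \<alpha> \<oplus> f \<beta>)" if beta: "\<beta> \<in> isum ?J s" for \<beta>
    proof -
      from beta obtain k t where v: "\<beta> = k \<oplus> t \<otimes> s" "k \<in> ?J" "t \<in> carrier R" by (rule isumE)
      have kc: "k \<in> carrier R" using ideal_mem[OF J v(2)] .
      have vc: "f \<beta> \<in> carrier R" using fc[OF v(2,3)] v(1) by simp
      have vs: "eqm a (t \<otimes> \<tau>) (f \<beta>)" 
        using eqm_sym[OF ac m_closed[OF v(3) \<tau>(1)] f[OF v(2,3)]] v(1) by simp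
      have "\<alpha> \<oplus> \<beta> = (i \<oplus> k) \<oplus> (r \<oplus> t) \<otimes> s" unfolding u(1) v(1) using ic kc u(3) v(3) s(1) by algebra
      then have "eqm a (f (\<alpha> \<oplus> \<beta>)) ((r \<oplus> t) \<otimes> \<tau>)" using f[OF ideal_add[OF J u(2) v(2)], of "r \<oplus> t"] u(3) v(3) by simp
      then have "eqm a (f (\<alpha> \<oplus> \<beta>)) (r \<otimes> \<tau> \<oplus> t \<otimes> \<tau>)" using u(3) v(3) \<tau>(1) by (simp add: l_distr)
      moreover have "eqm a (r \<otimes> \<tau> \<oplus> t \<otimes> \<tau>) (f \<alpha> \<oplus> f \<beta>)" using eqm_add[OF ac uc vc us vs] .
      ultimately show ?thesis by (rule eqm_trans[OF ac a_closed[OF uc vc]])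
    qed
    show "eqm a (f (t \<otimes> \<alpha>)) (t \<otimes> f \<alpha>)" if t: "t \<in> carrier R" for t
    proof -
      have "t \<otimes> \<alpha> = t \<otimes> i \<oplus> (t \<otimes> r) \<otimes> s" unfolding u(1) using ic u(3) t s(1) by algebra
      then have "eqm a (f (t \<otimes> \<alpha>)) ((t \<otimes> r) \<otimes> \<tau>)" using f[OF ideal_mult[OF J u(2) t], of "t \<otimes> r"] u(3) t by simp
      then have "eqm a (f (t \<otimes> \<alpha>)) (t \<otimes> (r \<otimes> \<tau>))" using u(3) t \<tau>(1) by (simp add: m_assoc)
      moreover have "eqm a (t \<otimes> (r \<otimes> \<tau>)) (t \<otimes> f \<alpha>)" using eqm_mult[OF ac uc t us] .
      ultimately show ?thesis by (rule eqm_trans[OF ac m_closed[OF t uc]])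
    qed
  qed
  then obtain \<rho> where \<rho>: "\<rho> \<in> carrier R" "\<And>\<alpha>. \<alpha> \<in> isum ?J s \<Longrightarrow> eqm a (f \<alpha>) (\<alpha> \<otimes> \<rho>)" by blast
  have "eqm a (f s) \<tau>" using f[OF ideal_zero[OF J] one_closed] s(1) \<tau>(1) by simp
  then have "eqm a \<tau> (f s)" by (rule eqm_sym[OF ac \<tau>(1)])
  then have "eqm a \<tau> (s \<otimes> \<rho>)"
    using \<rho>(2)[OF A(3)] by (rule eqm_trans[OF ac m_closed[OF s(1) \<rho>(1)]])
  then show ?thesis using \<rho>(1) by blast
qed

end

section \<open>Products of index sets\<close>

context cring
begin

lemma finsum_product:
  assumes "finite A" "finite B" "\<And>i j. i \<in> A \<Longrightarrow> j \<in> B \<Longrightarrow> f (i, j) \<in> carrier R"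
  shows "(\<Oplus>p\<in>A \<times> B. f p) = (\<Oplus>i\<in>A. \<Oplus>j\<in>B. f (i, j))"
  using assms(1,3)
proof (induction A)
  case empty then show ?case by simp
next
  case (insert a A)
  have "(\<Oplus>p\<in>insert a A \<times> B. f p) = (\<Oplus>p\<in>Pair a ` B \<union> A \<times> B. f p)"
    by (rule arg_cong[where f = "finsum R f"]) auto
  also have "\<dots> = (\<Oplus>p\<in>Pair a ` B. f p) \<oplus> (\<Oplus>p\<in>A \<times> B. f p)"
    by (rule finsum_Un_disjoint) (use insert assms(2) in auto)
  also have "(\<Oplus>p\<in>Pair a ` B. f p) = (\<Oplus>j\<in>B. f (a, j))"
    by (rule finsum_reindex) (use insert in \<open>auto simp: inj_on_def\<close>)
  also have "(\<Oplus>p\<in>A \<times> B. f p) = (\<Oplus>i\<in>A. \<Oplus>j\<in>B. f (i, j))" using insert by simp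
  also have "(\<Oplus>j\<in>B. f (a, j)) \<oplus> \<dots> = (\<Oplus>i\<in>insert a A. \<Oplus>j\<in>B. f (i, j))"
    by (rule finsum_insert[symmetric]) (use insert assms(2) in auto)
  finally show ?case .
qed

lemma dot_product_index:
  assumes "finite A" "finite B" "u \<in> vec (A \<times> B)" "v \<in> vec (A \<times> B)"
  shows "dot (A \<times> B) u v = (\<Oplus>i\<in>A. dot B (\<lambda>j. u (i, j)) (\<lambda>j. v (i, j)))"
  unfolding dot_def by (rule finsum_product) (use assms in auto)

text \<open>The elementary tensor of two vectors in coordinates.\<close>

definition outer :: "('x \<Rightarrow> 'a) \<Rightarrow> ('y \<Rightarrow> 'a) \<Rightarrow> 'x \<times> 'y \<Rightarrow> 'a" where
  "outer z \<psi> = (\<lambda>(i, j). z i \<otimes> \<psi> j)"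

lemma outer_vec: "z \<in> vec X \<Longrightarrow> \<psi> \<in> vec Y' \<Longrightarrow> outer z \<psi> \<in> vec (X \<times> Y')"
  unfolding vec_def outer_def by auto

lemma regular_vscale_cancel:
  assumes "regular a" "u \<in> vec X" "v \<in> vec X" "a *\<^sub>v u = a *\<^sub>v v" shows "u = v"
proof (rule vec_eqI)
  fix i
  show "u i = v i"
  proof (rule regular_cancel[OF assms(1)])
    show "a \<otimes> u i = a \<otimes> v i" using fun_cong[OF assms(4), of i] by simp
  qed (use assms in auto)
qed

lemma regular_power: assumes a: "regular a" shows "regular (a [^] (k :: nat))"
proof (induction k)
  case 0 then show ?case by (simp add: regular_def)
next
  case (Suc k)
  have ac: "a \<in> carrier R" using a by (simp add: regular_def)
  have "s' = \<zero>" if s': "s' \<in> carrier R" "a [^] Suc k \<otimes> s' = \<zero>" for s'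
  proof -
    have "a [^] k \<otimes> (a \<otimes> s') = \<zero>" using s' ac by (simp add: m_assoc)
    then have "a \<otimes> s' = \<zero>" using Suc s'(1) ac by (simp add: regular_def)
    then show ?thesis using a s'(1) by (simp add: regular_def)
  qed
  then show ?case using ac by (simp add: regular_def)
qed

lemma vec_row: "\<mu> \<in> vec (X \<times> Y) \<Longrightarrow> (\<lambda>j. \<mu> (i, j)) \<in> vec Y"
  unfolding vec_def by simp

lemma vscale_assoc: "r \<in> carrier R \<Longrightarrow> s \<in> carrier R \<Longrightarrow> v \<in> vec X \<Longrightarrow> r *\<^sub>v s *\<^sub>v v = (r \<otimes> s) *\<^sub>v v"
  by (rule vec_eqI) (simp add: m_assoc)

lemma vscale_commute: "r \<in> carrier R \<Longrightarrow> s \<in> carrier R \<Longrightarrow> v \<in> vec X \<Longrightarrow> r *\<^sub>v s *\<^sub>v v = s *\<^sub>v r *\<^sub>v v"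
  by (rule vec_eqI) (simp add: m_lcomm)

lemma vscale_add: "r \<in> carrier R \<Longrightarrow> u \<in> vec X \<Longrightarrow> v \<in> vec X \<Longrightarrow> r *\<^sub>v (u +\<^sub>v v) = r *\<^sub>v u +\<^sub>v r *\<^sub>v v"
  by (rule vec_eqI) (simp add: r_distr)

lemma vadd_assoc: "u \<in> vec X \<Longrightarrow> v \<in> vec X \<Longrightarrow> w \<in> vec X \<Longrightarrow> u +\<^sub>v v +\<^sub>v w = u +\<^sub>v (v +\<^sub>v w)"
  by (rule vec_eqI) (simp add: a_assoc)

lemma vscale_zero: "v \<in> vec X \<Longrightarrow> \<zero> *\<^sub>v v = vzero"
  by (rule vec_eqI) simp

lemma vscale_vzero: "r \<in> carrier R \<Longrightarrow> r *\<^sub>v vzero = vzero"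
  by (rule vec_eqI) simp

end

context noeth_local
begin

lemma eqm_vec:
  assumes a: "a \<in> carrier R" and "u \<in> vec X" "v \<in> vec X" "\<And>i. i \<in> X \<Longrightarrow> eqm a (u i) (v i)"
  shows "\<exists>t\<in>vec X. u = v +\<^sub>v a *\<^sub>v t"
proof -
  have "\<forall>i. \<exists>t. t \<in> carrier R \<and> u i = v i \<oplus> a \<otimes> t \<and> (i \<notin> X \<longrightarrow> t = \<zero>)"
  proof
    fix i
    show "\<exists>t. t \<in> carrier R \<and> u i = v i \<oplus> a \<otimes> t \<and> (i \<notin> X \<longrightarrow> t = \<zero>)"
    proof (cases "i \<in> X")
      case True then show ?thesis using assms(4) by (auto simp: eqm_def)
    next
      case False then show ?thesis using vec_off[OF assms(2)] vec_off[OF assms(3)] a by (intro exI[of _ \<zero>]) simp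
    qed
  qed
  then obtain t where t: "\<And>i. t i \<in> carrier R \<and> u i = v i \<oplus> a \<otimes> t i \<and> (i \<notin> X \<longrightarrow> t i = \<zero>)" by metis
  have "t \<in> vec X" unfolding vec_def using t by simp
  moreover have "u = v +\<^sub>v a *\<^sub>v t" using t by (intro vec_eqI) simp
  ultimately show ?thesis by blast
qed

end

section \<open>Modules with the Burch property\<close>

text \<open>Coordinates for the module \<open>M = R\<^sup>X/Z\<close>: \<open>Zsat\<close> says that \<open>M\<close> has no \<open>a\<close>-torsion, and \<open>Y\<close> represents an
  element \<open>y\<close> outside \<open>\<mm>M\<close> with \<open>\<mm>y \<subseteq> aM\<close>.\<close>

locale burch_presentation = inj_resolution +
  fixes X :: "'x set" and Z :: "('x \<Rightarrow> 'a) set" and a :: 'a and Y :: "'x \<Rightarrow> 'a" and x0 :: 'x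
  assumes finX: "finite X" and Zlin: "linsub X Z"
    and Zmin: "\<And>z i. z \<in> Z \<Longrightarrow> z i \<in> \<mm>"
    and areg: "regular a" and amm: "a \<in> \<mm>"
    and Zsat: "\<And>c. c \<in> vec X \<Longrightarrow> a *\<^sub>v c \<in> Z \<Longrightarrow> c \<in> Z"
    and Yvec: "Y \<in> vec X" and x0: "x0 \<in> X" and Yunit: "Y x0 \<notin> \<mm>"
    and Yburch: "\<And>c. c \<in> \<mm> \<Longrightarrow> \<exists>w\<in>vec X. \<exists>z\<in>Z. c *\<^sub>v Y = a *\<^sub>v w +\<^sub>v z"
begin

text \<open>\<open>N\<close> is the dual of \<open>M\<close>, \<open>N\<^sup>X/W\<close> is the tensor product of \<open>M\<close> with its dual, and \<open>U\<close> is \<open>JN\<close> for the ideal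
  \<open>J\<close> generated by the entries of the relations.\<close>

definition N :: "('x \<Rightarrow> 'a) set" where "N = {\<psi> \<in> vec X. \<forall>z\<in>Z. dot X z \<psi> = \<zero>}"

definition W :: "('x \<times> 'x \<Rightarrow> 'a) set" where
  "W = vspan {outer z \<psi> |z \<psi>. z \<in> Z \<and> \<psi> \<in> N}"

definition U :: "('x \<Rightarrow> 'a) set" where
  "U = vspan {z i *\<^sub>v \<nu> |z i \<nu>. z \<in> Z \<and> \<nu> \<in> N}"

lemma ac [simp]: "a \<in> carrier R" by (rule regular_carrier[OF areg])

lemma Zvec: "z \<in> Z \<Longrightarrow> z \<in> vec X" by (rule linsubD(1)[OF Zlin])

lemma Nvec: "\<psi> \<in> N \<Longrightarrow> \<psi> \<in> vec X" by (simp add: N_def)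

lemma Ndot: "\<psi> \<in> N \<Longrightarrow> z \<in> Z \<Longrightarrow> dot X z \<psi> = \<zero>" by (simp add: N_def)

lemma Nlin: "linsub X N"
  unfolding linsub_def N_def using Zvec finX by (auto simp: dot_add_right dot_scale_right)

lemma Nsat: assumes "\<nu> \<in> vec X" "a *\<^sub>v \<nu> \<in> N" shows "\<nu> \<in> N"
  unfolding N_def
proof (intro CollectI conjI ballI)
  fix z assume z: "z \<in> Z"
  have "a \<otimes> dot X z \<nu> = \<zero>"
    using Ndot[OF assms(2) z] dot_scale_right[OF finX ac assms(1) Zvec[OF z]] by simp
  then show "dot X z \<nu> = \<zero>" using areg assms(1) Zvec[OF z] by (simp add: regular_def)
qed (rule assms(1))

lemma Wlin: "linsub (X \<times> X) W"
  unfolding W_def by (rule vspan_linsub) (use outer_vec Zvec Nvec in blast)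

lemma Ulin: "linsub X U"
  unfolding U_def by (rule vspan_linsub) (use linsub_closed[OF Zlin] Nvec in \<open>auto intro!: vec_scale\<close>)

lemma outer_in_W: "z \<in> Z \<Longrightarrow> \<psi> \<in> N \<Longrightarrow> outer z \<psi> \<in> W"
  unfolding W_def by (rule vspan_base) blast

lemma scale_in_U: "z \<in> Z \<Longrightarrow> \<nu> \<in> N \<Longrightarrow> z i *\<^sub>v \<nu> \<in> U"
  unfolding U_def by (rule vspan_base) blast

lemma U_subset_N: "U \<subseteq> N"
  unfolding U_def by (rule vspan_subset[OF Nlin]) (use linsubD(4)[OF Nlin] linsub_closed[OF Zlin] in auto)

lemma W_row_U: assumes "\<mu> \<in> W" shows "(\<lambda>j. \<mu> (i, j)) \<in> U"
  using assms unfolding W_def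
proof (induction rule: vspan_induct)
  case zero
  have "(\<lambda>j. vzero (i, j)) = (vzero :: 'x \<Rightarrow> 'a)" by (rule vec_eqI) simp
  then show ?case using linsubD(2)[OF Ulin] by simp
next
  case (base v)
  then obtain z \<psi> where v: "z \<in> Z" "\<psi> \<in> N" "v = outer z \<psi>" by auto
  have "(\<lambda>j. v (i, j)) = z i *\<^sub>v \<psi>" unfolding v(3) by (rule vec_eqI) (simp add: outer_def)
  then show ?case using scale_in_U[OF v(1,2)] by simp
next
  case (add u v)
  have "(\<lambda>j. (u +\<^sub>v v) (i, j)) = (\<lambda>j. u (i, j)) +\<^sub>v (\<lambda>j. v (i, j))" by (rule vec_eqI) simp
  then show ?case using linsubD(3)[OF Ulin add.IH] by simp
next
  case (scale r u)
  have "(\<lambda>j. (r *\<^sub>v u) (i, j)) = r *\<^sub>v (\<lambda>j. u (i, j))" by (rule vec_eqI) simp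
  then show ?case using linsubD(4)[OF Ulin scale(1) scale.IH] by simp
qed

text \<open>Modulo \<open>\<mm>\<close> this is a functional on \<open>M\<close> with value one at \<open>y\<close>, since the relations have entries in \<open>\<mm>\<close>.\<close>

definition l :: "'x \<Rightarrow> 'a" where "l = inv (Y x0) *\<^sub>v unitv x0"

lemma Yx0: "Y x0 \<in> Units R" using unit_iff[of "Y x0"] Yunit Yvec by simp

lemma lvec [simp]: "l \<in> vec X" using Yx0 x0 by (simp add: l_def)

lemma dot_l: "v \<in> vec X \<Longrightarrow> dot X v l = inv (Y x0) \<otimes> v x0"
  unfolding l_def using Yx0 x0 finX by (simp add: dot_scale_right dot_comm[of v] dot_unitv)

lemma dot_Y_l: "dot X Y l = \<one>" using dot_l[OF Yvec] Yx0 by simp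

lemma dot_Z_l: "z \<in> Z \<Longrightarrow> dot X z l \<in> \<mm>"
  using dot_l[OF Zvec] Zmin[of z x0] ideal_mult[OF mm_ideal, of "z x0" "inv (Y x0)"] Yx0 by simp

text \<open>\<open>c \<psi>(y) = \<psi>(c y) \<in> \<psi>(aM)\<close>: values of functionals at \<open>y\<close> lie in the socle modulo \<open>a\<close>.\<close>

lemma dot_Y_socle: assumes "\<psi> \<in> N" "c \<in> \<mm>" shows "c \<otimes> dot X Y \<psi> \<in> PIdl a"
proof -
  have cc: "c \<in> carrier R" using mm_carrier[OF assms(2)] .
  obtain w z where w: "w \<in> vec X" "z \<in> Z" "c *\<^sub>v Y = a *\<^sub>v w +\<^sub>v z" using Yburch[OF assms(2)] by blast
  have "c \<otimes> dot X Y \<psi> = dot X (a *\<^sub>v w +\<^sub>v z) \<psi>"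
    using dot_scale_left[OF finX cc Yvec Nvec[OF assms(1)]] w(3) by simp
  also have "\<dots> = a \<otimes> dot X w \<psi>"
    using dot_add_left[OF vec_scale[OF ac w(1)] Zvec[OF w(2)] Nvec[OF assms(1)]]
      dot_scale_left[OF finX ac w(1) Nvec[OF assms(1)]] Ndot[OF assms(1) w(2)] w(1) Nvec[OF assms(1)] by simp
  finally have "c \<otimes> dot X Y \<psi> = dot X w \<psi> \<otimes> a" using w(1) Nvec[OF assms(1)] by (simp add: m_comm)
  then show ?thesis using w(1) Nvec[OF assms(1)] unfolding cgenideal_def by auto
qed

text \<open>Functionals on \<open>N\<^sup>X/W\<close> are constructed on the free module \<open>R\<^sup>X\<^sup>\<times>\<^sup>G\<close>, where \<open>G\<close> is a finite set of
  generators of \<open>N\<close>, which maps onto \<open>N\<^sup>X\<close>.\<close>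

definition gens :: "('x \<Rightarrow> 'a) set" where
  "gens = (SOME S. finite S \<and> S \<subseteq> N \<and> N = vspan S)"

lemma gens: "finite gens" "gens \<subseteq> N" "N = vspan gens"
proof -
  have "finite gens \<and> gens \<subseteq> N \<and> N = vspan gens"
    unfolding gens_def by (rule someI_ex) (rule noetherian_vec[OF noeth finX Nlin])
  then show "finite gens" "gens \<subseteq> N" "N = vspan gens" by auto
qed

lemma gens_vec: "g \<in> gens \<Longrightarrow> g \<in> vec X" using gens(2) Nvec by blast

lemma gens_closed [simp]: "g \<in> gens \<Longrightarrow> g i \<in> carrier R" by (rule vec_closed[OF gens_vec])

definition comb :: "(('x \<Rightarrow> 'a) \<Rightarrow> 'a) \<Rightarrow> 'x \<Rightarrow> 'a" where
  "comb e = (\<lambda>j. \<Oplus>g\<in>gens. e g \<otimes> g j)"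

lemma comb_dot: "comb e j = dot gens e (\<lambda>g. if g \<in> gens then g j else \<zero>)" if "e \<in> vec gens"
  unfolding comb_def dot_def by (rule finsum_cong') (use that in auto)

lemma gen_coord_vec: "(\<lambda>g. if g \<in> gens then g j else \<zero>) \<in> vec gens"
  unfolding vec_def by simp

lemma comb_add: "e \<in> vec gens \<Longrightarrow> e' \<in> vec gens \<Longrightarrow> comb (e +\<^sub>v e') = comb e +\<^sub>v comb e'"
  by (rule vec_eqI) (simp add: comb_dot dot_add_left gen_coord_vec)

lemma comb_scale: "r \<in> carrier R \<Longrightarrow> e \<in> vec gens \<Longrightarrow> comb (r *\<^sub>v e) = r *\<^sub>v comb e"
  by (rule vec_eqI) (simp add: comb_dot dot_scale_left gen_coord_vec gens(1))

lemma comb_zero: "comb vzero = vzero"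
  by (rule vec_eqI) (simp add: comb_dot gen_coord_vec)

lemma comb_in_span:
  assumes e: "e \<in> vec gens" shows "comb e \<in> N"
proof -
  have "(\<lambda>j. \<Oplus>g\<in>S. e g \<otimes> g j) \<in> N" if "finite S" "S \<subseteq> gens" for S
    using that
  proof (induction S)
    case empty
    have "(\<lambda>j. \<Oplus>g\<in>{}. e g \<otimes> g j) = vzero" by (rule vec_eqI) simp
    then show ?case using linsubD(2)[OF Nlin] by simp
  next
    case (insert g S)
    have "(\<lambda>j. \<Oplus>g\<in>insert g S. e g \<otimes> g j) = e g *\<^sub>v g +\<^sub>v (\<lambda>j. \<Oplus>g\<in>S. e g \<otimes> g j)"
      by (rule vec_eqI) (use insert e in \<open>auto simp: subset_iff intro!: finsum_insert\<close>)
    moreover have "e g *\<^sub>v g \<in> N" using linsubD(4)[OF Nlin, of "e g" g] e gens(2) insert.prems by auto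
    ultimately show ?case using linsubD(3)[OF Nlin] insert by simp
  qed
  from this[OF gens(1) order_refl] show ?thesis by (simp add: comb_def)
qed

lemma comb_surj: assumes "\<psi> \<in> N" shows "\<exists>e\<in>vec gens. \<psi> = comb e"
proof -
  have "gens \<subseteq> vec X" using gens_vec by blast
  then obtain e where "e \<in> vec gens" "\<And>i. \<psi> i = (\<Oplus>g\<in>gens. e g \<otimes> g i)"
    using vspan_coeffs[OF gens(1), of X \<psi>] assms gens(3) by blast
  then show ?thesis unfolding comb_def by (intro bexI[of _ e]) (auto intro: vec_eqI)
qed

text \<open>The map from coefficients with respect to the generators to families in \<open>N\<close>.\<close>

definition mcomb :: "('x \<times> ('x \<Rightarrow> 'a) \<Rightarrow> 'a) \<Rightarrow> 'x \<times> 'x \<Rightarrow> 'a" where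
  "mcomb c = (\<lambda>(i, j). comb (\<lambda>g. c (i, g)) j)"

lemma mcomb_row: "(\<lambda>j. mcomb c (i, j)) = comb (\<lambda>g. c (i, g))"
  by (simp add: mcomb_def)

lemma mcomb_vec: assumes "c \<in> vec (X \<times> gens)" shows "mcomb c \<in> vec (X \<times> X)"
  unfolding vec_def
proof (intro CollectI conjI allI impI)
  fix p :: "'x \<times> 'x"
  obtain i j where p: "p = (i, j)" by (cases p)
  have r: "comb (\<lambda>g. c (i, g)) \<in> vec X" using Nvec[OF comb_in_span[OF vec_row[OF assms]]] .
  show "mcomb c p \<in> carrier R" using r by (simp add: p mcomb_def)
  assume "p \<notin> X \<times> X"
  then consider "i \<notin> X" | "j \<notin> X" using p by auto
  then show "mcomb c p = \<zero>"
  proof cases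
    case 1
    then have "(\<lambda>g. c (i, g)) = vzero" using vec_off[OF assms] by (intro vec_eqI) simp
    then show ?thesis by (simp add: p mcomb_def comb_zero)
  next
    case 2
    then show ?thesis using vec_off[OF r] by (simp add: p mcomb_def)
  qed
qed

lemma mcomb_add:
  assumes "c \<in> vec (X \<times> gens)" "c' \<in> vec (X \<times> gens)"
  shows "mcomb (c +\<^sub>v c') = mcomb c +\<^sub>v mcomb c'"
proof (rule vec_eqI)
  fix p :: "'x \<times> 'x"
  obtain i j where p: "p = (i, j)" by (cases p)
  have "(\<lambda>g. (c +\<^sub>v c') (i, g)) = (\<lambda>g. c (i, g)) +\<^sub>v (\<lambda>g. c' (i, g))" by (rule vec_eqI) simp
  then show "mcomb (c +\<^sub>v c') p = (mcomb c +\<^sub>v mcomb c') p"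
    using comb_add[OF vec_row[OF assms(1), of i] vec_row[OF assms(2), of i]] by (simp add: p mcomb_def)
qed

lemma mcomb_scale:
  assumes "r \<in> carrier R" "c \<in> vec (X \<times> gens)"
  shows "mcomb (r *\<^sub>v c) = r *\<^sub>v mcomb c"
proof (rule vec_eqI)
  fix p :: "'x \<times> 'x"
  obtain i j where p: "p = (i, j)" by (cases p)
  have "(\<lambda>g. (r *\<^sub>v c) (i, g)) = r *\<^sub>v (\<lambda>g. c (i, g))" by (rule vec_eqI) simp
  then show "mcomb (r *\<^sub>v c) p = (r *\<^sub>v mcomb c) p"
    using comb_scale[OF assms(1) vec_row[OF assms(2), of i]] by (simp add: p mcomb_def)
qed

lemma mcomb_zero: "mcomb vzero = vzero"
proof (rule vec_eqI)
  fix p :: "'x \<times> 'x"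
  obtain i j where p: "p = (i, j)" by (cases p)
  have e: "(\<lambda>g. vzero (i, g)) = (vzero :: ('x \<Rightarrow> 'a) \<Rightarrow> 'a)" by (rule vec_eqI) simp
  have "mcomb vzero p = comb (\<lambda>g. vzero (i, g)) j" by (simp only: p mcomb_def split)
  also have "\<dots> = \<zero>" unfolding e comb_zero by (rule vzero_nth)
  finally show "mcomb vzero p = vzero p" by simp
qed

lemma mcomb_outer:
  assumes "z \<in> vec X" "e \<in> vec gens" shows "mcomb (outer z e) = outer z (comb e)"
proof (rule vec_eqI)
  fix p :: "'x \<times> 'x"
  obtain i j where p: "p = (i, j)" by (cases p)
  have "(\<lambda>g. outer z e (i, g)) = z i *\<^sub>v e" by (rule vec_eqI) (simp add: outer_def)
  then show "mcomb (outer z e) p = outer z (comb e) p"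
    using comb_scale[OF vec_closed[OF assms(1), of i] assms(2)] by (simp add: p mcomb_def outer_def)
qed


end

section \<open>An endomorphism of the dual module\<close>

text \<open>Here \<open>tensor_sat\<close> says that \<open>N\<^sup>X/W\<close> has no \<open>a\<close>-torsion, and \<open>s\<close> is a socle element of \<open>R/aR\<close>.\<close>

locale burch_tensor = burch_presentation +
  fixes s :: 'a
  assumes tensor_sat: "\<And>\<mu>. \<mu> \<in> vec (X \<times> X) \<Longrightarrow> (\<And>i. (\<lambda>j. \<mu> (i, j)) \<in> N) \<Longrightarrow> a *\<^sub>v \<mu> \<in> W \<Longrightarrow> \<mu> \<in> W"
    and s: "s \<in> carrier R" "s \<notin> PIdl a" "icolon (PIdl a) s = \<mm>"
begin

lemma s_mult: assumes "c \<in> \<mm>" shows "\<exists>q\<in>carrier R. c \<otimes> s = a \<otimes> q"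
proof -
  have "c \<otimes> s \<in> PIdl a" using assms s(3) by (auto simp: icolon_def)
  then obtain q where "q \<in> carrier R" "c \<otimes> s = q \<otimes> a" by (auto simp: cgenideal_def)
  then show ?thesis using m_comm[OF ac] by (intro bexI[of _ q]) auto
qed

text \<open>Since \<open>s\<close> is killed by \<open>\<mm>\<close> modulo \<open>a\<close>, \<open>s l\<close> is a functional on \<open>M\<close> modulo \<open>a\<close>. It lifts to \<open>\<eta>\<close>.\<close>

lemma exists_eta: "\<exists>\<eta>\<in>N. \<exists>t\<in>vec X. \<eta> = s *\<^sub>v l +\<^sub>v a *\<^sub>v t"
proof -
  have "\<exists>g\<in>vec X. (\<forall>i. eqm a (g i) ((s *\<^sub>v l) i)) \<and> (\<forall>c\<in>Z. dot X c g = \<zero>)"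
  proof (rule lift_functional[where f = "s *\<^sub>v l", OF areg amm finX Zlin Zsat])
    fix z assume z: "z \<in> Z"
    obtain q where q: "q \<in> carrier R" "dot X z l \<otimes> s = a \<otimes> q" using s_mult[OF dot_Z_l[OF z]] by blast
    have "dot X z (s *\<^sub>v l) = q \<otimes> a"
      using dot_scale_right[OF finX s(1) lvec Zvec[OF z]] q m_comm[OF s(1), of "dot X z l"] m_comm[OF ac q(1)]
        Zvec[OF z] by simp
    then show "dot X z (s *\<^sub>v l) \<in> PIdl a" using q(1) unfolding cgenideal_def by blast
  qed (use s(1) in auto)
  then obtain g where g: "g \<in> vec X" "\<And>i. eqm a (g i) ((s *\<^sub>v l) i)" "\<And>c. c \<in> Z \<Longrightarrow> dot X c g = \<zero>" by blast
  have "\<exists>t\<in>vec X. g = s *\<^sub>v l +\<^sub>v a *\<^sub>v t"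
    by (rule eqm_vec[OF ac g(1)]) (use g(2) s(1) in auto)
  moreover have "g \<in> N" using g by (simp add: N_def)
  ultimately show ?thesis by blast
qed

definition \<eta> :: "'c \<Rightarrow> 'a" where "\<eta> = (SOME \<eta>. \<eta> \<in> N \<and> (\<exists>t\<in>vec X. \<eta> = s *\<^sub>v l +\<^sub>v a *\<^sub>v t))"

lemma eta: "\<eta> \<in> N" "\<exists>t\<in>vec X. \<eta> = s *\<^sub>v l +\<^sub>v a *\<^sub>v t"
proof -
  have "\<exists>\<eta>. \<eta> \<in> N \<and> (\<exists>t\<in>vec X. \<eta> = s *\<^sub>v l +\<^sub>v a *\<^sub>v t)" using exists_eta by blast
  from someI_ex[OF this] have "\<eta> \<in> N \<and> (\<exists>t\<in>vec X. \<eta> = s *\<^sub>v l +\<^sub>v a *\<^sub>v t)"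
    unfolding \<eta>_def .
  then show "\<eta> \<in> N" "\<exists>t\<in>vec X. \<eta> = s *\<^sub>v l +\<^sub>v a *\<^sub>v t" by auto
qed

lemma dot_Y_eta: "\<exists>q\<in>carrier R. dot X Y \<eta> = s \<oplus> a \<otimes> q"
proof -
  obtain t where t: "t \<in> vec X" "\<eta> = s *\<^sub>v l +\<^sub>v a *\<^sub>v t" using eta(2) by blast
  have "dot X Y \<eta> = s \<otimes> dot X Y l \<oplus> a \<otimes> dot X Y t"
    unfolding t(2) using s(1) t(1) Yvec finX by (simp add: dot_add_right dot_scale_right)
  then show ?thesis using dot_Y_l s(1) t(1) Yvec by auto
qed

text \<open>Otherwise \<open>s \<equiv> \<eta>(y) \<equiv> 0\<close> modulo \<open>a\<close>.\<close>

lemma eta_notin: "\<nu> \<in> N \<Longrightarrow> \<eta> \<noteq> a *\<^sub>v \<nu>"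
proof
  assume \<nu>: "\<nu> \<in> N" and e: "\<eta> = a *\<^sub>v \<nu>"
  obtain q where q: "q \<in> carrier R" "dot X Y \<eta> = s \<oplus> a \<otimes> q" using dot_Y_eta by blast
  have d: "dot X Y \<nu> \<in> carrier R" using Nvec[OF \<nu>] Yvec by simp
  have "s = (s \<oplus> a \<otimes> q) \<ominus> a \<otimes> q" using s(1) q(1) ac by algebra
  also have "\<dots> = a \<otimes> dot X Y \<nu> \<ominus> a \<otimes> q"
    using q(2) e dot_scale_right[OF finX ac Nvec[OF \<nu>] Yvec] by simp
  also have "\<dots> = (dot X Y \<nu> \<ominus> q) \<otimes> a" using d q(1) ac by algebra
  finally have "s \<in> PIdl a" using d q(1) unfolding cgenideal_def by blast
  then show False using s(2) by simp
qed

lemma eta_mm: assumes "c \<in> \<mm>" shows "\<exists>\<nu>\<in>N. c *\<^sub>v \<eta> = a *\<^sub>v \<nu>"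
proof -
  obtain t where t: "t \<in> vec X" "\<eta> = s *\<^sub>v l +\<^sub>v a *\<^sub>v t" using eta(2) by blast
  obtain q where q: "q \<in> carrier R" "c \<otimes> s = a \<otimes> q" using s_mult[OF assms] by blast
  have cc: "c \<in> carrier R" using mm_carrier[OF assms] .
  have v: "q *\<^sub>v l +\<^sub>v c *\<^sub>v t \<in> vec X" using q(1) cc t(1) by simp
  have eq: "c *\<^sub>v \<eta> = a *\<^sub>v (q *\<^sub>v l +\<^sub>v c *\<^sub>v t)"
  proof (rule vec_eqI)
    fix i
    have li: "l i \<in> carrier R" and ti: "t i \<in> carrier R" using t(1) vec_closed[OF lvec] by auto
    have "c \<otimes> (s \<otimes> l i \<oplus> a \<otimes> t i) = (c \<otimes> s) \<otimes> l i \<oplus> a \<otimes> (c \<otimes> t i)"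
      using li ti cc s(1) ac by algebra
    also have "\<dots> = a \<otimes> (q \<otimes> l i \<oplus> c \<otimes> t i)" unfolding q(2) using li ti cc q(1) ac by algebra
    finally show "(c *\<^sub>v \<eta>) i = (a *\<^sub>v (q *\<^sub>v l +\<^sub>v c *\<^sub>v t)) i" unfolding t(2) by simp
  qed
  have "a *\<^sub>v (q *\<^sub>v l +\<^sub>v c *\<^sub>v t) \<in> N" using linsubD(4)[OF Nlin cc eta(1)] eq by simp
  then show ?thesis using Nsat[OF v] eq by blast
qed

text \<open>All \<open>z i \<eta>\<close> are divisible by \<open>a\<close>, with quotients \<open>\<nu> i \<in> N\<close>. In the tensor product \<open>a\<close> times the family
  \<open>\<nu>\<close> is \<open>outer z \<eta> = 0\<close>, so \<open>\<nu>\<close> itself lies in \<open>W\<close>, and the members of families in \<open>W\<close> lie in \<open>U\<close>.\<close>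

lemma eta_coeff_U: assumes z: "z \<in> Z" shows "\<exists>w\<in>U. z i *\<^sub>v \<eta> = a *\<^sub>v w"
proof -
  have "\<forall>i. \<exists>\<nu>\<in>N. z i *\<^sub>v \<eta> = a *\<^sub>v \<nu>" using eta_mm[OF Zmin[OF z]] by blast
  then obtain \<nu> where \<nu>: "\<And>i. \<nu> i \<in> N" "\<And>i. z i *\<^sub>v \<eta> = a *\<^sub>v \<nu> i" by metis
  have off: "\<nu> i = vzero" if "i \<notin> X" for i
  proof (rule regular_vscale_cancel[OF areg Nvec[OF \<nu>(1)] vec_zero])
    have "z i *\<^sub>v \<eta> = vzero" using vec_off[OF Zvec[OF z] that] vscale_zero[OF Nvec[OF eta(1)]] by simp
    then show "a *\<^sub>v \<nu> i = a *\<^sub>v vzero" using \<nu>(2)[of i] vscale_vzero[OF ac] by metis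
  qed
  define \<mu> where "\<mu> = (\<lambda>(i, j). \<nu> i j)"
  have row: "(\<lambda>j. \<mu> (i, j)) = \<nu> i" for i by (simp add: \<mu>_def)
  have "\<mu> \<in> vec (X \<times> X)"
    unfolding vec_def
  proof (intro CollectI conjI allI impI)
    fix p :: "'c \<times> 'c"
    obtain i j where p: "p = (i, j)" by (cases p)
    show "\<mu> p \<in> carrier R" using Nvec[OF \<nu>(1), of i] by (simp add: p \<mu>_def)
    assume "p \<notin> X \<times> X"
    then consider "i \<notin> X" | "j \<notin> X" using p by auto
    then show "\<mu> p = \<zero>"
      by cases (use off vec_off[OF Nvec[OF \<nu>(1), of i]] in \<open>auto simp: p \<mu>_def\<close>)
  qed
  moreover have "a *\<^sub>v \<mu> = outer z \<eta>"
  proof (rule vec_eqI)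
    fix p :: "'c \<times> 'c"
    obtain i j where p: "p = (i, j)" by (cases p)
    show "(a *\<^sub>v \<mu>) p = outer z \<eta> p" using fun_cong[OF \<nu>(2)[of i], of j] by (simp add: p \<mu>_def outer_def)
  qed
  ultimately have "\<mu> \<in> W" using tensor_sat[of \<mu>] outer_in_W[OF z eta(1)] \<nu>(1) row by simp
  from W_row_U[OF this, of i] have "\<nu> i \<in> U" by (simp add: row)
  then show ?thesis using \<nu>(2) by blast
qed

lemma mcomb_functional:
  assumes c: "c \<in> vec (X \<times> gens)"
  shows "dot (X \<times> gens) c (\<lambda>(i, g). if g \<in> gens then l i \<otimes> dot X Y g else \<zero>)
    = dot X l (\<lambda>i. dot X Y (\<lambda>j. mcomb c (i, j)))"
proof -
  let ?f = "\<lambda>(i, g). if g \<in> gens then l i \<otimes> dot X Y g else \<zero>"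
  have lc: "l i \<in> carrier R" for i by (rule vec_closed[OF lvec])
  have Yc: "Y i \<in> carrier R" for i by (rule vec_closed[OF Yvec])
  have cc: "c p \<in> carrier R" for p by (rule vec_closed[OF c])
  have "dot X Y (\<lambda>j. mcomb c (i, j)) = (\<Oplus>g\<in>gens. c (i, g) \<otimes> dot X Y g)" for i
  proof -
    have "dot X Y (\<lambda>j. mcomb c (i, j)) = (\<Oplus>j\<in>X. \<Oplus>g\<in>gens. Y j \<otimes> (c (i, g) \<otimes> g j))"
      unfolding dot_def mcomb_def comb_def
      by (rule finsum_cong') (auto simp: Yc cc gens(1) intro!: finsum_rdistr)
    also have "\<dots> = (\<Oplus>g\<in>gens. \<Oplus>j\<in>X. Y j \<otimes> (c (i, g) \<otimes> g j))"
      by (rule finsum_swap[OF finX gens(1)]) (auto simp: Yc cc)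
    also have "\<dots> = (\<Oplus>g\<in>gens. c (i, g) \<otimes> dot X Y g)"
    proof (rule finsum_cong')
      fix g assume g: "g \<in> gens"
      have "c (i, g) \<otimes> dot X Y g = (\<Oplus>j\<in>X. c (i, g) \<otimes> (Y j \<otimes> g j))"
        unfolding dot_def by (rule finsum_rdistr[OF finX]) (auto simp: Yc cc g)
      also have "\<dots> = (\<Oplus>j\<in>X. Y j \<otimes> (c (i, g) \<otimes> g j))"
        by (rule finsum_cong') (auto simp: Yc cc g m_lcomm)
      finally show "(\<Oplus>j\<in>X. Y j \<otimes> (c (i, g) \<otimes> g j)) = c (i, g) \<otimes> dot X Y g" by simp
    qed (use Yc cc gens_vec Yvec in auto)
    finally show ?thesis .
  qed
  then have "dot X l (\<lambda>i. dot X Y (\<lambda>j. mcomb c (i, j))) = (\<Oplus>i\<in>X. l i \<otimes> (\<Oplus>g\<in>gens. c (i, g) \<otimes> dot X Y g))"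
    unfolding dot_def[of X l] by simp
  also have "\<dots> = (\<Oplus>i\<in>X. \<Oplus>g\<in>gens. l i \<otimes> (c (i, g) \<otimes> dot X Y g))"
    by (rule finsum_cong') (use gens_vec Yvec in \<open>auto simp: lc cc gens(1) intro!: finsum_rdistr\<close>)
  also have "\<dots> = (\<Oplus>i\<in>X. \<Oplus>g\<in>gens. c (i, g) \<otimes> ?f (i, g))"
    by (intro finsum_cong') (use gens_vec Yvec in \<open>auto simp: lc cc m_lcomm\<close>)
  also have "\<dots> = (\<Oplus>p\<in>X \<times> gens. c p \<otimes> ?f p)"
    by (rule finsum_product[symmetric, OF finX gens(1)]) (use gens_vec Yvec in \<open>auto simp: lc cc\<close>)
  finally show ?thesis unfolding dot_def[of "X \<times> gens"] by simp
qed

text \<open>\<open>x \<otimes> \<psi> \<mapsto> l(x) \<psi>(y)\<close> is well-defined modulo \<open>a\<close> on the tensor product, since \<open>l(z) \<in> \<mm>\<close> for a relation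
  \<open>z\<close> and \<open>\<mm> \<psi>(y)\<close> vanishes modulo \<open>a\<close>.\<close>

lemma W_functional: assumes "\<mu> \<in> W" shows "dot X l (\<lambda>i. dot X Y (\<lambda>j. \<mu> (i, j))) \<in> PIdl a"
proof -
  note P = cgenideal_ideal[OF ac]
  have "vspan {outer z \<psi> |z \<psi>. z \<in> Z \<and> \<psi> \<in> N} \<subseteq>
      {\<mu> \<in> vec (X \<times> X). dot X l (\<lambda>i. dot X Y (\<lambda>j. \<mu> (i, j))) \<in> PIdl a}"
  proof (rule vspan_subset[of "X \<times> X"])
    have rv: "(\<lambda>i. dot X Y (\<lambda>j. \<mu> (i, j))) \<in> vec X" if "\<mu> \<in> vec (X \<times> X)" for \<mu>
      unfolding vec_def
    proof (intro CollectI conjI allI impI)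
      fix i
      show "dot X Y (\<lambda>j. \<mu> (i, j)) \<in> carrier R" using vec_row[OF that] Yvec by simp
      assume "i \<notin> X"
      then have "(\<lambda>j. \<mu> (i, j)) = vzero" using vec_off[OF that] by (intro vec_eqI) simp
      then show "dot X Y (\<lambda>j. \<mu> (i, j)) = \<zero>" using Yvec by simp
    qed
    show "linsub (X \<times> X) {\<mu> \<in> vec (X \<times> X). dot X l (\<lambda>i. dot X Y (\<lambda>j. \<mu> (i, j))) \<in> PIdl a}"
      unfolding linsub_def
    proof (intro conjI ballI)
      have "(\<lambda>i. dot X Y (\<lambda>j. vzero (i, j))) = (vzero :: 'c \<Rightarrow> 'a)"
      proof (rule vec_eqI)
        fix i
        have "(\<lambda>j. vzero (i, j)) = (vzero :: 'c \<Rightarrow> 'a)" by (rule vec_eqI) simp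
        then show "dot X Y (\<lambda>j. vzero (i, j)) = vzero i" using Yvec by simp
      qed
      then show "vzero \<in> {\<mu> \<in> vec (X \<times> X). dot X l (\<lambda>i. dot X Y (\<lambda>j. \<mu> (i, j))) \<in> PIdl a}"
        using ideal_zero[OF P] by simp
      fix \<mu> assume "\<mu> \<in> {\<mu> \<in> vec (X \<times> X). dot X l (\<lambda>i. dot X Y (\<lambda>j. \<mu> (i, j))) \<in> PIdl a}"
      then have \<mu>: "\<mu> \<in> vec (X \<times> X)" "dot X l (\<lambda>i. dot X Y (\<lambda>j. \<mu> (i, j))) \<in> PIdl a" by auto
      show "\<mu> +\<^sub>v \<nu> \<in> {\<mu> \<in> vec (X \<times> X). dot X l (\<lambda>i. dot X Y (\<lambda>j. \<mu> (i, j))) \<in> PIdl a}"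
        if "\<nu> \<in> {\<mu> \<in> vec (X \<times> X). dot X l (\<lambda>i. dot X Y (\<lambda>j. \<mu> (i, j))) \<in> PIdl a}" for \<nu>
      proof -
        have \<nu>: "\<nu> \<in> vec (X \<times> X)" "dot X l (\<lambda>i. dot X Y (\<lambda>j. \<nu> (i, j))) \<in> PIdl a" using that by auto
        have "(\<lambda>i. dot X Y (\<lambda>j. (\<mu> +\<^sub>v \<nu>) (i, j)))
            = (\<lambda>i. dot X Y (\<lambda>j. \<mu> (i, j))) +\<^sub>v (\<lambda>i. dot X Y (\<lambda>j. \<nu> (i, j)))"
        proof (rule vec_eqI)
          fix i
          have "(\<lambda>j. (\<mu> +\<^sub>v \<nu>) (i, j)) = (\<lambda>j. \<mu> (i, j)) +\<^sub>v (\<lambda>j. \<nu> (i, j))" by (rule vec_eqI) simp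
          then show "dot X Y (\<lambda>j. (\<mu> +\<^sub>v \<nu>) (i, j))
              = ((\<lambda>i. dot X Y (\<lambda>j. \<mu> (i, j))) +\<^sub>v (\<lambda>i. dot X Y (\<lambda>j. \<nu> (i, j)))) i"
            using dot_add_right[OF vec_row[OF \<mu>(1), of i] vec_row[OF \<nu>(1), of i] Yvec] by simp
        qed
        then show ?thesis
          using dot_add_right[OF rv[OF \<mu>(1)] rv[OF \<nu>(1)] lvec] \<mu> \<nu> ideal_add[OF P] by simp
      qed
      show "r *\<^sub>v \<mu> \<in> {\<mu> \<in> vec (X \<times> X). dot X l (\<lambda>i. dot X Y (\<lambda>j. \<mu> (i, j))) \<in> PIdl a}"
        if r: "r \<in> carrier R" for r
      proof -
        have "(\<lambda>i. dot X Y (\<lambda>j. (r *\<^sub>v \<mu>) (i, j))) = r *\<^sub>v (\<lambda>i. dot X Y (\<lambda>j. \<mu> (i, j)))"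
        proof (rule vec_eqI)
          fix i
          have "(\<lambda>j. (r *\<^sub>v \<mu>) (i, j)) = r *\<^sub>v (\<lambda>j. \<mu> (i, j))" by (rule vec_eqI) simp
          then show "dot X Y (\<lambda>j. (r *\<^sub>v \<mu>) (i, j)) = (r *\<^sub>v (\<lambda>i. dot X Y (\<lambda>j. \<mu> (i, j)))) i"
            using dot_scale_right[OF finX r vec_row[OF \<mu>(1), of i] Yvec] by simp
        qed
        then show ?thesis
          using dot_scale_right[OF finX r rv[OF \<mu>(1)] lvec] \<mu> r ideal_mult[OF P] by simp
      qed
    qed auto
    show "{outer z \<psi> |z \<psi>. z \<in> Z \<and> \<psi> \<in> N}
        \<subseteq> {\<mu> \<in> vec (X \<times> X). dot X l (\<lambda>i. dot X Y (\<lambda>j. \<mu> (i, j))) \<in> PIdl a}"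
    proof
      fix \<mu> assume "\<mu> \<in> {outer z \<psi> |z \<psi>. z \<in> Z \<and> \<psi> \<in> N}"
      then obtain z \<psi> where z: "z \<in> Z" "\<psi> \<in> N" "\<mu> = outer z \<psi>" by auto
      have d: "dot X Y \<psi> \<in> carrier R" using Nvec[OF z(2)] Yvec by simp
      have "(\<lambda>i. dot X Y (\<lambda>j. outer z \<psi> (i, j))) = dot X Y \<psi> *\<^sub>v z"
      proof (rule vec_eqI)
        fix i
        have "(\<lambda>j. outer z \<psi> (i, j)) = z i *\<^sub>v \<psi>" by (rule vec_eqI) (simp add: outer_def)
        then show "dot X Y (\<lambda>j. outer z \<psi> (i, j)) = (dot X Y \<psi> *\<^sub>v z) i"
          using dot_scale_right[OF finX vec_closed[OF Zvec[OF z(1)]] Nvec[OF z(2)] Yvec, of i] d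
            vec_closed[OF Zvec[OF z(1)], of i] by (simp add: m_comm)
      qed
      then have "dot X l (\<lambda>i. dot X Y (\<lambda>j. \<mu> (i, j))) = dot X z l \<otimes> dot X Y \<psi>"
        using dot_scale_right[OF finX d Zvec[OF z(1)] lvec] dot_comm[OF lvec Zvec[OF z(1)]] d Zvec[OF z(1)] z(3)
        by (simp add: m_comm)
      then show "\<mu> \<in> {\<mu> \<in> vec (X \<times> X). dot X l (\<lambda>i. dot X Y (\<lambda>j. \<mu> (i, j))) \<in> PIdl a}"
        using dot_Y_socle[OF z(2) dot_Z_l[OF z(1)]] outer_vec[OF Zvec[OF z(1)] Nvec[OF z(2)]] z(3) by simp
    qed
  qed
  then show ?thesis using assms unfolding W_def by blast
qed

text \<open>The tensor product is the quotient of \<open>R\<^sup>X\<^sup>\<times>\<^sup>G\<close> by the coefficients of families in \<open>W\<close> and has no \<open>a\<close>-torsion,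
  so the functional of \<open>W_functional\<close> lifts.\<close>

lemma exists_lift:
  "\<exists>h\<in>vec (X \<times> gens). (\<forall>i. \<forall>g\<in>gens. eqm a (h (i, g)) (l i \<otimes> dot X Y g)) \<and>
     (\<forall>c\<in>vec (X \<times> gens). mcomb c \<in> W \<longrightarrow> dot (X \<times> gens) c h = \<zero>)"
proof -
  let ?f = "\<lambda>(i, g). if g \<in> gens then l i \<otimes> dot X Y g else \<zero>"
  let ?K = "{c \<in> vec (X \<times> gens). mcomb c \<in> W}"
  have f: "?f \<in> vec (X \<times> gens)"
    unfolding vec_def
  proof (intro CollectI conjI allI impI)
    fix p :: "'c \<times> ('c \<Rightarrow> 'a)"
    obtain i g where p: "p = (i, g)" by (cases p)
    show "?f p \<in> carrier R" using gens_vec Yvec vec_closed[OF lvec, of i] by (simp add: p)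
    assume "p \<notin> X \<times> gens"
    then show "?f p = \<zero>" using vec_off[OF lvec, of i] gens_vec Yvec by (auto simp: p)
  qed
  have "\<exists>h\<in>vec (X \<times> gens). (\<forall>p. eqm a (h p) (?f p)) \<and> (\<forall>c\<in>?K. dot (X \<times> gens) c h = \<zero>)"
  proof (rule lift_functional[OF areg amm _ _ _ f])
    show "finite (X \<times> gens)" using finX gens(1) by simp
    show "linsub (X \<times> gens) ?K"
      unfolding linsub_def using linsubD(2,3,4)[OF Wlin]
      by (auto simp: mcomb_add mcomb_scale mcomb_zero)
    show "c \<in> ?K" if c: "c \<in> vec (X \<times> gens)" "a *\<^sub>v c \<in> ?K" for c
    proof -
      have "a *\<^sub>v mcomb c \<in> W" using c mcomb_scale[OF ac c(1)] by simp
      moreover have "(\<lambda>j. mcomb c (i, j)) \<in> N" for i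
        unfolding mcomb_row by (rule comb_in_span[OF vec_row[OF c(1)]])
      ultimately show ?thesis using tensor_sat[OF mcomb_vec[OF c(1)]] c(1) by blast
    qed
    show "dot (X \<times> gens) c ?f \<in> PIdl a" if "c \<in> ?K" for c
      using that mcomb_functional[of c] W_functional[of "mcomb c"] by simp
  qed
  then obtain h where h: "h \<in> vec (X \<times> gens)" "\<And>p. eqm a (h p) (?f p)"
    "\<And>c. c \<in> ?K \<Longrightarrow> dot (X \<times> gens) c h = \<zero>" by blast
  have "eqm a (h (i, g)) (l i \<otimes> dot X Y g)" if "g \<in> gens" for i g using h(2)[of "(i, g)"] that by simp
  then show ?thesis using h(1,3) by blast
qed

definition h :: "'c \<times> ('c \<Rightarrow> 'a) \<Rightarrow> 'a" where
  "h = (SOME h. h \<in> vec (X \<times> gens) \<and> (\<forall>i. \<forall>g\<in>gens. eqm a (h (i, g)) (l i \<otimes> dot X Y g)) \<and>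
     (\<forall>c\<in>vec (X \<times> gens). mcomb c \<in> W \<longrightarrow> dot (X \<times> gens) c h = \<zero>))"

lemma h: "h \<in> vec (X \<times> gens)" "g \<in> gens \<Longrightarrow> eqm a (h (i, g)) (l i \<otimes> dot X Y g)"
  "c \<in> vec (X \<times> gens) \<Longrightarrow> mcomb c \<in> W \<Longrightarrow> dot (X \<times> gens) c h = \<zero>"
proof -
  have "\<exists>h. h \<in> vec (X \<times> gens) \<and> (\<forall>i. \<forall>g\<in>gens. eqm a (h (i, g)) (l i \<otimes> dot X Y g)) \<and>
     (\<forall>c\<in>vec (X \<times> gens). mcomb c \<in> W \<longrightarrow> dot (X \<times> gens) c h = \<zero>)"
    using exists_lift by blast
  from someI_ex[OF this] have "h \<in> vec (X \<times> gens) \<and>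
     (\<forall>i. \<forall>g\<in>gens. eqm a (h (i, g)) (l i \<otimes> dot X Y g)) \<and>
     (\<forall>c\<in>vec (X \<times> gens). mcomb c \<in> W \<longrightarrow> dot (X \<times> gens) c h = \<zero>)"
    unfolding h_def .
  then show "h \<in> vec (X \<times> gens)" "g \<in> gens \<Longrightarrow> eqm a (h (i, g)) (l i \<otimes> dot X Y g)"
    "c \<in> vec (X \<times> gens) \<Longrightarrow> mcomb c \<in> W \<Longrightarrow> dot (X \<times> gens) c h = \<zero>" by auto
qed

text \<open>The endomorphism that corresponds to \<open>h\<close> by adjunction, \<open>\<phi>(\<psi>)(x) = h(x \<otimes> \<psi>)\<close>, on coefficients. It takes
  values in \<open>N\<close> because \<open>h\<close> vanishes on \<open>z \<otimes> \<psi>\<close>, and is independent of the coefficients because \<open>h\<close>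
  vanishes on the coefficients of the zero family.\<close>

definition \<Phi> :: "(('c \<Rightarrow> 'a) \<Rightarrow> 'a) \<Rightarrow> 'c \<Rightarrow> 'a" where
  "\<Phi> e = (\<lambda>i. dot gens e (\<lambda>g. h (i, g)))"

lemma Phi_vec: assumes "e \<in> vec gens" shows "\<Phi> e \<in> vec X"
  unfolding vec_def
proof (intro CollectI conjI allI impI)
  fix i
  show "\<Phi> e i \<in> carrier R" using assms vec_row[OF h(1), of i] by (simp add: \<Phi>_def)
  assume "i \<notin> X"
  then have "(\<lambda>g. h (i, g)) = vzero" using vec_off[OF h(1)] by (intro vec_eqI) simp
  then show "\<Phi> e i = \<zero>" using assms by (simp add: \<Phi>_def)
qed

lemma Phi_add: "e \<in> vec gens \<Longrightarrow> e' \<in> vec gens \<Longrightarrow> \<Phi> (e +\<^sub>v e') = \<Phi> e +\<^sub>v \<Phi> e'"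
  by (rule vec_eqI) (simp add: \<Phi>_def dot_add_left vec_row[OF h(1)])

lemma Phi_scale: "r \<in> carrier R \<Longrightarrow> e \<in> vec gens \<Longrightarrow> \<Phi> (r *\<^sub>v e) = r *\<^sub>v \<Phi> e"
  by (rule vec_eqI) (simp add: \<Phi>_def dot_scale_left vec_row[OF h(1)] gens(1))

lemma outer_dot_h:
  assumes "z \<in> vec X" "e \<in> vec gens"
  shows "dot (X \<times> gens) (outer z e) h = dot X z (\<Phi> e)"
proof -
  have "dot gens (\<lambda>g. outer z e (i, g)) (\<lambda>g. h (i, g)) = z i \<otimes> \<Phi> e i" for i
  proof -
    have "(\<lambda>g. outer z e (i, g)) = z i *\<^sub>v e" by (rule vec_eqI) (simp add: outer_def)
    then show ?thesis
      using dot_scale_left[OF gens(1) vec_closed[OF assms(1), of i] assms(2) vec_row[OF h(1), of i]] by (simp add: \<Phi>_def)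
  qed
  then show ?thesis
    using dot_product_index[OF finX gens(1) outer_vec[OF assms] h(1)] by (simp add: dot_def)
qed

lemma Phi_N: assumes "e \<in> vec gens" shows "\<Phi> e \<in> N"
  unfolding N_def
proof (intro CollectI conjI ballI)
  show "\<Phi> e \<in> vec X" by (rule Phi_vec[OF assms])
  fix z assume z: "z \<in> Z"
  have "mcomb (outer z e) \<in> W"
    using mcomb_outer[OF Zvec[OF z] assms] outer_in_W[OF z comb_in_span[OF assms]] by simp
  then show "dot X z (\<Phi> e) = \<zero>"
    using h(3)[OF outer_vec[OF Zvec[OF z] assms]] outer_dot_h[OF Zvec[OF z] assms] by simp
qed

lemma Phi_kernel: assumes e: "e \<in> vec gens" "comb e = vzero" shows "\<Phi> e = vzero"
proof (rule vec_eqI'[OF Phi_vec[OF e(1)] vec_zero])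
  fix i assume i: "i \<in> X"
  have "outer (unitv i) (vzero :: 'c \<Rightarrow> 'a) = vzero"
    by (rule vec_eqI) (auto simp: outer_def unitv_def split: prod.splits)
  then have "mcomb (outer (unitv i) e) \<in> W"
    using mcomb_outer[OF vec_unitv[OF i] e(1)] e(2) linsubD(2)[OF Wlin] by simp
  then have "dot X (unitv i) (\<Phi> e) = \<zero>"
    using h(3)[OF outer_vec[OF vec_unitv[OF i] e(1)]] outer_dot_h[OF vec_unitv[OF i] e(1)] by simp
  then show "\<Phi> e i = vzero i" using dot_unitv[OF finX i Phi_vec[OF e(1)]] by simp
qed

lemma Phi_cong: assumes "e \<in> vec gens" "e' \<in> vec gens" "comb e = comb e'" shows "\<Phi> e = \<Phi> e'"
proof -
  have v: "comb e' \<in> vec X" using Nvec[OF comb_in_span[OF assms(2)]] .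
  have m: "\<ominus> \<one> *\<^sub>v e' \<in> vec gens" using assms(2) by simp
  have "comb (e -\<^sub>v e') = vzero"
    using comb_add[OF assms(1) m] comb_scale[OF _ assms(2), of "\<ominus> \<one>"] assms(3) vec_closed[OF v]
    by (intro vec_eqI) (simp add: l_minus r_neg)
  then have "\<Phi> (e -\<^sub>v e') = vzero" using assms(1) m by (intro Phi_kernel) auto
  then have z: "\<Phi> e -\<^sub>v \<Phi> e' = vzero"
    using Phi_add[OF assms(1) m] Phi_scale[OF _ assms(2), of "\<ominus> \<one>"] by simp
  have "\<Phi> e = (\<Phi> e -\<^sub>v \<Phi> e') +\<^sub>v \<Phi> e'"
    using vdiff_add[OF Phi_vec[OF assms(1)] Phi_vec[OF assms(2)]] by simp
  also have "\<dots> = \<Phi> e'" unfolding z using vec_closed[OF Phi_vec[OF assms(2)]] by (intro vec_eqI) simp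
  finally show ?thesis .
qed

definition \<phi> :: "('c \<Rightarrow> 'a) \<Rightarrow> 'c \<Rightarrow> 'a" where
  "\<phi> \<psi> = \<Phi> (SOME e. e \<in> vec gens \<and> \<psi> = comb e)"

lemma phi_comb: assumes "e \<in> vec gens" shows "\<phi> (comb e) = \<Phi> e"
proof -
  have "(SOME e'. e' \<in> vec gens \<and> comb e = comb e') \<in> vec gens \<and>
      comb e = comb (SOME e'. e' \<in> vec gens \<and> comb e = comb e')"
    by (rule someI[of _ e]) (use assms in simp)
  then show ?thesis unfolding \<phi>_def using Phi_cong[OF assms] by metis
qed

lemma phi_N: "\<psi> \<in> N \<Longrightarrow> \<phi> \<psi> \<in> N"
  using comb_surj[of \<psi>] phi_comb Phi_N by auto

lemma phi_add: assumes "\<psi> \<in> N" "\<psi>' \<in> N" shows "\<phi> (\<psi> +\<^sub>v \<psi>') = \<phi> \<psi> +\<^sub>v \<phi> \<psi>'"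
proof -
  obtain e where e: "e \<in> vec gens" "\<psi> = comb e" using comb_surj[OF assms(1)] by blast
  obtain e' where e': "e' \<in> vec gens" "\<psi>' = comb e'" using comb_surj[OF assms(2)] by blast
  have "\<phi> (comb (e +\<^sub>v e')) = \<Phi> (e +\<^sub>v e')" by (rule phi_comb) (use e e' in simp)
  then show ?thesis using comb_add[OF e(1) e'(1)] Phi_add[OF e(1) e'(1)] phi_comb[OF e(1)] phi_comb[OF e'(1)] e(2) e'(2) by simp
qed

lemma phi_scale: assumes "r \<in> carrier R" "\<psi> \<in> N" shows "\<phi> (r *\<^sub>v \<psi>) = r *\<^sub>v \<phi> \<psi>"
proof -
  obtain e where e: "e \<in> vec gens" "\<psi> = comb e" using comb_surj[OF assms(2)] by blast
  have "\<phi> (comb (r *\<^sub>v e)) = \<Phi> (r *\<^sub>v e)" by (rule phi_comb) (use e assms in simp)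
  then show ?thesis using comb_scale[OF assms(1) e(1)] Phi_scale[OF assms(1) e(1)] phi_comb[OF e(1)] e(2) by simp
qed

lemma phi_mod: assumes \<psi>: "\<psi> \<in> N" shows "\<exists>t\<in>vec X. \<phi> \<psi> = dot X Y \<psi> *\<^sub>v l +\<^sub>v a *\<^sub>v t"
proof -
  obtain e where e: "e \<in> vec gens" "\<psi> = comb e" using comb_surj[OF \<psi>] by blast
  define f where "f = (\<lambda>g. if g \<in> gens then dot X Y g else \<zero>)"
  have f: "f \<in> vec gens" unfolding f_def vec_def using gens_vec Yvec by simp
  have "dot X Y \<psi> = dot gens e f"
  proof -
    have ec: "e g \<in> carrier R" for g by (rule vec_closed[OF e(1)])
    have Yc: "Y i \<in> carrier R" for i by (rule vec_closed[OF Yvec])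
    have "dot X Y \<psi> = (\<Oplus>j\<in>X. \<Oplus>g\<in>gens. Y j \<otimes> (e g \<otimes> g j))"
      unfolding dot_def e(2) comb_def
      by (rule finsum_cong') (auto simp: Yc ec gens(1) intro!: finsum_rdistr)
    also have "\<dots> = (\<Oplus>g\<in>gens. \<Oplus>j\<in>X. Y j \<otimes> (e g \<otimes> g j))"
      by (rule finsum_swap[OF finX gens(1)]) (auto simp: Yc ec)
    also have "\<dots> = (\<Oplus>g\<in>gens. e g \<otimes> f g)"
    proof (rule finsum_cong')
      fix g assume g: "g \<in> gens"
      have "e g \<otimes> dot X Y g = (\<Oplus>j\<in>X. e g \<otimes> (Y j \<otimes> g j))"
        unfolding dot_def by (rule finsum_rdistr[OF finX]) (auto simp: Yc ec g)
      also have "\<dots> = (\<Oplus>j\<in>X. Y j \<otimes> (e g \<otimes> g j))"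
        by (rule finsum_cong') (auto simp: Yc ec g m_lcomm)
      finally show "(\<Oplus>j\<in>X. Y j \<otimes> (e g \<otimes> g j)) = e g \<otimes> f g" using g by (simp add: f_def)
    qed (use ec vec_closed[OF f] in auto)
    finally show ?thesis by (simp add: dot_def)
  qed
  moreover have "eqm a (\<Phi> e i) (l i \<otimes> dot gens e f)" for i
  proof -
    have li: "l i \<in> carrier R" by (rule vec_closed[OF lvec])
    have "\<exists>t\<in>vec gens. (\<lambda>g. h (i, g)) = l i *\<^sub>v f +\<^sub>v a *\<^sub>v t"
      by (rule eqm_vec[OF ac vec_row[OF h(1)]]) (use li f h(2) in \<open>auto simp: f_def\<close>)
    then obtain t where t: "t \<in> vec gens" "(\<lambda>g. h (i, g)) = l i *\<^sub>v f +\<^sub>v a *\<^sub>v t" by blast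
    have "\<Phi> e i = l i \<otimes> dot gens e f \<oplus> a \<otimes> dot gens e t"
      unfolding \<Phi>_def t(2) using t(1) f e(1) li gens(1) by (simp add: dot_add_right dot_scale_right)
    then show ?thesis using t(1) e(1) by (intro eqmI[of "dot gens e t"]) auto
  qed
  ultimately have "\<exists>t\<in>vec X. \<Phi> e = dot X Y \<psi> *\<^sub>v l +\<^sub>v a *\<^sub>v t"
    using Phi_vec[OF e(1)] Nvec[OF \<psi>] Yvec vec_closed[OF lvec] e(1) f
    by (intro eqm_vec) (auto simp: m_comm)
  then show ?thesis using phi_comb[OF e(1)] e(2) by simp
qed

lemma phi_eta: "\<exists>\<nu>\<in>N. \<phi> \<eta> = \<eta> +\<^sub>v a *\<^sub>v \<nu>"
proof -
  obtain t where t: "t \<in> vec X" "\<eta> = s *\<^sub>v l +\<^sub>v a *\<^sub>v t" using eta(2) by blast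
  obtain u where u: "u \<in> vec X" "\<phi> \<eta> = dot X Y \<eta> *\<^sub>v l +\<^sub>v a *\<^sub>v u" using phi_mod[OF eta(1)] by blast
  obtain q where q: "q \<in> carrier R" "dot X Y \<eta> = s \<oplus> a \<otimes> q" using dot_Y_eta by blast
  \<comment> \<open>\<open>\<phi> \<eta>\<close> and \<open>\<eta>\<close> are both \<open>s l\<close> modulo \<open>a\<close>; this is their difference divided by \<open>a\<close>.\<close>
  let ?\<nu> = "q *\<^sub>v l +\<^sub>v u -\<^sub>v t"
  have v: "?\<nu> \<in> vec X" using q(1) u(1) t(1) by simp
  have eq: "\<phi> \<eta> = \<eta> +\<^sub>v a *\<^sub>v ?\<nu>"
  proof (rule vec_eqI)
    fix i
    have c: "l i \<in> carrier R" "t i \<in> carrier R" "u i \<in> carrier R" using t(1) u(1) vec_closed[OF lvec] by auto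
    have "(s \<oplus> a \<otimes> q) \<otimes> l i \<oplus> a \<otimes> u i
        = s \<otimes> l i \<oplus> a \<otimes> t i \<oplus> a \<otimes> (q \<otimes> l i \<oplus> u i \<oplus> \<ominus> \<one> \<otimes> t i)"
      using c q(1) s(1) ac by algebra
    moreover have "\<phi> \<eta> i = (s \<oplus> a \<otimes> q) \<otimes> l i \<oplus> a \<otimes> u i"
      by (simp only: u(2) q(2) vadd_nth vscale_nth)
    moreover have "\<eta> i = s \<otimes> l i \<oplus> a \<otimes> t i" by (simp only: t(2) vadd_nth vscale_nth)
    ultimately show "(\<phi> \<eta>) i = (\<eta> +\<^sub>v a *\<^sub>v ?\<nu>) i" by (simp only: vadd_nth vscale_nth)
  qed
  have "a *\<^sub>v ?\<nu> = \<phi> \<eta> -\<^sub>v \<eta>"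
  proof (rule vec_eqI)
    fix i
    have "?\<nu> i \<in> carrier R" "\<eta> i \<in> carrier R" using vec_closed[OF v] vec_closed[OF Nvec[OF eta(1)]] by auto
    then have "a \<otimes> ?\<nu> i = (\<eta> i \<oplus> a \<otimes> ?\<nu> i) \<oplus> \<ominus> \<one> \<otimes> \<eta> i" using ac by algebra
    then show "(a *\<^sub>v ?\<nu>) i = (\<phi> \<eta> -\<^sub>v \<eta>) i" using eq by (metis vadd_nth vscale_nth)
  qed
  then have "a *\<^sub>v ?\<nu> \<in> N" using linsubD(5)[OF Nlin phi_N[OF eta(1)] eta(1)] by simp
  then show ?thesis using Nsat[OF v] eq by blast
qed

text \<open>\<open>\<phi> \<psi> \<equiv> \<psi>(y) l\<close> modulo \<open>a\<close>, and \<open>\<psi>(y)\<close> is a multiple of \<open>s\<close> because the socle is generated by \<open>s\<close>.\<close>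

lemma phi_decomp: assumes \<psi>: "\<psi> \<in> N" shows "\<exists>\<rho>\<in>carrier R. \<exists>\<nu>\<in>N. \<phi> \<psi> = \<rho> *\<^sub>v \<eta> +\<^sub>v a *\<^sub>v \<nu>"
proof -
  obtain t where t: "t \<in> vec X" "\<eta> = s *\<^sub>v l +\<^sub>v a *\<^sub>v t" using eta(2) by blast
  obtain u where u: "u \<in> vec X" "\<phi> \<psi> = dot X Y \<psi> *\<^sub>v l +\<^sub>v a *\<^sub>v u" using phi_mod[OF \<psi>] by blast
  have "dot X Y \<psi> \<in> carrier R" using Nvec[OF \<psi>] Yvec by simp
  then obtain \<rho> where \<rho>: "\<rho> \<in> carrier R" "eqm a (dot X Y \<psi>) (s \<otimes> \<rho>)"
    using socle_one_dimensional[OF areg amm s(1,3)] dot_Y_socle[OF \<psi>] by blast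
  from \<rho>(2) obtain q where q: "q \<in> carrier R" "dot X Y \<psi> = s \<otimes> \<rho> \<oplus> a \<otimes> q" by (rule eqmE)
  let ?\<nu> = "q *\<^sub>v l +\<^sub>v u -\<^sub>v \<rho> *\<^sub>v t"
  have v: "?\<nu> \<in> vec X" using q(1) u(1) t(1) \<rho>(1) by simp
  have eq: "\<phi> \<psi> = \<rho> *\<^sub>v \<eta> +\<^sub>v a *\<^sub>v ?\<nu>"
  proof (rule vec_eqI)
    fix i
    have c: "l i \<in> carrier R" "t i \<in> carrier R" "u i \<in> carrier R" using t(1) u(1) vec_closed[OF lvec] by auto
    have "(s \<otimes> \<rho> \<oplus> a \<otimes> q) \<otimes> l i \<oplus> a \<otimes> u i
        = \<rho> \<otimes> (s \<otimes> l i \<oplus> a \<otimes> t i) \<oplus> a \<otimes> (q \<otimes> l i \<oplus> u i \<oplus> \<ominus> \<one> \<otimes> (\<rho> \<otimes> t i))"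
      using c q(1) s(1) ac \<rho>(1) by algebra
    then show "(\<phi> \<psi>) i = (\<rho> *\<^sub>v \<eta> +\<^sub>v a *\<^sub>v ?\<nu>) i" unfolding u(2) q(2) t(2) by simp
  qed
  have r\<eta>: "\<rho> *\<^sub>v \<eta> \<in> N" using linsubD(4)[OF Nlin \<rho>(1) eta(1)] .
  have "a *\<^sub>v ?\<nu> = \<phi> \<psi> -\<^sub>v \<rho> *\<^sub>v \<eta>"
  proof (rule vec_eqI)
    fix i
    have "?\<nu> i \<in> carrier R" "(\<rho> *\<^sub>v \<eta>) i \<in> carrier R" using vec_closed[OF v] vec_closed[OF Nvec[OF r\<eta>]] by auto
    then have "a \<otimes> ?\<nu> i = ((\<rho> *\<^sub>v \<eta>) i \<oplus> a \<otimes> ?\<nu> i) \<oplus> \<ominus> \<one> \<otimes> (\<rho> *\<^sub>v \<eta>) i" using ac by algebra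
    then show "(a *\<^sub>v ?\<nu>) i = (\<phi> \<psi> -\<^sub>v \<rho> *\<^sub>v \<eta>) i" using eq by (metis vadd_nth vscale_nth)
  qed
  then have "a *\<^sub>v ?\<nu> \<in> N" using linsubD(5)[OF Nlin phi_N[OF \<psi>] r\<eta>] by simp
  then show ?thesis using Nsat[OF v] eq \<rho>(1) by blast
qed

text \<open>\<open>\<phi>(z\<^sub>i \<nu>) = z\<^sub>i (\<rho> \<eta> + a \<nu>')\<close>, and \<open>z\<^sub>i \<eta> \<in> aU\<close>.\<close>

lemma phi_U: assumes "u \<in> U" shows "\<exists>w\<in>U. \<phi> u = a *\<^sub>v w"
  using assms unfolding U_def
proof (induction rule: vspan_induct)
  case zero
  have z: "\<zero> *\<^sub>v vzero = (vzero :: 'c \<Rightarrow> 'a)" by (rule vscale_zero[OF vec_zero])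
  have "\<phi> vzero = \<zero> *\<^sub>v \<phi> vzero"
    using phi_scale[OF zero_closed linsubD(2)[OF Nlin]] by (simp only: z)
  then have "\<phi> vzero = a *\<^sub>v vzero"
    using vscale_zero[OF Nvec[OF phi_N[OF linsubD(2)[OF Nlin]]]] vscale_vzero[OF ac] by metis
  then show ?case using vspan_zero by blast
next
  case (base v)
  then obtain z i \<nu> where v: "z \<in> Z" "\<nu> \<in> N" "v = z i *\<^sub>v \<nu>" by auto
  have zi: "z i \<in> carrier R" using linsub_closed[OF Zlin v(1)] .
  obtain \<rho> \<nu>' where p: "\<rho> \<in> carrier R" "\<nu>' \<in> N" "\<phi> \<nu> = \<rho> *\<^sub>v \<eta> +\<^sub>v a *\<^sub>v \<nu>'" using phi_decomp[OF v(2)] by blast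
  obtain w where w: "w \<in> U" "z i *\<^sub>v \<eta> = a *\<^sub>v w" using eta_coeff_U[OF v(1)] by blast
  note \<eta>v = Nvec[OF eta(1)] and \<nu>v = Nvec[OF p(2)] and wv = linsubD(1)[OF Ulin w(1)]
  have "\<phi> v = z i *\<^sub>v (\<rho> *\<^sub>v \<eta> +\<^sub>v a *\<^sub>v \<nu>')" using phi_scale[OF zi v(2)] v(3) p(3) by simp
  also have "\<dots> = \<rho> *\<^sub>v (z i *\<^sub>v \<eta>) +\<^sub>v a *\<^sub>v (z i *\<^sub>v \<nu>')"
    using vscale_add[OF zi vec_scale[OF p(1) \<eta>v] vec_scale[OF ac \<nu>v]] vscale_commute[OF zi p(1) \<eta>v]
      vscale_commute[OF zi ac \<nu>v] by simp
  also have "\<dots> = a *\<^sub>v (\<rho> *\<^sub>v w +\<^sub>v z i *\<^sub>v \<nu>')"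
    using w(2) vscale_commute[OF p(1) ac wv] vscale_add[OF ac vec_scale[OF p(1) wv] vec_scale[OF zi \<nu>v]] by simp
  finally have "\<phi> v = a *\<^sub>v (\<rho> *\<^sub>v w +\<^sub>v z i *\<^sub>v \<nu>')" .
  moreover have "\<rho> *\<^sub>v w +\<^sub>v z i *\<^sub>v \<nu>' \<in> U"
    by (intro linsubD(3)[OF Ulin] linsubD(4)[OF Ulin] p(1) w(1) scale_in_U v(1) p(2))
  ultimately show ?case unfolding U_def by blast
next
  case (add u v)
  obtain w w' where w: "w \<in> U" "\<phi> u = a *\<^sub>v w" "w' \<in> U" "\<phi> v = a *\<^sub>v w'"
    using add.IH unfolding U_def by blast
  have uv: "u \<in> N" "v \<in> N" using add.hyps U_subset_N unfolding U_def by auto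
  have "\<phi> (u +\<^sub>v v) = a *\<^sub>v (w +\<^sub>v w')"
    using phi_add[OF uv] w vscale_add[OF ac linsubD(1)[OF Ulin w(1)] linsubD(1)[OF Ulin w(3)]] by simp
  then have "\<exists>w\<in>U. \<phi> (u +\<^sub>v v) = a *\<^sub>v w" using linsubD(3)[OF Ulin w(1,3)] by blast
  then show ?case unfolding U_def .
next
  case (scale r u)
  obtain w where w: "w \<in> U" "\<phi> u = a *\<^sub>v w" using scale.IH unfolding U_def by blast
  have u: "u \<in> N" using scale.hyps U_subset_N unfolding U_def by auto
  have "\<phi> (r *\<^sub>v u) = a *\<^sub>v (r *\<^sub>v w)"
    using phi_scale[OF scale.hyps(1) u] w vscale_commute[OF ac scale.hyps(1) linsubD(1)[OF Ulin w(1)]] by simp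
  then have "\<exists>w\<in>U. \<phi> (r *\<^sub>v u) = a *\<^sub>v w" using linsubD(4)[OF Ulin scale.hyps(1) w(1)] by blast
  then show ?case unfolding U_def .
qed

lemma phi_pow_N: "\<psi> \<in> N \<Longrightarrow> (\<phi> ^^ k) \<psi> \<in> N"
  by (induction k) (auto intro: phi_N)

lemma phi_pow_scale: "r \<in> carrier R \<Longrightarrow> \<psi> \<in> N \<Longrightarrow> (\<phi> ^^ k) (r *\<^sub>v \<psi>) = r *\<^sub>v (\<phi> ^^ k) \<psi>"
  by (induction k) (auto simp: phi_scale phi_pow_N)

lemma phi_pow_eta: "\<exists>\<nu>\<in>N. (\<phi> ^^ k) \<eta> = \<eta> +\<^sub>v a *\<^sub>v \<nu>"
proof (induction k)
  case 0
  have "\<eta> = \<eta> +\<^sub>v a *\<^sub>v vzero" using vec_closed[OF Nvec[OF eta(1)]] by (intro vec_eqI) simp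
  then have "(\<phi> ^^ 0) \<eta> = \<eta> +\<^sub>v a *\<^sub>v vzero" by (simp only: funpow_0)
  then show ?case using linsubD(2)[OF Nlin] by (rule bexI)
next
  case (Suc k)
  then obtain \<nu> where \<nu>: "\<nu> \<in> N" "(\<phi> ^^ k) \<eta> = \<eta> +\<^sub>v a *\<^sub>v \<nu>" by blast
  obtain \<nu>' where \<nu>': "\<nu>' \<in> N" "\<phi> \<eta> = \<eta> +\<^sub>v a *\<^sub>v \<nu>'" using phi_eta by blast
  note p\<nu> = phi_N[OF \<nu>(1)]
  have "(\<phi> ^^ Suc k) \<eta> = \<phi> \<eta> +\<^sub>v a *\<^sub>v \<phi> \<nu>"
    using \<nu> phi_add[OF eta(1) linsubD(4)[OF Nlin ac \<nu>(1)]] phi_scale[OF ac \<nu>(1)] by simp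
  also have "\<dots> = \<eta> +\<^sub>v a *\<^sub>v (\<nu>' +\<^sub>v \<phi> \<nu>)"
    unfolding \<nu>'(2) using vadd_assoc[OF Nvec[OF eta(1)] vec_scale[OF ac Nvec[OF \<nu>'(1)]] vec_scale[OF ac Nvec[OF p\<nu>]]]
      vscale_add[OF ac Nvec[OF \<nu>'(1)] Nvec[OF p\<nu>]] by simp
  finally show ?case using linsubD(3)[OF Nlin \<nu>'(1) p\<nu>] by blast
qed

lemma phi_pow_U: "u \<in> U \<Longrightarrow> \<exists>w\<in>U. (\<phi> ^^ k) u = (a [^] k) *\<^sub>v w"
proof (induction k)
  case 0
  have "u = \<one> *\<^sub>v u" using linsub_closed[OF Ulin 0] by (intro vec_eqI) simp
  then show ?case using 0 by (metis funpow_0 nat_pow_0)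
next
  case (Suc k)
  then obtain w where w: "w \<in> U" "(\<phi> ^^ k) u = (a [^] k) *\<^sub>v w" by blast
  obtain w' where w': "w' \<in> U" "\<phi> w = a *\<^sub>v w'" using phi_U[OF w(1)] by blast
  have "(\<phi> ^^ Suc k) u = (a [^] k) *\<^sub>v (a *\<^sub>v w')"
    using w phi_scale[of "a [^] k" w] U_subset_N w'(2) by auto
  also have "\<dots> = (a [^] Suc k) *\<^sub>v w'" using vscale_assoc[of "a [^] k" a w' X] linsubD(1)[OF Ulin w'(1)] by simp
  finally show ?case using w'(1) by blast
qed

text \<open>Apply \<open>\<phi>\<close> to \<open>a\<^sup>k \<eta> \<in> U\<close> once more than there are factors \<open>a\<close>: each application produces a factor
  \<open>a\<close> but fixes \<open>\<eta>\<close> modulo \<open>a\<close>.\<close>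

lemma no_power: assumes "\<And>\<nu>. \<nu> \<in> N \<Longrightarrow> (a [^] (k :: nat)) *\<^sub>v \<nu> \<in> U" shows False
proof -
  have akc: "a [^] k \<in> carrier R" by simp
  obtain w where w: "w \<in> U" "(\<phi> ^^ Suc k) ((a [^] k) *\<^sub>v \<eta>) = (a [^] Suc k) *\<^sub>v w"
    using phi_pow_U[OF assms[OF eta(1)], of "Suc k"] by blast
  have wN: "w \<in> N" using w(1) U_subset_N by blast
  have "(a [^] k) *\<^sub>v (\<phi> ^^ Suc k) \<eta> = (a [^] k) *\<^sub>v (a *\<^sub>v w)"
    using w(2) phi_pow_scale[OF akc eta(1), of "Suc k"] vscale_assoc[OF akc ac Nvec[OF wN]] by simp
  then have e: "(\<phi> ^^ Suc k) \<eta> = a *\<^sub>v w"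
    by (intro regular_vscale_cancel[OF regular_power[OF areg] Nvec[OF phi_pow_N[OF eta(1)]] vec_scale[OF ac Nvec[OF wN]]])
  obtain \<nu> where \<nu>: "\<nu> \<in> N" "(\<phi> ^^ Suc k) \<eta> = \<eta> +\<^sub>v a *\<^sub>v \<nu>" using phi_pow_eta[of "Suc k"] by blast
  have "\<eta> = a *\<^sub>v (w -\<^sub>v \<nu>)"
  proof (rule vec_eqI)
    fix i
    have c: "\<eta> i \<in> carrier R" "w i \<in> carrier R" "\<nu> i \<in> carrier R"
      using vec_closed[OF Nvec[OF eta(1)]] vec_closed[OF Nvec[OF wN]] vec_closed[OF Nvec[OF \<nu>(1)]] by auto
    have e': "\<eta> i \<oplus> a \<otimes> \<nu> i = a \<otimes> w i" using e \<nu>(2) by (metis vadd_nth vscale_nth)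
    have "\<eta> i = (\<eta> i \<oplus> a \<otimes> \<nu> i) \<ominus> a \<otimes> \<nu> i" using c ac by algebra
    also have "\<dots> = a \<otimes> (w i \<oplus> \<ominus> \<one> \<otimes> \<nu> i)" unfolding e' using c ac by algebra
    finally show "\<eta> i = (a *\<^sub>v (w -\<^sub>v \<nu>)) i" by simp
  qed
  then show False using eta_notin[OF linsubD(5)[OF Nlin wN \<nu>(1)]] by simp
qed

text \<open>No power of \<open>a\<close> lies in the ideal of all \<open>r\<close> with \<open>rN \<subseteq> U\<close>, which contains the entries of the relations;
  so some prime contains this ideal but not \<open>a\<close>.\<close>

theorem relations_in_minimal_prime: "\<exists>p. primeideal p R \<and> p \<noteq> \<mm> \<and> (\<forall>z\<in>Z. \<forall>i. z i \<in> p)"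
proof -
  define J where "J = {r \<in> carrier R. \<forall>\<nu>\<in>N. r *\<^sub>v \<nu> \<in> U}"
  have J: "ideal J R"
  proof (rule ideal_intro)
    show "J \<subseteq> carrier R" by (auto simp: J_def)
    have "\<zero> *\<^sub>v \<nu> \<in> U" if "\<nu> \<in> N" for \<nu>
      using vscale_zero[OF Nvec[OF that]] linsubD(2)[OF Ulin] by simp
    then show "\<zero> \<in> J" by (simp add: J_def)
    fix x assume x: "x \<in> J"
    show "x \<oplus> y \<in> J" if y: "y \<in> J" for y
    proof -
      have "(x \<oplus> y) *\<^sub>v \<nu> \<in> U" if \<nu>: "\<nu> \<in> N" for \<nu>
      proof -
        have "(x \<oplus> y) *\<^sub>v \<nu> = x *\<^sub>v \<nu> +\<^sub>v y *\<^sub>v \<nu>"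
          using x y vec_closed[OF Nvec[OF \<nu>]] by (intro vec_eqI) (simp add: J_def l_distr)
        then show ?thesis using linsubD(3)[OF Ulin] x y \<nu> by (simp add: J_def)
      qed
      then show ?thesis using x y by (simp add: J_def)
    qed
    show "r \<otimes> x \<in> J" if r: "r \<in> carrier R" for r
    proof -
      have "(r \<otimes> x) *\<^sub>v \<nu> \<in> U" if \<nu>: "\<nu> \<in> N" for \<nu>
        using vscale_assoc[OF r, of x \<nu> X] x Nvec[OF \<nu>] linsubD(4)[OF Ulin r, of "x *\<^sub>v \<nu>"] \<nu> by (simp add: J_def)
      then show ?thesis using x r by (simp add: J_def)
    qed
  qed
  have "a [^] k \<notin> J" for k :: nat using no_power[of k] by (auto simp: J_def)
  then obtain p where p: "primeideal p R" "J \<subseteq> p" "a \<notin> p" using prime_avoiding_powers[OF J ac] by blast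
  have "z i \<in> J" if "z \<in> Z" for z i
    using scale_in_U[OF that] linsub_closed[OF Zlin that] by (simp add: J_def)
  then show ?thesis using p amm by blast
qed

end

section \<open>Free modules and spans\<close>

lemma mod_span_minimal: "submodule H R M \<Longrightarrow> A \<subseteq> H \<Longrightarrow> mod_span R M A \<subseteq> H"
  unfolding mod_span_def by blast

lemma mod_span_superset: "A \<subseteq> mod_span R M A"
  unfolding mod_span_def by blast

context module
begin

lemma submod_add: "submodule H R M \<Longrightarrow> x \<in> H \<Longrightarrow> y \<in> H \<Longrightarrow> x \<oplus>\<^bsub>M\<^esub> y \<in> H"
  by (rule submoduleE(5))

lemma submod_smult: "submodule H R M \<Longrightarrow> r \<in> carrier R \<Longrightarrow> x \<in> H \<Longrightarrow> r \<odot>\<^bsub>M\<^esub> x \<in> H"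
  by (rule submoduleE(4))

lemma submod_zero: "submodule H R M \<Longrightarrow> \<zero>\<^bsub>M\<^esub> \<in> H"
  using submoduleE(1,2)[of H] submod_smult[of H \<zero>] by (metis all_not_in_conv smult_l_null subsetD R.zero_closed)

lemma submod_minus: "submodule H R M \<Longrightarrow> x \<in> H \<Longrightarrow> y \<in> H \<Longrightarrow> x \<ominus>\<^bsub>M\<^esub> y \<in> H"
  unfolding a_minus_def by (intro submod_add submoduleE(3))

lemma submod_carrier: "submodule H R M \<Longrightarrow> x \<in> H \<Longrightarrow> x \<in> carrier M"
  using submoduleE(1) by blast

lemma submod_finsum:
  assumes H: "submodule H R M" and "finite S" "\<And>x. x \<in> S \<Longrightarrow> f x \<in> H"
  shows "(\<Oplus>\<^bsub>M\<^esub>x\<in>S. f x) \<in> H"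
  using assms(2,3)
proof (induction S)
  case empty then show ?case using submod_zero[OF H] by simp
next
  case (insert x S)
  have "f \<in> S \<rightarrow> carrier M" "f x \<in> carrier M" using insert.prems submod_carrier[OF H] by auto
  then show ?case using insert submod_add[OF H] by simp
qed

end

lemma mod_span_submodule:
  fixes R :: "'a ring" and M :: "('a, 'b) module"
  assumes "module R M" "A \<subseteq> carrier M" shows "submodule (mod_span R M A) R M"
proof -
  interpret module R M by fact
  show ?thesis
  proof (rule submoduleI)
  show "mod_span R M A \<subseteq> carrier M" by (rule mod_span_minimal[OF carrier_is_submodule assms(2)])
  show "\<zero>\<^bsub>M\<^esub> \<in> mod_span R M A" unfolding mod_span_def using submod_zero by blast
  show "\<ominus>\<^bsub>M\<^esub> x \<in> mod_span R M A" if "x \<in> mod_span R M A" for x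
    using that submoduleE(3) unfolding mod_span_def by blast
  show "x \<oplus>\<^bsub>M\<^esub> y \<in> mod_span R M A" if "x \<in> mod_span R M A" "y \<in> mod_span R M A" for x y
    using that submod_add unfolding mod_span_def by blast
  show "r \<odot>\<^bsub>M\<^esub> x \<in> mod_span R M A" if "r \<in> carrier R" "x \<in> mod_span R M A" for r x
    using that submod_smult unfolding mod_span_def by blast
  qed
qed

lemma lin_mapsD:
  assumes "f \<in> lin_maps R M N"
  shows "x \<in> carrier M \<Longrightarrow> f x \<in> carrier N"
    "x \<in> carrier M \<Longrightarrow> y \<in> carrier M \<Longrightarrow> f (x \<oplus>\<^bsub>M\<^esub> y) = f x \<oplus>\<^bsub>N\<^esub> f y"
    "r \<in> carrier R \<Longrightarrow> x \<in> carrier M \<Longrightarrow> f (r \<odot>\<^bsub>M\<^esub> x) = r \<odot>\<^bsub>N\<^esub> f x"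
  using assms by (auto simp: lin_maps_def PiE_def Pi_def)

context noeth_local
begin

text \<open>Names for facts on the ring that stay accessible where a module has facts of the same names.\<close>

lemmas R_zero_closed = zero_closed and R_one_closed = one_closed and R_finsum_insert = finsum_insert
  and R_finsum_cong' = finsum_cong' and R_finsum_addf = finsum_addf and R_finsum_closed = finsum_closed
  and R_m_assoc = m_assoc and R_m_lcomm = m_lcomm and R_l_minus = l_minus and R_r_neg = r_neg
  and R_m_closed = m_closed and R_m_comm = m_comm and R_a_comm = a_comm and R_l_distr = l_distr
  and R_mono_neutral = add.finprod_mono_neutral_cong_left

lemma vdiff_vadd:
  assumes "u \<in> vec X" "u' \<in> vec X" "v \<in> vec X" "v' \<in> vec X"
  shows "(u -\<^sub>v u') +\<^sub>v (v -\<^sub>v v') = (u +\<^sub>v v) -\<^sub>v (u' +\<^sub>v v')"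
proof (rule vec_eqI)
  fix i
  have "u i \<in> carrier R" "u' i \<in> carrier R" "v i \<in> carrier R" "v' i \<in> carrier R" using assms by auto
  then show "((u -\<^sub>v u') +\<^sub>v (v -\<^sub>v v')) i = ((u +\<^sub>v v) -\<^sub>v (u' +\<^sub>v v')) i" by simp algebra
qed

lemma vdiff_vdiff:
  assumes "u \<in> vec X" "v \<in> vec X"
  shows "u -\<^sub>v (u -\<^sub>v v) = v"
proof (rule vec_eqI)
  fix i
  have "u i \<in> carrier R" "v i \<in> carrier R" using assms by auto
  then show "(u -\<^sub>v (u -\<^sub>v v)) i = v i" by simp algebra
qed

lemma linsub_diffD':
  assumes "u -\<^sub>v v \<in> vec X" "v \<in> vec X" "\<And>i. u i \<in> carrier R" shows "u \<in> vec X"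
  unfolding vec_def
proof (intro CollectI conjI allI impI)
  fix i
  show "u i \<in> carrier R" by (rule assms(3))
  assume "i \<notin> X"
  then show "u i = \<zero>" using vec_off[OF assms(1), of i] vec_off[OF assms(2), of i] assms(3)[of i] by simp
qed

lemma free_carrier: "u \<in> carrier (free_module R P) \<longleftrightarrow>
    u \<in> P \<rightarrow>\<^sub>E carrier R \<and> finite {p \<in> P. u p \<noteq> \<zero>}"
  by (simp add: free_module_def)

lemma free_closed: "u \<in> carrier (free_module R P) \<Longrightarrow> p \<in> P \<Longrightarrow> u p \<in> carrier R"
  by (auto simp: free_carrier)

lemma free_ops:
  "\<zero>\<^bsub>free_module R P\<^esub> = (\<lambda>x\<in>P. \<zero>)"
  "u \<oplus>\<^bsub>free_module R P\<^esub> v = (\<lambda>x\<in>P. u x \<oplus> v x)"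
  "r \<odot>\<^bsub>free_module R P\<^esub> u = (\<lambda>x\<in>P. r \<otimes> u x)"
  by (simp_all add: free_module_def)

lemma free_eqI: "u \<in> carrier (free_module R P) \<Longrightarrow> v \<in> carrier (free_module R P) \<Longrightarrow>
    (\<And>p. p \<in> P \<Longrightarrow> u p = v p) \<Longrightarrow> u = v"
  unfolding free_carrier by (auto intro: PiE_ext)

lemma free_add_closed:
  assumes "u \<in> carrier (free_module R P)" "v \<in> carrier (free_module R P)"
  shows "u \<oplus>\<^bsub>free_module R P\<^esub> v \<in> carrier (free_module R P)"
proof -
  have "finite ({p \<in> P. u p \<noteq> \<zero>} \<union> {p \<in> P. v p \<noteq> \<zero>})" using assms by (simp add: free_carrier)
  moreover have "{p \<in> P. (\<lambda>x\<in>P. u x \<oplus> v x) p \<noteq> \<zero>} \<subseteq> {p \<in> P. u p \<noteq> \<zero>} \<union> {p \<in> P. v p \<noteq> \<zero>}" by auto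
  ultimately have "finite {p \<in> P. (\<lambda>x\<in>P. u x \<oplus> v x) p \<noteq> \<zero>}" by (rule rev_finite_subset)
  then show ?thesis using assms unfolding free_carrier free_ops by (auto simp: PiE_def Pi_def)
qed

lemma free_smult_closed:
  assumes "r \<in> carrier R" "u \<in> carrier (free_module R P)"
  shows "r \<odot>\<^bsub>free_module R P\<^esub> u \<in> carrier (free_module R P)"
proof -
  have "finite {p \<in> P. u p \<noteq> \<zero>}" using assms by (simp add: free_carrier)
  moreover have "{p \<in> P. (\<lambda>x\<in>P. r \<otimes> u x) p \<noteq> \<zero>} \<subseteq> {p \<in> P. u p \<noteq> \<zero>}" using assms(1) by auto
  ultimately have "finite {p \<in> P. (\<lambda>x\<in>P. r \<otimes> u x) p \<noteq> \<zero>}" by (rule rev_finite_subset)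
  then show ?thesis using assms unfolding free_carrier free_ops by (auto simp: PiE_def Pi_def)
qed

lemma free_zero_closed: "\<zero>\<^bsub>free_module R P\<^esub> \<in> carrier (free_module R P)"
  unfolding free_carrier free_ops by auto

lemma free_module_module: "module R (free_module R P)"
proof (rule moduleI)
  show "cring R" by (rule is_cring)
  show "abelian_group (free_module R P)"
  proof (rule abelian_groupI)
    fix u v w assume uvw: "u \<in> carrier (free_module R P)" "v \<in> carrier (free_module R P)" "w \<in> carrier (free_module R P)"
    note c = free_closed[OF uvw(1)] free_closed[OF uvw(2)] free_closed[OF uvw(3)]
    show "u \<oplus>\<^bsub>free_module R P\<^esub> v \<oplus>\<^bsub>free_module R P\<^esub> w = u \<oplus>\<^bsub>free_module R P\<^esub> (v \<oplus>\<^bsub>free_module R P\<^esub> w)"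
      by (rule free_eqI[OF free_add_closed[OF free_add_closed[OF uvw(1,2)] uvw(3)]
            free_add_closed[OF uvw(1) free_add_closed[OF uvw(2,3)]]])
        (use c in \<open>simp add: free_ops a_assoc\<close>)
    show "u \<oplus>\<^bsub>free_module R P\<^esub> v = v \<oplus>\<^bsub>free_module R P\<^esub> u"
      using c by (auto simp: free_ops a_comm)
  next
    fix u v assume uv: "u \<in> carrier (free_module R P)" "v \<in> carrier (free_module R P)"
    show "u \<oplus>\<^bsub>free_module R P\<^esub> v \<in> carrier (free_module R P)" by (rule free_add_closed[OF uv])
  next
    show "\<zero>\<^bsub>free_module R P\<^esub> \<in> carrier (free_module R P)" by (rule free_zero_closed)
  next
    fix u assume u: "u \<in> carrier (free_module R P)"
    note c = free_closed[OF u]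
    show "\<zero>\<^bsub>free_module R P\<^esub> \<oplus>\<^bsub>free_module R P\<^esub> u = u"
      by (rule free_eqI[OF free_add_closed[OF free_zero_closed u] u]) (use c in \<open>simp add: free_ops\<close>)
    show "\<exists>v\<in>carrier (free_module R P). v \<oplus>\<^bsub>free_module R P\<^esub> u = \<zero>\<^bsub>free_module R P\<^esub>"
    proof (rule bexI)
      have m: "\<ominus> \<one> \<odot>\<^bsub>free_module R P\<^esub> u \<in> carrier (free_module R P)" by (rule free_smult_closed[OF _ u]) simp
      show "\<ominus> \<one> \<odot>\<^bsub>free_module R P\<^esub> u \<oplus>\<^bsub>free_module R P\<^esub> u = \<zero>\<^bsub>free_module R P\<^esub>"
        by (rule free_eqI[OF free_add_closed[OF m u] free_zero_closed]) (use c in \<open>simp add: free_ops l_minus l_neg\<close>)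
      show "\<ominus> \<one> \<odot>\<^bsub>free_module R P\<^esub> u \<in> carrier (free_module R P)" by (rule m)
    qed
  qed
next
  fix r s u v assume r: "r \<in> carrier R" "s \<in> carrier R" and uv: "u \<in> carrier (free_module R P)" "v \<in> carrier (free_module R P)"
  note c = free_closed[OF uv(1)] free_closed[OF uv(2)]
  show "(r \<oplus> s) \<odot>\<^bsub>free_module R P\<^esub> u = r \<odot>\<^bsub>free_module R P\<^esub> u \<oplus>\<^bsub>free_module R P\<^esub> s \<odot>\<^bsub>free_module R P\<^esub> u"
    using r c by (auto simp: free_ops l_distr)
  show "r \<odot>\<^bsub>free_module R P\<^esub> (u \<oplus>\<^bsub>free_module R P\<^esub> v) = r \<odot>\<^bsub>free_module R P\<^esub> u \<oplus>\<^bsub>free_module R P\<^esub> r \<odot>\<^bsub>free_module R P\<^esub> v"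
    using r c by (auto simp: free_ops r_distr)
  show "r \<otimes> s \<odot>\<^bsub>free_module R P\<^esub> u = r \<odot>\<^bsub>free_module R P\<^esub> (s \<odot>\<^bsub>free_module R P\<^esub> u)"
    using r c by (auto simp: free_ops m_assoc)
next
  fix r u assume r: "r \<in> carrier R" and u: "u \<in> carrier (free_module R P)"
  show "r \<odot>\<^bsub>free_module R P\<^esub> u \<in> carrier (free_module R P)" by (rule free_smult_closed[OF r u])
next
  fix u assume u: "u \<in> carrier (free_module R P)"
  show "\<one> \<odot>\<^bsub>free_module R P\<^esub> u = u"
    by (rule free_eqI[OF free_smult_closed[OF one_closed u] u]) (use free_closed[OF u] in \<open>simp add: free_ops\<close>)
qed

end

section \<open>Minimal generators and relations\<close>

locale min_gens = noeth_local R + Mod?: module R M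
  for R :: "'a ring" (structure) and M :: "('a, 'b) module" +
  fixes A :: "'b set"
  assumes finA: "finite A" and Acar: "A \<subseteq> carrier M" and Agen: "mod_span R M A = carrier M"
    and Amin: "\<And>B. finite B \<Longrightarrow> B \<subseteq> carrier M \<Longrightarrow> mod_span R M B = carrier M \<Longrightarrow> card A \<le> card B"
begin

definition lc :: "('b \<Rightarrow> 'a) \<Rightarrow> 'b" where
  "lc c = (\<Oplus>\<^bsub>M\<^esub>x\<in>A. c x \<odot>\<^bsub>M\<^esub> x)"

lemma Ac [simp]: "x \<in> A \<Longrightarrow> x \<in> carrier M" using Acar by blast

lemma lc_closed [simp]: "c \<in> vec A \<Longrightarrow> lc c \<in> carrier M"
  unfolding lc_def by (rule M.finsum_closed) auto

lemma lc_add: assumes "c \<in> vec A" "c' \<in> vec A" shows "lc (c +\<^sub>v c') = lc c \<oplus>\<^bsub>M\<^esub> lc c'"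
proof -
  have "lc (c +\<^sub>v c') = (\<Oplus>\<^bsub>M\<^esub>x\<in>A. c x \<odot>\<^bsub>M\<^esub> x \<oplus>\<^bsub>M\<^esub> c' x \<odot>\<^bsub>M\<^esub> x)"
    unfolding lc_def by (rule M.finsum_cong') (use assms in \<open>auto simp: smult_l_distr\<close>)
  also have "\<dots> = lc c \<oplus>\<^bsub>M\<^esub> lc c'"
    unfolding lc_def by (rule M.finsum_addf) (use assms in auto)
  finally show ?thesis .
qed

lemma lc_scale: "r \<in> carrier R \<Longrightarrow> c \<in> vec A \<Longrightarrow> lc (r *\<^sub>v c) = r \<odot>\<^bsub>M\<^esub> lc c"
  unfolding lc_def by (subst finsum_smult_ldistr) (auto simp: finA smult_assoc1 intro!: M.finsum_cong')

lemma lc_zero [simp]: "lc vzero = \<zero>\<^bsub>M\<^esub>"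
proof -
  have "lc vzero = (\<Oplus>\<^bsub>M\<^esub>x\<in>A. \<zero>\<^bsub>M\<^esub>)" unfolding lc_def by (rule M.finsum_cong') auto
  then show ?thesis by simp
qed

lemma lc_unitv: assumes "x \<in> A" shows "lc (unitv x) = x"
proof -
  have "lc (unitv x) = (\<Oplus>\<^bsub>M\<^esub>y\<in>A. if x = y then y else \<zero>\<^bsub>M\<^esub>)"
    unfolding lc_def unitv_def by (rule M.finsum_cong') auto
  also have "\<dots> = x" by (rule M.finsum_singleton) (use assms finA in auto)
  finally show ?thesis .
qed

lemma lc_surj: assumes "x \<in> carrier M" shows "\<exists>c\<in>vec A. x = lc c"
proof -
  have "submodule (lc ` vec A) R M"
  proof (rule submoduleI)
    show "lc ` vec A \<subseteq> carrier M" by auto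
    show "\<zero>\<^bsub>M\<^esub> \<in> lc ` vec A" by (rule image_eqI[of _ _ vzero]) auto
    show "\<ominus>\<^bsub>M\<^esub> x \<in> lc ` vec A" if x: "x \<in> lc ` vec A" for x
    proof -
      obtain c where c: "c \<in> vec A" "x = lc c" using x by blast
      have "\<ominus>\<^bsub>M\<^esub> x = lc (\<ominus> \<one> *\<^sub>v c)" using lc_scale[OF _ c(1), of "\<ominus> \<one>"] c by (simp add: smult_l_minus)
      then show ?thesis using c(1) by simp
    qed
    show "x \<oplus>\<^bsub>M\<^esub> y \<in> lc ` vec A" if xy: "x \<in> lc ` vec A" "y \<in> lc ` vec A" for x y
    proof -
      obtain c c' where c: "c \<in> vec A" "x = lc c" "c' \<in> vec A" "y = lc c'" using xy by blast
      have "x \<oplus>\<^bsub>M\<^esub> y = lc (c +\<^sub>v c')" using lc_add c by simp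
      then show ?thesis using c(1,3) by simp
    qed
    show "r \<odot>\<^bsub>M\<^esub> x \<in> lc ` vec A" if r: "r \<in> carrier R" and x: "x \<in> lc ` vec A" for r x
    proof -
      obtain c where c: "c \<in> vec A" "x = lc c" using x by blast
      have "r \<odot>\<^bsub>M\<^esub> x = lc (r *\<^sub>v c)" using lc_scale r c by simp
      then show ?thesis using c(1) r by simp
    qed
  qed
  moreover have "A \<subseteq> lc ` vec A"
    using lc_unitv vec_unitv by (metis image_eqI subsetI)
  ultimately have "carrier M \<subseteq> lc ` vec A" using mod_span_minimal Agen by blast
  then show ?thesis using assms by blast
qed

definition coef :: "'b \<Rightarrow> 'b \<Rightarrow> 'a" where
  "coef x = (SOME c. c \<in> vec A \<and> x = lc c)"

lemma coef: assumes "x \<in> carrier M" shows "coef x \<in> vec A" "lc (coef x) = x"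
proof -
  have "\<exists>c. c \<in> vec A \<and> x = lc c" using lc_surj[OF assms] by blast
  from someI_ex[OF this] show "coef x \<in> vec A" "lc (coef x) = x" unfolding coef_def by auto
qed

definition Z :: "('b \<Rightarrow> 'a) set" where "Z = {c \<in> vec A. lc c = \<zero>\<^bsub>M\<^esub>}"

lemma Z_linsub: "linsub A Z"
  unfolding linsub_def Z_def by (auto simp: lc_add lc_scale)

lemma Z_diff: assumes "c \<in> vec A" "c' \<in> vec A" "lc c = lc c'" shows "c -\<^sub>v c' \<in> Z"
  using assms lc_add[of c "\<ominus> \<one> *\<^sub>v c'"] lc_scale[of "\<ominus> \<one>" c'] lc_closed[OF assms(2)]
  by (simp add: Z_def smult_l_minus M.r_neg)

text \<open>A relation with a unit coefficient would make a generator redundant.\<close>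

lemma Z_mm: assumes z: "z \<in> Z" shows "z x \<in> \<mm>"
proof (rule ccontr)
  assume n: "z x \<notin> \<mm>"
  have zv: "z \<in> vec A" "lc z = \<zero>\<^bsub>M\<^esub>" using z by (auto simp: Z_def)
  have xA: "x \<in> A"
  proof (rule ccontr)
    assume "x \<notin> A"
    then show False using vec_off[OF zv(1)] n ideal_zero[OF mm_ideal] by simp
  qed
  have u: "z x \<in> Units R" using unit_iff[of "z x"] n zv by simp
  have sub: "A - {x} \<subseteq> carrier M" by auto
  have H: "submodule (mod_span R M (A - {x})) R M" by (rule mod_span_submodule[OF module_axioms sub])
  let ?r = "\<Oplus>\<^bsub>M\<^esub>y\<in>A - {x}. z y \<odot>\<^bsub>M\<^esub> y"
  have r: "?r \<in> mod_span R M (A - {x})"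
    by (rule submod_finsum[OF H]) (use finA zv mod_span_superset[of "A - {x}" R M] in \<open>auto intro!: submod_smult[OF H]\<close>)
  have rc: "?r \<in> carrier M" using submod_carrier[OF H r] .
  have "lc z = z x \<odot>\<^bsub>M\<^esub> x \<oplus>\<^bsub>M\<^esub> ?r"
  proof -
    have "lc z = (\<Oplus>\<^bsub>M\<^esub>y\<in>insert x (A - {x}). z y \<odot>\<^bsub>M\<^esub> y)" unfolding lc_def using xA by (simp add: insert_absorb)
    also have "\<dots> = z x \<odot>\<^bsub>M\<^esub> x \<oplus>\<^bsub>M\<^esub> ?r" by (rule M.finsum_insert) (use finA zv xA in auto)
    finally show ?thesis .
  qed
  then have "z x \<odot>\<^bsub>M\<^esub> x = \<ominus>\<^bsub>M\<^esub> ?r" using zv rc xA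
    by (metis Ac M.minus_equality smult_closed vec_closed)
  then have "inv (z x) \<odot>\<^bsub>M\<^esub> (z x \<odot>\<^bsub>M\<^esub> x) = inv (z x) \<odot>\<^bsub>M\<^esub> (\<ominus>\<^bsub>M\<^esub> ?r)" by simp
  then have "x = inv (z x) \<odot>\<^bsub>M\<^esub> (\<ominus>\<^bsub>M\<^esub> ?r)" using u zv xA by (simp add: smult_assoc1[symmetric])
  then have "x \<in> mod_span R M (A - {x})" using submod_smult[OF H _ submoduleE(3)[OF H r], of "inv (z x)"] u by simp
  then have "A \<subseteq> mod_span R M (A - {x})" using mod_span_superset[of "A - {x}" R M] by blast
  then have "mod_span R M (A - {x}) = carrier M"
    using mod_span_minimal[OF H] Agen submoduleE(1)[OF H] by blast
  then have "card A \<le> card (A - {x})" using Amin[OF _ sub] finA by simp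
  moreover have "card (A - {x}) < card A" using finA xA by (rule card_Diff1_less)
  ultimately show False by simp
qed

lemma Z_saturated:
  assumes "torsion_free R M" "regular a" "c \<in> vec A" "a *\<^sub>v c \<in> Z" shows "c \<in> Z"
proof -
  have "a \<odot>\<^bsub>M\<^esub> lc c = \<zero>\<^bsub>M\<^esub>" using assms(3,4) lc_scale[OF regular_carrier[OF assms(2)]] by (simp add: Z_def)
  then have "lc c = \<zero>\<^bsub>M\<^esub>"
    using assms(1,2) lc_closed[OF assms(3)] unfolding torsion_free_def regular_def by blast
  then show ?thesis using assms(3) by (simp add: Z_def)
qed

section \<open>The dual module\<close>

abbreviation D :: "('a, 'b \<Rightarrow> 'a) module" where "D \<equiv> dual_module R M"

text \<open>The dual module in coordinates: a functional \<open>f\<close> on \<open>M\<close> corresponds to its vector of values on the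
  generators.\<close>

definition NN :: "('b \<Rightarrow> 'a) set" where "NN = {\<psi> \<in> vec A. \<forall>z\<in>Z. dot A z \<psi> = \<zero>}"

lemma D_simps:
  "carrier D = lin_maps R M (self_module R)"
  "f \<oplus>\<^bsub>D\<^esub> g = (\<lambda>x\<in>carrier M. f x \<oplus> g x)"
  "r \<odot>\<^bsub>D\<^esub> f = (\<lambda>x\<in>carrier M. r \<otimes> f x)"
  by (simp_all add: dual_module_def Hom_module_def self_module_def)

lemma NNvec: "\<psi> \<in> NN \<Longrightarrow> \<psi> \<in> vec A" by (simp add: NN_def)

lemma NN_cong: assumes "\<psi> \<in> NN" "c \<in> vec A" "c' \<in> vec A" "lc c = lc c'" shows "dot A c \<psi> = dot A c' \<psi>"
proof -
  have "dot A (c -\<^sub>v c') \<psi> = \<zero>" using Z_diff[OF assms(2-4)] assms(1) by (simp add: NN_def)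
  moreover have "dot A (c -\<^sub>v c') \<psi> = dot A c \<psi> \<ominus> dot A c' \<psi>"
    using assms(2,3) NNvec[OF assms(1)] finA by (simp add: dot_add_left dot_scale_left a_minus_def l_minus)
  ultimately show ?thesis using assms(2,3) NNvec[OF assms(1)] by simp
qed

definition fn :: "('b \<Rightarrow> 'a) \<Rightarrow> 'b \<Rightarrow> 'a" where
  "fn \<psi> = (\<lambda>x\<in>carrier M. dot A (coef x) \<psi>)"

lemma fn_lc: "\<psi> \<in> NN \<Longrightarrow> c \<in> vec A \<Longrightarrow> fn \<psi> (lc c) = dot A c \<psi>"
  unfolding fn_def using NN_cong[of \<psi> "coef (lc c)" c] coef[of "lc c"] by simp

lemma fn_D: assumes \<psi>: "\<psi> \<in> NN" shows "fn \<psi> \<in> carrier D"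
  unfolding D_simps lin_maps_def
proof (intro CollectI conjI ballI)
  show "fn \<psi> \<in> carrier M \<rightarrow>\<^sub>E carrier (self_module R)"
    unfolding fn_def self_module_def using coef NNvec[OF \<psi>] by auto
  fix x assume x: "x \<in> carrier M"
  show "fn \<psi> (x \<oplus>\<^bsub>M\<^esub> y) = fn \<psi> x \<oplus>\<^bsub>self_module R\<^esub> fn \<psi> y" if y: "y \<in> carrier M" for y
  proof -
    have "fn \<psi> (lc (coef x +\<^sub>v coef y)) = dot A (coef x) \<psi> \<oplus> dot A (coef y) \<psi>"
      using fn_lc[OF \<psi>] coef x y NNvec[OF \<psi>] by (simp add: dot_add_left)
    then show ?thesis using lc_add coef x y by (simp add: fn_def self_module_def)
  qed
  show "fn \<psi> (r \<odot>\<^bsub>M\<^esub> x) = r \<odot>\<^bsub>self_module R\<^esub> fn \<psi> x" if r: "r \<in> carrier R" for r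
  proof -
    have "fn \<psi> (lc (r *\<^sub>v coef x)) = r \<otimes> dot A (coef x) \<psi>"
      using fn_lc[OF \<psi>] coef x r NNvec[OF \<psi>] finA by (simp add: dot_scale_left)
    then show ?thesis using lc_scale coef x r by (simp add: fn_def self_module_def)
  qed
qed

lemma fn_add: "\<psi> \<in> NN \<Longrightarrow> \<psi>' \<in> NN \<Longrightarrow> fn (\<psi> +\<^sub>v \<psi>') = fn \<psi> \<oplus>\<^bsub>D\<^esub> fn \<psi>'"
  unfolding fn_def D_simps by (rule restrict_ext) (simp add: coef NNvec dot_add_right)

lemma fn_scale: "r \<in> carrier R \<Longrightarrow> \<psi> \<in> NN \<Longrightarrow> fn (r *\<^sub>v \<psi>) = r \<odot>\<^bsub>D\<^esub> fn \<psi>"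
  unfolding fn_def D_simps by (rule restrict_ext) (simp add: coef NNvec dot_scale_right finA)

definition vecof :: "('b \<Rightarrow> 'a) \<Rightarrow> 'b \<Rightarrow> 'a" where
  "vecof f = (\<lambda>i. if i \<in> A then f i else \<zero>)"

lemma D_closed: "f \<in> carrier D \<Longrightarrow> x \<in> carrier M \<Longrightarrow> f x \<in> carrier R"
  unfolding D_simps using lin_mapsD(1)[of f R M "self_module R" x] by (simp add: self_module_def)

lemma D_add: "f \<in> carrier D \<Longrightarrow> x \<in> carrier M \<Longrightarrow> y \<in> carrier M \<Longrightarrow> f (x \<oplus>\<^bsub>M\<^esub> y) = f x \<oplus> f y"
  unfolding D_simps using lin_mapsD(2)[of f R M "self_module R" x y] by (simp add: self_module_def)

lemma D_smult: "f \<in> carrier D \<Longrightarrow> r \<in> carrier R \<Longrightarrow> x \<in> carrier M \<Longrightarrow> f (r \<odot>\<^bsub>M\<^esub> x) = r \<otimes> f x"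
  unfolding D_simps using lin_mapsD(3)[of f R M "self_module R" r x] by (simp add: self_module_def)

lemma vecof_vec: "f \<in> carrier D \<Longrightarrow> vecof f \<in> vec A"
  unfolding vec_def vecof_def using D_closed by simp

lemma D_zero: assumes "f \<in> carrier D" shows "f \<zero>\<^bsub>M\<^esub> = \<zero>"
  using D_smult[OF assms R_zero_closed M.zero_closed] D_closed[OF assms M.zero_closed] by simp

lemma D_lc: assumes f: "f \<in> carrier D" and c: "c \<in> vec A" shows "f (lc c) = dot A c (vecof f)"
proof -
  have cc: "c x \<in> carrier R" for x by (rule vec_closed[OF c])
  have "f (\<Oplus>\<^bsub>M\<^esub>x\<in>S. c x \<odot>\<^bsub>M\<^esub> x) = (\<Oplus>x\<in>S. c x \<otimes> vecof f x)" if "finite S" "S \<subseteq> A" for S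
    using that
  proof (induction S)
    case empty then show ?case by (simp add: D_zero[OF f])
  next
    case (insert x S)
    have sc: "(\<Oplus>\<^bsub>M\<^esub>x\<in>S. c x \<odot>\<^bsub>M\<^esub> x) \<in> carrier M" by (rule M.finsum_closed) (use insert cc in auto)
    have "(\<Oplus>\<^bsub>M\<^esub>x\<in>insert x S. c x \<odot>\<^bsub>M\<^esub> x) = c x \<odot>\<^bsub>M\<^esub> x \<oplus>\<^bsub>M\<^esub> (\<Oplus>\<^bsub>M\<^esub>x\<in>S. c x \<odot>\<^bsub>M\<^esub> x)"
      by (rule M.finsum_insert) (use insert cc in auto)
    then have "f (\<Oplus>\<^bsub>M\<^esub>x\<in>insert x S. c x \<odot>\<^bsub>M\<^esub> x) = c x \<otimes> f x \<oplus> (\<Oplus>x\<in>S. c x \<otimes> vecof f x)"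
      using D_add[OF f _ sc] D_smult[OF f] insert cc by simp
    also have "\<dots> = (\<Oplus>x\<in>insert x S. c x \<otimes> vecof f x)"
      using insert cc vec_closed[OF vecof_vec[OF f]] D_closed[OF f] by (subst R_finsum_insert) (auto simp: vecof_def)
    finally show ?case .
  qed
  from this[OF finA order_refl] show ?thesis by (simp add: lc_def dot_def)
qed

lemma vecof_NN: assumes "f \<in> carrier D" shows "vecof f \<in> NN"
  unfolding NN_def using vecof_vec[OF assms] D_lc[OF assms, symmetric] D_zero[OF assms] by (auto simp: Z_def)

lemma vecof_fn: assumes "\<psi> \<in> NN" shows "vecof (fn \<psi>) = \<psi>"
proof (rule vec_eqI'[OF vecof_vec[OF fn_D[OF assms]] NNvec[OF assms]])
  fix i assume i: "i \<in> A"
  have "fn \<psi> (lc (unitv i)) = \<psi> i"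
    using fn_lc[OF assms vec_unitv[OF i]] dot_unitv[OF finA i NNvec[OF assms]] by simp
  then show "vecof (fn \<psi>) i = \<psi> i" using i lc_unitv[OF i] by (simp add: vecof_def)
qed

end

section \<open>Torsion in the tensor product\<close>

context module
begin

text \<open>Congruence modulo a submodule; it replaces computations with cosets in the tensor product.\<close>

definition mcong :: "'c set \<Rightarrow> 'c \<Rightarrow> 'c \<Rightarrow> bool" where
  "mcong H u v \<longleftrightarrow> u \<in> carrier M \<and> v \<in> carrier M \<and> u \<ominus>\<^bsub>M\<^esub> v \<in> H"

lemma mcong_carrier: "mcong H u v \<Longrightarrow> u \<in> carrier M" "mcong H u v \<Longrightarrow> v \<in> carrier M"
  by (simp_all add: mcong_def)

lemma mcong_refl: "submodule H R M \<Longrightarrow> u \<in> carrier M \<Longrightarrow> mcong H u u"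
  using submod_zero[of H] by (simp add: mcong_def a_minus_def M.r_neg)

lemma mcong_sym: assumes "submodule H R M" "mcong H u v" shows "mcong H v u"
proof -
  have c: "u \<in> carrier M" "v \<in> carrier M" using assms(2) by (auto simp: mcong_def)
  have "v \<ominus>\<^bsub>M\<^esub> u = \<ominus>\<^bsub>M\<^esub> (u \<ominus>\<^bsub>M\<^esub> v)" using c by (simp add: a_minus_def M.minus_add M.a_comm)
  then show ?thesis using assms submoduleE(3)[OF assms(1)] c by (simp add: mcong_def)
qed

lemma mcong_trans: assumes "submodule H R M" "mcong H u v" "mcong H v w" shows "mcong H u w"
proof -
  have c: "u \<in> carrier M" "v \<in> carrier M" "w \<in> carrier M" using assms(2,3) by (auto simp: mcong_def)
  have "u \<ominus>\<^bsub>M\<^esub> w = (u \<ominus>\<^bsub>M\<^esub> v) \<oplus>\<^bsub>M\<^esub> (v \<ominus>\<^bsub>M\<^esub> w)"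
    using c by (simp add: a_minus_def M.a_assoc M.r_neg1)
  then show ?thesis using assms submod_add[OF assms(1)] c by (simp add: mcong_def)
qed

lemma mcong_add: assumes "submodule H R M" "mcong H u v" "mcong H u' v'" shows "mcong H (u \<oplus>\<^bsub>M\<^esub> u') (v \<oplus>\<^bsub>M\<^esub> v')"
proof -
  have c: "u \<in> carrier M" "v \<in> carrier M" "u' \<in> carrier M" "v' \<in> carrier M" using assms(2,3) by (auto simp: mcong_def)
  have "(u \<oplus>\<^bsub>M\<^esub> u') \<ominus>\<^bsub>M\<^esub> (v \<oplus>\<^bsub>M\<^esub> v') = (u \<ominus>\<^bsub>M\<^esub> v) \<oplus>\<^bsub>M\<^esub> (u' \<ominus>\<^bsub>M\<^esub> v')"
    using c by (simp add: a_minus_def M.minus_add M.a_ac)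
  then show ?thesis using assms submod_add[OF assms(1)] c by (simp add: mcong_def)
qed

lemma mcong_finsum:
  assumes "submodule H R M" "finite S" "\<And>x. x \<in> S \<Longrightarrow> mcong H (f x) (g x)"
  shows "mcong H (\<Oplus>\<^bsub>M\<^esub>x\<in>S. f x) (\<Oplus>\<^bsub>M\<^esub>x\<in>S. g x)"
  using assms(2,3)
proof (induction S)
  case empty then show ?case using mcong_refl[OF assms(1)] by simp
next
  case (insert x S)
  have "f \<in> S \<rightarrow> carrier M" "f x \<in> carrier M" "g \<in> S \<rightarrow> carrier M" "g x \<in> carrier M"
    using insert.prems by (auto dest: mcong_carrier)
  then show ?case using insert mcong_add[OF assms(1)] by simp
qed

lemma mcong_zero: assumes "u \<in> carrier M" shows "mcong H u \<zero>\<^bsub>M\<^esub> \<longleftrightarrow> u \<in> H"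
proof -
  have z: "\<ominus>\<^bsub>M\<^esub> \<zero>\<^bsub>M\<^esub> = \<zero>\<^bsub>M\<^esub>" by (rule M.minus_equality) simp_all
  have "u \<ominus>\<^bsub>M\<^esub> \<zero>\<^bsub>M\<^esub> = u" unfolding a_minus_def z using assms by simp
  then show ?thesis using assms by (simp add: mcong_def)
qed

lemma mcong_mem: "submodule H R M \<Longrightarrow> mcong H u v \<Longrightarrow> v \<in> H \<Longrightarrow> u \<in> H"
  using mcong_trans[of H u v "\<zero>\<^bsub>M\<^esub>"] mcong_zero[of v H] mcong_zero[of u H] mcong_carrier by blast

end

lemma torsion_free_quotient:
  fixes R :: "'a ring" (structure) and F :: "('a, 'f) module"
  assumes "module R F" "submodule H R F" "torsion_free R (quot_module F H)"
    and r: "r \<in> carrier R" "\<forall>s\<in>carrier R. r \<otimes> s = \<zero> \<longrightarrow> s = \<zero>"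
    and u: "u \<in> carrier F" "r \<odot>\<^bsub>F\<^esub> u \<in> H"
  shows "u \<in> H"
proof -
  interpret module R F by fact
  note H = assms(2)
  have coset: "H +>\<^bsub>F\<^esub> v = H" if "v \<in> H" for v
  proof
    show "H +>\<^bsub>F\<^esub> v \<subseteq> H" unfolding a_r_coset_def' using submod_add[OF H _ that] by auto
    show "H \<subseteq> H +>\<^bsub>F\<^esub> v"
    proof
      fix h assume h: "h \<in> H"
      have "h = (h \<ominus>\<^bsub>F\<^esub> v) \<oplus>\<^bsub>F\<^esub> v"
        using submod_carrier[OF H h] submod_carrier[OF H that] by (simp add: a_minus_def M.a_assoc M.l_neg)
      then show "h \<in> H +>\<^bsub>F\<^esub> v" unfolding a_r_coset_def' using submod_minus[OF H h that] by blast
    qed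
  qed
  let ?X = "H +>\<^bsub>F\<^esub> u"
  have X: "?X \<in> carrier (quot_module F H)"
    unfolding quot_module_def A_RCOSETS_def' using u(1) by auto
  have mem: "r \<odot>\<^bsub>F\<^esub> x \<in> H" if x: "x \<in> ?X" for x
  proof -
    obtain h where h: "h \<in> H" "x = h \<oplus>\<^bsub>F\<^esub> u" using x unfolding a_r_coset_def' by auto
    have "r \<odot>\<^bsub>F\<^esub> x = r \<odot>\<^bsub>F\<^esub> h \<oplus>\<^bsub>F\<^esub> r \<odot>\<^bsub>F\<^esub> u"
      using h submod_carrier[OF H h(1)] u(1) r(1) by (simp add: smult_r_distr)
    then show ?thesis using submod_add[OF H submod_smult[OF H r(1) h(1)] u(2)] by simp
  qed
  have uX: "u \<in> ?X" unfolding a_r_coset_def' using submod_zero[OF H] u(1) by (auto intro!: bexI[of _ "\<zero>\<^bsub>F\<^esub>"])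
  have "r \<odot>\<^bsub>quot_module F H\<^esub> ?X = (\<Union>x\<in>?X. H +>\<^bsub>F\<^esub> (r \<odot>\<^bsub>F\<^esub> x))" by (simp add: quot_module_def)
  also have "\<dots> = H" using coset mem uX by auto
  finally have "r \<odot>\<^bsub>quot_module F H\<^esub> ?X = \<zero>\<^bsub>quot_module F H\<^esub>" by (simp add: quot_module_def)
  then have "?X = \<zero>\<^bsub>quot_module F H\<^esub>" using assms(3) r X unfolding torsion_free_def by blast
  then show ?thesis using uX by (simp add: quot_module_def)
qed

context min_gens
begin

abbreviation P :: "('b \<times> ('b \<Rightarrow> 'a)) set" where "P \<equiv> carrier M \<times> carrier D"
abbreviation F :: "('a, 'b \<times> ('b \<Rightarrow> 'a) \<Rightarrow> 'a) module" where "F \<equiv> free_module R P"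
abbreviation H :: "('b \<times> ('b \<Rightarrow> 'a) \<Rightarrow> 'a) set" where "H \<equiv> mod_span R F (tensor_rels R M D)"
abbreviation B :: "'b \<Rightarrow> ('b \<Rightarrow> 'a) \<Rightarrow> 'b \<times> ('b \<Rightarrow> 'a) \<Rightarrow> 'a" where "B \<equiv> tensor_gen R M D"

text \<open>In coordinates the tensor product of \<open>M\<close> with its dual is \<open>NN\<^sup>A/WW\<close>; the maps \<open>tens\<close> and \<open>\<Theta>\<close> below
  provide the two directions of the isomorphism.\<close>

definition WW :: "('b \<times> 'b \<Rightarrow> 'a) set" where
  "WW = vspan {outer z \<psi> |z \<psi>. z \<in> Z \<and> \<psi> \<in> NN}"

interpretation F: module R F by (rule free_module_module)

lemma B_closed [simp]: "B x f \<in> carrier F"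
proof -
  have "finite {p \<in> P. B x f p \<noteq> \<zero>}"
    by (rule finite_subset[of _ "{(x, f)}"]) (auto simp: tensor_gen_def)
  then show ?thesis by (auto simp: free_carrier tensor_gen_def)
qed

lemma D_add_closed: assumes "f \<in> carrier D" "g \<in> carrier D" shows "f \<oplus>\<^bsub>D\<^esub> g \<in> carrier D"
proof -
  have v: "vecof f +\<^sub>v vecof g \<in> NN"
    using vecof_NN[OF assms(1)] vecof_NN[OF assms(2)] by (auto simp: NN_def Z_def dot_add_right)
  have "f \<oplus>\<^bsub>D\<^esub> g = fn (vecof f +\<^sub>v vecof g)"
    unfolding D_simps fn_def
  proof (rule restrict_ext)
    fix x assume x: "x \<in> carrier M"
    have "f x = dot A (coef x) (vecof f)" "g x = dot A (coef x) (vecof g)"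
      using D_lc[OF assms(1) coef(1)[OF x]] D_lc[OF assms(2) coef(1)[OF x]] coef(2)[OF x] by auto
    then show "f x \<oplus> g x = dot A (coef x) (vecof f +\<^sub>v vecof g)"
      using coef(1)[OF x] vecof_vec[OF assms(1)] vecof_vec[OF assms(2)] by (simp add: dot_add_right)
  qed
  then show ?thesis using fn_D[OF v] by simp
qed

lemma D_smult_closed: assumes "r \<in> carrier R" "f \<in> carrier D" shows "r \<odot>\<^bsub>D\<^esub> f \<in> carrier D"
proof -
  have v: "r *\<^sub>v vecof f \<in> NN"
    using vecof_NN[OF assms(2)] assms(1) finA by (auto simp: NN_def Z_def dot_scale_right)
  have "r \<odot>\<^bsub>D\<^esub> f = fn (r *\<^sub>v vecof f)"
    unfolding D_simps fn_def
  proof (rule restrict_ext)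
    fix x assume x: "x \<in> carrier M"
    have "f x = dot A (coef x) (vecof f)"
      using D_lc[OF assms(2) coef(1)[OF x]] coef(2)[OF x] by auto
    then show "r \<otimes> f x = dot A (coef x) (r *\<^sub>v vecof f)"
      using coef(1)[OF x] vecof_vec[OF assms(2)] assms(1) finA by (simp add: dot_scale_right)
  qed
  then show ?thesis using fn_D[OF v] by simp
qed

lemma rels_carrier: "tensor_rels R M D \<subseteq> carrier F"
  unfolding tensor_rels_def Let_def by (auto intro!: F.M.minus_closed)

lemma H_submodule: "submodule H R F"
  by (rule mod_span_submodule[OF free_module_module rels_carrier])

lemma rel_in_H: "u \<in> tensor_rels R M D \<Longrightarrow> u \<in> H"
  by (rule subsetD[OF mod_span_superset])

lemma B_add_left:
  assumes "x \<in> carrier M" "x' \<in> carrier M" "f \<in> carrier D"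
  shows "F.mcong H (B (x \<oplus>\<^bsub>M\<^esub> x') f) (B x f \<oplus>\<^bsub>F\<^esub> B x' f)"
proof -
  have mem: "B (x \<oplus>\<^bsub>M\<^esub> x') f \<ominus>\<^bsub>F\<^esub> (B x f \<oplus>\<^bsub>F\<^esub> B x' f) \<in> H"
    by (rule rel_in_H, unfold tensor_rels_def Let_def, rule UnI1, rule UnI1, rule UnI1, rule CollectI,
        rule exI[of _ x], rule exI[of _ x'], rule exI[of _ f]) (intro conjI refl assms)
  show ?thesis unfolding F.mcong_def
    by (rule conjI[OF B_closed conjI[OF free_add_closed[OF B_closed B_closed] mem]])
qed

lemma B_add_right:
  assumes "x \<in> carrier M" "f \<in> carrier D" "f' \<in> carrier D"
  shows "F.mcong H (B x (f \<oplus>\<^bsub>D\<^esub> f')) (B x f \<oplus>\<^bsub>F\<^esub> B x f')"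
proof -
  have mem: "B x (f \<oplus>\<^bsub>D\<^esub> f') \<ominus>\<^bsub>F\<^esub> (B x f \<oplus>\<^bsub>F\<^esub> B x f') \<in> H"
    by (rule rel_in_H, unfold tensor_rels_def Let_def, rule UnI1, rule UnI1, rule UnI2, rule CollectI,
        rule exI[of _ x], rule exI[of _ f], rule exI[of _ f']) (intro conjI refl assms)
  show ?thesis unfolding F.mcong_def
    by (rule conjI[OF B_closed conjI[OF free_add_closed[OF B_closed B_closed] mem]])
qed

lemma B_smult_left:
  assumes "r \<in> carrier R" "x \<in> carrier M" "f \<in> carrier D"
  shows "F.mcong H (B (r \<odot>\<^bsub>M\<^esub> x) f) (r \<odot>\<^bsub>F\<^esub> B x f)"
proof -
  have mem: "B (r \<odot>\<^bsub>M\<^esub> x) f \<ominus>\<^bsub>F\<^esub> r \<odot>\<^bsub>F\<^esub> B x f \<in> H"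
    by (rule rel_in_H, unfold tensor_rels_def Let_def, rule UnI1, rule UnI2, rule CollectI,
        rule exI[of _ r], rule exI[of _ x], rule exI[of _ f]) (intro conjI refl assms)
  show ?thesis unfolding F.mcong_def
    by (rule conjI[OF B_closed conjI[OF free_smult_closed[OF assms(1) B_closed] mem]])
qed

lemma B_smult_right:
  assumes "r \<in> carrier R" "x \<in> carrier M" "f \<in> carrier D"
  shows "F.mcong H (B x (r \<odot>\<^bsub>D\<^esub> f)) (r \<odot>\<^bsub>F\<^esub> B x f)"
proof -
  have mem: "B x (r \<odot>\<^bsub>D\<^esub> f) \<ominus>\<^bsub>F\<^esub> r \<odot>\<^bsub>F\<^esub> B x f \<in> H"
    by (rule rel_in_H, unfold tensor_rels_def Let_def, rule UnI2, rule CollectI,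
        rule exI[of _ r], rule exI[of _ x], rule exI[of _ f]) (intro conjI refl assms)
  show ?thesis unfolding F.mcong_def
    by (rule conjI[OF B_closed conjI[OF free_smult_closed[OF assms(1) B_closed] mem]])
qed

lemma B_zero_left: assumes "f \<in> carrier D" shows "F.mcong H (B \<zero>\<^bsub>M\<^esub> f) \<zero>\<^bsub>F\<^esub>"
  using B_smult_left[OF R_zero_closed M.zero_closed assms] by simp

lemma B_lc:
  assumes c: "c \<in> vec A" and f: "f \<in> carrier D"
  shows "F.mcong H (B (lc c) f) (\<Oplus>\<^bsub>F\<^esub>x\<in>A. c x \<odot>\<^bsub>F\<^esub> B x f)"
proof -
  have cc: "c x \<in> carrier R" for x by (rule vec_closed[OF c])
  have "F.mcong H (B (\<Oplus>\<^bsub>M\<^esub>x\<in>S. c x \<odot>\<^bsub>M\<^esub> x) f) (\<Oplus>\<^bsub>F\<^esub>x\<in>S. c x \<odot>\<^bsub>F\<^esub> B x f)" if "finite S" "S \<subseteq> A" for S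
    using that
  proof (induction S)
    case empty then show ?case using B_zero_left[OF f] by simp
  next
    case (insert x S)
    have sc: "(\<Oplus>\<^bsub>M\<^esub>x\<in>S. c x \<odot>\<^bsub>M\<^esub> x) \<in> carrier M" by (rule M.finsum_closed) (use insert cc in auto)
    have e: "(\<Oplus>\<^bsub>M\<^esub>x\<in>insert x S. c x \<odot>\<^bsub>M\<^esub> x) = c x \<odot>\<^bsub>M\<^esub> x \<oplus>\<^bsub>M\<^esub> (\<Oplus>\<^bsub>M\<^esub>x\<in>S. c x \<odot>\<^bsub>M\<^esub> x)"
      by (rule M.finsum_insert) (use insert cc in auto)
    have e': "(\<Oplus>\<^bsub>F\<^esub>x\<in>insert x S. c x \<odot>\<^bsub>F\<^esub> B x f) = c x \<odot>\<^bsub>F\<^esub> B x f \<oplus>\<^bsub>F\<^esub> (\<Oplus>\<^bsub>F\<^esub>x\<in>S. c x \<odot>\<^bsub>F\<^esub> B x f)"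
      by (rule F.M.finsum_insert) (use insert cc in auto)
    have x: "x \<in> carrier M" using insert.prems by auto
    have IH: "F.mcong H (B (\<Oplus>\<^bsub>M\<^esub>x\<in>S. c x \<odot>\<^bsub>M\<^esub> x) f) (\<Oplus>\<^bsub>F\<^esub>x\<in>S. c x \<odot>\<^bsub>F\<^esub> B x f)"
      using insert by simp
    show ?case unfolding e e'
      by (rule F.mcong_trans[OF H_submodule B_add_left[OF smult_closed[OF cc x] sc f]
            F.mcong_add[OF H_submodule B_smult_left[OF cc x f] IH]])
  qed
  from this[OF finA order_refl] show ?thesis by (simp add: lc_def)
qed

text \<open>The map from \<open>NN\<^sup>A\<close> to the tensor product: a family \<open>\<mu>\<close> of functionals goes to \<open>\<Sum>\<^sub>x x \<otimes> \<mu>\<^sub>x\<close>. Because the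
  relations of \<open>M\<close> hold in the tensor product, it maps \<open>WW\<close> to zero.\<close>

definition tens :: "('b \<times> 'b \<Rightarrow> 'a) \<Rightarrow> 'b \<times> ('b \<Rightarrow> 'a) \<Rightarrow> 'a" where
  "tens \<mu> = (\<Oplus>\<^bsub>F\<^esub>x\<in>A. B x (fn (\<lambda>j. \<mu> (x, j))))"

lemma tens_closed [simp]: "tens \<mu> \<in> carrier F"
  unfolding tens_def by (rule F.M.finsum_closed) auto

lemma NN_linsub: "linsub A NN"
  unfolding linsub_def NN_def Z_def using finA by (auto simp: dot_add_right dot_scale_right)

lemma tens_add:
  assumes "\<And>x. (\<lambda>j. \<mu> (x, j)) \<in> NN" "\<And>x. (\<lambda>j. \<nu> (x, j)) \<in> NN"
  shows "F.mcong H (tens (\<mu> +\<^sub>v \<nu>)) (tens \<mu> \<oplus>\<^bsub>F\<^esub> tens \<nu>)"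
proof -
  have r: "(\<lambda>j. (\<mu> +\<^sub>v \<nu>) (x, j)) = (\<lambda>j. \<mu> (x, j)) +\<^sub>v (\<lambda>j. \<nu> (x, j))" for x by (rule vec_eqI) simp
  have "F.mcong H (tens (\<mu> +\<^sub>v \<nu>)) (\<Oplus>\<^bsub>F\<^esub>x\<in>A. B x (fn (\<lambda>j. \<mu> (x, j))) \<oplus>\<^bsub>F\<^esub> B x (fn (\<lambda>j. \<nu> (x, j))))"
    unfolding tens_def r fn_add[OF assms(1) assms(2)]
    by (rule F.mcong_finsum[OF H_submodule finA B_add_right]) (use assms fn_D in auto)
  moreover have "(\<Oplus>\<^bsub>F\<^esub>x\<in>A. B x (fn (\<lambda>j. \<mu> (x, j))) \<oplus>\<^bsub>F\<^esub> B x (fn (\<lambda>j. \<nu> (x, j)))) = tens \<mu> \<oplus>\<^bsub>F\<^esub> tens \<nu>"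
    unfolding tens_def by (rule F.M.finsum_addf) auto
  ultimately show ?thesis by simp
qed

lemma tens_scale:
  assumes "r \<in> carrier R" "\<And>x. (\<lambda>j. \<mu> (x, j)) \<in> NN"
  shows "F.mcong H (tens (r *\<^sub>v \<mu>)) (r \<odot>\<^bsub>F\<^esub> tens \<mu>)"
proof -
  have r: "(\<lambda>j. (r *\<^sub>v \<mu>) (x, j)) = r *\<^sub>v (\<lambda>j. \<mu> (x, j))" for x by (rule vec_eqI) simp
  have "F.mcong H (tens (r *\<^sub>v \<mu>)) (\<Oplus>\<^bsub>F\<^esub>x\<in>A. r \<odot>\<^bsub>F\<^esub> B x (fn (\<lambda>j. \<mu> (x, j))))"
    unfolding tens_def r fn_scale[OF assms]
    by (rule F.mcong_finsum[OF H_submodule finA B_smult_right]) (use assms fn_D in auto)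
  moreover have "(\<Oplus>\<^bsub>F\<^esub>x\<in>A. r \<odot>\<^bsub>F\<^esub> B x (fn (\<lambda>j. \<mu> (x, j)))) = r \<odot>\<^bsub>F\<^esub> tens \<mu>"
    unfolding tens_def by (rule F.finsum_smult_ldistr[symmetric]) (use finA assms in auto)
  ultimately show ?thesis by simp
qed

lemma tens_outer: assumes z: "z \<in> Z" and \<psi>: "\<psi> \<in> NN" shows "tens (outer z \<psi>) \<in> H"
proof -
  have zv: "z \<in> vec A" "lc z = \<zero>\<^bsub>M\<^esub>" using z by (auto simp: Z_def)
  have zc: "z x \<in> carrier R" for x by (rule vec_closed[OF zv(1)])
  have r: "(\<lambda>j. outer z \<psi> (x, j)) = z x *\<^sub>v \<psi>" for x by (rule vec_eqI) (simp add: outer_def)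
  note f = fn_D[OF \<psi>]
  have "F.mcong H (tens (outer z \<psi>)) (\<Oplus>\<^bsub>F\<^esub>x\<in>A. z x \<odot>\<^bsub>F\<^esub> B x (fn \<psi>))"
    unfolding tens_def r fn_scale[OF zc \<psi>]
    by (rule F.mcong_finsum[OF H_submodule finA B_smult_right[OF zc _ f]]) simp
  moreover have "F.mcong H (\<Oplus>\<^bsub>F\<^esub>x\<in>A. z x \<odot>\<^bsub>F\<^esub> B x (fn \<psi>)) (B (lc z) (fn \<psi>))"
    by (rule F.mcong_sym[OF H_submodule B_lc[OF zv(1) f]])
  moreover have "F.mcong H (B (lc z) (fn \<psi>)) \<zero>\<^bsub>F\<^esub>" unfolding zv(2) by (rule B_zero_left[OF f])
  ultimately have "F.mcong H (tens (outer z \<psi>)) \<zero>\<^bsub>F\<^esub>" using F.mcong_trans[OF H_submodule] by blast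
  then show ?thesis by (simp add: F.mcong_zero)
qed

lemma WW_rows: assumes "\<mu> \<in> WW" shows "(\<lambda>j. \<mu> (x, j)) \<in> NN"
  using assms unfolding WW_def
proof (induction rule: vspan_induct)
  case zero
  have "(\<lambda>j. vzero (x, j)) = (vzero :: 'b \<Rightarrow> 'a)" by (rule vec_eqI) simp
  then show ?case using linsubD(2)[OF NN_linsub] by simp
next
  case (base v)
  then obtain z \<psi> where v: "z \<in> Z" "\<psi> \<in> NN" "v = outer z \<psi>" by auto
  have "(\<lambda>j. v (x, j)) = z x *\<^sub>v \<psi>" unfolding v(3) by (rule vec_eqI) (simp add: outer_def)
  then show ?case using linsubD(4)[OF NN_linsub linsub_closed[OF Z_linsub v(1)] v(2)] by simp
next
  case (add u v)
  have "(\<lambda>j. (u +\<^sub>v v) (x, j)) = (\<lambda>j. u (x, j)) +\<^sub>v (\<lambda>j. v (x, j))" by (rule vec_eqI) simp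
  then show ?case using linsubD(3)[OF NN_linsub add.IH] by simp
next
  case (scale r u)
  have "(\<lambda>j. (r *\<^sub>v u) (x, j)) = r *\<^sub>v (\<lambda>j. u (x, j))" by (rule vec_eqI) simp
  then show ?case using linsubD(4)[OF NN_linsub scale(1) scale.IH] by simp
qed

lemma tens_WW: assumes "\<mu> \<in> WW" shows "tens \<mu> \<in> H"
  using assms unfolding WW_def
proof (induction rule: vspan_induct)
  case zero
  have "F.mcong H (tens (\<zero> *\<^sub>v vzero)) (\<zero> \<odot>\<^bsub>F\<^esub> tens vzero)"
  proof (rule tens_scale[OF R_zero_closed])
    fix x
    have "(\<lambda>j. vzero (x, j)) = (vzero :: 'b \<Rightarrow> 'a)" by (rule vec_eqI) simp
    then show "(\<lambda>j. vzero (x, j)) \<in> NN" using linsubD(2)[OF NN_linsub] by simp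
  qed
  moreover have "\<zero> *\<^sub>v vzero = (vzero :: 'b \<times> 'b \<Rightarrow> 'a)" by (rule vscale_zero[OF vec_zero])
  ultimately have "F.mcong H (tens vzero) \<zero>\<^bsub>F\<^esub>" by simp
  then have "tens vzero \<in> H" by (simp add: F.mcong_zero)
  then show ?case .
next
  case (base v)
  then show ?case using tens_outer by auto
next
  case (add u v)
  have "tens u \<oplus>\<^bsub>F\<^esub> tens v \<in> H" by (rule F.submod_add[OF H_submodule add.IH])
  moreover have "u \<in> WW" "v \<in> WW" using add.hyps by (auto simp: WW_def)
  ultimately have "tens (u +\<^sub>v v) \<in> H" using F.mcong_mem[OF H_submodule tens_add] WW_rows by blast
  then show ?case .
next
  case (scale r u)
  have "r \<odot>\<^bsub>F\<^esub> tens u \<in> H" by (rule F.submod_smult[OF H_submodule scale(1) scale.IH])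
  moreover have "u \<in> WW" using scale.hyps by (auto simp: WW_def)
  ultimately have "tens (r *\<^sub>v u) \<in> H" using F.mcong_mem[OF H_submodule tens_scale[OF scale(1)]] WW_rows by blast
  then show ?case .
qed

text \<open>The inverse map, induced by \<open>(x, f) \<mapsto> outer (coef x) f\<close>, which is bilinear modulo \<open>WW\<close> because two
  coefficient vectors of the same element differ by a relation.\<close>

definition \<Theta> :: "('b \<times> ('b \<Rightarrow> 'a) \<Rightarrow> 'a) \<Rightarrow> 'b \<times> 'b \<Rightarrow> 'a" where
  "\<Theta> u = (\<lambda>q. \<Oplus>p\<in>{p \<in> P. u p \<noteq> \<zero>}. u p \<otimes> outer (coef (fst p)) (vecof (snd p)) q)"

lemma outer_P: "p \<in> P \<Longrightarrow> outer (coef (fst p)) (vecof (snd p)) \<in> vec (A \<times> A)"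
  by (intro outer_vec coef vecof_vec) auto

lemma outer_P_closed: "p \<in> P \<Longrightarrow> outer (coef (fst p)) (vecof (snd p)) q \<in> carrier R"
  by (rule vec_closed[OF outer_P])

lemma Theta_superset:
  assumes u: "u \<in> carrier F" and S: "finite S" "S \<subseteq> P" "{p \<in> P. u p \<noteq> \<zero>} \<subseteq> S"
  shows "\<Theta> u q = (\<Oplus>p\<in>S. u p \<otimes> outer (coef (fst p)) (vecof (snd p)) q)"
  unfolding \<Theta>_def
proof (rule R_mono_neutral)
  fix p assume p: "p \<in> S - {p \<in> P. u p \<noteq> \<zero>}"
  then have "p \<in> P" "u p = \<zero>" using S(2) by auto
  then show "u p \<otimes> outer (coef (fst p)) (vecof (snd p)) q = \<zero>" using outer_P_closed[of p q] by simp
next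
  show "(\<lambda>p. u p \<otimes> outer (coef (fst p)) (vecof (snd p)) q) \<in> S \<rightarrow> carrier R"
    using S(2) free_closed[OF u] outer_P_closed by (intro Pi_I R_m_closed) blast+
qed (use S in auto)

lemma supp_finite: "u \<in> carrier F \<Longrightarrow> finite {p \<in> P. u p \<noteq> \<zero>}"
  by (simp add: free_carrier)

lemma Theta_add: assumes u: "u \<in> carrier F" "v \<in> carrier F" shows "\<Theta> (u \<oplus>\<^bsub>F\<^esub> v) = \<Theta> u +\<^sub>v \<Theta> v"
proof (rule vec_eqI)
  fix q
  let ?S = "{p \<in> P. u p \<noteq> \<zero>} \<union> {p \<in> P. v p \<noteq> \<zero>}"
  let ?o = "\<lambda>p. outer (coef (fst p)) (vecof (snd p)) q"
  have S: "finite ?S" "?S \<subseteq> P" using supp_finite u by auto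
  note c = free_closed[OF u(1)] free_closed[OF u(2)] outer_P_closed
  have "\<Theta> (u \<oplus>\<^bsub>F\<^esub> v) q = (\<Oplus>p\<in>?S. (u \<oplus>\<^bsub>F\<^esub> v) p \<otimes> ?o p)"
    by (rule Theta_superset[OF free_add_closed[OF u] S]) (auto simp: free_ops)
  also have "\<dots> = (\<Oplus>p\<in>?S. u p \<otimes> ?o p \<oplus> v p \<otimes> ?o p)"
    by (rule R_finsum_cong') (use c S(2) in \<open>auto simp: free_ops l_distr\<close>)
  also have "\<dots> = (\<Oplus>p\<in>?S. u p \<otimes> ?o p) \<oplus> (\<Oplus>p\<in>?S. v p \<otimes> ?o p)"
    by (rule R_finsum_addf) (use c S(2) in auto)
  also have "\<dots> = \<Theta> u q \<oplus> \<Theta> v q"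
    using Theta_superset[OF u(1) S, of q] Theta_superset[OF u(2) S, of q] by auto
  finally show "\<Theta> (u \<oplus>\<^bsub>F\<^esub> v) q = (\<Theta> u +\<^sub>v \<Theta> v) q" by simp
qed

lemma Theta_scale: assumes r: "r \<in> carrier R" and u: "u \<in> carrier F" shows "\<Theta> (r \<odot>\<^bsub>F\<^esub> u) = r *\<^sub>v \<Theta> u"
proof (rule vec_eqI)
  fix q
  let ?S = "{p \<in> P. u p \<noteq> \<zero>}"
  let ?o = "\<lambda>p. outer (coef (fst p)) (vecof (snd p)) q"
  have S: "finite ?S" "?S \<subseteq> P" using supp_finite u by auto
  note c = free_closed[OF u] outer_P_closed
  have "\<Theta> (r \<odot>\<^bsub>F\<^esub> u) q = (\<Oplus>p\<in>?S. (r \<odot>\<^bsub>F\<^esub> u) p \<otimes> ?o p)"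
    by (rule Theta_superset[OF free_smult_closed[OF r u] S]) (use r in \<open>auto simp: free_ops\<close>)
  also have "\<dots> = (\<Oplus>p\<in>?S. r \<otimes> (u p \<otimes> ?o p))"
    by (rule R_finsum_cong') (use c S(2) r in \<open>auto simp: free_ops R_m_assoc\<close>)
  also have "\<dots> = r \<otimes> (\<Oplus>p\<in>?S. u p \<otimes> ?o p)"
    by (rule finsum_rdistr[symmetric]) (use c S r in auto)
  finally show "\<Theta> (r \<odot>\<^bsub>F\<^esub> u) q = (r *\<^sub>v \<Theta> u) q" by (simp add: \<Theta>_def)
qed

lemma Theta_B: assumes "x \<in> carrier M" "f \<in> carrier D" shows "\<Theta> (B x f) = outer (coef x) (vecof f)"
proof (rule vec_eqI)
  fix q
  have p: "(x, f) \<in> P" using assms by simp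
  have "\<Theta> (B x f) q = (\<Oplus>p\<in>{(x, f)}. B x f p \<otimes> outer (coef (fst p)) (vecof (snd p)) q)"
    by (rule Theta_superset[OF B_closed]) (use p in \<open>auto simp: tensor_gen_def\<close>)
  also have "\<dots> = outer (coef x) (vecof f) q"
    using outer_P_closed[OF p, of q] assms by (simp add: tensor_gen_def)
  finally show "\<Theta> (B x f) q = outer (coef x) (vecof f) q" .
qed

lemma WW_linsub: "linsub (A \<times> A) WW"
  unfolding WW_def by (rule vspan_linsub) (use outer_vec linsubD(1)[OF Z_linsub] NNvec in blast)

lemma outer_WW: "z \<in> Z \<Longrightarrow> \<psi> \<in> NN \<Longrightarrow> outer z \<psi> \<in> WW"
  unfolding WW_def by (rule vspan_base) blast

lemma outer_diff: "z \<in> vec A \<Longrightarrow> z' \<in> vec A \<Longrightarrow> \<psi> \<in> vec A \<Longrightarrow> outer (z -\<^sub>v z') \<psi> = outer z \<psi> -\<^sub>v outer z' \<psi>"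
  by (rule vec_eqI) (auto simp: outer_def l_distr R_m_assoc split: prod.splits)

lemma outer_add_left: "z \<in> vec A \<Longrightarrow> z' \<in> vec A \<Longrightarrow> \<psi> \<in> vec A \<Longrightarrow> outer (z +\<^sub>v z') \<psi> = outer z \<psi> +\<^sub>v outer z' \<psi>"
  by (rule vec_eqI) (auto simp: outer_def l_distr split: prod.splits)

lemma outer_add_right: "z \<in> vec A \<Longrightarrow> \<psi> \<in> vec A \<Longrightarrow> \<psi>' \<in> vec A \<Longrightarrow> outer z (\<psi> +\<^sub>v \<psi>') = outer z \<psi> +\<^sub>v outer z \<psi>'"
  by (rule vec_eqI) (auto simp: outer_def r_distr split: prod.splits)

lemma outer_scale_left: "r \<in> carrier R \<Longrightarrow> z \<in> vec A \<Longrightarrow> \<psi> \<in> vec A \<Longrightarrow> outer (r *\<^sub>v z) \<psi> = r *\<^sub>v outer z \<psi>"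
  by (rule vec_eqI) (auto simp: outer_def R_m_assoc split: prod.splits)

lemma outer_scale_right: "r \<in> carrier R \<Longrightarrow> z \<in> vec A \<Longrightarrow> \<psi> \<in> vec A \<Longrightarrow> outer z (r *\<^sub>v \<psi>) = r *\<^sub>v outer z \<psi>"
  by (rule vec_eqI) (auto simp: outer_def R_m_lcomm split: prod.splits)

lemma vecof_add: "f \<in> carrier D \<Longrightarrow> g \<in> carrier D \<Longrightarrow> vecof (f \<oplus>\<^bsub>D\<^esub> g) = vecof f +\<^sub>v vecof g"
  by (rule vec_eqI) (auto simp: vecof_def D_simps)

lemma vecof_scale: "r \<in> carrier R \<Longrightarrow> f \<in> carrier D \<Longrightarrow> vecof (r \<odot>\<^bsub>D\<^esub> f) = r *\<^sub>v vecof f"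
  by (rule vec_eqI) (auto simp: vecof_def D_simps)

lemma Theta_diff: assumes "u \<in> carrier F" "v \<in> carrier F" shows "\<Theta> (u \<ominus>\<^bsub>F\<^esub> v) = \<Theta> u -\<^sub>v \<Theta> v"
proof -
  have "u \<ominus>\<^bsub>F\<^esub> v = u \<oplus>\<^bsub>F\<^esub> (\<ominus> \<one>) \<odot>\<^bsub>F\<^esub> v"
    using assms by (simp add: a_minus_def F.smult_l_minus)
  then show ?thesis using Theta_add[OF assms(1) free_smult_closed[OF _ assms(2), of "\<ominus> \<one>"]]
      Theta_scale[OF _ assms(2), of "\<ominus> \<one>"] by simp
qed

lemma vdiff_self: "u \<in> vec X \<Longrightarrow> u -\<^sub>v u = vzero"
  by (rule vec_eqI) (simp add: R_l_minus R_r_neg)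

lemma coef_rel:
  assumes "c \<in> vec A" "x \<in> carrier M" "lc c = x" "\<psi> \<in> NN"
  shows "outer (coef x) \<psi> -\<^sub>v outer c \<psi> \<in> WW"
  using outer_WW[OF Z_diff[OF coef(1)[OF assms(2)] assms(1)] assms(4)]
    outer_diff[OF coef(1)[OF assms(2)] assms(1) NNvec[OF assms(4)]] coef(2)[OF assms(2)] assms(3) by simp

lemma Theta_H: assumes "u \<in> H" shows "\<Theta> u \<in> WW"
proof -
  let ?K = "{u \<in> carrier F. \<Theta> u \<in> WW}"
  have Kz: "\<zero>\<^bsub>F\<^esub> \<in> ?K"
  proof -
    have "\<Theta> \<zero>\<^bsub>F\<^esub> = vzero" by (rule vec_eqI) (simp add: \<Theta>_def free_ops)
    then show ?thesis using linsubD(2)[OF WW_linsub] by simp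
  qed
  have Ks: "r \<odot>\<^bsub>F\<^esub> u \<in> ?K" if "r \<in> carrier R" "u \<in> ?K" for r u
    using that linsubD(4)[OF WW_linsub] by (simp add: Theta_scale)
  have K: "submodule ?K R F"
  proof (rule F.submoduleI)
    show "\<ominus>\<^bsub>F\<^esub> u \<in> ?K" if "u \<in> ?K" for u
      using Ks[of "\<ominus> \<one>" u] that by (simp add: F.smult_l_minus)
    show "u \<oplus>\<^bsub>F\<^esub> v \<in> ?K" if "u \<in> ?K" "v \<in> ?K" for u v
      using that linsubD(3)[OF WW_linsub] by (simp add: Theta_add)
  qed (use Kz Ks in auto)
  have "tensor_rels R M D \<subseteq> ?K"
  proof
    fix u assume "u \<in> tensor_rels R M D"
    then consider
      (1) x x' f where "u = B (x \<oplus>\<^bsub>M\<^esub> x') f \<ominus>\<^bsub>F\<^esub> (B x f \<oplus>\<^bsub>F\<^esub> B x' f)" "x \<in> carrier M" "x' \<in> carrier M" "f \<in> carrier D"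
    | (2) x f f' where "u = B x (f \<oplus>\<^bsub>D\<^esub> f') \<ominus>\<^bsub>F\<^esub> (B x f \<oplus>\<^bsub>F\<^esub> B x f')" "x \<in> carrier M" "f \<in> carrier D" "f' \<in> carrier D"
    | (3) r x f where "u = B (r \<odot>\<^bsub>M\<^esub> x) f \<ominus>\<^bsub>F\<^esub> r \<odot>\<^bsub>F\<^esub> B x f" "r \<in> carrier R" "x \<in> carrier M" "f \<in> carrier D"
    | (4) r x f where "u = B x (r \<odot>\<^bsub>D\<^esub> f) \<ominus>\<^bsub>F\<^esub> r \<odot>\<^bsub>F\<^esub> B x f" "r \<in> carrier R" "x \<in> carrier M" "f \<in> carrier D"
      unfolding tensor_rels_def Let_def by blast
    then show "u \<in> ?K"
    proof cases
      case 1
      note c = coef[OF 1(2)] coef[OF 1(3)] and f = vecof_NN[OF 1(4)]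
      have "\<Theta> u = outer (coef (x \<oplus>\<^bsub>M\<^esub> x')) (vecof f) -\<^sub>v outer (coef x +\<^sub>v coef x') (vecof f)"
        using 1 c by (simp add: Theta_diff Theta_add Theta_B outer_add_left NNvec[OF f])
      also have "\<dots> \<in> WW" by (rule coef_rel[OF _ _ _ f]) (use 1 c lc_add in auto)
      finally show ?thesis using 1 by simp
    next
      case 2
      note f = vecof_vec[OF 2(3)] vecof_vec[OF 2(4)]
      have "\<Theta> u = outer (coef x) (vecof f +\<^sub>v vecof f') -\<^sub>v outer (coef x) (vecof f +\<^sub>v vecof f')"
        using 2 D_add_closed[OF 2(3,4)] coef[OF 2(2)] f
        by (simp add: Theta_diff Theta_add Theta_B vecof_add outer_add_right)
      also have "\<dots> = vzero"
        by (rule vdiff_self[OF outer_vec[OF coef(1)[OF 2(2)] vec_add[OF f]]])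
      finally show ?thesis using 2 linsubD(2)[OF WW_linsub] by simp
    next
      case 3
      note c = coef[OF 3(3)] and f = vecof_NN[OF 3(4)]
      have "\<Theta> u = outer (coef (r \<odot>\<^bsub>M\<^esub> x)) (vecof f) -\<^sub>v outer (r *\<^sub>v coef x) (vecof f)"
        using 3 c by (simp add: Theta_diff Theta_scale Theta_B outer_scale_left NNvec[OF f])
      also have "\<dots> \<in> WW" by (rule coef_rel[OF _ _ _ f]) (use 3 c lc_scale in auto)
      finally show ?thesis using 3 by simp
    next
      case 4
      note f = vecof_vec[OF 4(4)]
      have "\<Theta> u = r *\<^sub>v outer (coef x) (vecof f) -\<^sub>v r *\<^sub>v outer (coef x) (vecof f)"
        using 4 D_smult_closed[OF 4(2,4)] coef[OF 4(3)] f
        by (simp add: Theta_diff Theta_scale Theta_B vecof_scale outer_scale_right)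
      also have "\<dots> = vzero"
        by (rule vdiff_self[OF vec_scale[OF 4(2) outer_vec[OF coef(1)[OF 4(3)] f]]])
      finally show ?thesis using 4 linsubD(2)[OF WW_linsub] by simp
    qed
  qed
  then show ?thesis using mod_span_minimal[OF K] assms by blast
qed

lemma Theta_tens:
  assumes \<mu>: "\<mu> \<in> vec (A \<times> A)" and rows: "\<And>x. (\<lambda>j. \<mu> (x, j)) \<in> NN"
  shows "\<Theta> (tens \<mu>) -\<^sub>v \<mu> \<in> WW"
proof -
  let ?r = "\<lambda>x j. \<mu> (x, j)"
  let ?\<mu> = "\<lambda>S (i, j). if i \<in> S then \<mu> (i, j) else \<zero>"
  have "\<Theta> (\<Oplus>\<^bsub>F\<^esub>x\<in>S. B x (fn (?r x))) -\<^sub>v ?\<mu> S \<in> WW" if "finite S" "S \<subseteq> A" for S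
    using that
  proof (induction S)
    case empty
    have e: "\<Theta> (\<Oplus>\<^bsub>F\<^esub>x\<in>{}. B x (fn (?r x))) -\<^sub>v ?\<mu> {} = vzero"
      by (rule vec_eqI) (auto simp: \<Theta>_def free_ops split: prod.splits)
    show ?case unfolding e by (rule linsubD(2)[OF WW_linsub])
  next
    case (insert x S)
    have x: "x \<in> A" "x \<in> carrier M" using insert.prems by auto
    note f = fn_D[OF rows[of x]]
    let ?E = "\<Oplus>\<^bsub>F\<^esub>x\<in>S. B x (fn (?r x))"
    have Ec: "?E \<in> carrier F" by (rule F.M.finsum_closed) auto
    have \<mu>S: "?\<mu> S \<in> vec (A \<times> A)" using \<mu> unfolding vec_def by auto
    have IH: "\<Theta> ?E -\<^sub>v ?\<mu> S \<in> WW" by (rule insert.IH) (use insert.prems in auto)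
    have TE: "\<Theta> ?E \<in> vec (A \<times> A)"
    proof (rule linsub_diffD'[OF _ \<mu>S])
      show "\<Theta> ?E -\<^sub>v ?\<mu> S \<in> vec (A \<times> A)" by (rule linsubD(1)[OF WW_linsub IH])
      show "\<Theta> ?E q \<in> carrier R" for q
        unfolding \<Theta>_def by (rule R_finsum_closed) (use free_closed[OF Ec] outer_P_closed in auto)
    qed
    have o1: "outer (coef x) (?r x) \<in> vec (A \<times> A)" and o2: "outer (unitv x) (?r x) \<in> vec (A \<times> A)"
      using outer_vec[OF coef(1)[OF x(2)] NNvec[OF rows]] outer_vec[OF vec_unitv[OF x(1)] NNvec[OF rows]] by auto
    have e: "(\<Oplus>\<^bsub>F\<^esub>x\<in>insert x S. B x (fn (?r x))) = B x (fn (?r x)) \<oplus>\<^bsub>F\<^esub> ?E"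
      by (rule F.M.finsum_insert) (use insert in auto)
    have T: "\<Theta> (\<Oplus>\<^bsub>F\<^esub>x\<in>insert x S. B x (fn (?r x))) = outer (coef x) (?r x) +\<^sub>v \<Theta> ?E"
      unfolding e using Theta_add[OF B_closed Ec] Theta_B[OF x(2) f] vecof_fn[OF rows[of x]] by simp
    have m: "?\<mu> (insert x S) = outer (unitv x) (?r x) +\<^sub>v ?\<mu> S"
      by (rule vec_eqI) (use insert(2) vec_closed[OF \<mu>] in \<open>auto simp: outer_def unitv_def split: prod.splits\<close>)
    have "(outer (coef x) (?r x) -\<^sub>v outer (unitv x) (?r x)) +\<^sub>v (\<Theta> ?E -\<^sub>v ?\<mu> S) \<in> WW"
      by (rule linsubD(3)[OF WW_linsub coef_rel[OF vec_unitv[OF x(1)] x(2) lc_unitv[OF x(1)] rows] IH])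
    also have "(outer (coef x) (?r x) -\<^sub>v outer (unitv x) (?r x)) +\<^sub>v (\<Theta> ?E -\<^sub>v ?\<mu> S)
        = (outer (coef x) (?r x) +\<^sub>v \<Theta> ?E) -\<^sub>v (outer (unitv x) (?r x) +\<^sub>v ?\<mu> S)"
      by (rule vdiff_vadd[OF o1 o2 TE \<mu>S])
    finally show ?case unfolding T m .
  qed
  from this[OF finA order_refl] have "\<Theta> (tens \<mu>) -\<^sub>v ?\<mu> A \<in> WW" by (simp only: tens_def)
  moreover have "?\<mu> A = \<mu>"
    by (rule vec_eqI) (use vec_off[OF \<mu>] in \<open>auto split: prod.splits\<close>)
  ultimately show ?thesis by simp
qed

text \<open>If \<open>a \<mu> \<in> WW\<close>, then \<open>tens \<mu>\<close> is torsion in the tensor product, hence zero there, and \<open>\<Theta>\<close> brings this back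
  to \<open>\<mu> \<in> WW\<close>.\<close>

theorem WW_saturated:
  assumes tf: "torsion_free R (tensor_module R M D)" and a: "regular a"
    and \<mu>: "\<mu> \<in> vec (A \<times> A)" and rows: "\<And>x. (\<lambda>j. \<mu> (x, j)) \<in> NN" and aW: "a *\<^sub>v \<mu> \<in> WW"
  shows "\<mu> \<in> WW"
proof -
  note ac = regular_carrier[OF a]
  have "F.mcong H (a \<odot>\<^bsub>F\<^esub> tens \<mu>) (tens (a *\<^sub>v \<mu>))"
    by (rule F.mcong_sym[OF H_submodule tens_scale[OF ac rows]])
  then have aH: "a \<odot>\<^bsub>F\<^esub> tens \<mu> \<in> H" by (rule F.mcong_mem[OF H_submodule _ tens_WW[OF aW]])
  have tf': "torsion_free R (quot_module F H)" using tf unfolding tensor_module_def Let_def .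
  have "\<forall>s\<in>carrier R. a \<otimes> s = \<zero> \<longrightarrow> s = \<zero>" using a unfolding regular_def by blast
  then have "tens \<mu> \<in> H"
    by (rule torsion_free_quotient[OF free_module_module H_submodule tf' ac _ tens_closed aH])
  then have T: "\<Theta> (tens \<mu>) \<in> WW" by (rule Theta_H)
  have "\<Theta> (tens \<mu>) -\<^sub>v (\<Theta> (tens \<mu>) -\<^sub>v \<mu>) \<in> WW" by (rule linsubD(5)[OF WW_linsub T Theta_tens[OF \<mu> rows]])
  moreover have "\<Theta> (tens \<mu>) -\<^sub>v (\<Theta> (tens \<mu>) -\<^sub>v \<mu>) = \<mu>"
    by (rule vdiff_vdiff[OF linsubD(1)[OF WW_linsub T] \<mu>])
  ultimately show ?thesis by simp
qed

end

section \<open>Localization\<close>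

text \<open>Evaluates operations on equivalence classes that are defined by unions over representatives.\<close>

lemma UN_pairs_const:
  assumes "\<And>a s x t. (a, s) \<in> V \<Longrightarrow> (x, t) \<in> W \<Longrightarrow> f a s x t = C" "(a0, s0) \<in> V" "(x0, t0) \<in> W"
  shows "(\<Union>(a, s)\<in>V. \<Union>(x, t)\<in>W. f a s x t) = C"
proof (intro equalityI subsetI)
  fix q assume "q \<in> (\<Union>(a, s)\<in>V. \<Union>(x, t)\<in>W. f a s x t)"
  then obtain a s x t where "(a, s) \<in> V" "(x, t) \<in> W" "q \<in> f a s x t" by blast
  then show "q \<in> C" using assms(1) by simp
next
  fix q assume "q \<in> C"
  then have "q \<in> f a0 s0 x0 t0" using assms by simp
  then show "q \<in> (\<Union>(a, s)\<in>V. \<Union>(x, t)\<in>W. f a s x t)" using assms(2,3) by blast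
qed

locale localization = module R M for R :: "'a ring" (structure) and M :: "('a, 'b) module" +
  fixes S :: "'a set"
  assumes S_carrier: "S \<subseteq> carrier R" and S_one: "\<one> \<in> S"
    and S_mult: "s \<in> S \<Longrightarrow> t \<in> S \<Longrightarrow> s \<otimes> t \<in> S"
begin

abbreviation L :: "(('a \<times> 'a) set, ('b \<times> 'a) set) module" where "L \<equiv> loc_module R S M"

definition frac :: "'b \<Rightarrow> 'a \<Rightarrow> ('b \<times> 'a) set" where
  "frac x s = frac_rel R S M `` {(x, s)}"

lemma Sc [simp]: "s \<in> S \<Longrightarrow> s \<in> carrier R" using S_carrier by blast

lemma frac_rel_iff: "((x, s), (y, t)) \<in> frac_rel R S M \<longleftrightarrow>
    x \<in> carrier M \<and> s \<in> S \<and> y \<in> carrier M \<and> t \<in> S \<and>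
    (\<exists>u\<in>S. u \<odot>\<^bsub>M\<^esub> (t \<odot>\<^bsub>M\<^esub> x) = u \<odot>\<^bsub>M\<^esub> (s \<odot>\<^bsub>M\<^esub> y))"
  by (simp add: frac_rel_def)

lemma frac_rel_trans:
  assumes "((x, s), (y, t)) \<in> frac_rel R S M" "((y, t), (z, w)) \<in> frac_rel R S M"
  shows "((x, s), (z, w)) \<in> frac_rel R S M"
proof -
  obtain u v where u: "u \<in> S" "u \<odot>\<^bsub>M\<^esub> (t \<odot>\<^bsub>M\<^esub> x) = u \<odot>\<^bsub>M\<^esub> (s \<odot>\<^bsub>M\<^esub> y)"
    and v: "v \<in> S" "v \<odot>\<^bsub>M\<^esub> (w \<odot>\<^bsub>M\<^esub> y) = v \<odot>\<^bsub>M\<^esub> (t \<odot>\<^bsub>M\<^esub> z)"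
    using assms by (auto simp: frac_rel_iff)
  have c: "x \<in> carrier M" "y \<in> carrier M" "z \<in> carrier M" "s \<in> S" "t \<in> S" "w \<in> S"
    using assms by (auto simp: frac_rel_iff)
  have k: "s \<in> carrier R" "t \<in> carrier R" "w \<in> carrier R" "u \<in> carrier R" "v \<in> carrier R"
    using c u(1) v(1) by auto
  have "(u \<otimes> v \<otimes> t) \<odot>\<^bsub>M\<^esub> (w \<odot>\<^bsub>M\<^esub> x) = (v \<otimes> w) \<odot>\<^bsub>M\<^esub> (u \<odot>\<^bsub>M\<^esub> (t \<odot>\<^bsub>M\<^esub> x))"
    using c k by (simp add: smult_assoc1[symmetric] R.m_ac)
  also have "\<dots> = (u \<otimes> s) \<odot>\<^bsub>M\<^esub> (v \<odot>\<^bsub>M\<^esub> (w \<odot>\<^bsub>M\<^esub> y))"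
    unfolding u(2) using c k by (simp add: smult_assoc1[symmetric] R.m_ac)
  also have "\<dots> = (u \<otimes> v \<otimes> t) \<odot>\<^bsub>M\<^esub> (s \<odot>\<^bsub>M\<^esub> z)"
    unfolding v(2) using c k by (simp add: smult_assoc1[symmetric] R.m_ac)
  finally show ?thesis using c S_mult[OF S_mult[OF u(1) v(1)] c(5)] by (auto simp: frac_rel_iff)
qed

lemma equiv_frac_rel: "equiv (carrier M \<times> S) (frac_rel R S M)"
proof (rule equivI)
  show "frac_rel R S M \<subseteq> (carrier M \<times> S) \<times> (carrier M \<times> S)" by (auto simp: frac_rel_def)
  show "refl_on (carrier M \<times> S) (frac_rel R S M)"
    unfolding refl_on_def using S_one by (auto simp: frac_rel_def)
  show "sym (frac_rel R S M)"
    unfolding sym_def by (auto simp: frac_rel_iff) metis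
  show "trans (frac_rel R S M)"
    unfolding trans_def using frac_rel_trans by auto
qed

lemma frac_eq_iff:
  assumes "x \<in> carrier M" "s \<in> S" "y \<in> carrier M" "t \<in> S"
  shows "frac x s = frac y t \<longleftrightarrow> (\<exists>u\<in>S. u \<odot>\<^bsub>M\<^esub> (t \<odot>\<^bsub>M\<^esub> x) = u \<odot>\<^bsub>M\<^esub> (s \<odot>\<^bsub>M\<^esub> y))"
  unfolding frac_def using eq_equiv_class_iff[OF equiv_frac_rel, of "(x, s)" "(y, t)"] assms
  by (simp add: frac_rel_iff)

lemma frac_eqI: "x \<in> carrier M \<Longrightarrow> s \<in> S \<Longrightarrow> y \<in> carrier M \<Longrightarrow> t \<in> S \<Longrightarrow> t \<odot>\<^bsub>M\<^esub> x = s \<odot>\<^bsub>M\<^esub> y \<Longrightarrow> frac x s = frac y t"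
  using frac_eq_iff S_one by metis

lemma carrier_L: "carrier L = {frac x s |x s. x \<in> carrier M \<and> s \<in> S}"
  unfolding loc_module_def frac_def quotient_def by auto

lemma frac_closed: "x \<in> carrier M \<Longrightarrow> s \<in> S \<Longrightarrow> frac x s \<in> carrier L"
  by (auto simp: carrier_L)

lemma zero_L: "\<zero>\<^bsub>L\<^esub> = frac \<zero>\<^bsub>M\<^esub> \<one>"
  by (simp add: loc_module_def frac_def)

lemma mem_frac: "(y, t) \<in> frac x s \<longleftrightarrow> ((x, s), (y, t)) \<in> frac_rel R S M"
  by (simp add: frac_def)

lemma frac_self: "x \<in> carrier M \<Longrightarrow> s \<in> S \<Longrightarrow> (x, s) \<in> frac x s"
  unfolding mem_frac frac_rel_iff using S_one by auto

lemma frac_mem_eq: "(y, t) \<in> frac x s \<Longrightarrow> y \<in> carrier M \<and> t \<in> S \<and> x \<in> carrier M \<and> s \<in> S \<and> frac y t = frac x s"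
  unfolding mem_frac using equiv_class_eq[OF equiv_frac_rel, of "(x, s)" "(y, t)"]
  by (auto simp: frac_def frac_rel_iff)

lemma frac_add:
  assumes x: "x \<in> carrier M" "s \<in> S" and y: "y \<in> carrier M" "t \<in> S"
  shows "frac x s \<oplus>\<^bsub>L\<^esub> frac y t = frac (t \<odot>\<^bsub>M\<^esub> x \<oplus>\<^bsub>M\<^esub> s \<odot>\<^bsub>M\<^esub> y) (s \<otimes> t)"
proof -
  have "frac (t' \<odot>\<^bsub>M\<^esub> x' \<oplus>\<^bsub>M\<^esub> s' \<odot>\<^bsub>M\<^esub> y') (s' \<otimes> t') = frac (t \<odot>\<^bsub>M\<^esub> x \<oplus>\<^bsub>M\<^esub> s \<odot>\<^bsub>M\<^esub> y) (s \<otimes> t)"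
    if mem: "(x', s') \<in> frac x s" "(y', t') \<in> frac y t" for x' s' y' t'
  proof -
    have c: "x' \<in> carrier M" "s' \<in> S" "y' \<in> carrier M" "t' \<in> S" using mem frac_mem_eq by blast+
    obtain u v where u: "u \<in> S" "u \<odot>\<^bsub>M\<^esub> (s' \<odot>\<^bsub>M\<^esub> x) = u \<odot>\<^bsub>M\<^esub> (s \<odot>\<^bsub>M\<^esub> x')"
      and v: "v \<in> S" "v \<odot>\<^bsub>M\<^esub> (t' \<odot>\<^bsub>M\<^esub> y) = v \<odot>\<^bsub>M\<^esub> (t \<odot>\<^bsub>M\<^esub> y')"
      using mem by (auto simp: mem_frac frac_rel_iff)
    have k: "s \<in> carrier R" "t \<in> carrier R" "s' \<in> carrier R" "t' \<in> carrier R" "u \<in> carrier R" "v \<in> carrier R"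
      using c x y u(1) v(1) by auto
    have 1: "(u \<otimes> v) \<odot>\<^bsub>M\<^esub> ((s \<otimes> t) \<odot>\<^bsub>M\<^esub> (t' \<odot>\<^bsub>M\<^esub> x')) = (u \<otimes> v) \<odot>\<^bsub>M\<^esub> ((s' \<otimes> t') \<odot>\<^bsub>M\<^esub> (t \<odot>\<^bsub>M\<^esub> x))"
    proof -
      have "(u \<otimes> v) \<odot>\<^bsub>M\<^esub> ((s \<otimes> t) \<odot>\<^bsub>M\<^esub> (t' \<odot>\<^bsub>M\<^esub> x')) = (v \<otimes> t \<otimes> t') \<odot>\<^bsub>M\<^esub> (u \<odot>\<^bsub>M\<^esub> (s \<odot>\<^bsub>M\<^esub> x'))"
        using c k by (simp add: smult_assoc1[symmetric] R.m_ac)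
      also have "\<dots> = (u \<otimes> v) \<odot>\<^bsub>M\<^esub> ((s' \<otimes> t') \<odot>\<^bsub>M\<^esub> (t \<odot>\<^bsub>M\<^esub> x))"
        unfolding u(2)[symmetric] using x k by (simp add: smult_assoc1[symmetric] R.m_ac)
      finally show ?thesis .
    qed
    have 2: "(u \<otimes> v) \<odot>\<^bsub>M\<^esub> ((s \<otimes> t) \<odot>\<^bsub>M\<^esub> (s' \<odot>\<^bsub>M\<^esub> y')) = (u \<otimes> v) \<odot>\<^bsub>M\<^esub> ((s' \<otimes> t') \<odot>\<^bsub>M\<^esub> (s \<odot>\<^bsub>M\<^esub> y))"
    proof -
      have "(u \<otimes> v) \<odot>\<^bsub>M\<^esub> ((s \<otimes> t) \<odot>\<^bsub>M\<^esub> (s' \<odot>\<^bsub>M\<^esub> y')) = (u \<otimes> s \<otimes> s') \<odot>\<^bsub>M\<^esub> (v \<odot>\<^bsub>M\<^esub> (t \<odot>\<^bsub>M\<^esub> y'))"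
        using c k by (simp add: smult_assoc1[symmetric] R.m_ac)
      also have "\<dots> = (u \<otimes> v) \<odot>\<^bsub>M\<^esub> ((s' \<otimes> t') \<odot>\<^bsub>M\<^esub> (s \<odot>\<^bsub>M\<^esub> y))"
        unfolding v(2)[symmetric] using y k by (simp add: smult_assoc1[symmetric] R.m_ac)
      finally show ?thesis .
    qed
    have "(u \<otimes> v) \<odot>\<^bsub>M\<^esub> ((s \<otimes> t) \<odot>\<^bsub>M\<^esub> (t' \<odot>\<^bsub>M\<^esub> x' \<oplus>\<^bsub>M\<^esub> s' \<odot>\<^bsub>M\<^esub> y'))
        = (u \<otimes> v) \<odot>\<^bsub>M\<^esub> ((s' \<otimes> t') \<odot>\<^bsub>M\<^esub> (t \<odot>\<^bsub>M\<^esub> x \<oplus>\<^bsub>M\<^esub> s \<odot>\<^bsub>M\<^esub> y))"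
      using 1 2 c x y k by (simp add: smult_r_distr)
    then show ?thesis
      using frac_eq_iff[of "t' \<odot>\<^bsub>M\<^esub> x' \<oplus>\<^bsub>M\<^esub> s' \<odot>\<^bsub>M\<^esub> y'" "s' \<otimes> t'" "t \<odot>\<^bsub>M\<^esub> x \<oplus>\<^bsub>M\<^esub> s \<odot>\<^bsub>M\<^esub> y" "s \<otimes> t"]
        S_mult[OF u(1) v(1)] S_mult[OF c(2,4)] S_mult[OF x(2) y(2)] c x y k by auto
  qed
  then have "(\<Union>(x', s')\<in>frac x s. \<Union>(y', t')\<in>frac y t.
      frac (t' \<odot>\<^bsub>M\<^esub> x' \<oplus>\<^bsub>M\<^esub> s' \<odot>\<^bsub>M\<^esub> y') (s' \<otimes> t')) = frac (t \<odot>\<^bsub>M\<^esub> x \<oplus>\<^bsub>M\<^esub> s \<odot>\<^bsub>M\<^esub> y) (s \<otimes> t)"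
    by (rule UN_pairs_const[OF _ frac_self[OF x] frac_self[OF y]])
  then show ?thesis by (simp add: loc_module_def frac_def)
qed

end


lemma self_module_simps:
  "carrier (self_module R) = carrier R" "zero (self_module R) = zero R" "add (self_module R) = add R"
  "smult (self_module R) = mult R"
  by (simp_all add: self_module_def)

lemma self_module_module:
  fixes R :: "'a ring" (structure)
  assumes "cring R" shows "module R (self_module R)"
proof -
  interpret cring R by fact
  show ?thesis
  proof (rule moduleI)
    show "abelian_group (self_module R)"
    proof (rule abelian_groupI)
      show "\<exists>y\<in>carrier (self_module R). y \<oplus>\<^bsub>self_module R\<^esub> x = \<zero>\<^bsub>self_module R\<^esub>"
        if "x \<in> carrier (self_module R)" for x
        using that by (intro bexI[of _ "\<ominus> x"]) (auto simp: self_module_simps l_neg)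
    qed (auto simp: self_module_simps a_ac)
  qed (auto simp: self_module_simps l_distr r_distr m_assoc is_cring)
qed

context localization
begin

interpretation R0: localization R "self_module R" S
  by (intro localization.intro self_module_module localization_axioms.intro)
    (auto simp: R.is_cring S_carrier S_one S_mult)

abbreviation rfrac :: "'a \<Rightarrow> 'a \<Rightarrow> ('a \<times> 'a) set" where "rfrac \<equiv> R0.frac"

lemma frac_smult:
  assumes a: "a \<in> carrier R" "s \<in> S" and x: "x \<in> carrier M" "t \<in> S"
  shows "rfrac a s \<odot>\<^bsub>L\<^esub> frac x t = frac (a \<odot>\<^bsub>M\<^esub> x) (s \<otimes> t)"
proof -
  have "frac (a' \<odot>\<^bsub>M\<^esub> x') (s' \<otimes> t') = frac (a \<odot>\<^bsub>M\<^esub> x) (s \<otimes> t)"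
    if mem: "(a', s') \<in> rfrac a s" "(x', t') \<in> frac x t" for a' s' x' t'
  proof -
    have c: "a' \<in> carrier R" "s' \<in> S" "x' \<in> carrier M" "t' \<in> S"
      using R0.frac_mem_eq[OF mem(1)] frac_mem_eq[OF mem(2)] by (auto simp: self_module_simps)
    obtain u v where u: "u \<in> S" "u \<otimes> (s' \<otimes> a) = u \<otimes> (s \<otimes> a')"
      and v: "v \<in> S" "v \<odot>\<^bsub>M\<^esub> (t' \<odot>\<^bsub>M\<^esub> x) = v \<odot>\<^bsub>M\<^esub> (t \<odot>\<^bsub>M\<^esub> x')"
      using mem by (auto simp: mem_frac frac_rel_iff R0.mem_frac R0.frac_rel_iff self_module_simps)
    have k: "s \<in> carrier R" "t \<in> carrier R" "s' \<in> carrier R" "t' \<in> carrier R" "u \<in> carrier R" "v \<in> carrier R"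
      using c a x u(1) v(1) by auto
    have "(u \<otimes> v) \<odot>\<^bsub>M\<^esub> ((s \<otimes> t) \<odot>\<^bsub>M\<^esub> (a' \<odot>\<^bsub>M\<^esub> x')) = (u \<otimes> (s \<otimes> a')) \<odot>\<^bsub>M\<^esub> (v \<odot>\<^bsub>M\<^esub> (t \<odot>\<^bsub>M\<^esub> x'))"
      using c k by (simp add: smult_assoc1[symmetric] R.m_ac)
    also have "\<dots> = (u \<otimes> v) \<odot>\<^bsub>M\<^esub> ((s' \<otimes> t') \<odot>\<^bsub>M\<^esub> (a \<odot>\<^bsub>M\<^esub> x))"
      unfolding u(2)[symmetric] v(2)[symmetric] using a x k by (simp add: smult_assoc1[symmetric] R.m_ac)
    finally show ?thesis
      using frac_eq_iff[of "a' \<odot>\<^bsub>M\<^esub> x'" "s' \<otimes> t'" "a \<odot>\<^bsub>M\<^esub> x" "s \<otimes> t"]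
        S_mult[OF u(1) v(1)] S_mult[OF c(2,4)] S_mult[OF a(2) x(2)] c a x by auto
  qed
  moreover have "(a, s) \<in> rfrac a s" using R0.frac_self a by (simp add: self_module_simps)
  ultimately have "(\<Union>(a', s')\<in>rfrac a s. \<Union>(x', t')\<in>frac x t. frac (a' \<odot>\<^bsub>M\<^esub> x') (s' \<otimes> t'))
      = frac (a \<odot>\<^bsub>M\<^esub> x) (s \<otimes> t)"
    by (rule UN_pairs_const[OF _ _ frac_self[OF x]])
  then show ?thesis by (simp add: loc_module_def frac_def)
qed

abbreviation Rp :: "('a \<times> 'a) set ring" where "Rp \<equiv> loc_ring R S"

lemma Rp_simps:
  "carrier Rp = {rfrac a s |a s. a \<in> carrier R \<and> s \<in> S}"
  "\<zero>\<^bsub>Rp\<^esub> = rfrac \<zero> \<one>" "\<one>\<^bsub>Rp\<^esub> = rfrac \<one> \<one>"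
  unfolding loc_ring_def Let_def using R0.carrier_L R0.zero_L
  by (simp_all add: self_module_simps R0.frac_def)

lemma Rp_add: "a \<in> carrier R \<Longrightarrow> s \<in> S \<Longrightarrow> b \<in> carrier R \<Longrightarrow> t \<in> S \<Longrightarrow>
    rfrac a s \<oplus>\<^bsub>Rp\<^esub> rfrac b t = rfrac (t \<otimes> a \<oplus> s \<otimes> b) (s \<otimes> t)"
  unfolding loc_ring_def Let_def using R0.frac_add[of a s b t] by (simp add: self_module_simps)

lemma rfrac_eqI: "a \<in> carrier R \<Longrightarrow> s \<in> S \<Longrightarrow> b \<in> carrier R \<Longrightarrow> t \<in> S \<Longrightarrow> t \<otimes> a = s \<otimes> b \<Longrightarrow> rfrac a s = rfrac b t"
  using R0.frac_eqI[of a s b t] by (simp add: self_module_simps)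

lemma rfrac_zeroD: assumes "a \<in> carrier R" "rfrac a \<one> = rfrac \<zero> \<one>" shows "\<exists>u\<in>S. u \<otimes> a = \<zero>"
  using R0.frac_eq_iff[of a \<one> \<zero> \<one>] assms S_one by (auto simp: self_module_simps)

end

lemma (in localization) Rp_mult:
  assumes "a \<in> carrier R" "s \<in> S" "b \<in> carrier R" "t \<in> S"
  shows "localization.frac R (self_module R) S a s \<otimes>\<^bsub>Rp\<^esub> localization.frac R (self_module R) S b t
    = localization.frac R (self_module R) S (a \<otimes> b) (s \<otimes> t)"
proof -
  interpret R0: localization R "self_module R" S
    by (intro localization.intro self_module_module localization_axioms.intro)
      (auto simp: R.is_cring S_carrier S_one S_mult)
  show ?thesis
    unfolding loc_ring_def Let_def using R0.frac_smult[of a s b t] assms by (simp add: self_module_simps)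
qed

context localization
begin

interpretation R0: localization R "self_module R" S
  by (intro localization.intro self_module_module localization_axioms.intro)
    (auto simp: R.is_cring S_carrier S_one S_mult)

lemma rfrac_closed: "a \<in> carrier R \<Longrightarrow> s \<in> S \<Longrightarrow> rfrac a s \<in> carrier Rp"
  by (auto simp: Rp_simps)

lemma Rp_laws:
  assumes "g \<in> carrier Rp"
  shows "g \<otimes>\<^bsub>Rp\<^esub> \<one>\<^bsub>Rp\<^esub> = g" "g \<otimes>\<^bsub>Rp\<^esub> \<zero>\<^bsub>Rp\<^esub> = \<zero>\<^bsub>Rp\<^esub>" "\<zero>\<^bsub>Rp\<^esub> \<otimes>\<^bsub>Rp\<^esub> g = \<zero>\<^bsub>Rp\<^esub>"
    "g \<oplus>\<^bsub>Rp\<^esub> \<zero>\<^bsub>Rp\<^esub> = g" "\<zero>\<^bsub>Rp\<^esub> \<oplus>\<^bsub>Rp\<^esub> g = g"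
proof -
  obtain a s where g: "g = rfrac a s" "a \<in> carrier R" "s \<in> S" using assms by (auto simp: Rp_simps)
  have m: "rfrac a s \<otimes>\<^bsub>Rp\<^esub> rfrac b t = rfrac (a \<otimes> b) (s \<otimes> t)"
    "rfrac b t \<otimes>\<^bsub>Rp\<^esub> rfrac a s = rfrac (b \<otimes> a) (t \<otimes> s)" if "b \<in> carrier R" "t \<in> S" for b t
    using Rp_mult[OF g(2,3) that] Rp_mult[OF that g(2,3)] by auto
  show "g \<otimes>\<^bsub>Rp\<^esub> \<one>\<^bsub>Rp\<^esub> = g" using g m(1)[OF R.one_closed S_one] by (simp add: Rp_simps)
  show "g \<otimes>\<^bsub>Rp\<^esub> \<zero>\<^bsub>Rp\<^esub> = \<zero>\<^bsub>Rp\<^esub>" using g m(1)[OF R.zero_closed S_one] S_one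
    by (simp add: Rp_simps) (intro rfrac_eqI, auto)
  show "\<zero>\<^bsub>Rp\<^esub> \<otimes>\<^bsub>Rp\<^esub> g = \<zero>\<^bsub>Rp\<^esub>" using g m(2)[OF R.zero_closed S_one] S_one
    by (simp add: Rp_simps) (intro rfrac_eqI, auto)
  show "g \<oplus>\<^bsub>Rp\<^esub> \<zero>\<^bsub>Rp\<^esub> = g" using g S_one by (simp add: Rp_simps Rp_add)
  show "\<zero>\<^bsub>Rp\<^esub> \<oplus>\<^bsub>Rp\<^esub> g = g" using g S_one by (simp add: Rp_simps Rp_add)
qed

text \<open>The consequences of freeness of the localized module in terms of \<open>M\<close>: representatives \<open>e\<close> of a basis
  generate \<open>M\<close> up to multiples by elements of \<open>S\<close>, and the coefficients of a relation between them are
  killed by elements of \<open>S\<close>.\<close>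

lemma localized_basis:
  assumes "module_iso Rp L (free_module Rp {..<r :: nat})"
  shows "\<exists>e. (\<forall>i<r. e i \<in> carrier M) \<and>
    (\<forall>x\<in>carrier M. \<exists>s\<in>S. \<exists>c. (\<forall>i. c i \<in> carrier R) \<and> s \<odot>\<^bsub>M\<^esub> x = (\<Oplus>\<^bsub>M\<^esub>i\<in>{..<r}. c i \<odot>\<^bsub>M\<^esub> e i)) \<and>
    (\<forall>c. (\<forall>i. c i \<in> carrier R) \<and> (\<Oplus>\<^bsub>M\<^esub>i\<in>{..<r}. c i \<odot>\<^bsub>M\<^esub> e i) = \<zero>\<^bsub>M\<^esub> \<longrightarrow> (\<forall>i<r. \<exists>u\<in>S. u \<otimes> c i = \<zero>))"
proof -
  let ?V = "free_module Rp {..<r}"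
  obtain \<theta> where \<theta>: "\<theta> \<in> lin_maps Rp L ?V" "bij_betw \<theta> (carrier L) (carrier ?V)"
    using assms by (auto simp: module_iso_def)
  have V: "f \<in> carrier ?V \<longleftrightarrow> f \<in> {..<r} \<rightarrow>\<^sub>E carrier Rp" for f by (simp add: free_module_def)
  have one: "\<one>\<^bsub>Rp\<^esub> \<in> carrier Rp" and zero: "\<zero>\<^bsub>Rp\<^esub> \<in> carrier Rp" using S_one by (auto simp: Rp_simps)
  have \<theta>c: "\<theta> X j \<in> carrier Rp" if "X \<in> carrier L" "j < r" for X j
    using lin_mapsD(1)[OF \<theta>(1) that(1)] that(2) by (auto simp: V)
  have \<theta>add: "\<theta> (X \<oplus>\<^bsub>L\<^esub> Y) j = \<theta> X j \<oplus>\<^bsub>Rp\<^esub> \<theta> Y j" if "X \<in> carrier L" "Y \<in> carrier L" "j < r" for X Y j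
    using lin_mapsD(2)[OF \<theta>(1) that(1,2)] that(3) by (simp add: free_module_def)
  have \<theta>smult: "\<theta> (g \<odot>\<^bsub>L\<^esub> X) j = g \<otimes>\<^bsub>Rp\<^esub> \<theta> X j" if "g \<in> carrier Rp" "X \<in> carrier L" "j < r" for g X j
    using lin_mapsD(3)[OF \<theta>(1) that(1,2)] that(3) by (simp add: free_module_def)
  have \<theta>inj: "X = Y" if "X \<in> carrier L" "Y \<in> carrier L" "\<And>j. j < r \<Longrightarrow> \<theta> X j = \<theta> Y j" for X Y
  proof -
    have "\<theta> X = \<theta> Y"
      using lin_mapsD(1)[OF \<theta>(1) that(1)] lin_mapsD(1)[OF \<theta>(1) that(2)] that(3)
      unfolding V by (intro PiE_ext) auto
    then show ?thesis using \<theta>(2) that(1,2) by (auto simp: bij_betw_def inj_on_def)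
  qed
  have "\<exists>x t. x \<in> carrier M \<and> t \<in> S \<and> (\<forall>j<r. \<theta> (frac x t) j = (if j = i then \<one>\<^bsub>Rp\<^esub> else \<zero>\<^bsub>Rp\<^esub>))" for i
  proof -
    have "(\<lambda>j\<in>{..<r}. if j = i then \<one>\<^bsub>Rp\<^esub> else \<zero>\<^bsub>Rp\<^esub>) \<in> carrier ?V"
      using one zero by (auto simp: V)
    then have "(\<lambda>j\<in>{..<r}. if j = i then \<one>\<^bsub>Rp\<^esub> else \<zero>\<^bsub>Rp\<^esub>) \<in> \<theta> ` carrier L"
      unfolding bij_betw_imp_surj_on[OF \<theta>(2)] .
    then obtain X where X: "(\<lambda>j\<in>{..<r}. if j = i then \<one>\<^bsub>Rp\<^esub> else \<zero>\<^bsub>Rp\<^esub>) = \<theta> X" "X \<in> carrier L"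
      by (rule imageE)
    obtain x t where xt: "X = frac x t" "x \<in> carrier M" "t \<in> S" using X(2) unfolding carrier_L by blast
    have "\<theta> (frac x t) j = (if j = i then \<one>\<^bsub>Rp\<^esub> else \<zero>\<^bsub>Rp\<^esub>)" if "j < r" for j
      using fun_cong[OF X(1), of j] that by (simp add: xt(1))
    then show ?thesis using xt(2,3) by blast
  qed
  then obtain e t where et: "\<And>i. e i \<in> carrier M" "\<And>i. t i \<in> S"
    "\<And>i j. j < r \<Longrightarrow> \<theta> (frac (e i) (t i)) j = (if j = i then \<one>\<^bsub>Rp\<^esub> else \<zero>\<^bsub>Rp\<^esub>)" by metis
  have \<theta>zero: "\<theta> (frac \<zero>\<^bsub>M\<^esub> \<one>) j = \<zero>\<^bsub>Rp\<^esub>" if "j < r" for j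
  proof -
    have z: "frac \<zero>\<^bsub>M\<^esub> \<one> \<in> carrier L" using frac_closed S_one by simp
    have "rfrac \<zero> \<one> \<odot>\<^bsub>L\<^esub> frac \<zero>\<^bsub>M\<^esub> \<one> = frac \<zero>\<^bsub>M\<^esub> \<one>" using frac_smult[of \<zero> \<one> "\<zero>\<^bsub>M\<^esub>" \<one>] S_one by simp
    then show ?thesis using \<theta>smult[OF zero z that] Rp_laws(3)[OF \<theta>c[OF z that]] by (simp add: Rp_simps)
  qed
  have span: "\<exists>s\<in>S. \<exists>c. (\<forall>i. c i \<in> carrier R) \<and> s \<odot>\<^bsub>M\<^esub> x = (\<Oplus>\<^bsub>M\<^esub>i\<in>{..<r}. c i \<odot>\<^bsub>M\<^esub> e i)"
    if x: "x \<in> carrier M" for x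
  proof -
    have xL: "frac x \<one> \<in> carrier L" using frac_closed[OF x S_one] .
    have "\<exists>c s. c \<in> carrier R \<and> s \<in> S \<and> (i < r \<longrightarrow> \<theta> (frac x \<one>) i = rfrac c s)" for i
    proof (cases "i < r")
      case True then show ?thesis using \<theta>c[OF xL True] by (auto simp: Rp_simps)
    next
      case False then show ?thesis using S_one R.zero_closed by blast
    qed
    then obtain c s where cs: "\<And>i. c i \<in> carrier R" "\<And>i. s i \<in> S" "\<And>i. i < r \<Longrightarrow> \<theta> (frac x \<one>) i = rfrac (c i) (s i)"
      by metis
    have "\<exists>w\<in>S. \<exists>b. (\<forall>i. b i \<in> carrier R) \<and>
        (\<forall>j<r. \<theta> (frac (\<Oplus>\<^bsub>M\<^esub>i\<in>{..<k}. b i \<odot>\<^bsub>M\<^esub> e i) w) j = (if j < k then \<theta> (frac x \<one>) j else \<zero>\<^bsub>Rp\<^esub>))"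
      if "k \<le> r" for k
      using that
    proof (induction k)
      case 0
      show ?case using \<theta>zero S_one by (intro bexI[of _ \<one>] exI[of _ "\<lambda>_. \<zero>"]) auto
    next
      case (Suc k)
      then obtain w b where w: "w \<in> S" "\<And>i. b i \<in> carrier R"
        "\<And>j. j < r \<Longrightarrow> \<theta> (frac (\<Oplus>\<^bsub>M\<^esub>i\<in>{..<k}. b i \<odot>\<^bsub>M\<^esub> e i) w) j = (if j < k then \<theta> (frac x \<one>) j else \<zero>\<^bsub>Rp\<^esub>)"
        by auto
      let ?y = "\<Oplus>\<^bsub>M\<^esub>i\<in>{..<k}. b i \<odot>\<^bsub>M\<^esub> e i"
      define v where "v = s k \<otimes> t k"
      define b' where "b' i = (if i < k then v \<otimes> b i else w \<otimes> c k)" for i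
      have v: "v \<in> S" unfolding v_def using S_mult cs(2) et(2) by simp
      have y: "?y \<in> carrier M" by (rule M.finsum_closed) (use w et in auto)
      have yL: "frac ?y w \<in> carrier L" by (rule frac_closed[OF y w(1)])
      have kL: "rfrac (c k) (s k) \<odot>\<^bsub>L\<^esub> frac (e k) (t k) = frac (c k \<odot>\<^bsub>M\<^esub> e k) v"
        unfolding v_def by (rule frac_smult[OF cs(1,2) et(1,2)])
      have kL': "frac (c k \<odot>\<^bsub>M\<^esub> e k) v \<in> carrier L" by (rule frac_closed) (use cs et v in auto)
      have sum: "(\<Oplus>\<^bsub>M\<^esub>i\<in>{..<Suc k}. b' i \<odot>\<^bsub>M\<^esub> e i) = v \<odot>\<^bsub>M\<^esub> ?y \<oplus>\<^bsub>M\<^esub> w \<odot>\<^bsub>M\<^esub> (c k \<odot>\<^bsub>M\<^esub> e k)"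
      proof -
        have "(\<Oplus>\<^bsub>M\<^esub>i\<in>{..<Suc k}. b' i \<odot>\<^bsub>M\<^esub> e i) = b' k \<odot>\<^bsub>M\<^esub> e k \<oplus>\<^bsub>M\<^esub> (\<Oplus>\<^bsub>M\<^esub>i\<in>{..<k}. b' i \<odot>\<^bsub>M\<^esub> e i)"
          unfolding lessThan_Suc by (rule M.finsum_insert) (use w cs et v in \<open>auto simp: b'_def\<close>)
        also have "(\<Oplus>\<^bsub>M\<^esub>i\<in>{..<k}. b' i \<odot>\<^bsub>M\<^esub> e i) = (\<Oplus>\<^bsub>M\<^esub>i\<in>{..<k}. v \<odot>\<^bsub>M\<^esub> (b i \<odot>\<^bsub>M\<^esub> e i))"
          by (rule M.finsum_cong') (use w et v in \<open>auto simp: b'_def smult_assoc1\<close>)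
        also have "\<dots> = v \<odot>\<^bsub>M\<^esub> ?y" by (rule finsum_smult_ldistr[symmetric]) (use w et v in auto)
        also have "b' k \<odot>\<^bsub>M\<^esub> e k = w \<odot>\<^bsub>M\<^esub> (c k \<odot>\<^bsub>M\<^esub> e k)" using w cs et by (simp add: b'_def smult_assoc1)
        finally show ?thesis using y w cs et v by (simp add: M.a_comm)
      qed
      have "\<theta> (frac (\<Oplus>\<^bsub>M\<^esub>i\<in>{..<Suc k}. b' i \<odot>\<^bsub>M\<^esub> e i) (w \<otimes> v)) j = (if j < Suc k then \<theta> (frac x \<one>) j else \<zero>\<^bsub>Rp\<^esub>)"
        if j: "j < r" for j
      proof -
        have "frac (\<Oplus>\<^bsub>M\<^esub>i\<in>{..<Suc k}. b' i \<odot>\<^bsub>M\<^esub> e i) (w \<otimes> v) = frac ?y w \<oplus>\<^bsub>L\<^esub> frac (c k \<odot>\<^bsub>M\<^esub> e k) v"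
          unfolding sum by (rule frac_add[symmetric]) (use y w v cs et in auto)
        then have "\<theta> (frac (\<Oplus>\<^bsub>M\<^esub>i\<in>{..<Suc k}. b' i \<odot>\<^bsub>M\<^esub> e i) (w \<otimes> v)) j
            = \<theta> (frac ?y w) j \<oplus>\<^bsub>Rp\<^esub> \<theta> (frac (c k \<odot>\<^bsub>M\<^esub> e k) v) j" using \<theta>add[OF yL kL' j] by simp
        also have "\<theta> (frac (c k \<odot>\<^bsub>M\<^esub> e k) v) j = \<theta> (frac x \<one>) k \<otimes>\<^bsub>Rp\<^esub> (if j = k then \<one>\<^bsub>Rp\<^esub> else \<zero>\<^bsub>Rp\<^esub>)"
        proof -
          have "\<theta> (frac (c k \<odot>\<^bsub>M\<^esub> e k) v) j = rfrac (c k) (s k) \<otimes>\<^bsub>Rp\<^esub> \<theta> (frac (e k) (t k)) j"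
            unfolding kL[symmetric] by (rule \<theta>smult[OF rfrac_closed[OF cs(1,2)] frac_closed[OF et(1,2)] j])
          then show ?thesis using cs(3)[of k] et(3)[OF j] Suc.prems by simp
        qed
        finally have eq: "\<theta> (frac (\<Oplus>\<^bsub>M\<^esub>i\<in>{..<Suc k}. b' i \<odot>\<^bsub>M\<^esub> e i) (w \<otimes> v)) j
            = (if j < k then \<theta> (frac x \<one>) j else \<zero>\<^bsub>Rp\<^esub>) \<oplus>\<^bsub>Rp\<^esub>
              \<theta> (frac x \<one>) k \<otimes>\<^bsub>Rp\<^esub> (if j = k then \<one>\<^bsub>Rp\<^esub> else \<zero>\<^bsub>Rp\<^esub>)" using w(3)[OF j] by simp
        have k: "\<theta> (frac x \<one>) k \<in> carrier Rp" using \<theta>c[OF xL] Suc.prems by simp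
        consider "j < k" | "j = k" | "k < j" by linarith
        then show ?thesis unfolding eq
          by cases (simp_all add: Rp_laws(1,2)[OF k] Rp_laws(4,5)[OF k] Rp_laws(4)[OF \<theta>c[OF xL j]] Rp_laws(4)[OF zero])
      qed
      moreover have "b' i \<in> carrier R" for i using w cs v by (auto simp: b'_def)
      ultimately show ?case using S_mult[OF w(1) v] by blast
    qed
    from this[OF order_refl] obtain w b where w: "w \<in> S" "\<And>i. b i \<in> carrier R"
      "\<And>j. j < r \<Longrightarrow> \<theta> (frac (\<Oplus>\<^bsub>M\<^esub>i\<in>{..<r}. b i \<odot>\<^bsub>M\<^esub> e i) w) j = \<theta> (frac x \<one>) j" by auto
    let ?y = "\<Oplus>\<^bsub>M\<^esub>i\<in>{..<r}. b i \<odot>\<^bsub>M\<^esub> e i"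
    have y: "?y \<in> carrier M" by (rule M.finsum_closed) (use w et in auto)
    have "frac ?y w = frac x \<one>" by (rule \<theta>inj[OF frac_closed[OF y w(1)] xL w(3)])
    then obtain u where u: "u \<in> S" "u \<odot>\<^bsub>M\<^esub> (\<one> \<odot>\<^bsub>M\<^esub> ?y) = u \<odot>\<^bsub>M\<^esub> (w \<odot>\<^bsub>M\<^esub> x)"
      using frac_eq_iff[OF y w(1) x S_one] by blast
    have "(u \<otimes> w) \<odot>\<^bsub>M\<^esub> x = u \<odot>\<^bsub>M\<^esub> ?y" using u w x y by (simp add: smult_assoc1)
    also have "\<dots> = (\<Oplus>\<^bsub>M\<^esub>i\<in>{..<r}. u \<odot>\<^bsub>M\<^esub> (b i \<odot>\<^bsub>M\<^esub> e i))"
      by (rule finsum_smult_ldistr) (use u w et in auto)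
    also have "\<dots> = (\<Oplus>\<^bsub>M\<^esub>i\<in>{..<r}. (u \<otimes> b i) \<odot>\<^bsub>M\<^esub> e i)"
      by (rule M.finsum_cong') (use u w et in \<open>auto simp: smult_assoc1\<close>)
    finally have "(u \<otimes> w) \<odot>\<^bsub>M\<^esub> x = (\<Oplus>\<^bsub>M\<^esub>i\<in>{..<r}. (u \<otimes> b i) \<odot>\<^bsub>M\<^esub> e i)" .
    then show ?thesis using S_mult[OF u(1) w(1)] u w
      by (intro bexI[of _ "u \<otimes> w"] exI[of _ "\<lambda>i. u \<otimes> b i"]) auto
  qed
  have indep: "\<exists>u\<in>S. u \<otimes> c i = \<zero>"
    if c: "\<And>i. c i \<in> carrier R" "(\<Oplus>\<^bsub>M\<^esub>i\<in>{..<r}. c i \<odot>\<^bsub>M\<^esub> e i) = \<zero>\<^bsub>M\<^esub>" and i: "i < r" for c i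
  proof -
    have "\<theta> (frac (\<Oplus>\<^bsub>M\<^esub>i\<in>{..<k}. c i \<odot>\<^bsub>M\<^esub> e i) \<one>) j = (if j < k then rfrac (c j \<otimes> t j) \<one> else \<zero>\<^bsub>Rp\<^esub>)"
      if "k \<le> r" "j < r" for k j
      using that
    proof (induction k)
      case 0 then show ?case using \<theta>zero by simp
    next
      case (Suc k)
      let ?y = "\<Oplus>\<^bsub>M\<^esub>i\<in>{..<k}. c i \<odot>\<^bsub>M\<^esub> e i"
      have y: "?y \<in> carrier M" by (rule M.finsum_closed) (use c et in auto)
      have ce: "c k \<odot>\<^bsub>M\<^esub> e k \<in> carrier M" using c et by simp
      have ct: "c k \<otimes> t k \<in> carrier R" "c j \<otimes> t j \<in> carrier R" using c et by auto
      have "(\<Oplus>\<^bsub>M\<^esub>i\<in>{..<Suc k}. c i \<odot>\<^bsub>M\<^esub> e i) = c k \<odot>\<^bsub>M\<^esub> e k \<oplus>\<^bsub>M\<^esub> ?y"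
        unfolding lessThan_Suc by (rule M.finsum_insert) (use c et in auto)
      then have "frac (\<Oplus>\<^bsub>M\<^esub>i\<in>{..<Suc k}. c i \<odot>\<^bsub>M\<^esub> e i) \<one> = frac ?y \<one> \<oplus>\<^bsub>L\<^esub> frac (c k \<odot>\<^bsub>M\<^esub> e k) \<one>"
        using frac_add[OF y S_one ce S_one] y ce by (simp add: M.a_comm)
      moreover have "frac (c k \<odot>\<^bsub>M\<^esub> e k) \<one> = rfrac (c k \<otimes> t k) \<one> \<odot>\<^bsub>L\<^esub> frac (e k) (t k)"
      proof -
        have "rfrac (c k \<otimes> t k) \<one> \<odot>\<^bsub>L\<^esub> frac (e k) (t k) = frac ((c k \<otimes> t k) \<odot>\<^bsub>M\<^esub> e k) (t k)"
          using frac_smult[OF ct(1) S_one et(1,2)] et by simp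
        also have "\<dots> = frac (c k \<odot>\<^bsub>M\<^esub> e k) \<one>"
          by (rule frac_eqI) (use c et S_one ct in \<open>auto simp: smult_assoc1[symmetric] R.m_comm\<close>)
        finally show ?thesis by simp
      qed
      moreover have IH: "\<theta> (frac ?y \<one>) j = (if j < k then rfrac (c j \<otimes> t j) \<one> else \<zero>\<^bsub>Rp\<^esub>)"
        by (rule Suc.IH) (use Suc.prems in auto)
      ultimately have eq: "\<theta> (frac (\<Oplus>\<^bsub>M\<^esub>i\<in>{..<Suc k}. c i \<odot>\<^bsub>M\<^esub> e i) \<one>) j
          = (if j < k then rfrac (c j \<otimes> t j) \<one> else \<zero>\<^bsub>Rp\<^esub>) \<oplus>\<^bsub>Rp\<^esub>
            rfrac (c k \<otimes> t k) \<one> \<otimes>\<^bsub>Rp\<^esub> (if j = k then \<one>\<^bsub>Rp\<^esub> else \<zero>\<^bsub>Rp\<^esub>)"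
        using \<theta>add[OF frac_closed[OF y S_one] frac_closed[OF ce S_one] Suc.prems(2)]
          \<theta>smult[OF rfrac_closed[OF ct(1) S_one] frac_closed[OF et(1)[of k] et(2)[of k]] Suc.prems(2)]
          et(3)[OF Suc.prems(2), of k] by simp
      note k = rfrac_closed[OF ct(1) S_one] and j = rfrac_closed[OF ct(2) S_one]
      consider "j < k" | "j = k" | "k < j" by linarith
      then show ?case unfolding eq
        by cases (simp_all add: Rp_laws(1,2)[OF k] Rp_laws(4,5)[OF k] Rp_laws(4)[OF j] Rp_laws(4)[OF zero])
    qed
    from this[OF order_refl i] have "rfrac (c i \<otimes> t i) \<one> = rfrac \<zero> \<one>"
      using c(2) \<theta>zero[OF i] i by (simp add: Rp_simps)
    then obtain u where u: "u \<in> S" "u \<otimes> (c i \<otimes> t i) = \<zero>" using rfrac_zeroD[of "c i \<otimes> t i"] c et by auto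
    have "(u \<otimes> t i) \<otimes> c i = \<zero>" using u c et Sc[OF u(1)] Sc[OF et(2)[of i]] by (simp add: R.m_ac)
    then show ?thesis using S_mult[OF u(1) et(2)] by blast
  qed
  show ?thesis using et(1) span indep by (intro exI[of _ e]) blast
qed

end

section \<open>Comparing the rank with the number of generators\<close>

context cring
begin

lemma vec_induct [consumes 2, case_names zero unit add scale]:
  assumes X: "finite X" and v: "v \<in> vec X" and "P vzero" "\<And>x. x \<in> X \<Longrightarrow> P (unitv x)"
    "\<And>u w. u \<in> vec X \<Longrightarrow> w \<in> vec X \<Longrightarrow> P u \<Longrightarrow> P w \<Longrightarrow> P (u +\<^sub>v w)"
    "\<And>r u. r \<in> carrier R \<Longrightarrow> u \<in> vec X \<Longrightarrow> P u \<Longrightarrow> P (r *\<^sub>v u)"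
  shows "P v"
proof -
  have vc: "v i \<in> carrier R" for i by (rule vec_closed[OF v])
  have "P (\<lambda>i. if i \<in> Y then v i else \<zero>)" if "finite Y" "Y \<subseteq> X" for Y
    using that
  proof (induction Y)
    case empty
    have "(\<lambda>i. if i \<in> {} then v i else \<zero>) = vzero" by (rule vec_eqI) simp
    then show ?case using assms(3) by simp
  next
    case (insert y Y)
    have e: "(\<lambda>i. if i \<in> insert y Y then v i else \<zero>) = v y *\<^sub>v unitv y +\<^sub>v (\<lambda>i. if i \<in> Y then v i else \<zero>)"
      by (rule vec_eqI) (use insert.hyps vc in \<open>simp add: unitv_def\<close>)
    have y: "y \<in> X" and Y: "Y \<subseteq> X" using insert.prems by auto
    have w: "(\<lambda>i. if i \<in> Y then v i else \<zero>) \<in> vec X"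
      unfolding vec_def using Y vc by (simp del: vec_closed) blast
    show ?case unfolding e
      by (rule assms(5)[OF vec_scale[OF vc vec_unitv[OF y]] w assms(6)[OF vc vec_unitv[OF y] assms(4)[OF y]] insert.IH[OF Y]])
  qed
  from this[OF X order_refl] have "P (\<lambda>i. if i \<in> X then v i else \<zero>)" .
  moreover have "(\<lambda>i. if i \<in> X then v i else \<zero>) = v" by (rule vec_eqI) (use vec_off[OF v] in auto)
  ultimately show ?thesis by simp
qed

lemma linear_functional_dot:
  assumes X: "finite X" and v: "v \<in> vec X" and cl: "\<And>u. u \<in> vec X \<Longrightarrow> f u \<in> carrier R"
    and add: "\<And>u w. u \<in> vec X \<Longrightarrow> w \<in> vec X \<Longrightarrow> f (u +\<^sub>v w) = f u \<oplus> f w"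
    and scale: "\<And>r u. r \<in> carrier R \<Longrightarrow> u \<in> vec X \<Longrightarrow> f (r *\<^sub>v u) = r \<otimes> f u"
  shows "f v = dot X v (\<lambda>x. if x \<in> X then f (unitv x) else \<zero>)" (is "_ = dot X v ?g")
proof -
  have g: "?g \<in> vec X" using cl[OF vec_unitv] by (simp add: vec_def del: vec_closed)
  have z: "f vzero = \<zero>" using scale[OF zero_closed vec_zero] cl[OF vec_zero] vscale_zero[OF vec_zero] by (metis l_null)
  show ?thesis
  proof (rule vec_induct[OF X v])
    show "f vzero = dot X vzero ?g" using z dot_zero_left[OF g] by simp
    show "f (unitv x) = dot X (unitv x) ?g" if "x \<in> X" for x using dot_unitv[OF X that g] that by simp
    fix u w assume u: "u \<in> vec X" "f u = dot X u ?g"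
    show "f (u +\<^sub>v w) = dot X (u +\<^sub>v w) ?g" if "w \<in> vec X" "f w = dot X w ?g"
      using add[OF u(1) that(1)] dot_add_left[OF u(1) that(1) g] u that by simp
    show "f (r *\<^sub>v u) = dot X (r *\<^sub>v u) ?g" if "r \<in> carrier R" for r
      using scale[OF that u(1)] dot_scale_left[OF X that u(1) g] u by simp
  qed
qed

lemma dot_restrict:
  assumes "finite X" "Y \<subseteq> X" "v \<in> vec Y" "w \<in> vec X"
  shows "dot X v w = dot Y v (\<lambda>x. if x \<in> Y then w x else \<zero>)"
proof -
  have "dot X v w = (\<Oplus>i\<in>Y. v i \<otimes> w i)"
    unfolding dot_def
    by (rule add.finprod_mono_neutral_cong_left[symmetric])
      (use assms vec_off[OF assms(3)] in auto)
  also have "\<dots> = dot Y v (\<lambda>x. if x \<in> Y then w x else \<zero>)"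
    unfolding dot_def by (rule finsum_cong') (use assms in auto)
  finally show ?thesis .
qed

text \<open>Fewer linear equations than unknowns have a nonzero solution over the field of fractions of \<open>R/p\<close>, and
  clearing denominators a solution modulo \<open>p\<close>. Gaussian elimination: an equation with a coefficient \<open>\<pi>\<close>
  outside \<open>p\<close> is used to eliminate the unknown \<open>y\<close> from the other equations; \<open>w\<close> reinstates it.\<close>

lemma dependence_mod_prime:
  assumes p: "primeideal p R" and B: "finite B"
    and "finite A" "card B < card A" "\<And>b. b \<in> B \<Longrightarrow> C b \<in> vec A"
  shows "\<exists>v\<in>vec A. (\<exists>x. v x \<notin> p) \<and> (\<forall>b\<in>B. dot A v (C b) \<in> p)"
  using B assms(3-)
proof (induction B arbitrary: A C)
  interpret p: primeideal p R by fact
  have pi: "ideal p R" by (rule p.is_ideal)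
  case empty
  then obtain x where x: "x \<in> A" by (metis card.empty equals0I less_irrefl)
  have "\<one> \<notin> p" using p.one_imp_carrier p.I_notcarr by auto
  moreover have "unitv x x = \<one>" by (simp add: unitv_def)
  ultimately have "\<exists>y. unitv x y \<notin> p" by metis
  then show ?case using vec_unitv[OF x] by blast
next
  interpret p: primeideal p R by fact
  have pi: "ideal p R" by (rule p.is_ideal)
  case (insert b B)
  have Cv: "C c \<in> vec A" if "c \<in> insert b B" for c using insert.prems that by auto
  show ?case
  proof (cases "\<forall>x\<in>A. C b x \<in> p")
    case True
    have "card B < card A" using insert by simp
    from insert.IH[OF insert.prems(1) this, of C] Cv obtain v where v: "v \<in> vec A" "\<exists>x. v x \<notin> p"
      "\<forall>c\<in>B. dot A v (C c) \<in> p" by auto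
    have Cb: "C b \<in> vec A" using Cv by simp
    have "dot A (C b) v \<in> p" by (rule dot_coeff_ideal[OF pi insert.prems(1) Cb v(1)]) (use True in auto)
    then have "dot A v (C b) \<in> p" using dot_comm[OF v(1) Cb] by simp
    then show ?thesis using v by auto
  next
    case False
    then obtain y where y: "y \<in> A" "C b y \<notin> p" by blast
    let ?A = "A - {y}"
    define \<pi> where "\<pi> = C b y"
    \<comment> \<open>\<open>E c\<close> has entry zero at the pivot \<open>y\<close>, and \<open>G c\<close> drops this entry.\<close>
    define E where "E c = \<pi> *\<^sub>v C c -\<^sub>v C c y *\<^sub>v C b" for c
    define G where "G c = (\<lambda>x. if x \<in> ?A then E c x else \<zero>)" for c
    have Cb: "C b \<in> vec A" using Cv by simp
    have \<pi>: "\<pi> \<in> carrier R" "\<pi> \<notin> p" using y vec_closed[OF Cb] by (auto simp: \<pi>_def)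
    have E: "E c \<in> vec A" if "c \<in> B" for c
      unfolding E_def using Cv[of c] Cb \<pi> that vec_closed[OF Cv[of c]] by simp
    have G: "G c \<in> vec ?A" if "c \<in> B" for c using vec_closed[OF E[OF that]] by (auto simp del: vec_closed simp: vec_def G_def)
    have "card B < card ?A" using insert y by simp
    then obtain v where v: "v \<in> vec ?A" "\<exists>x. v x \<notin> p" "\<forall>c\<in>B. dot ?A v (G c) \<in> p"
      using insert.IH[of ?A G] insert.prems(1) G by auto
    have vA: "v \<in> vec A" using v(1) by (rule vec_mono[rotated]) auto
    define q where "q = dot A v (C b)"
    have q: "q \<in> carrier R" using vA Cb by (simp add: q_def)
    define w where "w = \<pi> *\<^sub>v v -\<^sub>v q *\<^sub>v unitv y"
    have wA: "w \<in> vec A" unfolding w_def using vA q \<pi> y by simp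
    have wdot: "dot A w u = \<pi> \<otimes> dot A v u \<ominus> q \<otimes> u y" if u: "u \<in> vec A" for u
      unfolding w_def using vA q \<pi> y insert.prems(1) u dot_unitv[OF insert.prems(1) y(1) u]
      by (simp add: dot_add_left dot_scale_left a_minus_def l_minus)
    have "dot A w (C c) \<in> p" if c: "c \<in> insert b B" for c
    proof (cases "c = b")
      case True
      have "dot A w (C b) = \<zero>" unfolding wdot[OF Cb] q_def[symmetric] using q \<pi> by (simp add: \<pi>_def[symmetric] m_comm)
      then show ?thesis using True ideal_zero[OF pi] by simp
    next
      case False
      then have c: "c \<in> B" using c by simp
      have Cc: "C c \<in> vec A" using Cv c by simp
      note yc = vec_closed[OF Cc, of y]
      have "dot ?A v (G c) = dot A v (E c)"
        unfolding G_def by (rule dot_restrict[symmetric]) (use insert.prems(1) v(1) E[OF c] in auto)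
      also have "\<dots> = \<pi> \<otimes> dot A v (C c) \<ominus> C c y \<otimes> q"
        unfolding E_def q_def using Cc Cb vA \<pi> insert.prems(1) yc
        by (simp add: dot_add_right dot_scale_right a_minus_def l_minus)
      also have "\<dots> = dot A w (C c)" unfolding wdot[OF Cc] using q yc by (simp add: m_comm)
      finally show ?thesis using v(3) c by metis
    qed
    moreover have "\<exists>x. w x \<notin> p"
    proof -
      obtain x where x: "v x \<notin> p" using v(2) by blast
      have "x \<noteq> y" using x vec_off[OF v(1), of y] ideal_zero[OF pi] by auto
      then have "w x = \<pi> \<otimes> v x" unfolding w_def unitv_def using q \<pi> vec_closed[OF vA, of x] by (simp add: l_minus)
      then show ?thesis using p.prime_notin[OF \<pi>(1) vec_closed[OF vA] \<pi>(2) x] by metis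
    qed
    ultimately show ?thesis using wA by blast
  qed
qed

text \<open>The kernel of the map from \<open>R\<close> to its localization at the prime \<open>p\<close>.\<close>

definition loc_kernel :: "'a set \<Rightarrow> 'a set" where
  "loc_kernel p = {c \<in> carrier R. \<exists>u\<in>carrier R - p. u \<otimes> c = \<zero>}"

end

context primeideal
begin

lemma loc_kernel_subset: "loc_kernel I \<subseteq> I"
proof
  fix c assume "c \<in> loc_kernel I"
  then obtain u where u: "c \<in> carrier R" "u \<in> carrier R" "u \<notin> I" "u \<otimes> c = \<zero>" by (auto simp: loc_kernel_def)
  then show "c \<in> I" using prime_notin[of u c] ideal_zero[OF is_ideal] by auto
qed

lemma ideal_loc_kernel: "ideal (loc_kernel I) R"
proof (rule ideal_intro)
  show "loc_kernel I \<subseteq> carrier R" by (auto simp: loc_kernel_def)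
  have one: "\<one> \<notin> I" using one_imp_carrier I_notcarr by auto
  then show "\<zero> \<in> loc_kernel I" by (auto simp: loc_kernel_def intro!: bexI[of _ \<one>])
  fix x assume "x \<in> loc_kernel I"
  then obtain u where u: "x \<in> carrier R" "u \<in> carrier R" "u \<notin> I" "u \<otimes> x = \<zero>" by (auto simp: loc_kernel_def)
  show "x \<oplus> y \<in> loc_kernel I" if y: "y \<in> loc_kernel I" for y
  proof -
    obtain v where v: "y \<in> carrier R" "v \<in> carrier R" "v \<notin> I" "v \<otimes> y = \<zero>" using y by (auto simp: loc_kernel_def)
    have "(u \<otimes> v) \<otimes> (x \<oplus> y) = v \<otimes> (u \<otimes> x) \<oplus> u \<otimes> (v \<otimes> y)" using u(1,2) v(1,2) by algebra
    also have "\<dots> = \<zero>" using u v by simp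
    finally show ?thesis using u v prime_notin[OF u(2) v(2) u(3) v(3)] by (auto simp: loc_kernel_def)
  qed
  show "r \<otimes> x \<in> loc_kernel I" if r: "r \<in> carrier R" for r
  proof -
    have "u \<otimes> (r \<otimes> x) = r \<otimes> (u \<otimes> x)" using u(1,2) r by algebra
    then show ?thesis using u r by (auto simp: loc_kernel_def)
  qed
qed

lemma loc_kernel_saturated:
  assumes "u \<in> carrier R" "u \<notin> I" "c \<in> carrier R" "u \<otimes> c \<in> loc_kernel I" shows "c \<in> loc_kernel I"
proof -
  obtain v where v: "v \<in> carrier R" "v \<notin> I" "v \<otimes> (u \<otimes> c) = \<zero>" using assms(4) by (auto simp: loc_kernel_def)
  then have "(v \<otimes> u) \<otimes> c = \<zero>" using assms by (simp add: m_assoc)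
  then show ?thesis using assms v prime_notin[OF v(1) assms(1) v(2) assms(2)] by (auto simp: loc_kernel_def)
qed

end

text \<open>A basis \<open>e\<close> of \<open>M\<close> localized at \<open>p\<close>. The matrix \<open>C\<close> expresses the generators \<open>A\<close> in the basis with the common
  denominator \<open>s\<close>.\<close>

locale local_frame = min_gens R M A + noeth_local_dim1 R
  for R :: "'a ring" (structure) and M :: "('a, 'b) module" and A :: "'b set" +
  fixes p :: "'a set" and r :: nat and e :: "nat \<Rightarrow> 'b" and s :: 'a and C :: "'b \<Rightarrow> nat \<Rightarrow> 'a"
  assumes p: "primeideal p R" "p \<noteq> \<mm>"
    and e: "\<And>i. e i \<in> carrier M"
    and s: "s \<in> carrier R" "s \<notin> p"
    and C: "\<And>i. (\<lambda>x. C x i) \<in> vec A"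
    and C_span: "\<And>x. x \<in> A \<Longrightarrow> s \<odot>\<^bsub>M\<^esub> x = (\<Oplus>\<^bsub>M\<^esub>i\<in>{..<r}. C x i \<odot>\<^bsub>M\<^esub> e i)"
    and indep: "\<And>c i. (\<And>i. c i \<in> carrier R) \<Longrightarrow> (\<Oplus>\<^bsub>M\<^esub>i\<in>{..<r}. c i \<odot>\<^bsub>M\<^esub> e i) = \<zero>\<^bsub>M\<^esub> \<Longrightarrow> i < r \<Longrightarrow>
      c i \<in> loc_kernel p"
begin

interpretation p: primeideal p R by (rule p)

lemma p_ideal: "ideal p R" by (rule p.is_ideal)

abbreviation T :: "'a set" where "T \<equiv> loc_kernel p"

definition ev :: "(nat \<Rightarrow> 'a) \<Rightarrow> 'b" where
  "ev c = (\<Oplus>\<^bsub>M\<^esub>i\<in>{..<r}. c i \<odot>\<^bsub>M\<^esub> e i)"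

text \<open>\<open>Phi\<close> and \<open>Psi\<close> are the matrices between \<open>R\<^sup>A\<close> and \<open>R\<^sup>r\<close> that lift the identity of \<open>M\<close>, the first one up to the
  factor \<open>s\<close>.\<close>

definition Phi :: "('b \<Rightarrow> 'a) \<Rightarrow> nat \<Rightarrow> 'a" where
  "Phi v = (\<lambda>i. if i < r then dot A v (\<lambda>x. C x i) else \<zero>)"

definition E :: "'b \<Rightarrow> nat \<Rightarrow> 'a" where
  "E y = (\<lambda>i. if i < r then coef (e i) y else \<zero>)"

definition Psi :: "(nat \<Rightarrow> 'a) \<Rightarrow> 'b \<Rightarrow> 'a" where
  "Psi w = (\<lambda>y. dot {..<r} w (E y))"

lemma C_carrier: "C x i \<in> carrier R" using vec_closed[OF C] .

lemma E_vec: "E y \<in> vec {..<r}" using vec_closed[OF coef(1)[OF e]] by (auto simp del: vec_closed simp: vec_def E_def)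

lemma Phi_vec: "v \<in> vec A \<Longrightarrow> Phi v \<in> vec {..<r}"
  using dot_closed[OF _ C] by (auto simp del: vec_closed simp: vec_def[of "{..<r}"] Phi_def)

lemma Psi_vec: assumes w: "w \<in> vec {..<r}" shows "Psi w \<in> vec A"
  unfolding vec_def
proof (intro CollectI conjI allI impI)
  fix y
  show "Psi w y \<in> carrier R" unfolding Psi_def by (rule dot_closed[OF w E_vec])
  assume "y \<notin> A"
  then have "E y = vzero" using vec_off[OF coef(1)[OF e]] by (intro vec_eqI) (simp add: E_def)
  then show "Psi w y = \<zero>" unfolding Psi_def using w by simp
qed

lemma Phi_add: "u \<in> vec A \<Longrightarrow> v \<in> vec A \<Longrightarrow> Phi (u +\<^sub>v v) = Phi u +\<^sub>v Phi v"
  by (rule vec_eqI) (simp add: Phi_def dot_add_left[OF _ _ C])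

lemma Phi_scale: "c \<in> carrier R \<Longrightarrow> v \<in> vec A \<Longrightarrow> Phi (c *\<^sub>v v) = c *\<^sub>v Phi v"
  by (rule vec_eqI) (simp add: Phi_def dot_scale_left[OF finA _ _ C])

lemma Phi_zero: "Phi vzero = vzero"
  by (rule vec_eqI) (simp add: Phi_def dot_zero_left[OF C])

lemma Phi_unitv: "x \<in> A \<Longrightarrow> i < r \<Longrightarrow> Phi (unitv x) i = C x i"
  using dot_unitv[OF finA _ C] by (simp add: Phi_def)

lemma Psi_add: "u \<in> vec {..<r} \<Longrightarrow> v \<in> vec {..<r} \<Longrightarrow> Psi (u +\<^sub>v v) = Psi u +\<^sub>v Psi v"
  by (rule vec_eqI) (simp add: Psi_def dot_add_left[OF _ _ E_vec])

lemma Psi_scale: "c \<in> carrier R \<Longrightarrow> v \<in> vec {..<r} \<Longrightarrow> Psi (c *\<^sub>v v) = c *\<^sub>v Psi v"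
  by (rule vec_eqI) (simp add: Psi_def dot_scale_left[OF _ _ _ E_vec])

lemma Psi_zero: "Psi vzero = vzero"
  by (rule vec_eqI) (simp add: Psi_def dot_zero_left[OF E_vec])

lemma Psi_unitv: "i < r \<Longrightarrow> Psi (unitv i) = coef (e i)"
  by (rule vec_eqI, unfold Psi_def, subst dot_unitv[OF _ _ E_vec]) (simp_all add: E_def)

lemma ev_closed: "c \<in> vec {..<r} \<Longrightarrow> ev c \<in> carrier M"
  unfolding ev_def by (rule M.finsum_closed) (use e in auto)

lemma ev_add: assumes "c \<in> vec {..<r}" "c' \<in> vec {..<r}" shows "ev (c +\<^sub>v c') = ev c \<oplus>\<^bsub>M\<^esub> ev c'"
proof -
  have "ev (c +\<^sub>v c') = (\<Oplus>\<^bsub>M\<^esub>i\<in>{..<r}. c i \<odot>\<^bsub>M\<^esub> e i \<oplus>\<^bsub>M\<^esub> c' i \<odot>\<^bsub>M\<^esub> e i)"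
    unfolding ev_def by (rule M.finsum_cong') (use assms e in \<open>auto simp: smult_l_distr\<close>)
  also have "\<dots> = ev c \<oplus>\<^bsub>M\<^esub> ev c'"
    unfolding ev_def by (rule M.finsum_addf) (use assms e in auto)
  finally show ?thesis .
qed

lemma ev_scale: assumes "t \<in> carrier R" "c \<in> vec {..<r}" shows "ev (t *\<^sub>v c) = t \<odot>\<^bsub>M\<^esub> ev c"
proof -
  have "ev (t *\<^sub>v c) = (\<Oplus>\<^bsub>M\<^esub>i\<in>{..<r}. t \<odot>\<^bsub>M\<^esub> (c i \<odot>\<^bsub>M\<^esub> e i))"
    unfolding ev_def by (rule M.finsum_cong') (use assms e in \<open>auto simp: smult_assoc1\<close>)
  also have "\<dots> = t \<odot>\<^bsub>M\<^esub> ev c"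
    unfolding ev_def by (rule finsum_smult_ldistr[symmetric]) (use assms e in auto)
  finally show ?thesis .
qed

lemma ev_zero: "ev vzero = \<zero>\<^bsub>M\<^esub>"
proof -
  have "ev vzero = (\<Oplus>\<^bsub>M\<^esub>i\<in>{..<r}. \<zero>\<^bsub>M\<^esub>)" unfolding ev_def by (rule M.finsum_cong') (use e in auto)
  then show ?thesis by simp
qed

lemma ev_unitv: assumes "i < r" shows "ev (unitv i) = e i"
proof -
  have "ev (unitv i) = (\<Oplus>\<^bsub>M\<^esub>j\<in>{..<r}. if i = j then e j else \<zero>\<^bsub>M\<^esub>)"
    unfolding ev_def unitv_def by (rule M.finsum_cong') (use e in auto)
  also have "\<dots> = e i" by (rule M.finsum_singleton) (use assms e in auto)
  finally show ?thesis .
qed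

lemma lc_Psi: assumes w: "w \<in> vec {..<r}" shows "lc (Psi w) = ev w"
proof (rule vec_induct[OF finite_lessThan w])
  show "lc (Psi vzero) = ev vzero" unfolding Psi_zero ev_zero by (rule lc_zero)
  show "lc (Psi (unitv i)) = ev (unitv i)" if "i \<in> {..<r}" for i
    using that by (simp add: Psi_unitv ev_unitv coef(2)[OF e])
  fix u v assume u: "u \<in> vec {..<r}" "lc (Psi u) = ev u"
  show "lc (Psi (u +\<^sub>v v)) = ev (u +\<^sub>v v)" if "v \<in> vec {..<r}" "lc (Psi v) = ev v"
    unfolding Psi_add[OF u(1) that(1)] ev_add[OF u(1) that(1)] lc_add[OF Psi_vec[OF u(1)] Psi_vec[OF that(1)]]
    using u that by simp
  show "lc (Psi (t *\<^sub>v u)) = ev (t *\<^sub>v u)" if "t \<in> carrier R" for t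
    unfolding Psi_scale[OF that u(1)] ev_scale[OF that u(1)] lc_scale[OF that Psi_vec[OF u(1)]] using u by simp
qed

lemma ev_Phi: assumes v: "v \<in> vec A" shows "ev (Phi v) = s \<odot>\<^bsub>M\<^esub> lc v"
proof (rule vec_induct[OF finA v])
  show "ev (Phi vzero) = s \<odot>\<^bsub>M\<^esub> lc vzero" unfolding Phi_zero ev_zero lc_zero using s by simp
  show "ev (Phi (unitv x)) = s \<odot>\<^bsub>M\<^esub> lc (unitv x)" if x: "x \<in> A" for x
  proof -
    have "ev (Phi (unitv x)) = (\<Oplus>\<^bsub>M\<^esub>i\<in>{..<r}. C x i \<odot>\<^bsub>M\<^esub> e i)"
      unfolding ev_def by (rule M.finsum_cong') (use x e C_carrier in \<open>auto simp: Phi_unitv\<close>)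
    then show ?thesis using C_span[OF x] lc_unitv[OF x] by simp
  qed
  fix u w assume u: "u \<in> vec A" "ev (Phi u) = s \<odot>\<^bsub>M\<^esub> lc u"
  show "ev (Phi (u +\<^sub>v w)) = s \<odot>\<^bsub>M\<^esub> lc (u +\<^sub>v w)" if w: "w \<in> vec A" "ev (Phi w) = s \<odot>\<^bsub>M\<^esub> lc w"
    unfolding Phi_add[OF u(1) w(1)] ev_add[OF Phi_vec[OF u(1)] Phi_vec[OF w(1)]] lc_add[OF u(1) w(1)]
    using smult_r_distr[OF s(1) lc_closed[OF u(1)] lc_closed[OF w(1)]] u w by simp
  show "ev (Phi (t *\<^sub>v u)) = s \<odot>\<^bsub>M\<^esub> lc (t *\<^sub>v u)" if t: "t \<in> carrier R" for t
    unfolding Phi_scale[OF t u(1)] ev_scale[OF t Phi_vec[OF u(1)]] lc_scale[OF t u(1)] u(2)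
    using s(1) t lc_closed[OF u(1)] by (simp add: smult_assoc1[symmetric] R_m_comm)
qed

lemma ev_zeroD: assumes "c \<in> vec {..<r}" "ev c = \<zero>\<^bsub>M\<^esub>" shows "c i \<in> T"
proof (cases "i < r")
  case True then show ?thesis using indep[of c i] assms by (simp add: ev_def)
next
  case False
  then have "c i = \<zero>" using vec_off[OF assms(1)] by simp
  then show ?thesis using ideal_zero[OF p.ideal_loc_kernel] by simp
qed

text \<open>\<open>tau\<close> maps \<open>R\<^sup>A\<close> to the relations and is \<open>s\<close> on \<open>Z\<close> up to the kernel of localization; locally it
  splits off \<open>Z\<close> as a direct summand of \<open>R\<^sup>A\<close>.\<close>

definition tau :: "('b \<Rightarrow> 'a) \<Rightarrow> 'b \<Rightarrow> 'a" where
  "tau v = s *\<^sub>v v -\<^sub>v Psi (Phi v)"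

lemma tau_Z: assumes v: "v \<in> vec A" shows "tau v \<in> Z"
  unfolding tau_def
proof (rule Z_diff)
  show "s *\<^sub>v v \<in> vec A" using s v by simp
  show "Psi (Phi v) \<in> vec A" by (rule Psi_vec[OF Phi_vec[OF v]])
  show "lc (s *\<^sub>v v) = lc (Psi (Phi v))"
    using lc_scale[OF s(1) v] lc_Psi[OF Phi_vec[OF v]] ev_Phi[OF v] by simp
qed

lemma tau_vec: "v \<in> vec A \<Longrightarrow> tau v \<in> vec A" by (rule linsubD(1)[OF Z_linsub tau_Z])

lemma tau_add: assumes "u \<in> vec A" "v \<in> vec A" shows "tau (u +\<^sub>v v) y = tau u y \<oplus> tau v y"
proof -
  have c: "u y \<in> carrier R" "v y \<in> carrier R" "Psi (Phi u) y \<in> carrier R" "Psi (Phi v) y \<in> carrier R"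
    using assms vec_closed[OF Psi_vec[OF Phi_vec]] by auto
  show ?thesis unfolding tau_def Phi_add[OF assms] Psi_add[OF Phi_vec[OF assms(1)] Phi_vec[OF assms(2)]]
    unfolding vadd_nth vscale_nth using c s(1) by algebra
qed

lemma tau_scale: assumes "t \<in> carrier R" "v \<in> vec A" shows "tau (t *\<^sub>v v) y = t \<otimes> tau v y"
proof -
  have c: "v y \<in> carrier R" "Psi (Phi v) y \<in> carrier R"
    using assms vec_closed[OF Psi_vec[OF Phi_vec]] by auto
  show ?thesis unfolding tau_def Phi_scale[OF assms] Psi_scale[OF assms(1) Phi_vec[OF assms(2)]]
    unfolding vadd_nth vscale_nth using c s(1) assms(1) by algebra
qed

lemma Psi_ideal: "ideal J R \<Longrightarrow> w \<in> vec {..<r} \<Longrightarrow> (\<And>i. w i \<in> J) \<Longrightarrow> Psi w y \<in> J"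
  unfolding Psi_def by (rule dot_coeff_ideal[OF _ _ _ E_vec]) auto

lemma scale_s_ideal:
  assumes J: "ideal J R" and v: "v \<in> vec A" and "tau v y \<in> J" "\<And>i. Phi v i \<in> J"
  shows "s \<otimes> v y \<in> J"
proof -
  note P = Phi_vec[OF v]
  have c: "v y \<in> carrier R" "Psi (Phi v) y \<in> carrier R" using v vec_closed[OF Psi_vec[OF P]] by auto
  have eq: "s \<otimes> v y = tau v y \<oplus> Psi (Phi v) y" unfolding tau_def vadd_nth vscale_nth using c s(1) by algebra
  show ?thesis by (subst eq, rule ideal_add[OF J assms(3) Psi_ideal[OF J P assms(4)]])
qed

text \<open>If \<open>r < |A|\<close>, some \<open>v\<close> that is nonzero modulo \<open>p\<close> has \<open>Phi v \<equiv> 0\<close>. Then \<open>s v \<equiv> tau v\<close> is congruent to a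
  relation, so it is zero modulo \<open>p\<close>.\<close>

lemma card_le_rank:
  assumes "\<And>z x. z \<in> Z \<Longrightarrow> z x \<in> p" shows "card A \<le> r"
proof (rule ccontr)
  assume "\<not> ?thesis"
  then obtain v where v: "v \<in> vec A" "\<exists>x. v x \<notin> p" "\<forall>i\<in>{..<r}. dot A v (\<lambda>x. C x i) \<in> p"
    using dependence_mod_prime[OF p(1), of "{..<r}" A "\<lambda>i x. C x i"] finA C by auto
  have "Phi v i \<in> p" for i using v(3) ideal_zero[OF p_ideal] by (auto simp: Phi_def)
  then have "s \<otimes> v x \<in> p" for x
    using scale_s_ideal[OF p_ideal v(1) assms[OF tau_Z[OF v(1)]]] by blast
  then show False using v(2) p.prime_notin[OF s(1) vec_closed[OF v(1)] s(2)] by blast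
qed

text \<open>Otherwise the images \<open>E\<close> of the basis vectors together with \<open>z\<close> are \<open>r + 1 > |A|\<close> vectors in \<open>R\<^sup>A\<close>, and a
  combination \<open>u\<close> of them is zero modulo \<open>p\<close> with a coefficient outside \<open>p\<close>. Applying \<open>Phi\<close> shows that
  the coefficients of the basis vectors lie in \<open>p\<close>, so the coefficient of \<open>z\<close> does not, and \<open>z\<close> is zero
  modulo \<open>p\<close>.\<close>

lemma relations_in_prime:
  assumes card: "card A \<le> r" and z: "z \<in> Z" shows "z x \<in> p"
proof (rule ccontr)
  assume zx: "z x \<notin> p"
  note zv = linsubD(1)[OF Z_linsub z]
  let ?I = "{..<Suc r}"
  define G where "G y = (\<lambda>i. if i = r then z y else E y i)" for y
  have G: "G y \<in> vec ?I" for y using vec_closed[OF zv] vec_closed[OF E_vec] vec_off[OF E_vec]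
    by (auto simp del: vec_closed simp: vec_def G_def)
  obtain w where w: "w \<in> vec ?I" "\<exists>i. w i \<notin> p" "\<forall>y\<in>A. dot ?I w (G y) \<in> p"
    using dependence_mod_prime[OF p(1) finA, of ?I G] card G by auto
  define w' where "w' = (\<lambda>i. if i < r then w i else \<zero>)"
  have w': "w' \<in> vec {..<r}" using vec_closed[OF w(1)] by (auto simp del: vec_closed simp: vec_def w'_def)
  have wr: "w r \<in> carrier R" by (rule vec_closed[OF w(1)])
  define u where "u = Psi w' +\<^sub>v w r *\<^sub>v z"
  have u: "u \<in> vec A" unfolding u_def using Psi_vec[OF w'] wr zv by simp
  have up: "u y \<in> p" for y
  proof (cases "y \<in> A")
    case True
    have "dot ?I w (G y) = w r \<otimes> z y \<oplus> (\<Oplus>i\<in>{..<r}. w i \<otimes> G y i)"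
      unfolding dot_def lessThan_Suc using vec_closed[OF w(1)] vec_closed[OF G[of y]] vec_closed[OF zv]
      by (subst R_finsum_insert) (auto simp: G_def)
    also have "(\<Oplus>i\<in>{..<r}. w i \<otimes> G y i) = Psi w' y"
      unfolding Psi_def dot_def
      by (rule R_finsum_cong') (use vec_closed[OF w'] vec_closed[OF E_vec] in \<open>auto simp: G_def w'_def\<close>)
    finally have "dot ?I w (G y) = u y"
      unfolding u_def vadd_nth vscale_nth using vec_closed[OF Psi_vec[OF w'], of y] wr vec_closed[OF zv, of y]
      by (simp add: R_a_comm)
    then show ?thesis using w(3) True by metis
  next
    case False then show ?thesis using vec_off[OF u] ideal_zero[OF p_ideal] by simp
  qed
  have P: "Phi u i \<in> p" for i
    using dot_coeff_ideal[OF p_ideal finA u C up] ideal_zero[OF p_ideal] by (simp add: Phi_def)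
  have lcu: "lc u = ev w'"
    unfolding u_def using lc_add[OF Psi_vec[OF w'] vec_scale[OF wr zv]] lc_scale[OF wr zv] lc_Psi[OF w'] z wr ev_closed[OF w']
    by (simp add: Z_def)
  have "ev (s *\<^sub>v w' -\<^sub>v Phi u) = \<zero>\<^bsub>M\<^esub>"
    using s w' Phi_vec[OF u] ev_Phi[OF u] ev_closed[OF w']
    by (simp add: ev_add ev_scale lcu smult_l_minus M.r_neg)
  then have T: "(s *\<^sub>v w' -\<^sub>v Phi u) i \<in> p" for i
    using ev_zeroD[of "s *\<^sub>v w' -\<^sub>v Phi u" i] s(1) w' Phi_vec[OF u] p.loc_kernel_subset by auto
  have w'p: "w' i \<in> p" for i
  proof -
    have c: "w' i \<in> carrier R" "Phi u i \<in> carrier R" using vec_closed[OF w'] vec_closed[OF Phi_vec[OF u]] by auto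
    have eq: "s \<otimes> w' i = (s *\<^sub>v w' -\<^sub>v Phi u) i \<oplus> Phi u i" unfolding vadd_nth vscale_nth using c s(1) by algebra
    have "s \<otimes> w' i \<in> p" by (subst eq, rule ideal_add[OF p_ideal T P])
    then show ?thesis using p.prime_notin[OF s(1) c(1) s(2)] by blast
  qed
  have "w r \<notin> p"
  proof
    assume "w r \<in> p"
    have "w i \<in> p" for i
    proof -
      consider "i < r" | "i = r" | "i > r" by linarith
      then show ?thesis
        using w'p[of i] \<open>w r \<in> p\<close> vec_off[OF w(1), of i] ideal_zero[OF p_ideal]
        by cases (auto simp: w'_def)
    qed
    then show False using w(2) by blast
  qed
  moreover have "w r \<otimes> z x \<in> p"
  proof -
    have c: "w r \<otimes> z x \<in> carrier R" using wr vec_closed[OF zv] by simp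
    have "w r \<otimes> z x \<oplus> Psi w' x \<in> p"
      using up[of x] c vec_closed[OF Psi_vec[OF w'], of x] by (simp add: u_def R_a_comm)
    then show ?thesis using ideal_addD[OF p_ideal _ Psi_ideal[OF p_ideal w' w'p] c] by blast
  qed
  ultimately show False using zx p.prime_notin[OF wr vec_closed[OF zv]] by blast
qed

text \<open>If \<open>Z\<close> localized at \<open>p\<close> were nonzero, it would contain a nonzero element \<open>w\<close> killed by \<open>p\<close>, as \<open>p\<close> is minimal.
  But \<open>s w = tau w\<close> is the combination of the relations \<open>tau (unitv x)\<close>, whose entries lie in \<open>p\<close>, with
  coefficients \<open>w x\<close>, and therefore zero.\<close>

lemma relations_locally_zero:
  assumes Zp: "\<And>z x. z \<in> Z \<Longrightarrow> z x \<in> p" and z: "z \<in> Z" shows "z x \<in> T"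
proof (rule ccontr)
  assume zx: "z x \<notin> T"
  note T = p.ideal_loc_kernel
  have zv: "z y \<in> carrier R" for y by (rule linsub_closed[OF Z_linsub z])
  define J where "J = {c \<in> carrier R. \<forall>y. c \<otimes> z y \<in> T}"
  have J: "ideal J R"
    by (rule ideal_intro)
      (use zv ideal_zero[OF T] ideal_add[OF T] ideal_mult[OF T] in \<open>auto simp: J_def R_l_distr R_m_assoc\<close>)
  have "\<one> \<notin> J" using zx zv by (auto simp: J_def)
  then obtain c where c: "c \<in> carrier R" "c \<notin> J" "primeideal (icolon J c) R"
    using exists_prime_colon[OF J R_zero_closed R_one_closed] ideal_zero[OF J] by auto
  have "icolon J c \<subseteq> p"
  proof
    fix u assume "u \<in> icolon J c"
    then have u: "u \<in> carrier R" "u \<otimes> c \<in> J" by (auto simp: icolon_def)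
    show "u \<in> p"
    proof (rule ccontr)
      assume "u \<notin> p"
      have "c \<otimes> z y \<in> T" for y
        by (rule p.loc_kernel_saturated[OF u(1) \<open>u \<notin> p\<close>]) (use u c zv in \<open>auto simp: J_def R_m_assoc\<close>)
      then show False using c by (simp add: J_def)
    qed
  qed
  then have colon: "icolon J c = p" by (rule prime_eq[OF p(1) c(3) _ p(2)])
  \<comment> \<open>An element of \<open>Z\<close> whose annihilator in the localization is \<open>p\<close>.\<close>
  define w where "w = c *\<^sub>v z"
  have wZ: "w \<in> Z" unfolding w_def by (rule linsubD(4)[OF Z_linsub c(1) z])
  note wv = linsubD(1)[OF Z_linsub wZ]
  have kill: "u \<otimes> w y \<in> T" if u: "u \<in> p" for u y
  proof -
    have "u \<in> carrier R" "u \<otimes> c \<in> J" using u colon by (auto simp: icolon_def)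
    then show ?thesis using c(1) zv by (auto simp: J_def w_def R_m_assoc)
  qed
  have "w y \<in> T" for y
  proof -
    let ?g = "\<lambda>x. if x \<in> A then tau (unitv x) y else \<zero>"
    have gp: "?g x \<in> p" for x using Zp[OF tau_Z] ideal_zero[OF p_ideal] by auto
    have "(\<Oplus>x\<in>B. w x \<otimes> ?g x) \<in> T" if "finite B" for B
      using that
    proof (induction B)
      case empty then show ?case using ideal_zero[OF T] by simp
    next
      case (insert x B)
      have c: "w x \<otimes> ?g x \<in> carrier R" for x using vec_closed[OF wv] ideal_mem[OF p_ideal gp] by (rule R_m_closed)
      have m: "w x \<otimes> ?g x \<in> T" using kill[OF gp[of x], of x] R_m_comm[OF vec_closed[OF wv] ideal_mem[OF p_ideal gp]] by metis
      have e: "(\<Oplus>x\<in>insert x B. w x \<otimes> ?g x) = w x \<otimes> ?g x \<oplus> (\<Oplus>x\<in>B. w x \<otimes> ?g x)"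
        by (rule R_finsum_insert[OF insert.hyps(1,2) Pi_I[OF c] c])
      show ?case unfolding e by (rule ideal_add[OF T m insert.IH])
    qed
    from this[OF finA] have "dot A w ?g \<in> T" unfolding dot_def .
    moreover have "tau w y = dot A w ?g"
      by (rule linear_functional_dot[OF finA wv, of "\<lambda>v. tau v y"])
        (fact vec_closed[OF tau_vec] tau_add tau_scale)+
    ultimately have "tau w y \<in> T" by simp
    moreover have "Phi w i \<in> T" for i
    proof (rule ev_zeroD[OF Phi_vec[OF wv]])
      show "ev (Phi w) = \<zero>\<^bsub>M\<^esub>" using ev_Phi[OF wv] wZ s(1) by (simp add: Z_def)
    qed
    ultimately have "s \<otimes> w y \<in> T" by (rule scale_s_ideal[OF T wv])
    then show ?thesis by (rule p.loc_kernel_saturated[OF s vec_closed[OF wv]])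
  qed
  then show False using c by (simp add: J_def w_def)
qed

end

section \<open>Freeness and regularity\<close>

locale min_gens_dim1 = min_gens R M A + noeth_local_dim1 R
  for R :: "'a ring" (structure) and M :: "('a, 'b) module" and A :: "'b set"
begin

text \<open>The denominators of finitely many elements of \<open>M\<close> have a common multiple.\<close>

lemma exists_frame:
  assumes p: "primeideal p R" "p \<noteq> \<mm>"
    and iso: "module_iso (loc_ring R (carrier R - p)) (loc_module R (carrier R - p) M)
      (free_module (loc_ring R (carrier R - p)) {..<r::nat})"
  shows "\<exists>e s C. local_frame R M A p r e s C"
proof -
  interpret p: primeideal p R by (rule p)
  have one: "\<one> \<notin> p" using p.one_imp_carrier p.I_notcarr by auto
  let ?S = "carrier R - p"
  have mult: "u \<otimes> v \<in> ?S" if "u \<in> ?S" "v \<in> ?S" for u v using p.prime_notin that by auto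
  have S: "localization R M ?S"
  proof (intro localization.intro localization_axioms.intro)
    show "module R M" by (rule Mod.module_axioms)
    show "?S \<subseteq> carrier R" by blast
    show "\<one> \<in> ?S" using one R_one_closed by blast
    show "u \<otimes> v \<in> ?S" if "u \<in> ?S" "v \<in> ?S" for u v by (rule mult[OF that])
  qed
  obtain e where e: "\<forall>i<r. e i \<in> carrier M"
    "\<And>x. x \<in> carrier M \<Longrightarrow> \<exists>s\<in>?S. \<exists>c. (\<forall>i. c i \<in> carrier R) \<and> s \<odot>\<^bsub>M\<^esub> x = (\<Oplus>\<^bsub>M\<^esub>i\<in>{..<r}. c i \<odot>\<^bsub>M\<^esub> e i)"
    "\<And>c i. (\<And>i. c i \<in> carrier R) \<Longrightarrow> (\<Oplus>\<^bsub>M\<^esub>i\<in>{..<r}. c i \<odot>\<^bsub>M\<^esub> e i) = \<zero>\<^bsub>M\<^esub> \<Longrightarrow> i < r \<Longrightarrow> \<exists>u\<in>?S. u \<otimes> c i = \<zero>"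
    using localization.localized_basis[OF S iso] by (elim exE conjE) blast
  define e' where "e' i = (if i < r then e i else \<zero>\<^bsub>M\<^esub>)" for i
  have e'c: "e' i \<in> carrier M" for i using e(1) by (simp add: e'_def)
  have sum: "(\<Oplus>\<^bsub>M\<^esub>i\<in>{..<r}. c i \<odot>\<^bsub>M\<^esub> e i) = (\<Oplus>\<^bsub>M\<^esub>i\<in>{..<r}. c i \<odot>\<^bsub>M\<^esub> e' i)" if "\<And>i. c i \<in> carrier R" for c
    by (rule M.finsum_cong') (use that e'c in \<open>auto simp: e'_def\<close>)
  have "\<exists>s\<in>?S. \<forall>x\<in>B. \<exists>c. (\<forall>i. c i \<in> carrier R) \<and> s \<odot>\<^bsub>M\<^esub> x = (\<Oplus>\<^bsub>M\<^esub>i\<in>{..<r}. c i \<odot>\<^bsub>M\<^esub> e' i)"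
    if "finite B" "B \<subseteq> carrier M" for B
    using that
  proof (induction B)
    case empty then show ?case using one by auto
  next
    case (insert y B)
    then obtain s where s: "s \<in> ?S"
      "\<forall>x\<in>B. \<exists>c. (\<forall>i. c i \<in> carrier R) \<and> s \<odot>\<^bsub>M\<^esub> x = (\<Oplus>\<^bsub>M\<^esub>i\<in>{..<r}. c i \<odot>\<^bsub>M\<^esub> e' i)" by auto
    have y: "y \<in> carrier M" using insert.prems by simp
    obtain s' c' where s': "s' \<in> ?S" "\<And>i. c' i \<in> carrier R" "s' \<odot>\<^bsub>M\<^esub> y = (\<Oplus>\<^bsub>M\<^esub>i\<in>{..<r}. c' i \<odot>\<^bsub>M\<^esub> e' i)"
      using e(2)[OF y] sum by metis
    have scale: "\<exists>c. (\<forall>i. c i \<in> carrier R) \<and> (u \<otimes> v) \<odot>\<^bsub>M\<^esub> x = (\<Oplus>\<^bsub>M\<^esub>i\<in>{..<r}. c i \<odot>\<^bsub>M\<^esub> e' i)"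
      if u: "u \<in> carrier R" "v \<in> carrier R" and x: "x \<in> carrier M"
        and c: "\<And>i. c i \<in> carrier R" "v \<odot>\<^bsub>M\<^esub> x = (\<Oplus>\<^bsub>M\<^esub>i\<in>{..<r}. c i \<odot>\<^bsub>M\<^esub> e' i)" for u v x c
    proof (intro exI conjI allI)
      show "u \<otimes> c i \<in> carrier R" for i using u c by simp
      have "(u \<otimes> v) \<odot>\<^bsub>M\<^esub> x = u \<odot>\<^bsub>M\<^esub> (\<Oplus>\<^bsub>M\<^esub>i\<in>{..<r}. c i \<odot>\<^bsub>M\<^esub> e' i)" using u x c(2) by (simp add: smult_assoc1)
      also have "\<dots> = (\<Oplus>\<^bsub>M\<^esub>i\<in>{..<r}. u \<odot>\<^bsub>M\<^esub> (c i \<odot>\<^bsub>M\<^esub> e' i))"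
        by (rule finsum_smult_ldistr) (use u c e'c in auto)
      also have "\<dots> = (\<Oplus>\<^bsub>M\<^esub>i\<in>{..<r}. (u \<otimes> c i) \<odot>\<^bsub>M\<^esub> e' i)"
        by (rule M.finsum_cong') (use u c e'c in \<open>auto simp: smult_assoc1\<close>)
      finally show "(u \<otimes> v) \<odot>\<^bsub>M\<^esub> x = (\<Oplus>\<^bsub>M\<^esub>i\<in>{..<r}. (u \<otimes> c i) \<odot>\<^bsub>M\<^esub> e' i)" .
    qed
    show ?case
    proof (intro bexI[of _ "s' \<otimes> s"] ballI)
      fix x assume "x \<in> insert y B"
      then consider "x = y" | "x \<in> B" by blast
      then show "\<exists>c. (\<forall>i. c i \<in> carrier R) \<and> (s' \<otimes> s) \<odot>\<^bsub>M\<^esub> x = (\<Oplus>\<^bsub>M\<^esub>i\<in>{..<r}. c i \<odot>\<^bsub>M\<^esub> e' i)"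
      proof cases
        case 1
        have c: "s \<in> carrier R" "s' \<in> carrier R" using s s' by auto
        show ?thesis using scale[OF c y s'(2,3)] R_m_comm[OF c] 1 by simp
      next
        case 2
        then obtain c where c: "\<And>i. c i \<in> carrier R" "s \<odot>\<^bsub>M\<^esub> x = (\<Oplus>\<^bsub>M\<^esub>i\<in>{..<r}. c i \<odot>\<^bsub>M\<^esub> e' i)"
          using s(2) by blast
        show ?thesis by (rule scale[OF _ _ _ c]) (use s s' 2 insert.prems in auto)
      qed
    qed (use mult s s' in auto)
  qed
  from this[OF finA Acar] obtain s where s: "s \<in> ?S"
    "\<forall>x\<in>A. \<exists>c. (\<forall>i. c i \<in> carrier R) \<and> s \<odot>\<^bsub>M\<^esub> x = (\<Oplus>\<^bsub>M\<^esub>i\<in>{..<r}. c i \<odot>\<^bsub>M\<^esub> e' i)" by blast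
  obtain C where C: "\<And>x i. x \<in> A \<Longrightarrow> C x i \<in> carrier R"
    "\<And>x. x \<in> A \<Longrightarrow> s \<odot>\<^bsub>M\<^esub> x = (\<Oplus>\<^bsub>M\<^esub>i\<in>{..<r}. C x i \<odot>\<^bsub>M\<^esub> e' i)" using s(2) by metis
  define C' where "C' x i = (if x \<in> A then C x i else \<zero>)" for x i
  have "local_frame R M A p r e' s C'"
  proof
    show "(\<lambda>x. C' x i) \<in> vec A" for i using C(1) by (simp add: C'_def vec_def del: vec_closed)
    show "s \<odot>\<^bsub>M\<^esub> x = (\<Oplus>\<^bsub>M\<^esub>i\<in>{..<r}. C' x i \<odot>\<^bsub>M\<^esub> e' i)" if "x \<in> A" for x using C(2)[OF that] that by (simp add: C'_def)
    show "c i \<in> loc_kernel p" if "\<And>i. c i \<in> carrier R" "(\<Oplus>\<^bsub>M\<^esub>i\<in>{..<r}. c i \<odot>\<^bsub>M\<^esub> e' i) = \<zero>\<^bsub>M\<^esub>" "i < r" for c i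
      using e(3)[OF that(1) _ that(3)] sum[OF that(1)] that by (simp add: loc_kernel_def)
  qed (use p e'c s in auto)
  then show ?thesis by blast
qed

text \<open>At the prime \<open>q\<close> the rank \<open>r\<close> is at least \<open>|A|\<close>, and the rank is the same at every nonmaximal prime; so
  \<open>Z\<close> is zero at all of them. The annihilator of an entry of \<open>z\<close> then lies in no nonmaximal prime and
  contains a power of the regular element \<open>a\<close>.\<close>

lemma relations_vanish:
  assumes rank: "has_rank R M" and a: "regular a" "a \<in> \<mm>"
    and q: "primeideal q R" "q \<noteq> \<mm>" "\<And>z x. z \<in> Z \<Longrightarrow> z x \<in> q" and z: "z \<in> Z"
  shows "z = vzero"
proof -
  obtain r :: nat where r: "\<And>p. p \<in> Ass R \<Longrightarrow>
    module_iso (loc_ring R (carrier R - p)) (loc_module R (carrier R - p) M) (free_module (loc_ring R (carrier R - p)) {..<r})"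
    using rank by (auto simp: has_rank_def Let_def)
  have frame: "\<exists>e s C. local_frame R M A p r e s C" if "primeideal p R" "p \<noteq> \<mm>" for p
    by (rule exists_frame[OF that r[OF nonmax_prime_Ass[OF that]]])
  obtain e s C where "local_frame R M A q r e s C" using frame[OF q(1,2)] by blast
  then have card: "card A \<le> r" by (rule local_frame.card_le_rank) (rule q(3))
  have loc: "z x \<in> loc_kernel p" if p: "primeideal p R" "p \<noteq> \<mm>" for p x
  proof -
    obtain e s C where f: "local_frame R M A p r e s C" using frame[OF p] by blast
    have "z' y \<in> p" if "z' \<in> Z" for z' y by (rule local_frame.relations_in_prime[OF f card that])
    then show ?thesis by (rule local_frame.relations_locally_zero[OF f _ z])
  qed
  note zc = linsub_closed[OF Z_linsub z] and ac = regular_carrier[OF a(1)]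
  show ?thesis
  proof (rule vec_eqI)
    fix x
    let ?J = "icolon {\<zero>} (z x)"
    have J: "ideal ?J R" by (rule ideal_icolon[OF zeroideal zc])
    have "\<exists>k::nat. a [^] k \<in> ?J"
    proof (rule ccontr)
      assume "\<not> ?thesis"
      then obtain p where p: "primeideal p R" "?J \<subseteq> p" "a \<notin> p" using prime_avoiding_powers[OF J ac] by blast
      have "p \<noteq> \<mm>" using p(3) a(2) by blast
      then have "z x \<in> loc_kernel p" by (rule loc[OF p(1)])
      then show False using p(2) zc by (auto simp: loc_kernel_def icolon_def)
    qed
    then obtain k :: nat where "a [^] k \<otimes> z x = \<zero>" by (auto simp: icolon_def)
    then show "z x = vzero x" using regular_power[OF a(1), of k] zc by (simp add: regular_def)
  qed
qed

lemma free_if_no_relations: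
  assumes "\<And>z. z \<in> Z \<Longrightarrow> z = vzero" shows "is_free_module R M"
proof -
  have inj: "c = c'" if c: "c \<in> vec A" "c' \<in> vec A" "lc c = lc c'" for c c'
  proof -
    have "c -\<^sub>v c' = vzero" using assms[OF Z_diff[OF c]] .
    then have "c' = c -\<^sub>v vzero" using vdiff_vdiff[OF c(1,2)] by simp
    also have "\<dots> = c" using c(1) by (intro vec_eqI) simp
    finally show ?thesis ..
  qed
  have coef_lc: "coef (lc c) = c" if "c \<in> vec A" for c
    by (rule inj) (use that coef[OF lc_closed[OF that]] in auto)
  define f where "f = (\<lambda>x\<in>carrier M. restrict (coef x) A)"
  let ?F = "free_module R A"
  have cc: "coef x y \<in> carrier R" if "x \<in> carrier M" for x y by (rule vec_closed[OF coef(1)[OF that]])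
  have F: "g \<in> carrier ?F \<longleftrightarrow> g \<in> A \<rightarrow>\<^sub>E carrier R" for g using finA by (simp add: free_carrier)
  have fc: "f x \<in> carrier ?F" if "x \<in> carrier M" for x unfolding F f_def using that cc by auto
  have add: "coef (x \<oplus>\<^bsub>M\<^esub> y) = coef x +\<^sub>v coef y" if "x \<in> carrier M" "y \<in> carrier M" for x y
    using coef_lc[of "coef x +\<^sub>v coef y"] lc_add coef that by simp
  have scale: "coef (r \<odot>\<^bsub>M\<^esub> x) = r *\<^sub>v coef x" if "r \<in> carrier R" "x \<in> carrier M" for r x
    using coef_lc[of "r *\<^sub>v coef x"] lc_scale coef that by simp
  have "f \<in> lin_maps R M ?F"
    unfolding lin_maps_def
  proof (intro CollectI conjI ballI)
    show "f \<in> carrier M \<rightarrow>\<^sub>E carrier ?F" using fc by (auto simp: f_def)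
    show "f (x \<oplus>\<^bsub>M\<^esub> y) = f x \<oplus>\<^bsub>?F\<^esub> f y" if "x \<in> carrier M" "y \<in> carrier M" for x y
      using that add[OF that] by (auto simp: f_def free_ops)
    show "f (r \<odot>\<^bsub>M\<^esub> x) = r \<odot>\<^bsub>?F\<^esub> f x" if "r \<in> carrier R" "x \<in> carrier M" for r x
      using that scale[OF that] by (auto simp: f_def free_ops)
  qed
  moreover have "bij_betw f (carrier M) (carrier ?F)"
    unfolding bij_betw_def
  proof (intro conjI inj_onI equalityI subsetI)
    fix x y assume xy: "x \<in> carrier M" "y \<in> carrier M" "f x = f y"
    have "coef x i = coef y i" if "i \<in> A" for i
      using fun_cong[OF xy(3), of i] that xy(1,2) by (simp add: f_def)
    then have "coef x = coef y" by (rule vec_eqI'[OF coef(1)[OF xy(1)] coef(1)[OF xy(2)]])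
    then show "x = y" using coef(2) xy(1,2) by metis
  next
    fix g assume "g \<in> f ` carrier M" then show "g \<in> carrier ?F" using fc by auto
  next
    fix g assume "g \<in> carrier ?F"
    then have g: "g \<in> A \<rightarrow>\<^sub>E carrier R" unfolding F .
    let ?c = "\<lambda>i. if i \<in> A then g i else \<zero>"
    have c: "?c \<in> vec A" using g by (auto simp: vec_def simp del: vec_closed)
    have "g = f (lc ?c)"
      using g lc_closed[OF c] coef_lc[OF c] by (auto simp: f_def PiE_def extensional_def)
    then show "g \<in> f ` carrier M" using lc_closed[OF c] by blast
  qed
  ultimately show ?thesis unfolding is_free_module_def module_iso_def by blast
qed

text \<open>By the Burch property some \<open>b \<in> \<mm>\<close> and \<open>t\<close> with \<open>\<mm>t \<subseteq> M\<close> satisfy \<open>b t \<notin> \<mm>M\<close>. The ideal \<open>J\<close> of all \<open>c\<close> with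
  \<open>c t \<in> \<mm>M\<close> contains \<open>\<mm>\<^sup>2\<close> but not \<open>\<mm>\<close>, so \<open>b\<close> can be replaced by a regular element \<open>a\<close> outside \<open>J\<close>. Put
  \<open>y = a t\<close>; then \<open>c y = a (c t) \<in> aM\<close> for \<open>c \<in> \<mm>\<close>.\<close>

lemma burch_element:
  assumes burch: "burch_module TYPE('t) R M"
    and depth: "\<And>s. s \<in> carrier R \<Longrightarrow> icolon {\<zero>} s \<noteq> \<mm>"
  shows "\<exists>a Y x0. regular a \<and> a \<in> \<mm> \<and> Y \<in> vec A \<and> x0 \<in> A \<and> Y x0 \<notin> \<mm> \<and>
    (\<forall>c\<in>\<mm>. \<exists>w\<in>vec A. \<exists>z\<in>Z. c *\<^sub>v Y = a *\<^sub>v w +\<^sub>v z)"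
proof -
  obtain T :: "('a, 't) module" and \<iota> where T: "fg_module R T" and \<iota>: "\<iota> \<in> lin_maps R M T" "inj_on \<iota> (carrier M)"
    and nsub: "\<not> ideal_smult R T \<mm> (colon T (\<iota> ` carrier M) \<mm>) \<subseteq> ideal_smult R T \<mm> (\<iota> ` carrier M)"
    using burch by (auto simp: burch_module_def Let_def)
  interpret T: module R T using T by (simp add: fg_module_def)
  define H where "H = ideal_smult R T \<mm> (\<iota> ` carrier M)"
  have \<iota>c: "\<iota> x \<in> carrier T" if "x \<in> carrier M" for x by (rule lin_mapsD(1)[OF \<iota>(1) that])
  have gens: "{c \<odot>\<^bsub>T\<^esub> x | c x. c \<in> \<mm> \<and> x \<in> \<iota> ` carrier M} \<subseteq> carrier T" using \<iota>c mm_carrier by auto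
  have H: "submodule H R T" unfolding H_def ideal_smult_def by (rule mod_span_submodule[OF T.module_axioms gens])
  have Hgen: "c \<odot>\<^bsub>T\<^esub> \<iota> x \<in> H" if "c \<in> \<mm>" "x \<in> carrier M" for c x
    unfolding H_def ideal_smult_def by (rule subsetD[OF mod_span_superset]) (use that in blast)
  have "\<not> {c \<odot>\<^bsub>T\<^esub> x | c x. c \<in> \<mm> \<and> x \<in> colon T (\<iota> ` carrier M) \<mm>} \<subseteq> H"
    using nsub mod_span_minimal[OF H] unfolding H_def[symmetric] by (auto simp: ideal_smult_def)
  then obtain b t where b: "b \<in> \<mm>" and t: "t \<in> colon T (\<iota> ` carrier M) \<mm>" and bt: "b \<odot>\<^bsub>T\<^esub> t \<notin> H" by blast
  have tc: "t \<in> carrier T" and tm: "\<exists>m\<in>carrier M. c \<odot>\<^bsub>T\<^esub> t = \<iota> m" if "c \<in> \<mm>" for c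
    using t that by (auto simp: colon_def)
  then have tc: "t \<in> carrier T" using b by blast
  define J where "J = {c \<in> carrier R. c \<odot>\<^bsub>T\<^esub> t \<in> H}"
  have "\<exists>a\<in>\<mm> - J. regular a"
  proof (rule exists_regular_avoiding[OF depth])
    show "ideal J R"
    proof (rule ideal_intro)
      show "J \<subseteq> carrier R" by (auto simp: J_def)
      show "\<zero> \<in> J" using T.submod_zero[OF H] tc by (simp add: J_def)
      show "x \<oplus> y \<in> J" if "x \<in> J" "y \<in> J" for x y
        using T.submod_add[OF H] that tc by (simp add: J_def T.smult_l_distr)
      show "u \<otimes> x \<in> J" if "u \<in> carrier R" "x \<in> J" for u x
        using T.submod_smult[OF H that(1)] that tc by (simp add: J_def T.smult_assoc1)
    qed
    show "\<not> \<mm> \<subseteq> J" using b bt by (auto simp: J_def)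
    fix x y assume xy: "x \<in> \<mm>" "y \<in> \<mm>"
    obtain m where m: "m \<in> carrier M" "y \<odot>\<^bsub>T\<^esub> t = \<iota> m" using tm[OF xy(2)] by blast
    have "(x \<otimes> y) \<odot>\<^bsub>T\<^esub> t = x \<odot>\<^bsub>T\<^esub> \<iota> m" using xy mm_carrier tc m(2) by (simp add: T.smult_assoc1)
    then show "x \<otimes> y \<in> J" using Hgen[OF xy(1) m(1)] xy mm_carrier by (simp add: J_def)
  qed
  then obtain a where a: "a \<in> \<mm>" "a \<notin> J" "regular a" by blast
  note ac = mm_carrier[OF a(1)]
  obtain y where y: "y \<in> carrier M" "a \<odot>\<^bsub>T\<^esub> t = \<iota> y" using tm[OF a(1)] by blast
  have \<iota>y: "\<iota> y \<notin> H" using a(2) ac y(2) by (simp add: J_def)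
  define Y where "Y = coef y"
  have Y: "Y \<in> vec A" "lc Y = y" using coef[OF y(1)] by (simp_all add: Y_def)
  have "\<exists>x0\<in>A. Y x0 \<notin> \<mm>"
  proof (rule ccontr)
    assume no: "\<not> ?thesis"
    define K where "K = {m \<in> carrier M. \<iota> m \<in> H}"
    have \<iota>_smult: "\<iota> (u \<odot>\<^bsub>M\<^esub> m) = u \<odot>\<^bsub>T\<^esub> \<iota> m" if "u \<in> carrier R" "m \<in> carrier M" for u m
      by (rule lin_mapsD(3)[OF \<iota>(1) that])
    have K: "submodule K R M"
    proof (rule submoduleI)
      show "K \<subseteq> carrier M" by (auto simp: K_def)
      have "\<iota> \<zero>\<^bsub>M\<^esub> = \<zero>\<^bsub>T\<^esub>" using \<iota>_smult[OF R_zero_closed M.zero_closed] \<iota>c by simp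
      then show "\<zero>\<^bsub>M\<^esub> \<in> K" using T.submod_zero[OF H] by (simp add: K_def)
      show smult: "u \<odot>\<^bsub>M\<^esub> m \<in> K" if "u \<in> carrier R" "m \<in> K" for u m
        using \<iota>_smult[OF that(1)] T.submod_smult[OF H that(1)] that by (simp add: K_def)
      show "\<ominus>\<^bsub>M\<^esub> m \<in> K" if "m \<in> K" for m
      proof -
        have "\<ominus>\<^bsub>M\<^esub> m = (\<ominus> \<one>) \<odot>\<^bsub>M\<^esub> m" using that by (simp add: K_def smult_l_minus)
        then show ?thesis using smult[OF _ that, of "\<ominus> \<one>"] by simp
      qed
      show "m \<oplus>\<^bsub>M\<^esub> m' \<in> K" if "m \<in> K" "m' \<in> K" for m m'
        using lin_mapsD(2)[OF \<iota>(1)] T.submod_add[OF H] that by (simp add: K_def)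
    qed
    have "lc Y \<in> K"
      unfolding lc_def
    proof (rule submod_finsum[OF K finA])
      fix x assume x: "x \<in> A"
      then show "Y x \<odot>\<^bsub>M\<^esub> x \<in> K"
        using \<iota>_smult[of "Y x" x] Hgen[of "Y x" x] no vec_closed[OF Y(1)] by (auto simp: K_def)
    qed
    then show False using \<iota>y Y(2) by (simp add: K_def)
  qed
  then obtain x0 where x0: "x0 \<in> A" "Y x0 \<notin> \<mm>" by blast
  have "\<exists>w\<in>vec A. \<exists>z\<in>Z. c *\<^sub>v Y = a *\<^sub>v w +\<^sub>v z" if c: "c \<in> \<mm>" for c
  proof -
    note cc = mm_carrier[OF c]
    obtain m where m: "m \<in> carrier M" "c \<odot>\<^bsub>T\<^esub> t = \<iota> m" using tm[OF c] by blast
    have "\<iota> (c \<odot>\<^bsub>M\<^esub> y) = c \<odot>\<^bsub>T\<^esub> (a \<odot>\<^bsub>T\<^esub> t)" using lin_mapsD(3)[OF \<iota>(1) cc y(1)] y(2) by simp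
    also have "\<dots> = a \<odot>\<^bsub>T\<^esub> (c \<odot>\<^bsub>T\<^esub> t)" using cc ac tc by (simp add: T.smult_assoc1[symmetric] R_m_comm)
    also have "\<dots> = \<iota> (a \<odot>\<^bsub>M\<^esub> m)" using lin_mapsD(3)[OF \<iota>(1) ac m(1)] m(2) by simp
    finally have eq: "c \<odot>\<^bsub>M\<^esub> y = a \<odot>\<^bsub>M\<^esub> m" using inj_onD[OF \<iota>(2)] cc ac y(1) m(1) by simp
    let ?w = "coef m"
    note w = coef[OF m(1)]
    have z: "c *\<^sub>v Y -\<^sub>v a *\<^sub>v ?w \<in> Z"
      by (rule Z_diff) (use lc_scale[OF cc Y(1)] lc_scale[OF ac w(1)] Y w eq cc ac in auto)
    have "c *\<^sub>v Y = a *\<^sub>v ?w +\<^sub>v (c *\<^sub>v Y -\<^sub>v a *\<^sub>v ?w)"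
    proof (rule vec_eqI)
      fix i
      have k: "Y i \<in> carrier R" "?w i \<in> carrier R" using vec_closed[OF Y(1)] vec_closed[OF w(1)] by auto
      show "(c *\<^sub>v Y) i = (a *\<^sub>v ?w +\<^sub>v (c *\<^sub>v Y -\<^sub>v a *\<^sub>v ?w)) i"
        unfolding vadd_nth vscale_nth using k cc ac by algebra
    qed
    then show ?thesis using w(1) z by blast
  qed
  then show ?thesis using a Y(1) x0 by blast
qed

end

theorem corollary1p3:
  fixes R :: "'a ring" and M :: "('a, 'b) module"
  assumes "gorenstein_local_ring TYPE('i) R"
    and "krull_dim R = 1"
    and "fg_module R M"
    and "has_rank R M"
    and "torsion_free R M"
    and "torsion_free R (tensor_module R M (dual_module R M))"
    and "burch_module TYPE('t) R M"
  shows "regular_local_ring R \<and> is_free_module R M"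
proof -
  have lring: "local_ring R" and noeth: "noetherian_ring R" and fid: "finite_inj_dim TYPE('i) R (self_module R)"
    using assms(1) by (auto simp: gorenstein_local_ring_def)
  interpret R: cring R using lring by (simp add: local_ring_def)
  have max: "\<exists>!m. maximalideal m R" using lring by (simp add: local_ring_def)
  interpret noeth_local_dim1 R 
    by (rule noeth_local_dim1.intro[OF noeth_local.intro[OF R.is_cring noeth_local_axioms.intro[OF noeth max]]
          noeth_local_dim1_axioms.intro[OF assms(2)]])
  have carr: "carrier (self_module R) = carrier R" by (simp add: self_module_def)
  obtain I :: "nat \<Rightarrow> ('a, 'i) module" and \<epsilon> d n where I:
      "\<forall>j. injective_module R (I j)" "\<forall>j>n. carrier (I j) = {\<zero>\<^bsub>I j\<^esub>}"
      "\<epsilon> \<in> lin_maps R (self_module R) (I 0)" "inj_on \<epsilon> (carrier R)"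
      "\<forall>j. d j \<in> lin_maps R (I j) (I (Suc j))"
      "\<epsilon> ` carrier R = {x \<in> carrier (I 0). d 0 x = \<zero>\<^bsub>I (Suc 0)\<^esub>}"
      "\<forall>j. d j ` carrier (I j) = {x \<in> carrier (I (Suc j)). d (Suc j) x = \<zero>\<^bsub>I (Suc (Suc j))\<^esub>}"
    using fid unfolding finite_inj_dim_def carr by (elim exE conjE) (rule that)
  have res: "inj_resolution R I \<epsilon> d n"
    by (rule inj_resolution.intro[OF noeth_local_dim1_axioms inj_resolution_axioms.intro])
      (fact I(1)[rule_format] I(2)[rule_format] I(3) I(4) I(5)[rule_format] I(6) I(7)[rule_format])+
  interpret res: inj_resolution R I \<epsilon> d n by (rule res)
  have modM: "module R M" using assms(3) by (simp add: fg_module_def)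
  let ?gens = "\<lambda>A. finite A \<and> A \<subseteq> carrier M \<and> mod_span R M A = carrier M"
  obtain A0 where "?gens A0" using assms(3) by (auto simp: fg_module_def)
  then have "\<exists>A. ?gens A \<and> (\<forall>B. ?gens B \<longrightarrow> card A \<le> card B)" by (rule ex_has_least_nat)
  then obtain A where A: "?gens A" "\<And>B. ?gens B \<Longrightarrow> card A \<le> card B" by blast
  interpret M: module R M by (rule modM)
  interpret G: min_gens_dim1 R M A by unfold_locales (use A in blast)+
  obtain a Y x0 where a: "R.regular a" "a \<in> \<mm>" and Y: "Y \<in> R.vec A" and x0: "x0 \<in> A" "Y x0 \<notin> \<mm>"
    and Yb: "\<And>c. c \<in> \<mm> \<Longrightarrow> \<exists>w\<in>R.vec A. \<exists>z\<in>G.Z. R.vscale c Y = R.vadd (R.vscale a w) z"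
    using G.burch_element[OF assms(7) res.depth_pos] by blast
  obtain s where s: "s \<in> carrier R" "s \<notin> cgenideal R a" "R.icolon (cgenideal R a) s = \<mm>"
    using res.exists_socle[OF a] by blast
  interpret P: burch_presentation R I \<epsilon> d n A G.Z a Y x0
    by unfold_locales (fact G.finA G.Z_linsub G.Z_mm a G.Z_saturated[OF assms(5) a(1)] Y x0 Yb)+
  have N: "P.N = G.NN" by (simp add: P.N_def G.NN_def)
  have W: "P.W = G.WW" by (simp add: P.W_def G.WW_def N)
  have bt: "burch_tensor R I \<epsilon> d n A G.Z a Y x0 s"
  proof (rule burch_tensor.intro[OF P.burch_presentation_axioms burch_tensor_axioms.intro[OF _ s]])
    fix \<mu> assume "\<mu> \<in> R.vec (A \<times> A)" "\<And>i. (\<lambda>j. \<mu> (i, j)) \<in> P.N" "R.vscale a \<mu> \<in> P.W"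
    then show "\<mu> \<in> P.W" unfolding N W by (rule G.WW_saturated[OF assms(6) a(1)])
  qed
  obtain q where q: "primeideal q R" "q \<noteq> \<mm>" "\<And>z x. z \<in> G.Z \<Longrightarrow> z x \<in> q"
    using burch_tensor.relations_in_minimal_prime[OF bt] by (elim exE conjE) blast
  have Z: "z = R.vzero" if "z \<in> G.Z" for z by (rule G.relations_vanish[OF assms(4) a q(1,2) _ that]) (rule q(3))
  note ac = mm_carrier[OF a(2)]
  \<comment> \<open>Without relations, \<open>c Y = a w\<close> at the coordinate where \<open>Y\<close> is a unit shows \<open>c \<in> aR\<close>.\<close>
  have "\<mm> = cgenideal R a"
  proof
    show "cgenideal R a \<subseteq> \<mm>" by (rule R.cgenideal_minimal[OF mm_ideal a(2)])
    show "\<mm> \<subseteq> cgenideal R a"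
    proof
      fix c assume c: "c \<in> \<mm>"
      note cc = mm_carrier[OF c] and Yc = R.vec_closed[OF Y, of x0]
      obtain w where w: "w \<in> R.vec A" "R.vscale c Y = R.vadd (R.vscale a w) R.vzero" using Yb[OF c] Z by metis
      note wc = R.vec_closed[OF w(1), of x0]
      have eq: "c \<otimes>\<^bsub>R\<^esub> Y x0 = a \<otimes>\<^bsub>R\<^esub> w x0"
        using fun_cong[OF w(2), of x0] ac wc by (simp add: R.vscale_def R.vadd_def R.vzero_def)
      have u: "Y x0 \<in> Units R" using unit_iff[OF Yc] x0(2) by simp
      have "c = (c \<otimes>\<^bsub>R\<^esub> Y x0) \<otimes>\<^bsub>R\<^esub> inv\<^bsub>R\<^esub> Y x0" using u cc Yc by (simp add: R.m_assoc)
      also have "\<dots> = (w x0 \<otimes>\<^bsub>R\<^esub> inv\<^bsub>R\<^esub> Y x0) \<otimes>\<^bsub>R\<^esub> a" unfolding eq using u ac wc by (simp add: R.m_ac)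
      finally show "c \<in> cgenideal R a" using u wc unfolding cgenideal_def by auto
    qed
  qed
  then have "\<mm> = genideal R {a}" using R.cgenideal_eq_genideal[OF ac] by simp
  then have "regular_local_ring R"
    unfolding regular_local_ring_def using assms(2) ac
    by (intro conjI exI[of _ "{a}"] lring \<open>noetherian_ring R\<close>) (auto simp: one_enat_def)
  moreover have "is_free_module R M" by (rule G.free_if_no_relations[OF Z])
  ultimately show ?thesis ..
qed

end
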